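(* Let $X_t$ be a stochastic process on $\mathbb S^{n-1}$ solving the Stratonovich SDE $$\mathrm dX_t=F_0(X_t)\,\mathrm dt+\sum_{i=1}^kF_i(X_t)\,\partial B_t^i,\qquad X_0\in\mathbb S^{n-1},$$ where $B^1,\dots,B^k$ are independent real Brownian motions and $F_0,\dots,F_k:\mathbb S^{n-1}\to T\mathbb S^{n-1}\subseteq\mathbb R^n$ are tangent vector fields on the sphere, with $F_0\in C^{1,\delta}$ and $F_1,\dots,F_k\in C^{2,\delta}$ for some $\delta\in(0,1]$, satisfying $F_i(-x)=-F_i(x)$ for all $x\in\mathbb S^{n-1}$ and $i=0,\dots,k$ in Euclidean coordinates. Then any invariant probability measure $\hat\rho\in\mathcal P(\mathbb S^{n-1})$ of the process $X_t$ generates a family $(\rho_\alpha)_{\alpha\in[0,1]}\subset\mathcal P(\mathbb S^{n-1}\times\mathbb S^{n-1})$ given by $$\rho_\alpha(\mathrm dx,\mathrm dy)=\hat\rho(\mathrm dx)\times\big(\alpha\,\delta_x(\mathrm dy)+(1-\alpha)\,\delta_{-x}(\mathrm dy)\big),\qquad\alpha\in[0,1],$$ such that every $\rho_\alpha$ is an invariant measure of the coupled two-point process $$\mathrm dX_t=F_0(X_t)\,\mathrm dt+\sum_{i=1}^kF_i(X_t)\,\partial B_t^i,\quad X_0\in\mathbb S^{n-1},$$ $$\mathrm dY_t=F_0(Y_t)\,\mathrm dt+\sum_{i=1}^kF_i(Y_t)\,\partial B_t^i,\quad Y_0\in\mathbb S^{n-1},$$ in which both components are driven by the same Brownian motions.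
   Context: $\mathbb S^{n-1}\subset\mathbb R^n$ is the unit sphere; $\mathcal P(\mathcal X)$ denotes the Borel probability measures on $\mathcal X$; $\partial$ denotes Stratonovich integration. The infinitesimal generator of a diffusion $X_t$ on $\mathcal X$ is $(Lf)(x)=\lim_{t\to0}\frac1t\mathbb E[f(X_t)-f(X_0)\mid X_0=x]$, and $\rho\in\mathcal P(\mathcal X)$ is called an invariant measure of $X_t$ if $\int_{\mathcal X}(Lu)(x)\,\mathrm d\rho(x)=0$ for all $u\in C_c^\infty(\mathcal X)$. The same definition applies to the two-point process on $\mathcal X=\mathbb S^{n-1}\times\mathbb S^{n-1}$. *)

theory Defs
  imports "HOL-Probability.Probability"
begin

section \<open>Function classes on subsets of Euclidean space\<close>

definition holder_continuous_on ::
    "real \<Rightarrow> 'a::euclidean_space set \<Rightarrow> ('a \<Rightarrow> 'b::euclidean_space) \<Rightarrow> bool" where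
  "holder_continuous_on \<delta> U f \<longleftrightarrow> (\<exists>C. \<forall>x\<in>U. \<forall>y\<in>U. norm (f x - f y) \<le> C * norm (x - y) powr \<delta>)"

text \<open>\<open>differentiable_class P m U f\<close>: on the open set \<open>U\<close> the function \<open>f\<close> is \<open>m\<close> times
  differentiable and all its partial derivatives of order \<open>m\<close> satisfy \<open>P U\<close>.  Here \<open>D e\<close> is the
  partial derivative of \<open>f\<close> in the direction of the basis vector \<open>e\<close>.\<close>

primrec differentiable_class ::
    "('a::euclidean_space set \<Rightarrow> ('a \<Rightarrow> 'b::euclidean_space) \<Rightarrow> bool) \<Rightarrow> nat \<Rightarrow> 'a set \<Rightarrow> ('a \<Rightarrow> 'b) \<Rightarrow> bool"
where
  "differentiable_class P 0 U f \<longleftrightarrow> P U f"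
| "differentiable_class P (Suc m) U f \<longleftrightarrow>
     (\<exists>D. (\<forall>x\<in>U. (f has_derivative (\<lambda>h. \<Sum>e\<in>Basis. (h \<bullet> e) *\<^sub>R D e x)) (at x)) \<and>
          (\<forall>e\<in>Basis. differentiable_class P m U (D e)))"

text \<open>A function on a compact submanifold \<open>S\<close> of Euclidean space belongs to a regularity class if
  it is the restriction of a function of that class on some open neighbourhood of \<open>S\<close>.\<close>

definition C_holder_on ::
    "nat \<Rightarrow> real \<Rightarrow> 'a::euclidean_space set \<Rightarrow> ('a \<Rightarrow> 'b::euclidean_space) \<Rightarrow> bool" where
  "C_holder_on m \<delta> S f \<longleftrightarrow> (\<exists>U g. open U \<and> S \<subseteq> U \<and>
     differentiable_class (holder_continuous_on \<delta>) m U g \<and> (\<forall>x\<in>S. g x = f x))"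

definition smooth_compact_support :: "'a::euclidean_space set \<Rightarrow> ('a \<Rightarrow> real) \<Rightarrow> bool" where
  "smooth_compact_support S f \<longleftrightarrow>
     (\<exists>U g. open U \<and> S \<subseteq> U \<and> (\<forall>m. differentiable_class continuous_on m U g) \<and> (\<forall>x\<in>S. g x = f x)) \<and>
     compact (S \<inter> closure {x\<in>S. f x \<noteq> 0})"

section \<open>Brownian motion and continuous semimartingales\<close>

text \<open>The time index is \<open>real\<close>, but only times \<open>t \<ge> 0\<close> are used.\<close>

locale filtered_prob_space = prob_space M + filtration "space M" \<F>
  for M :: "'w measure" and \<F> :: "real \<Rightarrow> 'w measure" +
  assumes sets_F_subset: "\<And>t. sets (\<F> t) \<subseteq> sets M"

definition continuous_adapted :: "'w measure \<Rightarrow> (real \<Rightarrow> 'w measure) \<Rightarrow>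
    (real \<Rightarrow> 'w \<Rightarrow> 'a::euclidean_space) \<Rightarrow> bool" where
  "continuous_adapted M \<F> X \<longleftrightarrow> (\<forall>t\<ge>0. X t \<in> borel_measurable (\<F> t)) \<and>
     (\<forall>\<omega>\<in>space M. continuous_on {0..} (\<lambda>t. X t \<omega>))"

text \<open>\<open>B 1, \<dots>, B k\<close> are independent standard real Brownian motions with respect to \<open>\<F>\<close>: the
  increments of \<open>B 1, \<dots>, B k\<close> over \<open>[s, t]\<close> and the past \<open>\<F> s\<close> are mutually independent
  (the index \<open>None\<close> stands for \<open>\<F> s\<close>, and \<open>Some i\<close> for the increment of \<open>B i\<close>).\<close>

definition brownian_motions :: "'w measure \<Rightarrow> (real \<Rightarrow> 'w measure) \<Rightarrow> nat \<Rightarrow>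
    (nat \<Rightarrow> real \<Rightarrow> 'w \<Rightarrow> real) \<Rightarrow> bool" where
  "brownian_motions M \<F> k B \<longleftrightarrow>
     (\<forall>i\<in>{1..k}. continuous_adapted M \<F> (B i) \<and> (AE \<omega> in M. B i 0 \<omega> = 0)) \<and>
     (\<forall>s t. 0 \<le> s \<and> s < t \<longrightarrow>
        (\<forall>i\<in>{1..k}. distributed M lborel (\<lambda>\<omega>. B i t \<omega> - B i s \<omega>) (normal_density 0 (sqrt (t - s)))) \<and>
        prob_space.indep_sets M
          (\<lambda>j. case j of
                 None \<Rightarrow> sets (\<F> s)
               | Some i \<Rightarrow> {(\<lambda>\<omega>. B i t \<omega> - B i s \<omega>) -` A \<inter> space M |A. A \<in> sets borel})
          (insert None (Some ` {1..k})))"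

definition martingale :: "'w measure \<Rightarrow> (real \<Rightarrow> 'w measure) \<Rightarrow> (real \<Rightarrow> 'w \<Rightarrow> real) \<Rightarrow> bool" where
  "martingale M \<F> N \<longleftrightarrow> (\<forall>t\<ge>0. N t \<in> borel_measurable (\<F> t) \<and> integrable M (N t)) \<and>
     (\<forall>s t. 0 \<le> s \<and> s \<le> t \<longrightarrow> (AE \<omega> in M. real_cond_exp M (\<F> s) (N t) \<omega> = N s \<omega>))"

definition continuous_local_martingale ::
    "'w measure \<Rightarrow> (real \<Rightarrow> 'w measure) \<Rightarrow> (real \<Rightarrow> 'w \<Rightarrow> real) \<Rightarrow> bool" where
  "continuous_local_martingale M \<F> N \<longleftrightarrow> continuous_adapted M \<F> N \<and>
     (\<exists>\<tau> :: nat \<Rightarrow> 'w \<Rightarrow> real.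
        (\<forall>n. stopping_time \<F> (\<tau> n) \<and> (\<forall>\<omega>\<in>space M. 0 \<le> \<tau> n \<omega>)) \<and>
        (AE \<omega> in M. incseq (\<lambda>n. \<tau> n \<omega>) \<and> filterlim (\<lambda>n. \<tau> n \<omega>) at_top sequentially) \<and>
        (\<forall>n. martingale M \<F> (\<lambda>t \<omega>. N (min t (\<tau> n \<omega>)) \<omega>)))"

text \<open>A finite variation process is a difference of nondecreasing ones.  A vector-valued process is
  a semimartingale if all its coordinates are.\<close>

definition continuous_semimartingale :: "'w measure \<Rightarrow> (real \<Rightarrow> 'w measure) \<Rightarrow>
    (real \<Rightarrow> 'w \<Rightarrow> 'a::euclidean_space) \<Rightarrow> bool" where
  "continuous_semimartingale M \<F> X \<longleftrightarrow> continuous_adapted M \<F> X \<and>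
     (\<forall>e\<in>Basis. \<exists>N A\<^sub>1 A\<^sub>2 :: real \<Rightarrow> 'w \<Rightarrow> real.
        continuous_local_martingale M \<F> N \<and>
        continuous_adapted M \<F> A\<^sub>1 \<and> (\<forall>\<omega>\<in>space M. mono_on {0..} (\<lambda>t. A\<^sub>1 t \<omega>)) \<and>
        continuous_adapted M \<F> A\<^sub>2 \<and> (\<forall>\<omega>\<in>space M. mono_on {0..} (\<lambda>t. A\<^sub>2 t \<omega>)) \<and>
        (\<forall>\<omega>\<in>space M. N 0 \<omega> = 0 \<and> A\<^sub>1 0 \<omega> = 0 \<and> A\<^sub>2 0 \<omega> = 0) \<and>
        (\<forall>t\<ge>0. \<forall>\<omega>\<in>space M. X t \<omega> \<bullet> e = X 0 \<omega> \<bullet> e + N t \<omega> + (A\<^sub>1 t \<omega> - A\<^sub>2 t \<omega>)))"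

section \<open>Stratonovich integrals and equations\<close>

definition stratonovich_sum :: "(real \<Rightarrow> 'w \<Rightarrow> 'a::euclidean_space) \<Rightarrow> (real \<Rightarrow> 'w \<Rightarrow> real) \<Rightarrow>
    nat \<Rightarrow> (nat \<Rightarrow> real) \<Rightarrow> 'w \<Rightarrow> 'a" where
  "stratonovich_sum Y B m p \<omega> =
     (\<Sum>j<m. (B (p (Suc j)) \<omega> - B (p j) \<omega>) *\<^sub>R ((1/2) *\<^sub>R (Y (p j) \<omega> + Y (p (Suc j)) \<omega>)))"

text \<open>The random variable \<open>J\<close> is (a version of) the integral of \<open>Y\<close> over \<open>[0, t]\<close> against
  \<open>\<partial>B\<close>: the Stratonovich sums over partitions \<open>0 = p 0 \<le> \<dots> \<le> p m = t\<close> converge to \<open>J\<close> in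
  probability as the mesh tends to zero.\<close>

definition has_stratonovich_integral :: "'w measure \<Rightarrow> (real \<Rightarrow> 'w \<Rightarrow> 'a::euclidean_space) \<Rightarrow>
    (real \<Rightarrow> 'w \<Rightarrow> real) \<Rightarrow> real \<Rightarrow> ('w \<Rightarrow> 'a) \<Rightarrow> bool" where
  "has_stratonovich_integral M Y B t J \<longleftrightarrow> J \<in> borel_measurable M \<and>
     (\<forall>\<epsilon>>0. \<exists>\<eta>>0. \<forall>m p.
        p 0 = 0 \<and> p m = t \<and> (\<forall>j<m. p j \<le> p (Suc j) \<and> p (Suc j) - p j < \<eta>) \<longrightarrow>
        measure M {\<omega>\<in>space M. norm (stratonovich_sum Y B m p \<omega> - J \<omega>) > \<epsilon>} < \<epsilon>)"

definition stratonovich_solution :: "'w measure \<Rightarrow> (real \<Rightarrow> 'w measure) \<Rightarrow> nat \<Rightarrow>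
    (nat \<Rightarrow> real \<Rightarrow> 'w \<Rightarrow> real) \<Rightarrow> (nat \<Rightarrow> 'a \<Rightarrow> 'a) \<Rightarrow> 'a::euclidean_space set \<Rightarrow>
    (real \<Rightarrow> 'w \<Rightarrow> 'a) \<Rightarrow> bool" where
  "stratonovich_solution M \<F> k B F S X \<longleftrightarrow>
     (\<forall>t\<ge>0. \<forall>\<omega>\<in>space M. X t \<omega> \<in> S) \<and> continuous_semimartingale M \<F> X \<and>
     (\<exists>J. (\<forall>i\<in>{1..k}. \<forall>t\<ge>0. has_stratonovich_integral M (\<lambda>s \<omega>. F i (X s \<omega>)) (B i) t (J i t)) \<and>
          (\<forall>t\<ge>0. AE \<omega> in M. X t \<omega> =
             X 0 \<omega> + integral {0..t} (\<lambda>s. F 0 (X s \<omega>)) + (\<Sum>i=1..k. J i t \<omega>)))"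

text \<open>A diffusion is given by one process for each deterministic starting point:
  \<open>X x\<close> starts in \<open>x\<close>.\<close>

definition one_point_process :: "'w measure \<Rightarrow> (real \<Rightarrow> 'w measure) \<Rightarrow> nat \<Rightarrow>
    (nat \<Rightarrow> real \<Rightarrow> 'w \<Rightarrow> real) \<Rightarrow> (nat \<Rightarrow> 'a \<Rightarrow> 'a) \<Rightarrow> 'a::euclidean_space set \<Rightarrow>
    ('a \<Rightarrow> real \<Rightarrow> 'w \<Rightarrow> 'a) \<Rightarrow> bool" where
  "one_point_process M \<F> k B F S X \<longleftrightarrow>
     (\<forall>x\<in>S. stratonovich_solution M \<F> k B F S (X x) \<and> (AE \<omega> in M. X x 0 \<omega> = x))"

definition two_point_process :: "'w measure \<Rightarrow> (real \<Rightarrow> 'w measure) \<Rightarrow> nat \<Rightarrow>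
    (nat \<Rightarrow> real \<Rightarrow> 'w \<Rightarrow> real) \<Rightarrow> (nat \<Rightarrow> 'a \<Rightarrow> 'a) \<Rightarrow> 'a::euclidean_space set \<Rightarrow>
    ('a \<times> 'a \<Rightarrow> real \<Rightarrow> 'w \<Rightarrow> 'a \<times> 'a) \<Rightarrow> bool" where
  "two_point_process M \<F> k B F S Z \<longleftrightarrow>
     (\<forall>z\<in>S \<times> S. stratonovich_solution M \<F> k B F S (\<lambda>t \<omega>. fst (Z z t \<omega>)) \<and>
                stratonovich_solution M \<F> k B F S (\<lambda>t \<omega>. snd (Z z t \<omega>)) \<and>
                (AE \<omega> in M. Z z 0 \<omega> = z))"

section \<open>Generators and invariant measures\<close>

text \<open>The expectation conditional on the initial value \<open>x\<close> is the expectation for the process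
  started in \<open>x\<close>.\<close>

definition generator_quotient ::
    "'w measure \<Rightarrow> ('s \<Rightarrow> real \<Rightarrow> 'w \<Rightarrow> 's) \<Rightarrow> ('s \<Rightarrow> real) \<Rightarrow> 's \<Rightarrow> real \<Rightarrow> real" where
  "generator_quotient M X f x t = (1 / t) * (\<integral>\<omega>. f (X x t \<omega>) - f (X x 0 \<omega>) \<partial>M)"

definition generator ::
    "'w measure \<Rightarrow> ('s \<Rightarrow> real \<Rightarrow> 'w \<Rightarrow> 's) \<Rightarrow> ('s \<Rightarrow> real) \<Rightarrow> 's \<Rightarrow> real" where
  "generator M X f x = Lim (at_right 0) (generator_quotient M X f x)"

definition borel_prob_measures :: "'s::topological_space set \<Rightarrow> 's measure set" where
  "borel_prob_measures S = {\<rho>. prob_space \<rho> \<and> sets \<rho> = sets (restrict_space borel S)}"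

text \<open>\<open>Lim\<close> and the integral are total functions, so the existence of the limit and integrability
  are stated explicitly.\<close>

definition invariant_measure :: "'w measure \<Rightarrow> 's::euclidean_space set \<Rightarrow>
    ('s \<Rightarrow> real \<Rightarrow> 'w \<Rightarrow> 's) \<Rightarrow> 's measure \<Rightarrow> bool" where
  "invariant_measure M S X \<rho> \<longleftrightarrow> \<rho> \<in> borel_prob_measures S \<and>
     (\<forall>u. smooth_compact_support S u \<longrightarrow>
        (\<forall>x\<in>S. \<exists>l. (generator_quotient M X u x \<longlongrightarrow> l) (at_right 0)) \<and>
        integrable \<rho> (generator M X u) \<and> (\<integral>x. generator M X u x \<partial>\<rho>) = 0)"

text \<open>The measure \<open>\<rho>(dx) \<times> (\<alpha> \<delta>\<^sub>x(dy) + (1 - \<alpha>) \<delta>\<^sub>-\<^sub>x(dy))\<close> on \<open>S \<times> S\<close>: the inner mixture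
  of Dirac measures is evaluated on the section of \<open>E\<close> at \<open>x\<close> and integrated against \<open>\<rho>\<close>.\<close>

definition diagonal_mixture :: "'s::euclidean_space set \<Rightarrow> 's measure \<Rightarrow> real \<Rightarrow> ('s \<times> 's) measure" where
  "diagonal_mixture S \<rho> \<alpha> =
     measure_of (S \<times> S) (sets (restrict_space borel (S \<times> S)))
       (\<lambda>E. \<integral>\<^sup>+x. ennreal \<alpha> * emeasure (return (restrict_space borel S) x) {y. (x, y) \<in> E}
                 + ennreal (1 - \<alpha>) * emeasure (return (restrict_space borel S) (- x)) {y. (x, y) \<in> E} \<partial>\<rho>)"

end

theory Submission
  imports Defs
begin

text \<open>
  For every smooth \<open>u\<close> on \<open>S \<times> S\<close> there is one continuous function \<open>G\<close> such that the generator
  quotients of \<^emph>\<open>every\<close> solution of the two-point equation started in \<open>z\<close> converge to \<open>G z\<close>.  Uniqueness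
  of solutions is therefore irrelevant: since the fields are odd, \<open>(X x, X x)\<close> and \<open>(X x, - X x)\<close> are
  solutions started in \<open>(x, x)\<close> and \<open>(x, - x)\<close>, so \<open>G (x, x)\<close> and \<open>G (x, - x)\<close> are the one-point
  generator applied to \<open>u (x, x)\<close> and \<open>u (x, - x)\<close>, and their integrals against \<open>\<rho>\<close> vanish.

  The limit \<open>G\<close> is found without stochastic integrals, from the Stratonovich sums alone.  Such a sum is
  an Ito sum plus a correction, half the discrete covariation of \<open>f i (X)\<close> and \<open>B i\<close>.  The square
  variation of a semimartingale is tight, and comparing two partition scales bootstraps this to
  \<open>E \<bar>X t - X s\<bar>\<^sup>2 \<le> c (t - s)\<close>.  Then \<open>X t = x + (\<Sum>i. B i t *\<^sub>R f i x) + W\<close> with \<open>E \<bar>W\<bar>\<^sup>2 \<le> c t\<^sup>2\<close> and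
  \<open>E W = t (f 0 x + (1/2) (\<Sum>i. Df i x (f i x))) + o(t)\<close>, and a second-order Taylor expansion of \<open>u\<close> at \<open>x\<close>
  gives the limit.
\<close>

section \<open>Estimates in probability\<close>

text \<open>The obstacle is that \<open>has_stratonovich_integral\<close> gives convergence in
  probability, with no rate and no moments, whereas a generator is a limit of expectations divided
  by \<open>t\<close>. Bounds on the approximants have to be carried over to the solution before any
  uniform integrability is known: \<open>fatou_in_prob\<close> does this for second moments, and
  \<open>norm_expectation_le_of_approx\<close> does it for means once a second moment is available.
  Moreover the martingale part of a semimartingale is only local, and merely integrable after
  stopping, so there is no isometry to start from; tightness of the square variation is what lets
  the bootstrap begin. The bootstrap has two rounds: the first gives the order \<open>t - s\<close>
  for the mean square increment of \<open>X\<close>, the second feeds this back and gives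
  \<open>(t - s)\<^sup>2\<close> for \<open>W\<close>. The coupled process needs no analysis of its
  own: two solutions driven by the same \<open>B\<close> form one solution of an equation on a
  product, and the generator is computed for any compact set and any fields with continuously
  differentiable extensions near it.\<close>

lemma young_weighted:
  fixes a b c :: real
  assumes "0 < c"
  shows "a * b \<le> (c * a\<^sup>2 + b\<^sup>2 / c) / 2"
proof -
  have "0 \<le> (c * a - b)\<^sup>2 / c"
    using assms by simp
  also have "(c * a - b)\<^sup>2 / c = c * a\<^sup>2 - 2 * (a * b) + b\<^sup>2 / c"
    using assms by (simp add: power2_eq_square field_simps)
  finally show ?thesis by simp
qed

lemma norm_sum_squared_le:
  fixes a :: "'i \<Rightarrow> 'a::real_normed_vector"
  assumes "finite I"
  shows "(norm (\<Sum>i\<in>I. a i))\<^sup>2 \<le> real (card I) * (\<Sum>i\<in>I. (norm (a i))\<^sup>2)"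
proof -
  have "(norm (\<Sum>i\<in>I. a i))\<^sup>2 \<le> (\<Sum>i\<in>I. 1 * norm (a i))\<^sup>2"
    using norm_sum[of a I] by (intro power_mono) auto
  also have "\<dots> \<le> (\<Sum>i\<in>I. 1\<^sup>2) * (\<Sum>i\<in>I. (norm (a i))\<^sup>2)"
    by (rule Cauchy_Schwarz_ineq_sum)
  finally show ?thesis by simp
qed

lemma norm_add_squared_le:
  fixes a b :: "'a::real_normed_vector"
  shows "(norm (a + b))\<^sup>2 \<le> 2 * (norm a)\<^sup>2 + 2 * (norm b)\<^sup>2"
proof -
  have "(norm (a + b))\<^sup>2 \<le> (norm a + norm b)\<^sup>2"
    by (simp add: norm_triangle_ineq)
  also have "\<dots> \<le> 2 * (norm a)\<^sup>2 + 2 * (norm b)\<^sup>2"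
    using sum_squares_bound[of "norm a" "norm b"] by (simp add: power2_sum)
  finally show ?thesis .
qed

lemma norm_add4_squared_le:
  fixes a b c d :: "'a::real_normed_vector"
  shows "(norm (a + b + c + d))\<^sup>2 \<le> 4 * (norm a)\<^sup>2 + 4 * (norm b)\<^sup>2 + 4 * (norm c)\<^sup>2 + 4 * (norm d)\<^sup>2"
  using norm_add_squared_le[of "a + b" "c + d"] norm_add_squared_le[of a b] norm_add_squared_le[of c d]
  by (simp add: add.assoc)

section \<open>Convergence in probability and the passage to expectations\<close>

context prob_space
begin

text \<open>The same \<open>\<epsilon>\<close> bounds the size and the probability, which is the
  form in which \<open>has_stratonovich_integral\<close> states convergence. Nonmeasurable sets have
  \<open>measure\<close> 0, so the condition is meaningful only for measurable \<open>D n\<close>;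
  hence the measurability premises of the lemmas about it.\<close>

definition vanishes_in_prob :: "(nat \<Rightarrow> 'a \<Rightarrow> 'b::real_normed_vector) \<Rightarrow> bool" where
  "vanishes_in_prob D \<longleftrightarrow>
     (\<forall>\<epsilon>>0. \<forall>\<^sub>F n in sequentially. prob {\<omega>\<in>space M. norm (D n \<omega>) > \<epsilon>} < \<epsilon>)"

lemma prob_le_of_subset_Un:
  assumes "A \<subseteq> B \<union> C" "B \<in> sets M" "C \<in> sets M"
  shows "prob A \<le> prob B + prob C"
proof -
  have "prob A \<le> prob (B \<union> C)"
    using assms by (intro finite_measure_mono) auto
  also have "\<dots> \<le> prob B + prob C"
    using assms by (intro measure_Un_le) auto
  finally show ?thesis .
qed

text \<open>The two roles of \<open>\<epsilon>\<close> are separated by applying the definition at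
  \<open>min \<epsilon> \<eta>\<close>.\<close>

lemma vanishes_in_probD:
  assumes "vanishes_in_prob D" "0 < \<epsilon>" "0 < \<eta>"
    and "\<And>n. D n \<in> borel_measurable M"
  shows "\<forall>\<^sub>F n in sequentially. prob {\<omega>\<in>space M. norm (D n \<omega>) > \<epsilon>} < \<eta>"
proof -
  have "\<forall>\<^sub>F n in sequentially. prob {\<omega>\<in>space M. norm (D n \<omega>) > min \<epsilon> \<eta>} < min \<epsilon> \<eta>"
    by (rule assms(1)[unfolded vanishes_in_prob_def, rule_format]) (use assms in simp)
  then show ?thesis
  proof eventually_elim
    case (elim n)
    note assms(4)[measurable]
    have "prob {\<omega>\<in>space M. norm (D n \<omega>) > \<epsilon>} \<le> prob {\<omega>\<in>space M. norm (D n \<omega>) > min \<epsilon> \<eta>}"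
      by (intro finite_measure_mono) auto
    with elim show ?case by simp
  qed
qed

lemma vanishes_in_prob_add:
  fixes D E :: "nat \<Rightarrow> 'a \<Rightarrow> 'b::{real_normed_vector, second_countable_topology}"
  assumes D: "vanishes_in_prob D" "\<And>n. D n \<in> borel_measurable M"
    and E: "vanishes_in_prob E" "\<And>n. E n \<in> borel_measurable M"
  shows "vanishes_in_prob (\<lambda>n \<omega>. D n \<omega> + E n \<omega>)"
  unfolding vanishes_in_prob_def
proof (intro allI impI)
  fix \<epsilon> :: real assume \<epsilon>: "0 < \<epsilon>"
  have "\<forall>\<^sub>F n in sequentially. prob {\<omega>\<in>space M. norm (D n \<omega>) > \<epsilon>/2} < \<epsilon>/2"
    using D \<epsilon> by (intro vanishes_in_probD) auto
  moreover have "\<forall>\<^sub>F n in sequentially. prob {\<omega>\<in>space M. norm (E n \<omega>) > \<epsilon>/2} < \<epsilon>/2"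
    using E \<epsilon> by (intro vanishes_in_probD) auto
  ultimately show "\<forall>\<^sub>F n in sequentially. prob {\<omega>\<in>space M. norm (D n \<omega> + E n \<omega>) > \<epsilon>} < \<epsilon>"
  proof eventually_elim
    case (elim n)
    note D(2)[measurable] E(2)[measurable]
    have "prob {\<omega>\<in>space M. norm (D n \<omega> + E n \<omega>) > \<epsilon>}
      \<le> prob {\<omega>\<in>space M. norm (D n \<omega>) > \<epsilon>/2} + prob {\<omega>\<in>space M. norm (E n \<omega>) > \<epsilon>/2}"
    proof (rule prob_le_of_subset_Un)
      show "{\<omega> \<in> space M. \<epsilon> < norm (D n \<omega> + E n \<omega>)}
        \<subseteq> {\<omega> \<in> space M. \<epsilon> / 2 < norm (D n \<omega>)} \<union> {\<omega> \<in> space M. \<epsilon> / 2 < norm (E n \<omega>)}"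
        using norm_triangle_ineq[of "D n _" "E n _"] by (auto simp: not_less) (smt (verit) field_sum_of_halves)
    qed measurable
    with elim show ?case by simp
  qed
qed

lemma vanishes_in_prob_zero: "vanishes_in_prob (\<lambda>n \<omega>. 0)"
  by (auto simp: vanishes_in_prob_def)

lemma vanishes_in_prob_sum:
  fixes D :: "'i \<Rightarrow> nat \<Rightarrow> 'a \<Rightarrow> 'b::{real_normed_vector, second_countable_topology}"
  assumes "\<And>i. i \<in> I \<Longrightarrow> vanishes_in_prob (D i)" "\<And>i n. i \<in> I \<Longrightarrow> D i n \<in> borel_measurable M"
  shows "vanishes_in_prob (\<lambda>n \<omega>. \<Sum>i\<in>I. D i n \<omega>)"
  using assms
proof (induction I rule: infinite_finite_induct)
  case (insert i I)
  have "vanishes_in_prob (\<lambda>n \<omega>. D i n \<omega> + (\<Sum>i\<in>I. D i n \<omega>))"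
    using insert by (intro vanishes_in_prob_add borel_measurable_sum) auto
  then show ?case using insert by simp
qed (auto intro: vanishes_in_prob_zero)

lemma vanishes_in_prob_dominated:
  assumes "vanishes_in_prob D" "0 \<le> c"
    and "\<And>n. D n \<in> borel_measurable M"
    and "\<And>n. AE \<omega> in M. norm (E n \<omega>) \<le> c * norm (D n \<omega>)"
    and [measurable]: "\<And>n. E n \<in> borel_measurable M"
  shows "vanishes_in_prob E"
  unfolding vanishes_in_prob_def
proof (intro allI impI)
  fix \<epsilon> :: real assume \<epsilon>: "0 < \<epsilon>"
  note assms(3)[measurable]
  \<comment> \<open>Dividing by \<open>c + 1\<close> instead of \<open>c\<close> keeps the threshold
    meaningful for \<open>c = 0\<close>.\<close>
  have "\<forall>\<^sub>F n in sequentially. prob {\<omega>\<in>space M. norm (D n \<omega>) > \<epsilon> / (c + 1)} < \<epsilon>"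
    using assms \<epsilon> by (intro vanishes_in_probD) auto
  then show "\<forall>\<^sub>F n in sequentially. prob {\<omega>\<in>space M. norm (E n \<omega>) > \<epsilon>} < \<epsilon>"
  proof eventually_elim
    case (elim n)
    have "prob {\<omega>\<in>space M. norm (E n \<omega>) > \<epsilon>} \<le> prob {\<omega>\<in>space M. norm (D n \<omega>) > \<epsilon> / (c + 1)}"
    proof (rule finite_measure_mono_AE)
      show "AE \<omega> in M. \<omega> \<in> {\<omega>\<in>space M. norm (E n \<omega>) > \<epsilon>} \<longrightarrow> \<omega> \<in> {\<omega>\<in>space M. norm (D n \<omega>) > \<epsilon> / (c + 1)}"
        using assms(4)[of n]
      proof eventually_elim
        case (elim \<omega>)
        have "c * norm (D n \<omega>) \<le> (c + 1) * norm (D n \<omega>)"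
          by (intro mult_right_mono) auto
        with elim assms(2) show ?case
          by (auto simp: divide_less_eq mult.commute)
      qed
    qed measurable
    with elim show ?case by simp
  qed
qed

text \<open>Dominated convergence for the indicators of \<open>A n\<close>, which are almost surely
  0 from some index on.\<close>

lemma prob_tendsto_zero:
  assumes [measurable]: "\<And>n. A n \<in> sets M"
    and ev: "AE \<omega> in M. \<forall>\<^sub>F n in sequentially. \<omega> \<notin> A n"
  shows "(\<lambda>n. prob (A n)) \<longlonglongrightarrow> 0"
proof -
  have "(\<lambda>n. \<integral>\<omega>. indicator (A n) \<omega> \<partial>M) \<longlonglongrightarrow> (\<integral>\<omega>. (0::real) \<partial>M)"
  proof (rule integral_dominated_convergence[where w = "\<lambda>_. 1"])
    show "AE \<omega> in M. (\<lambda>n. indicator (A n) \<omega>) \<longlonglongrightarrow> (0::real)"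
      using ev
    proof eventually_elim
      case (elim \<omega>)
      then have "\<forall>\<^sub>F n in sequentially. (0::real) = indicator (A n) \<omega>"
        by eventually_elim simp
      then show ?case by (rule Lim_transform_eventually[OF tendsto_const])
    qed
  qed (auto simp: indicator_def)
  then show ?thesis by simp
qed

lemma real_rv_tight:
  fixes Y :: "'a \<Rightarrow> real"
  assumes [measurable]: "Y \<in> borel_measurable M" and "0 < \<epsilon>"
  shows "\<exists>L>0. prob {\<omega>\<in>space M. Y \<omega> > L} \<le> \<epsilon>"
proof -
  have "(\<lambda>n. prob {\<omega>\<in>space M. Y \<omega> > real (Suc n)}) \<longlonglongrightarrow> 0"
  proof (rule prob_tendsto_zero)
    show "AE \<omega> in M. \<forall>\<^sub>F n in sequentially. \<omega> \<notin> {\<omega>\<in>space M. Y \<omega> > real (Suc n)}"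
    proof (rule AE_I2)
      fix \<omega>
      obtain m where "Y \<omega> \<le> real m" using real_arch_simple by blast
      then have "\<omega> \<notin> {\<omega>\<in>space M. Y \<omega> > real (Suc n)}" if "n \<ge> m" for n
        using that by simp
      then show "\<forall>\<^sub>F n in sequentially. \<omega> \<notin> {\<omega>\<in>space M. Y \<omega> > real (Suc n)}"
        by (auto simp: eventually_sequentially)
    qed
  qed measurable
  then have "\<forall>\<^sub>F n in sequentially. prob {\<omega>\<in>space M. Y \<omega> > real (Suc n)} < \<epsilon>"
    using assms(2) by (rule order_tendstoD)
  then obtain n where "prob {\<omega>\<in>space M. Y \<omega> > real (Suc n)} < \<epsilon>"
    by (auto simp: eventually_sequentially)
  then show ?thesis
    by (intro exI[of _ "real (Suc n)"]) auto
qed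

text \<open>Nothing is known of \<open>Y\<close> on the exceptional event, so \<open>Y\<close> is
  cut off at \<open>N\<close>: the event then costs at most \<open>N\<close> times its probability,
  which vanishes as the tolerance shrinks. Monotone convergence in \<open>N\<close> removes the
  cut-off. A bound that holds up to small probability thus becomes integrability, with the same
  constant \<open>c\<close>.\<close>

lemma fatou_in_prob:
  fixes Y :: "'a \<Rightarrow> real"
  assumes [measurable]: "Y \<in> borel_measurable M" and nn: "\<And>\<omega>. \<omega> \<in> space M \<Longrightarrow> 0 \<le> Y \<omega>"
    and approx: "\<And>\<epsilon>. 0 < \<epsilon> \<Longrightarrow>
      \<exists>G. integrable M G \<and> (\<forall>\<omega>\<in>space M. 0 \<le> G \<omega>) \<and> (\<integral>\<omega>. G \<omega> \<partial>M) \<le> c \<and>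
        prob {\<omega>\<in>space M. Y \<omega> > G \<omega> + \<epsilon>} \<le> \<epsilon>"
  shows "integrable M Y" "(\<integral>\<omega>. Y \<omega> \<partial>M) \<le> c"
proof -
  have int: "integrable M (\<lambda>\<omega>. min (Y \<omega>) (real N))" for N
    using nn by (intro integrable_const_bound[where B = "real N"] AE_I2) (auto simp: min_def)
  have le: "(\<integral>\<omega>. min (Y \<omega>) (real N) \<partial>M) \<le> c" for N
  proof (rule field_le_epsilon)
    fix e :: real assume e: "0 < e"
    \<comment> \<open>Chosen so that the tolerance and the exceptional event together cost
      \<open>\<epsilon> + N * \<epsilon> = e\<close>.\<close>
    define \<epsilon> where "\<epsilon> = e / (1 + real N)"
    have \<epsilon>: "0 < \<epsilon>" using e by (auto simp: \<epsilon>_def)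
    obtain G where G: "integrable M G" "\<forall>\<omega>\<in>space M. 0 \<le> G \<omega>" "(\<integral>\<omega>. G \<omega> \<partial>M) \<le> c"
      "prob {\<omega>\<in>space M. Y \<omega> > G \<omega> + \<epsilon>} \<le> \<epsilon>"
      using approx[OF \<epsilon>] by blast
    note [measurable] = borel_measurable_integrable[OF G(1)]
    define A where "A = {\<omega>\<in>space M. Y \<omega> > G \<omega> + \<epsilon>}"
    have A[measurable]: "A \<in> sets M" unfolding A_def by measurable
    have "(\<integral>\<omega>. min (Y \<omega>) (real N) \<partial>M) \<le> (\<integral>\<omega>. G \<omega> + \<epsilon> + real N * indicator A \<omega> \<partial>M)"
    proof (rule integral_mono[OF int])
      show "integrable M (\<lambda>\<omega>. G \<omega> + \<epsilon> + real N * indicator A \<omega>)" using G A by (simp add: less_top[symmetric])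
      show "min (Y \<omega>) (real N) \<le> G \<omega> + \<epsilon> + real N * indicator A \<omega>" if "\<omega> \<in> space M" for \<omega>
        using that G \<epsilon> by (cases "\<omega> \<in> A") (auto simp: A_def min_le_iff_disj)
    qed
    also have "\<dots> = (\<integral>\<omega>. G \<omega> \<partial>M) + \<epsilon> + real N * prob A"
      using G(1) A by (simp add: prob_space less_top[symmetric])
    also have "\<dots> \<le> c + \<epsilon> + real N * \<epsilon>"
      using G(3,4) by (intro add_mono mult_left_mono) (auto simp: A_def)
    also have "\<dots> = c + e"
      by (simp add: \<epsilon>_def field_simps add_divide_distrib[symmetric])
    finally show "(\<integral>\<omega>. min (Y \<omega>) (real N) \<partial>M) \<le> c + e" .
  qed
  have inc: "incseq (\<lambda>N. \<integral>\<omega>. min (Y \<omega>) (real N) \<partial>M)"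
    using int by (intro monoI integral_mono) (auto simp: min_def)
  obtain x where x: "(\<lambda>N. \<integral>\<omega>. min (Y \<omega>) (real N) \<partial>M) \<longlonglongrightarrow> x"
    using incseq_convergent[OF inc, of c] le by blast
  have lim: "(\<lambda>N. min (Y \<omega>) (real N)) \<longlonglongrightarrow> Y \<omega>" for \<omega>
  proof -
    obtain m where m: "Y \<omega> \<le> real m" using real_arch_simple by blast
    then have "\<forall>\<^sub>F N in sequentially. Y \<omega> = min (Y \<omega>) (real N)"
      by (auto simp: eventually_sequentially min_def intro!: exI[of _ m])
    then show ?thesis by (rule Lim_transform_eventually[OF tendsto_const])
  qed
  have *: "AE \<omega> in M. mono (\<lambda>N. min (Y \<omega>) (real N))" "AE \<omega> in M. 0 \<le> min (Y \<omega>) (real N)"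
    "AE \<omega> in M. (\<lambda>N. min (Y \<omega>) (real N)) \<longlonglongrightarrow> Y \<omega>" for N
    using nn lim by (auto intro!: AE_I2 monoI simp: min_def)
  show "integrable M Y"
    by (rule integral_monotone_convergence_nonneg(1)[OF int * x]) measurable
  have "(\<integral>\<omega>. Y \<omega> \<partial>M) = x"
    by (rule integral_monotone_convergence_nonneg(2)[OF int * x]) measurable
  also have "x \<le> c"
    using x le by (intro LIMSEQ_le_const2) auto
  finally show "(\<integral>\<omega>. Y \<omega> \<partial>M) \<le> c" .
qed

lemma integrable_of_square:
  fixes Y :: "'a \<Rightarrow> 'b::{banach, second_countable_topology}"
  assumes "integrable M (\<lambda>\<omega>. (norm (Y \<omega>))\<^sup>2)" "Y \<in> borel_measurable M"
  shows "integrable M Y"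
proof (rule Bochner_Integration.integrable_bound)
  show "integrable M (\<lambda>\<omega>. 1 + (norm (Y \<omega>))\<^sup>2)" using assms by simp
  show "AE \<omega> in M. norm (Y \<omega>) \<le> norm (1 + (norm (Y \<omega>))\<^sup>2)"
    using young_weighted[of 1 1 "norm (Y _)"] by (intro AE_I2) (simp, smt (verit) zero_le_power2)
qed (use assms in auto)

text \<open>On the exceptional event the norm is split by Young's inequality into
  \<open>\<epsilon>\<close> times its square and the constant \<open>1 / \<epsilon>\<close>. The
  event has probability at most \<open>\<epsilon>\<^sup>2\<close>, so the second part contributes
  only the order \<open>\<epsilon>\<close>. With \<open>c\<close> held fixed, smallness in
  probability therefore becomes smallness of the mean.\<close>

lemma norm_expectation_le_of_approx:
  fixes D :: "'a \<Rightarrow> 'b::{banach, second_countable_topology}"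
  assumes D: "D \<in> borel_measurable M" "integrable M (\<lambda>\<omega>. (norm (D \<omega>))\<^sup>2)"
    and c: "(\<integral>\<omega>. (norm (D \<omega>))\<^sup>2 \<partial>M) \<le> c"
    and e: "integrable M e" "\<And>\<omega>. \<omega> \<in> space M \<Longrightarrow> 0 \<le> e \<omega>"
    and \<epsilon>: "0 < \<epsilon>" "prob {\<omega>\<in>space M. norm (D \<omega>) > e \<omega> + \<epsilon>\<^sup>2} \<le> \<epsilon>\<^sup>2"
  shows "norm (\<integral>\<omega>. D \<omega> \<partial>M) \<le> (\<integral>\<omega>. e \<omega> \<partial>M) + \<epsilon>\<^sup>2 + \<epsilon> * (c + 1) / 2"
proof -
  note [measurable] = D(1) borel_measurable_integrable[OF e(1)]
  define A where "A = {\<omega>\<in>space M. norm (D \<omega>) > e \<omega> + \<epsilon>\<^sup>2}"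
  have A[measurable]: "A \<in> sets M" unfolding A_def by measurable
  have iD: "integrable M (\<lambda>\<omega>. norm (D \<omega>))"
    using integrable_of_square[OF D(2,1)] by simp
  have "norm (\<integral>\<omega>. D \<omega> \<partial>M) \<le> (\<integral>\<omega>. norm (D \<omega>) \<partial>M)"
    by simp
  also have "\<dots> \<le> (\<integral>\<omega>. e \<omega> + \<epsilon>\<^sup>2 + (\<epsilon> * (norm (D \<omega>))\<^sup>2 + indicator A \<omega> / \<epsilon>) / 2 \<partial>M)"
  proof (rule integral_mono)
    fix \<omega> assume \<omega>: "\<omega> \<in> space M"
    show "norm (D \<omega>) \<le> e \<omega> + \<epsilon>\<^sup>2 + (\<epsilon> * (norm (D \<omega>))\<^sup>2 + indicator A \<omega> / \<epsilon>) / 2"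
    proof (cases "\<omega> \<in> A")
      case True
      have "norm (D \<omega>) * 1 \<le> (\<epsilon> * (norm (D \<omega>))\<^sup>2 + 1\<^sup>2 / \<epsilon>) / 2"
        by (rule young_weighted) fact
      moreover have "0 \<le> e \<omega> + \<epsilon>\<^sup>2" using e(2)[OF \<omega>] by simp
      moreover have "indicator A \<omega> = (1::real)" using True by simp
      ultimately show ?thesis by (simp only: mult_1_right power_one add_increasing)
    next
      case False
      then have "norm (D \<omega>) \<le> e \<omega> + \<epsilon>\<^sup>2" using \<omega> by (simp add: A_def)
      moreover have "0 \<le> \<epsilon> * (norm (D \<omega>))\<^sup>2" using \<epsilon>(1) by simp
      ultimately show ?thesis using False by simp
    qed
  qed (use iD D e A in \<open>auto simp: less_top[symmetric]\<close>)
  also have "\<dots> = (\<integral>\<omega>. e \<omega> \<partial>M) + \<epsilon>\<^sup>2 + (\<epsilon> * (\<integral>\<omega>. (norm (D \<omega>))\<^sup>2 \<partial>M) + prob A / \<epsilon>) / 2"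
    using e D A by (simp add: prob_space less_top[symmetric])
  also have "\<dots> \<le> (\<integral>\<omega>. e \<omega> \<partial>M) + \<epsilon>\<^sup>2 + (\<epsilon> * c + \<epsilon>\<^sup>2 / \<epsilon>) / 2"
    using c \<epsilon> by (intro add_mono divide_right_mono mult_left_mono) (auto simp: A_def)
  also have "\<dots> = (\<integral>\<omega>. e \<omega> \<partial>M) + \<epsilon>\<^sup>2 + \<epsilon> * (c + 1) / 2"
    using \<epsilon>(1) by (simp add: power2_eq_square field_simps)
  finally show ?thesis .
qed

end

section \<open>Brownian increments\<close>

definition uniform_pt :: "real \<Rightarrow> real \<Rightarrow> nat \<Rightarrow> nat \<Rightarrow> real" where
  "uniform_pt s t n j = s + real j * ((t - s) / real n)"

lemma uniform_pt_0 [simp]: "uniform_pt s t n 0 = s"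
  by (simp add: uniform_pt_def)

lemma uniform_pt_last [simp]: "0 < n \<Longrightarrow> uniform_pt s t n n = t"
  by (simp add: uniform_pt_def)

lemma uniform_pt_Suc_diff: "uniform_pt s t n (Suc j) - uniform_pt s t n j = (t - s) / real n"
  by (simp add: uniform_pt_def algebra_simps add_divide_distrib diff_divide_distrib)

lemma uniform_pt_le_Suc: "s \<le> t \<Longrightarrow> uniform_pt s t n j \<le> uniform_pt s t n (Suc j)"
  using uniform_pt_Suc_diff[of s t n j] by (smt (verit) divide_nonneg_nonneg of_nat_0_le_iff)

lemma uniform_pt_less_Suc: "s < t \<Longrightarrow> 0 < n \<Longrightarrow> uniform_pt s t n j < uniform_pt s t n (Suc j)"
  using uniform_pt_Suc_diff[of s t n j] by (smt (verit) divide_pos_pos of_nat_0_less_iff)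

lemma uniform_pt_ge: "s \<le> t \<Longrightarrow> s \<le> uniform_pt s t n j"
  by (simp add: uniform_pt_def)

lemma uniform_pt_le:
  assumes "s \<le> t" "j \<le> n" shows "uniform_pt s t n j \<le> t"
proof (cases "n = 0")
  case False
  have "real j * ((t - s) / real n) \<le> real n * ((t - s) / real n)"
    using assms by (intro mult_right_mono) auto
  then show ?thesis using False by (simp add: uniform_pt_def)
qed (use assms in simp)

lemma uniform_pt_bounds:
  assumes "0 \<le> s" "s < t" "j < n"
  shows "0 \<le> uniform_pt s t n j" "0 \<le> uniform_pt s t n (Suc j)"
    "uniform_pt s t n j < uniform_pt s t n (Suc j)"
    "uniform_pt s t n j \<le> t" "uniform_pt s t n (Suc j) \<le> t"
    "s \<le> uniform_pt s t n j" "s \<le> uniform_pt s t n (Suc j)"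
  using assms uniform_pt_ge[of s t n j] uniform_pt_ge[of s t n "Suc j"] uniform_pt_le[of s t j n]
    uniform_pt_le[of s t "Suc j" n] uniform_pt_less_Suc[of s t n j]
  by auto

lemma uniform_pt_refine:
  assumes "0 < n" "0 < m"
  shows "uniform_pt (uniform_pt s t n j) (uniform_pt s t n (Suc j)) m l = uniform_pt s t (n * m) (j * m + l)"
  using assms unfolding uniform_pt_def
  by (simp add: field_simps)

lemma sum_uniform_refine:
  fixes f :: "nat \<Rightarrow> 'a::comm_monoid_add"
  shows "(\<Sum>j<n. \<Sum>l<m. f (j * m + l)) = (\<Sum>j<n * m. f j)"
proof -
  have "(\<Sum>l<m. f (j * m + l)) = sum f {j * m..<j * m + m}" for j
    using sum.shift_bounds_nat_ivl[of f 0 "j * m" m] by (simp add: lessThan_atLeast0 add.commute)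
  then show ?thesis
    by (simp add: sum.nat_group)
qed

text \<open>Chebyshev's inequality. The second moment has to fall below
  \<open>\<epsilon> * \<epsilon>\<^sup>2\<close> because \<open>\<epsilon>\<close> bounds the
  probability as well as the size.\<close>

lemma (in prob_space) vanishes_in_prob_of_L2:
  fixes D :: "nat \<Rightarrow> 'a \<Rightarrow> real"
  assumes [measurable]: "\<And>n. D n \<in> borel_measurable M"
    and int: "\<And>n. integrable M (\<lambda>\<omega>. (D n \<omega>)\<^sup>2)"
    and lim: "(\<lambda>n. \<integral>\<omega>. (D n \<omega>)\<^sup>2 \<partial>M) \<longlonglongrightarrow> 0"
  shows "vanishes_in_prob D"
  unfolding vanishes_in_prob_def
proof (intro allI impI)
  fix \<epsilon> :: real assume \<epsilon>: "0 < \<epsilon>"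
  have "\<forall>\<^sub>F n in sequentially. (\<integral>\<omega>. (D n \<omega>)\<^sup>2 \<partial>M) < \<epsilon> * \<epsilon>\<^sup>2"
    using lim by (rule order_tendstoD) (use \<epsilon> in simp)
  then show "\<forall>\<^sub>F n in sequentially. prob {\<omega>\<in>space M. norm (D n \<omega>) > \<epsilon>} < \<epsilon>"
  proof eventually_elim
    case (elim n)
    have "prob {\<omega>\<in>space M. norm (D n \<omega>) > \<epsilon>} \<le> prob {\<omega>\<in>space M. (D n \<omega>)\<^sup>2 \<ge> \<epsilon>\<^sup>2}"
      using \<epsilon> by (intro finite_measure_mono) (auto simp: abs_le_square_iff[symmetric])
    also have "\<dots> \<le> (\<integral>\<omega>. (D n \<omega>)\<^sup>2 \<partial>M) / \<epsilon>\<^sup>2"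
      using int[of n] \<epsilon> by (intro integral_Markov_inequality_measure[where A = "{}"]) auto
    also have "\<dots> < \<epsilon>"
      using elim \<epsilon> by (simp add: divide_less_eq)
    finally show ?case .
  qed
qed

section \<open>Increments of the driving Brownian motions\<close>

locale brownian_setup = filtered_prob_space M \<F>
  for M :: "'w measure" and \<F> :: "real \<Rightarrow> 'w measure" +
  fixes k :: nat and B :: "nat \<Rightarrow> real \<Rightarrow> 'w \<Rightarrow> real"
  assumes bm: "brownian_motions M \<F> k B"
begin

definition inc :: "nat \<Rightarrow> real \<Rightarrow> real \<Rightarrow> 'w \<Rightarrow> real" where
  "inc i s t \<omega> = B i t \<omega> - B i s \<omega>"

lemma subalgebra_F: "subalgebra M (\<F> t)"
  using sets_F_subset space_F by (auto simp: subalgebra_def)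

lemma measurable_F_M: "Y \<in> borel_measurable (\<F> t) \<Longrightarrow> Y \<in> borel_measurable M"
  by (rule measurable_from_subalg[OF subalgebra_F])

lemma measurable_F_mono: "Y \<in> borel_measurable (\<F> s) \<Longrightarrow> s \<le> t \<Longrightarrow> Y \<in> borel_measurable (\<F> t)"
  by (rule measurable_from_subalg[where F = "\<F> s"]) (use sets_F_mono space_F in \<open>auto simp: subalgebra_def\<close>)

lemma B_measurable: "i \<in> {1..k} \<Longrightarrow> 0 \<le> t \<Longrightarrow> B i t \<in> borel_measurable (\<F> t)"
  using bm by (auto simp: brownian_motions_def continuous_adapted_def)

lemma inc_measurable_F:
  assumes "i \<in> {1..k}" "0 \<le> s" "s \<le> t"
  shows "inc i s t \<in> borel_measurable (\<F> t)"
proof -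
  have [measurable]: "B i s \<in> borel_measurable (\<F> t)" "B i t \<in> borel_measurable (\<F> t)"
    using assms B_measurable measurable_F_mono[of "B i s" s t] by auto
  show ?thesis unfolding inc_def by measurable
qed

lemma inc_measurable:
  "i \<in> {1..k} \<Longrightarrow> 0 \<le> s \<Longrightarrow> s \<le> t \<Longrightarrow> inc i s t \<in> borel_measurable M"
  using inc_measurable_F measurable_F_M by blast

lemma inc_moment_integrable:
  assumes "i \<in> {1..k}" "0 \<le> s" "s < t"
  shows "integrable M (\<lambda>\<omega>. inc i s t \<omega> ^ n)"
proof -
  have D: "distributed M lborel (inc i s t) (normal_density 0 (sqrt (t - s)))"
    using bm assms unfolding brownian_motions_def inc_def by simp
  have "integrable lborel (\<lambda>x. normal_density 0 (sqrt (t - s)) x * x ^ n)"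
    using integrable_normal_moment[of "sqrt (t - s)" 0 n] assms by simp
  then show ?thesis
    using distributed_integrable[OF D, of "\<lambda>x. x ^ n"] by simp
qed

lemma inc_moments:
  assumes "i \<in> {1..k}" "0 \<le> s" "s < t"
  shows "(\<integral>\<omega>. inc i s t \<omega> \<partial>M) = 0" "(\<integral>\<omega>. (inc i s t \<omega>)\<^sup>2 \<partial>M) = t - s"
    "(\<integral>\<omega>. inc i s t \<omega> ^ 4 \<partial>M) = 3 * (t - s)\<^sup>2"
proof -
  have D: "distributed M lborel (inc i s t) (normal_density 0 (sqrt (t - s)))"
    using bm assms unfolding brownian_motions_def inc_def by simp
  have *: "(\<integral>\<omega>. inc i s t \<omega> ^ n \<partial>M) = (\<integral>x. normal_density 0 (sqrt (t - s)) x * x ^ n \<partial>lborel)" for n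
    using distributed_integral[OF D, of "\<lambda>x. x ^ n"] by simp
  have pos: "0 < sqrt (t - s)" using assms by simp
  show "(\<integral>\<omega>. inc i s t \<omega> \<partial>M) = 0"
    using *[of 1] integral_normal_moment_odd[OF pos, of 0 0] by simp
  show "(\<integral>\<omega>. (inc i s t \<omega>)\<^sup>2 \<partial>M) = t - s"
    using *[of 2] integral_normal_moment_even[OF pos, of 0 1] assms by (simp add: eval_nat_numeral)
  show "(\<integral>\<omega>. inc i s t \<omega> ^ 4 \<partial>M) = 3 * (t - s)\<^sup>2"
    using *[of 4] integral_normal_moment_even[OF pos, of 0 2] assms
    by (simp add: power_divide fact_numeral power2_eq_square field_simps)
qed

text \<open>The past enters as a single real random variable at index \<open>None\<close>: the
  events generated by \<open>Y\<close> belong to \<open>\<F> s\<close>, and independence passes to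
  smaller families of events.\<close>

lemma indep_past_inc:
  assumes "Y \<in> borel_measurable (\<F> s)" "0 \<le> s" "s < t"
  shows "indep_vars (\<lambda>_. borel) (case_option Y (\<lambda>i. inc i s t)) (insert None (Some ` {1..k}))"
  unfolding indep_vars_def2
proof (intro conjI ballI)
  fix j assume "j \<in> insert None (Some ` {1..k})"
  then show "case_option Y (\<lambda>i. inc i s t) j \<in> borel_measurable M"
    using assms inc_measurable[of _ s t] measurable_F_M by auto
next
  have "indep_sets (\<lambda>j. case j of None \<Rightarrow> sets (\<F> s)
      | Some i \<Rightarrow> {(\<lambda>\<omega>. B i t \<omega> - B i s \<omega>) -` A \<inter> space M |A. A \<in> sets borel}) (insert None (Some ` {1..k}))"
    using bm assms unfolding brownian_motions_def by blast
  then show "indep_sets (\<lambda>j. {case_option Y (\<lambda>i. inc i s t) j -` A \<inter> space M |A. A \<in> sets borel})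
      (insert None (Some ` {1..k}))"
  proof (rule indep_sets_mono_sets)
    fix j assume "j \<in> insert None (Some ` {1..k})"
    then show "{case_option Y (\<lambda>i. inc i s t) j -` A \<inter> space M |A. A \<in> sets borel}
      \<subseteq> (case j of None \<Rightarrow> sets (\<F> s)
        | Some i \<Rightarrow> {(\<lambda>\<omega>. B i t \<omega> - B i s \<omega>) -` A \<inter> space M |A. A \<in> sets borel})"
    proof (cases j)
      case None
      then show ?thesis using measurable_sets[OF assms(1)] by (auto simp: space_F)
    next
      case (Some i)
      then show ?thesis by (simp add: inc_def[abs_def])
    qed
  qed
qed

text \<open>Expectations factor over the three independent indices \<open>None\<close>,
  \<open>Some i\<close> and \<open>Some l\<close>, which are distinct because
  \<open>i \<noteq> l\<close>; the function \<open>\<phi>\<close> attaches the identity,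
  \<open>g\<close> and \<open>h\<close> to them.\<close>

lemma past_inc_inc:
  fixes Y :: "'w \<Rightarrow> real"
  assumes Y: "Y \<in> borel_measurable (\<F> s)" "integrable M Y" and st: "0 \<le> s" "s < t"
    and il: "i \<in> {1..k}" "l \<in> {1..k}" "i \<noteq> l"
    and [measurable]: "g \<in> borel_measurable borel" "h \<in> borel_measurable borel"
    and gh: "integrable M (\<lambda>\<omega>. g (inc i s t \<omega>))" "integrable M (\<lambda>\<omega>. h (inc l s t \<omega>))"
  shows "integrable M (\<lambda>\<omega>. Y \<omega> * (g (inc i s t \<omega>) * h (inc l s t \<omega>)))"
    "(\<integral>\<omega>. Y \<omega> * (g (inc i s t \<omega>) * h (inc l s t \<omega>)) \<partial>M)
      = (\<integral>\<omega>. Y \<omega> \<partial>M) * ((\<integral>\<omega>. g (inc i s t \<omega>) \<partial>M) * (\<integral>\<omega>. h (inc l s t \<omega>) \<partial>M))"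
proof -
  define \<phi> where "\<phi> j = (case j of None \<Rightarrow> (\<lambda>x. x) | Some m \<Rightarrow> if m = i then g else h)" for j
  let ?J = "{None, Some i, Some l}"
  have "indep_vars (\<lambda>_. borel) (case_option Y (\<lambda>i. inc i s t)) ?J"
    using indep_vars_subset[OF indep_past_inc[OF Y(1) st], of ?J] il by auto
  then have ind: "indep_vars (\<lambda>_. borel) (\<lambda>j \<omega>. \<phi> j (case_option Y (\<lambda>i. inc i s t) j \<omega>)) ?J"
    by (rule indep_vars_compose2) (auto simp: \<phi>_def split: option.split)
  have int: "integrable M (\<lambda>\<omega>. \<phi> j (case_option Y (\<lambda>i. inc i s t) j \<omega>))" if "j \<in> ?J" for j
    using that Y gh il(3) by (auto simp: \<phi>_def)
  show "integrable M (\<lambda>\<omega>. Y \<omega> * (g (inc i s t \<omega>) * h (inc l s t \<omega>)))"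
    using indep_vars_integrable[OF _ ind int] il(3) by (simp add: \<phi>_def)
  show "(\<integral>\<omega>. Y \<omega> * (g (inc i s t \<omega>) * h (inc l s t \<omega>)) \<partial>M)
      = (\<integral>\<omega>. Y \<omega> \<partial>M) * ((\<integral>\<omega>. g (inc i s t \<omega>) \<partial>M) * (\<integral>\<omega>. h (inc l s t \<omega>) \<partial>M))"
    using indep_vars_lebesgue_integral[OF _ ind int] il(3) by (simp add: \<phi>_def)
qed

lemma past_inc:
  fixes Y :: "'w \<Rightarrow> real"
  assumes Y: "Y \<in> borel_measurable (\<F> s)" "integrable M Y" and st: "0 \<le> s" "s < t"
    and i: "i \<in> {1..k}"
    and [measurable]: "g \<in> borel_measurable borel"
    and g: "integrable M (\<lambda>\<omega>. g (inc i s t \<omega>))"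
  shows "integrable M (\<lambda>\<omega>. Y \<omega> * g (inc i s t \<omega>))"
    "(\<integral>\<omega>. Y \<omega> * g (inc i s t \<omega>) \<partial>M) = (\<integral>\<omega>. Y \<omega> \<partial>M) * (\<integral>\<omega>. g (inc i s t \<omega>) \<partial>M)"
proof -
  define \<phi> where "\<phi> j = (case j of None \<Rightarrow> (\<lambda>x. x) | Some m \<Rightarrow> g)" for j :: "nat option"
  let ?J = "{None, Some i}"
  have "indep_vars (\<lambda>_. borel) (case_option Y (\<lambda>i. inc i s t)) ?J"
    using indep_vars_subset[OF indep_past_inc[OF Y(1) st], of ?J] i by auto
  then have ind: "indep_vars (\<lambda>_. borel) (\<lambda>j \<omega>. \<phi> j (case_option Y (\<lambda>i. inc i s t) j \<omega>)) ?J"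
    by (rule indep_vars_compose2) (auto simp: \<phi>_def split: option.split)
  have int: "integrable M (\<lambda>\<omega>. \<phi> j (case_option Y (\<lambda>i. inc i s t) j \<omega>))" if "j \<in> ?J" for j
    using that Y g by (auto simp: \<phi>_def)
  show "integrable M (\<lambda>\<omega>. Y \<omega> * g (inc i s t \<omega>))"
    using indep_vars_integrable[OF _ ind int] by (simp add: \<phi>_def)
  show "(\<integral>\<omega>. Y \<omega> * g (inc i s t \<omega>) \<partial>M) = (\<integral>\<omega>. Y \<omega> \<partial>M) * (\<integral>\<omega>. g (inc i s t \<omega>) \<partial>M)"
    using indep_vars_lebesgue_integral[OF _ ind int] by (simp add: \<phi>_def)
qed

text \<open>\<open>\<xi>\<close> has conditional mean \<open>0\<close> and conditional variance \<open>v\<close> given \<open>\<F> s\<close>, tested against integrable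
  \<open>\<F> s\<close>-measurable variables so that no conditional expectations are needed.\<close>

definition innovation :: "real \<Rightarrow> real \<Rightarrow> ('w \<Rightarrow> real) \<Rightarrow> real \<Rightarrow> bool" where
  "innovation s t \<xi> v \<longleftrightarrow> \<xi> \<in> borel_measurable (\<F> t) \<and>
     (\<forall>Y. Y \<in> borel_measurable (\<F> s) \<and> integrable M Y \<longrightarrow>
        integrable M (\<lambda>\<omega>. Y \<omega> * \<xi> \<omega>) \<and> (\<integral>\<omega>. Y \<omega> * \<xi> \<omega> \<partial>M) = 0 \<and>
        integrable M (\<lambda>\<omega>. Y \<omega> * (\<xi> \<omega>)\<^sup>2) \<and> (\<integral>\<omega>. Y \<omega> * (\<xi> \<omega>)\<^sup>2 \<partial>M) = v * (\<integral>\<omega>. Y \<omega> \<partial>M))"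

lemma innovation_inc:
  assumes "i \<in> {1..k}" "0 \<le> s" "s < t"
  shows "innovation s t (inc i s t) (t - s)"
  unfolding innovation_def
proof (intro conjI allI impI, goal_cases)
  case 1
  show ?case using assms by (intro inc_measurable_F) auto
next
  case (2 Y)
  then show ?case
    using past_inc(1)[OF _ _ assms(2,3,1), of Y "\<lambda>x. x"] inc_moment_integrable[OF assms, of 1] by simp
next
  case (3 Y)
  then show ?case
    using past_inc(2)[OF _ _ assms(2,3,1), of Y "\<lambda>x. x"] inc_moment_integrable[OF assms, of 1]
    unfolding inc_moments(1)[OF assms] by simp
next
  case (4 Y)
  then show ?case
    using past_inc(1)[OF _ _ assms(2,3,1), of Y "\<lambda>x. x\<^sup>2"] inc_moment_integrable[OF assms, of 2] by simp
next
  case (5 Y)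
  then show ?case
    using past_inc(2)[OF _ _ assms(2,3,1), of Y "\<lambda>x. x\<^sup>2"] inc_moment_integrable[OF assms, of 2]
    unfolding inc_moments(2)[OF assms] by (simp add: mult.commute)
qed

text \<open>The centred square of an increment. Its variance is
  \<open>3 * (t - s)\<^sup>2 - 2 * (t - s)\<^sup>2 + (t - s)\<^sup>2\<close>, the first term being
  the Gaussian fourth moment.\<close>

lemma innovation_inc_square:
  assumes "i \<in> {1..k}" "0 \<le> s" "s < t"
  shows "innovation s t (\<lambda>\<omega>. (inc i s t \<omega>)\<^sup>2 - (t - s)) (2 * (t - s)\<^sup>2)"
proof -
  have eq: "((inc i s t \<omega>)\<^sup>2 - (t - s))\<^sup>2 = inc i s t \<omega> ^ 4 - 2 * (t - s) * (inc i s t \<omega>)\<^sup>2 + (t - s)\<^sup>2" for \<omega>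
    by (simp add: power2_eq_square power4_eq_xxxx algebra_simps)
  have i: "integrable M (\<lambda>\<omega>. (inc i s t \<omega>)\<^sup>2 - (t - s))"
    "integrable M (\<lambda>\<omega>. ((inc i s t \<omega>)\<^sup>2 - (t - s))\<^sup>2)"
    using inc_moment_integrable[OF assms, of 2] inc_moment_integrable[OF assms, of 4]
    unfolding eq by auto
  have e: "(\<integral>\<omega>. (inc i s t \<omega>)\<^sup>2 - (t - s) \<partial>M) = 0"
    using inc_moment_integrable[OF assms, of 2] inc_moments[OF assms] by (simp add: prob_space)
  have e2: "(\<integral>\<omega>. ((inc i s t \<omega>)\<^sup>2 - (t - s))\<^sup>2 \<partial>M) = 2 * (t - s)\<^sup>2"
    using inc_moment_integrable[OF assms, of 2] inc_moment_integrable[OF assms, of 4] inc_moments[OF assms]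
    unfolding eq by (simp add: prob_space power2_eq_square)
  have [measurable]: "inc i s t \<in> borel_measurable (\<F> t)"
    using assms by (intro inc_measurable_F) auto
  show ?thesis
    unfolding innovation_def
  proof (intro conjI allI impI, goal_cases)
    case 1
    show ?case by measurable
  next
    case (2 Y)
    then show ?case
      using past_inc(1)[OF _ _ assms(2,3,1), of Y "\<lambda>x. x\<^sup>2 - (t - s)"] i by simp
  next
    case (3 Y)
    then show ?case
      using past_inc(2)[OF _ _ assms(2,3,1), of Y "\<lambda>x. x\<^sup>2 - (t - s)"] i unfolding e by simp
  next
    case (4 Y)
    then show ?case
      using past_inc(1)[OF _ _ assms(2,3,1), of Y "\<lambda>x. (x\<^sup>2 - (t - s))\<^sup>2"] i by simp
  next
    case (5 Y)
    then show ?case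
      using past_inc(2)[OF _ _ assms(2,3,1), of Y "\<lambda>x. (x\<^sup>2 - (t - s))\<^sup>2"] i unfolding e2 by simp
  qed
qed

lemma innovation_inc_inc:
  assumes "i \<in> {1..k}" "l \<in> {1..k}" "i \<noteq> l" "0 \<le> s" "s < t"
  shows "innovation s t (\<lambda>\<omega>. inc i s t \<omega> * inc l s t \<omega>) ((t - s)\<^sup>2)"
proof -
  note a = assms(1,4,5) and b = assms(2,4,5)
  have [measurable]: "inc i s t \<in> borel_measurable (\<F> t)" "inc l s t \<in> borel_measurable (\<F> t)"
    using assms by (auto intro!: inc_measurable_F)
  note i1 = inc_moment_integrable[OF a, of 1, simplified] inc_moment_integrable[OF b, of 1, simplified]
  note i2 = inc_moment_integrable[OF a, of 2] inc_moment_integrable[OF b, of 2]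
  show ?thesis
    unfolding innovation_def
  proof (intro conjI allI impI, goal_cases)
    case 1
    show ?case by measurable
  next
    case (2 Y)
    then show ?case
      using past_inc_inc(1)[OF _ _ assms(4,5,1,2,3), of Y "\<lambda>x. x" "\<lambda>x. x"] i1 by simp
  next
    case (3 Y)
    then show ?case
      using past_inc_inc(2)[OF _ _ assms(4,5,1,2,3), of Y "\<lambda>x. x" "\<lambda>x. x"] i1 inc_moments(1)[OF a] by simp
  next
    case (4 Y)
    then show ?case
      using past_inc_inc(1)[OF _ _ assms(4,5,1,2,3), of Y "\<lambda>x. x\<^sup>2" "\<lambda>x. x\<^sup>2"] i2
      by (simp add: power_mult_distrib)
  next
    case (5 Y)
    have "(\<integral>\<omega>. Y \<omega> * ((inc i s t \<omega>)\<^sup>2 * (inc l s t \<omega>)\<^sup>2) \<partial>M) = (\<integral>\<omega>. Y \<omega> \<partial>M) * ((t - s) * (t - s))"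
      using past_inc_inc(2)[OF _ _ assms(4,5,1,2,3), of Y "\<lambda>x. x\<^sup>2" "\<lambda>x. x\<^sup>2"] i2 5
      unfolding inc_moments(2)[OF a] inc_moments(2)[OF b] by simp
    then show ?case
      by (simp only: power_mult_distrib power2_eq_square[of "t - s"] mult.commute)
  qed
qed

text \<open>A discrete Ito isometry. When the last term is added to the partial sum
  \<open>S\<close>, the cross term is the product of \<open>S \<bullet> y m\<close>, which is known
  at time \<open>p m\<close>, with the innovation \<open>\<xi> m\<close>, so its mean is 0; the
  square of the new term contributes \<open>v m\<close> times the second moment of
  \<open>y m\<close>.\<close>

lemma orthogonal_sum:
  fixes y :: "nat \<Rightarrow> 'w \<Rightarrow> 'b::euclidean_space"
  assumes p: "\<And>j. j < m \<Longrightarrow> p j \<le> p (Suc j)"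
    and \<xi>: "\<And>j. j < m \<Longrightarrow> innovation (p j) (p (Suc j)) (\<xi> j) (v j)"
    and y: "\<And>j. j < m \<Longrightarrow> y j \<in> borel_measurable (\<F> (p j))"
      "\<And>j. j < m \<Longrightarrow> integrable M (\<lambda>\<omega>. (norm (y j \<omega>))\<^sup>2)"
  shows "(\<lambda>\<omega>. \<Sum>j<m. \<xi> j \<omega> *\<^sub>R y j \<omega>) \<in> borel_measurable (\<F> (p m))"
    "integrable M (\<lambda>\<omega>. (norm (\<Sum>j<m. \<xi> j \<omega> *\<^sub>R y j \<omega>))\<^sup>2)"
    "(\<integral>\<omega>. (norm (\<Sum>j<m. \<xi> j \<omega> *\<^sub>R y j \<omega>))\<^sup>2 \<partial>M) = (\<Sum>j<m. v j * (\<integral>\<omega>. (norm (y j \<omega>))\<^sup>2 \<partial>M))"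
    "(\<integral>\<omega>. (\<Sum>j<m. \<xi> j \<omega> *\<^sub>R y j \<omega>) \<partial>M) = 0"
proof -
  have "(\<lambda>\<omega>. \<Sum>j<m. \<xi> j \<omega> *\<^sub>R y j \<omega>) \<in> borel_measurable (\<F> (p m)) \<and>
    integrable M (\<lambda>\<omega>. (norm (\<Sum>j<m. \<xi> j \<omega> *\<^sub>R y j \<omega>))\<^sup>2) \<and>
    (\<integral>\<omega>. (norm (\<Sum>j<m. \<xi> j \<omega> *\<^sub>R y j \<omega>))\<^sup>2 \<partial>M) = (\<Sum>j<m. v j * (\<integral>\<omega>. (norm (y j \<omega>))\<^sup>2 \<partial>M)) \<and>
    (\<integral>\<omega>. (\<Sum>j<m. \<xi> j \<omega> *\<^sub>R y j \<omega>) \<partial>M) = 0"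
    using assms
  proof (induction m)
    case (Suc m)
    define S where "S \<omega> = (\<Sum>j<m. \<xi> j \<omega> *\<^sub>R y j \<omega>)" for \<omega>
    have S: "S \<in> borel_measurable (\<F> (p m))" "integrable M (\<lambda>\<omega>. (norm (S \<omega>))\<^sup>2)"
      "(\<integral>\<omega>. (norm (S \<omega>))\<^sup>2 \<partial>M) = (\<Sum>j<m. v j * (\<integral>\<omega>. (norm (y j \<omega>))\<^sup>2 \<partial>M))"
      "(\<integral>\<omega>. S \<omega> \<partial>M) = 0"
      using Suc.IH Suc.prems unfolding S_def by auto
    have Y: "y m \<in> borel_measurable (\<F> (p m))" "integrable M (\<lambda>\<omega>. (norm (y m \<omega>))\<^sup>2)"
      using Suc.prems by auto
    have inn: "innovation (p m) (p (Suc m)) (\<xi> m) (v m)" and pm: "p m \<le> p (Suc m)"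
      using Suc.prems by auto
    note inn' = inn[unfolded innovation_def, THEN conjunct2, rule_format]
    have [measurable]: "S \<in> borel_measurable (\<F> (p (Suc m)))" "y m \<in> borel_measurable (\<F> (p (Suc m)))"
      "\<xi> m \<in> borel_measurable (\<F> (p (Suc m)))"
      using measurable_F_mono[OF S(1) pm] measurable_F_mono[OF Y(1) pm] inn by (auto simp: innovation_def)
    note [measurable] = measurable_F_M[OF S(1)] measurable_F_M[OF Y(1)]
    have \<xi>M[measurable]: "\<xi> m \<in> borel_measurable M"
      using inn measurable_F_M unfolding innovation_def by blast
    have SY: "(\<lambda>\<omega>. S \<omega> \<bullet> y m \<omega>) \<in> borel_measurable (\<F> (p m))"
      using S(1) Y(1) by measurable
    have iSY: "integrable M (\<lambda>\<omega>. S \<omega> \<bullet> y m \<omega>)"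
    proof (rule Bochner_Integration.integrable_bound)
      show "integrable M (\<lambda>\<omega>. (norm (S \<omega>))\<^sup>2 + (norm (y m \<omega>))\<^sup>2)" using S Y by simp
      show "AE \<omega> in M. norm (S \<omega> \<bullet> y m \<omega>) \<le> norm ((norm (S \<omega>))\<^sup>2 + (norm (y m \<omega>))\<^sup>2)"
      proof (rule AE_I2)
        fix \<omega>
        have "\<bar>S \<omega> \<bullet> y m \<omega>\<bar> \<le> norm (S \<omega>) * norm (y m \<omega>)" by (rule Cauchy_Schwarz_ineq2)
        also have "\<dots> \<le> (norm (S \<omega>))\<^sup>2 + (norm (y m \<omega>))\<^sup>2"
          using young_weighted[of 1 "norm (S \<omega>)" "norm (y m \<omega>)"] by (simp, smt (verit) zero_le_power2)
        finally show "norm (S \<omega> \<bullet> y m \<omega>) \<le> norm ((norm (S \<omega>))\<^sup>2 + (norm (y m \<omega>))\<^sup>2)" by simp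
      qed
    qed measurable
    have c: "integrable M (\<lambda>\<omega>. (S \<omega> \<bullet> y m \<omega>) * \<xi> m \<omega>)" "(\<integral>\<omega>. (S \<omega> \<bullet> y m \<omega>) * \<xi> m \<omega> \<partial>M) = 0"
      using inn'[of "\<lambda>\<omega>. S \<omega> \<bullet> y m \<omega>"] SY iSY by auto
    have n: "(\<lambda>\<omega>. (norm (y m \<omega>))\<^sup>2) \<in> borel_measurable (\<F> (p m))"
      using Y(1) by measurable
    have d: "integrable M (\<lambda>\<omega>. (norm (y m \<omega>))\<^sup>2 * (\<xi> m \<omega>)\<^sup>2)"
      "(\<integral>\<omega>. (norm (y m \<omega>))\<^sup>2 * (\<xi> m \<omega>)\<^sup>2 \<partial>M) = v m * (\<integral>\<omega>. (norm (y m \<omega>))\<^sup>2 \<partial>M)"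
      using inn'[of "\<lambda>\<omega>. (norm (y m \<omega>))\<^sup>2"] n Y(2) by auto
    have eq: "(norm (S \<omega> + \<xi> m \<omega> *\<^sub>R y m \<omega>))\<^sup>2 =
        (norm (S \<omega>))\<^sup>2 + 2 * ((S \<omega> \<bullet> y m \<omega>) * \<xi> m \<omega>) + (norm (y m \<omega>))\<^sup>2 * (\<xi> m \<omega>)\<^sup>2" for \<omega>
      unfolding power2_norm_eq_inner
      by (simp add: inner_add_left inner_add_right inner_commute power2_eq_square algebra_simps)
    have int2: "integrable M (\<lambda>\<omega>. (norm (\<xi> m \<omega> *\<^sub>R y m \<omega>))\<^sup>2)"
      using d(1) by (simp add: power_mult_distrib mult.commute)
    have int1: "integrable M (\<lambda>\<omega>. \<xi> m \<omega> *\<^sub>R y m \<omega>)"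
      by (rule integrable_of_square[OF int2]) measurable
    have "(\<integral>\<omega>. \<xi> m \<omega> *\<^sub>R y m \<omega> \<partial>M) \<bullet> e = 0" for e
    proof -
      have "(\<integral>\<omega>. \<xi> m \<omega> *\<^sub>R y m \<omega> \<partial>M) \<bullet> e = (\<integral>\<omega>. (y m \<omega> \<bullet> e) * \<xi> m \<omega> \<partial>M)"
        using int1 by (subst integral_inner_left[symmetric]) (auto simp: mult.commute)
      also have "\<dots> = 0"
      proof -
        have "integrable M (\<lambda>\<omega>. y m \<omega> \<bullet> e)"
          using integrable_of_square[OF Y(2)] by (intro integrable_inner_left) auto
        moreover have "(\<lambda>\<omega>. y m \<omega> \<bullet> e) \<in> borel_measurable (\<F> (p m))"
          using Y(1) by measurable
        ultimately show ?thesis using inn'[of "\<lambda>\<omega>. y m \<omega> \<bullet> e"] by auto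
      qed
      finally show ?thesis .
    qed
    \<comment> \<open>With the mean itself as test vector, orthogonality to every vector becomes
      vanishing of its norm.\<close>
    from this[of "\<integral>\<omega>. \<xi> m \<omega> *\<^sub>R y m \<omega> \<partial>M"]
    have z: "(\<integral>\<omega>. \<xi> m \<omega> *\<^sub>R y m \<omega> \<partial>M) = 0"
      by (rule inner_eq_zero_iff[THEN iffD1])
    have "integrable M S" by (rule integrable_of_square[OF S(2) measurable_F_M[OF S(1)]])
    then have "(\<integral>\<omega>. S \<omega> + \<xi> m \<omega> *\<^sub>R y m \<omega> \<partial>M) = 0"
      using int1 S(4) z by simp
    moreover have "(\<integral>\<omega>. (norm (S \<omega> + \<xi> m \<omega> *\<^sub>R y m \<omega>))\<^sup>2 \<partial>M) =
      (\<Sum>j<m. v j * (\<integral>\<omega>. (norm (y j \<omega>))\<^sup>2 \<partial>M)) + v m * (\<integral>\<omega>. (norm (y m \<omega>))\<^sup>2 \<partial>M)"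
      unfolding eq using S(2,3) c d by simp
    moreover have "integrable M (\<lambda>\<omega>. (norm (S \<omega> + \<xi> m \<omega> *\<^sub>R y m \<omega>))\<^sup>2)"
      unfolding eq using S(2) c(1) d(1) by simp
    moreover have "(\<lambda>\<omega>. S \<omega> + \<xi> m \<omega> *\<^sub>R y m \<omega>) \<in> borel_measurable (\<F> (p (Suc m)))"
      by measurable
    ultimately show ?case unfolding S_def by simp
  qed auto
  then show "(\<lambda>\<omega>. \<Sum>j<m. \<xi> j \<omega> *\<^sub>R y j \<omega>) \<in> borel_measurable (\<F> (p m))"
    "integrable M (\<lambda>\<omega>. (norm (\<Sum>j<m. \<xi> j \<omega> *\<^sub>R y j \<omega>))\<^sup>2)"
    "(\<integral>\<omega>. (norm (\<Sum>j<m. \<xi> j \<omega> *\<^sub>R y j \<omega>))\<^sup>2 \<partial>M) = (\<Sum>j<m. v j * (\<integral>\<omega>. (norm (y j \<omega>))\<^sup>2 \<partial>M))"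
    "(\<integral>\<omega>. (\<Sum>j<m. \<xi> j \<omega> *\<^sub>R y j \<omega>) \<partial>M) = 0"
    by auto
qed

text \<open>The \<open>n\<close> centred products are orthogonal and each has variance of order
  \<open>1 / n\<^sup>2\<close>, so the second moment of their sum is of order
  \<open>1 / n\<close>.\<close>

lemma quadratic_variation_inc:
  assumes il: "i \<in> {1..k}" "l \<in> {1..k}" and st: "0 \<le> s" "s < t"
  shows "vanishes_in_prob (\<lambda>n \<omega>.
    (\<Sum>j<n. inc i (uniform_pt s t n j) (uniform_pt s t n (Suc j)) \<omega> *
            inc l (uniform_pt s t n j) (uniform_pt s t n (Suc j)) \<omega>)
      - (if i = l then t - s else 0))"
    (is "vanishes_in_prob ?D")
proof (rule vanishes_in_prob_of_L2)
  define p where "p n j = uniform_pt s t n j" for n j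
  \<comment> \<open>The Kronecker symbol. The variance factor \<open>1 + \<delta>\<close> is 2 for
    the square of one increment and 1 for the product of two independent ones.\<close>
  define \<delta> :: real where "\<delta> = (if i = l then 1 else 0)"
  define \<xi> where "\<xi> n j \<omega> = inc i (p n j) (p n (Suc j)) \<omega> * inc l (p n j) (p n (Suc j)) \<omega>
    - \<delta> * ((t - s) / real n)" for n j \<omega>
  define v where "v n = (1 + \<delta>) * ((t - s) / real n)\<^sup>2" for n
  \<comment> \<open>For \<open>n = 0\<close> there is no cell over which the subtracted limit could
    be distributed; only large \<open>n\<close> matter.\<close>
  have D: "?D n = (\<lambda>\<omega>. \<Sum>j<n. \<xi> n j \<omega> *\<^sub>R 1)" if "0 < n" for n
    using that by (auto simp: fun_eq_iff \<xi>_def p_def \<delta>_def sum_subtractf)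
  have inn: "innovation (p n j) (p n (Suc j)) (\<xi> n j) (v n)" if "j < n" for n j
  proof -
    have h: "(t - s) / real n = p n (Suc j) - p n j"
      by (simp add: p_def uniform_pt_Suc_diff)
    have "0 \<le> p n j" "p n j < p n (Suc j)"
      using uniform_pt_bounds[OF st that] by (auto simp: p_def)
    note pp = this
    show ?thesis
    proof (cases "i = l")
      case True
      show ?thesis
        using innovation_inc_square[OF il(1) pp] True
        unfolding \<xi>_def v_def h \<delta>_def by (simp add: power2_eq_square[of "inc l _ _ _"])
    next
      case False
      show ?thesis
        using innovation_inc_inc[OF il False pp] False
        unfolding \<xi>_def v_def h \<delta>_def by simp
    qed
  qed
  have le: "p n j \<le> p n (Suc j)" for n j
    using st by (auto simp: p_def intro!: uniform_pt_le_Suc)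
  note os = orthogonal_sum[of n "p n" "\<xi> n" "\<lambda>_. v n" "\<lambda>_ _. 1::real" for n, OF le inn]
  show "?D n \<in> borel_measurable M" for n
    using D[of n] os(1)[of n] measurable_F_M by (cases "n = 0") auto
  show "integrable M (\<lambda>\<omega>. (?D n \<omega>)\<^sup>2)" for n
    using D[of n, THEN fun_cong] os(2)[of n] by (cases "n = 0") auto
  have E: "(\<integral>\<omega>. (?D n \<omega>)\<^sup>2 \<partial>M) = (1 + \<delta>) * (t - s)\<^sup>2 / real n" if "0 < n" for n
    using D[OF that, THEN fun_cong] os(3)[of n] that
    by (simp add: prob_space v_def power2_eq_square)
  show "(\<lambda>n. \<integral>\<omega>. (?D n \<omega>)\<^sup>2 \<partial>M) \<longlonglongrightarrow> 0"
  proof (rule Lim_transform_eventually)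
    show "(\<lambda>n. (1 + \<delta>) * (t - s)\<^sup>2 / real n) \<longlonglongrightarrow> 0"
      by (rule lim_const_over_n)
    show "\<forall>\<^sub>F n in sequentially. (1 + \<delta>) * (t - s)\<^sup>2 / real n = (\<integral>\<omega>. (?D n \<omega>)\<^sup>2 \<partial>M)"
      using eventually_gt_at_top[of 0] by eventually_elim (simp add: E)
  qed
qed

end

section \<open>Square variation of continuous semimartingales\<close>

context prob_space
begin

text \<open>One-sided, since it is meant for sums of squares; \<open>L\<close> may have any sign,
  which is why \<open>\<bar>L\<bar>\<close> appears in \<open>QX_approx\<close>. Measurability is
  part of the notion because nonmeasurable sets have \<open>measure\<close> 0 and would make the
  tail condition void.\<close>

definition tight_on :: "'p set \<Rightarrow> ('p \<Rightarrow> 'a \<Rightarrow> real) \<Rightarrow> bool" where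
  "tight_on P Y \<longleftrightarrow> (\<forall>\<pi>\<in>P. Y \<pi> \<in> borel_measurable M) \<and>
     (\<forall>\<epsilon>>0. \<exists>L. \<forall>\<pi>\<in>P. prob {\<omega>\<in>space M. Y \<pi> \<omega> > L} \<le> \<epsilon>)"

lemma tight_on_add:
  assumes Y: "tight_on P Y" and Z: "tight_on P Z"
  shows "tight_on P (\<lambda>\<pi> \<omega>. Y \<pi> \<omega> + Z \<pi> \<omega>)"
  unfolding tight_on_def
proof (intro conjI ballI allI impI)
  fix \<epsilon> :: real assume \<epsilon>: "0 < \<epsilon>"
  obtain L where L: "\<forall>\<pi>\<in>P. prob {\<omega>\<in>space M. Y \<pi> \<omega> > L} \<le> \<epsilon> / 2"
    using Y \<epsilon> unfolding tight_on_def by (meson half_gt_zero)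
  obtain L' where L': "\<forall>\<pi>\<in>P. prob {\<omega>\<in>space M. Z \<pi> \<omega> > L'} \<le> \<epsilon> / 2"
    using Z \<epsilon> unfolding tight_on_def by (meson half_gt_zero)
  have "prob {\<omega>\<in>space M. Y \<pi> \<omega> + Z \<pi> \<omega> > L + L'} \<le> \<epsilon>" if "\<pi> \<in> P" for \<pi>
  proof -
    have [measurable]: "Y \<pi> \<in> borel_measurable M" "Z \<pi> \<in> borel_measurable M"
      using that Y Z by (auto simp: tight_on_def)
    have "prob {\<omega>\<in>space M. Y \<pi> \<omega> + Z \<pi> \<omega> > L + L'}
      \<le> prob {\<omega>\<in>space M. Y \<pi> \<omega> > L} + prob {\<omega>\<in>space M. Z \<pi> \<omega> > L'}"
      by (rule prob_le_of_subset_Un) auto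
    then show ?thesis using L L' that by fastforce
  qed
  then show "\<exists>L. \<forall>\<pi>\<in>P. prob {\<omega>\<in>space M. Y \<pi> \<omega> + Z \<pi> \<omega> > L} \<le> \<epsilon>" by blast
qed (use Y Z in \<open>auto simp: tight_on_def intro!: borel_measurable_add\<close>)

lemma tight_on_const:
  assumes "Y \<in> borel_measurable M"
  shows "tight_on P (\<lambda>_. Y)"
  using assms real_rv_tight[OF assms] by (fastforce simp: tight_on_def)

lemma tight_on_sum:
  assumes "finite I" "\<And>i. i \<in> I \<Longrightarrow> tight_on P (Y i)"
  shows "tight_on P (\<lambda>\<pi> \<omega>. \<Sum>i\<in>I. Y i \<pi> \<omega>)"
  using assms
proof (induction I)
  case (insert i I)
  then have "tight_on P (\<lambda>\<pi> \<omega>. Y i \<pi> \<omega> + (\<Sum>i\<in>I. Y i \<pi> \<omega>))"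
    by (intro tight_on_add) auto
  then show ?case using insert by simp
qed (simp add: tight_on_const)

lemma tight_on_mono:
  assumes Y: "tight_on P Y" and Z: "\<And>\<pi>. \<pi> \<in> P \<Longrightarrow> Z \<pi> \<in> borel_measurable M"
    and le: "\<And>\<pi> \<omega>. \<pi> \<in> P \<Longrightarrow> \<omega> \<in> space M \<Longrightarrow> Z \<pi> \<omega> \<le> Y \<pi> \<omega>"
  shows "tight_on P Z"
  unfolding tight_on_def
proof (intro conjI ballI allI impI)
  fix \<epsilon> :: real assume \<epsilon>: "0 < \<epsilon>"
  obtain L where L: "\<forall>\<pi>\<in>P. prob {\<omega>\<in>space M. Y \<pi> \<omega> > L} \<le> \<epsilon>"
    using Y \<epsilon> unfolding tight_on_def by blast
  have "prob {\<omega>\<in>space M. Z \<pi> \<omega> > L} \<le> \<epsilon>" if "\<pi> \<in> P" for \<pi>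
  proof -
    have [measurable]: "Y \<pi> \<in> borel_measurable M"
      using that Y by (auto simp: tight_on_def)
    have "prob {\<omega>\<in>space M. Z \<pi> \<omega> > L} \<le> prob {\<omega>\<in>space M. Y \<pi> \<omega> > L}"
      using le[OF that] by (intro finite_measure_mono) (auto intro: less_le_trans)
    then show ?thesis using L that by fastforce
  qed
  then show "\<exists>L. \<forall>\<pi>\<in>P. prob {\<omega>\<in>space M. Z \<pi> \<omega> > L} \<le> \<epsilon>" by blast
qed (use Z in auto)

end

section \<open>A strictly convex function of linear growth\<close>

definition root_fun :: "real \<Rightarrow> real" where "root_fun a = sqrt (1 + a\<^sup>2)"

lemma root_fun_pos: "1 \<le> root_fun a" "0 < root_fun a"
proof -
  show "1 \<le> root_fun a" by (simp add: root_fun_def)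
  then show "0 < root_fun a" by linarith
qed

lemma root_fun_sq: "(root_fun a)\<^sup>2 = 1 + a\<^sup>2"
  by (simp add: root_fun_def)

lemma root_fun_le: "root_fun a \<le> 1 + \<bar>a\<bar>"
  by (rule power2_le_imp_le) (simp_all add: root_fun_sq power2_sum)

lemma abs_le_root_fun: "\<bar>a\<bar> \<le> root_fun a"
  by (rule power2_le_imp_le) (use root_fun_pos[of a] in \<open>simp_all add: root_fun_sq\<close>)

text \<open>\<open>D\<close> is the Bregman divergence of \<open>root_fun\<close>. With
  \<open>p = root_fun a * root_fun b\<close> and \<open>q = 1 + a * b\<close>, multiplication by
  \<open>root_fun a\<close> turns it into \<open>p - q\<close>, and
  \<open>p\<^sup>2 - q\<^sup>2 = (b - a)\<^sup>2\<close>. Hence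
  \<open>\<bar>q\<bar> \<le> p\<close>, which is convexity, and
  \<open>(b - a)\<^sup>2 = (p - q) * (p + q)\<close>, where
  \<open>p + q \<le> 2 * (1 + K\<^sup>2)\<close> as long as both points stay in
  \<open>{-K..K}\<close>.\<close>

lemma root_fun_bregman:
  defines "D \<equiv> (\<lambda>a b. root_fun b - root_fun a - a / root_fun a * (b - a))"
  shows root_fun_convex: "0 \<le> D a b"
    and root_fun_strictly_convex:
      "\<bar>a\<bar> \<le> K \<Longrightarrow> \<bar>b\<bar> \<le> K \<Longrightarrow> (b - a)\<^sup>2 \<le> 2 * (1 + K\<^sup>2)\<^sup>2 * D a b"
proof -
  define p where "p = root_fun a * root_fun b"
  define q where "q = 1 + a * b"
  have D: "D a b * root_fun a = p - q"
    using root_fun_pos[of a] root_fun_sq[of a]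
    by (simp add: D_def p_def q_def field_simps power2_eq_square)
  have pq: "p\<^sup>2 - q\<^sup>2 = (b - a)\<^sup>2"
  proof -
    have "p\<^sup>2 = (1 + a\<^sup>2) * (1 + b\<^sup>2)" by (simp add: p_def power_mult_distrib root_fun_sq)
    then show ?thesis by (simp add: q_def power2_eq_square algebra_simps)
  qed
  have p0: "0 \<le> p" using root_fun_pos[of a] root_fun_pos[of b] by (simp add: p_def)
  have "q\<^sup>2 \<le> p\<^sup>2" using pq zero_le_power2[of "b - a"] by linarith
  then have qp: "\<bar>q\<bar> \<le> p" using p0 by (simp add: abs_le_square_iff[symmetric])
  then show nn: "0 \<le> D a b" using D root_fun_pos[of a] by (smt (verit) mult_neg_pos)
  assume ab: "\<bar>a\<bar> \<le> K" "\<bar>b\<bar> \<le> K"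
  have K: "a\<^sup>2 \<le> K\<^sup>2" "b\<^sup>2 \<le> K\<^sup>2" using ab by (auto simp: abs_le_square_iff[symmetric])
  have sq: "root_fun a \<le> sqrt (1 + K\<^sup>2)" "root_fun b \<le> sqrt (1 + K\<^sup>2)"
    using K by (auto simp: root_fun_def)
  have "p \<le> sqrt (1 + K\<^sup>2) * sqrt (1 + K\<^sup>2)"
    unfolding p_def using sq root_fun_pos[of b] by (intro mult_mono) auto
  then have p1: "p \<le> 1 + K\<^sup>2" by simp
  have "sqrt (1 + K\<^sup>2) \<le> 1 + K\<^sup>2" using self_le_power[of "1 + K\<^sup>2" 2] by (intro real_le_lsqrt) auto
  then have r1: "root_fun a \<le> 1 + K\<^sup>2" using sq by linarith
  have "(b - a)\<^sup>2 = (p - q) * (p + q)"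
    using pq by (simp add: power2_eq_square algebra_simps)
  also have "\<dots> \<le> (p - q) * (2 * (1 + K\<^sup>2))"
    using qp p1 by (intro mult_left_mono) auto
  also have "\<dots> = D a b * root_fun a * (2 * (1 + K\<^sup>2))"
    using D by simp
  also have "\<dots> \<le> D a b * (1 + K\<^sup>2) * (2 * (1 + K\<^sup>2))"
    using nn r1 by (intro mult_right_mono mult_left_mono) auto
  finally show "(b - a)\<^sup>2 \<le> 2 * (1 + K\<^sup>2)\<^sup>2 * D a b"
    by (simp add: power2_eq_square algebra_simps)
qed

lemma sum_squares_le_square_sum:
  fixes a :: "nat \<Rightarrow> real"
  assumes "\<And>j. j < m \<Longrightarrow> 0 \<le> a j"
  shows "(\<Sum>j<m. (a j)\<^sup>2) \<le> (\<Sum>j<m. a j)\<^sup>2"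
  using assms
proof (induction m)
  case (Suc m)
  then have "0 \<le> (\<Sum>j<m. a j)" "0 \<le> a m" by (auto intro!: sum_nonneg)
  then have "0 \<le> (\<Sum>j<m. a j) * a m" by (rule mult_nonneg_nonneg)
  then show ?case using Suc by (simp add: power2_sum)
qed simp

text \<open>The points may start and end anywhere in \<open>[0, T]\<close>, so one tightness
  statement covers the subdivisions of all subintervals simultaneously.\<close>

definition partitions_upto :: "real \<Rightarrow> (nat \<times> (nat \<Rightarrow> real)) set" where
  "partitions_upto T = {(m, p). \<forall>j<m. 0 \<le> p j \<and> p j \<le> p (Suc j) \<and> p (Suc j) \<le> T}"

definition square_variation :: "(real \<Rightarrow> 'w \<Rightarrow> 'a::real_normed_vector) \<Rightarrow> nat \<times> (nat \<Rightarrow> real) \<Rightarrow> 'w \<Rightarrow> real" where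
  "square_variation X \<pi> \<omega> = (\<Sum>j<fst \<pi>. (norm (X (snd \<pi> (Suc j)) \<omega> - X (snd \<pi> j) \<omega>))\<^sup>2)"

section \<open>Martingales, local martingales and semimartingales\<close>

context brownian_setup
begin

lemma square_variation_measurable:
  fixes X :: "real \<Rightarrow> 'w \<Rightarrow> 'b::euclidean_space"
  assumes "\<And>t. 0 \<le> t \<Longrightarrow> X t \<in> borel_measurable M" "\<pi> \<in> partitions_upto T"
  shows "square_variation X \<pi> \<in> borel_measurable M"
  unfolding square_variation_def[abs_def]
proof (rule borel_measurable_sum)
  fix j assume "j \<in> {..<fst \<pi>}"
  then have "0 \<le> snd \<pi> j" "snd \<pi> j \<le> snd \<pi> (Suc j)"
    using assms(2) by (auto simp: partitions_upto_def)
  then have [measurable]: "X (snd \<pi> j) \<in> borel_measurable M" "X (snd \<pi> (Suc j)) \<in> borel_measurable M"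
    using assms(1) by auto
  show "(\<lambda>\<omega>. (norm (X (snd \<pi> (Suc j)) \<omega> - X (snd \<pi> j) \<omega>))\<^sup>2) \<in> borel_measurable M"
    by measurable
qed

text \<open>The characteristic property of \<open>real_cond_exp\<close> for a bounded
  past-measurable factor; boundedness of \<open>Z\<close> makes the product with the merely
  integrable \<open>N t\<close> integrable.\<close>

lemma martingale_mult_past:
  assumes N: "martingale M \<F> N" and st: "0 \<le> s" "s \<le> t"
    and Z[measurable]: "Z \<in> borel_measurable (\<F> s)" and c: "\<And>\<omega>. \<bar>Z \<omega>\<bar> \<le> (c::real)"
  shows "integrable M (\<lambda>\<omega>. Z \<omega> * N t \<omega>)" "(\<integral>\<omega>. Z \<omega> * N t \<omega> \<partial>M) = (\<integral>\<omega>. Z \<omega> * N s \<omega> \<partial>M)"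
proof -
  interpret S: finite_measure_subalgebra M "\<F> s"
    by unfold_locales (rule subalgebra_F)
  have i: "integrable M (N t)" and [measurable]: "N s \<in> borel_measurable M" "N t \<in> borel_measurable M"
    using N st measurable_F_M[of "N s" s] measurable_F_M[of "N t" t] unfolding martingale_def by auto
  have [measurable]: "Z \<in> borel_measurable M" using Z by (rule measurable_F_M)
  show int: "integrable M (\<lambda>\<omega>. Z \<omega> * N t \<omega>)"
  proof (rule Bochner_Integration.integrable_bound)
    show "integrable M (\<lambda>\<omega>. c * N t \<omega>)" using i by simp
    show "AE \<omega> in M. norm (Z \<omega> * N t \<omega>) \<le> norm (c * N t \<omega>)"
      using c by (intro AE_I2) (auto simp: abs_mult intro!: mult_right_mono intro: order_trans[OF c])
  qed measurable
  have "(\<integral>\<omega>. Z \<omega> * N t \<omega> \<partial>M) = (\<integral>\<omega>. Z \<omega> * real_cond_exp M (\<F> s) (N t) \<omega> \<partial>M)"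
    by (rule S.real_cond_exp_intg(2)[OF int, symmetric]) measurable
  also have "\<dots> = (\<integral>\<omega>. Z \<omega> * N s \<omega> \<partial>M)"
  proof (rule integral_cong_AE)
    have "AE \<omega> in M. real_cond_exp M (\<F> s) (N t) \<omega> = N s \<omega>"
      using N st by (auto simp: martingale_def)
    then show "AE \<omega> in M. Z \<omega> * real_cond_exp M (\<F> s) (N t) \<omega> = Z \<omega> * N s \<omega>"
      by eventually_elim simp
  qed measurable
  finally show "(\<integral>\<omega>. Z \<omega> * N t \<omega> \<partial>M) = (\<integral>\<omega>. Z \<omega> * N s \<omega> \<partial>M)" .
qed

text \<open>Conditional Jensen in its simplest instance: test the martingale property against
  \<open>sgn (N s)\<close>, which is bounded by 1 and known at time \<open>s\<close>.\<close>

lemma martingale_abs_mono: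
  assumes N: "martingale M \<F> N" and st: "0 \<le> s" "s \<le> t"
  shows "(\<integral>\<omega>. \<bar>N s \<omega>\<bar> \<partial>M) \<le> (\<integral>\<omega>. \<bar>N t \<omega>\<bar> \<partial>M)"
proof -
  have [measurable]: "N s \<in> borel_measurable (\<F> s)" and i: "integrable M (N t)" "integrable M (N s)"
    using N st unfolding martingale_def by auto
  have Z: "(\<lambda>\<omega>. sgn (N s \<omega>)) \<in> borel_measurable (\<F> s)" by measurable
  have "(\<integral>\<omega>. \<bar>N s \<omega>\<bar> \<partial>M) = (\<integral>\<omega>. sgn (N s \<omega>) * N s \<omega> \<partial>M)"
    by (simp add: abs_sgn mult.commute)
  also have "\<dots> = (\<integral>\<omega>. sgn (N s \<omega>) * N t \<omega> \<partial>M)"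
    by (rule martingale_mult_past(2)[OF N st Z, of 1, symmetric]) (simp add: abs_sgn_eq)
  also have "\<dots> \<le> (\<integral>\<omega>. \<bar>N t \<omega>\<bar> \<partial>M)"
  proof (rule integral_mono)
    show "integrable M (\<lambda>\<omega>. sgn (N s \<omega>) * N t \<omega>)"
      by (rule martingale_mult_past(1)[OF N st Z, of 1]) (simp add: abs_sgn_eq)
    show "sgn (N s \<omega>) * N t \<omega> \<le> \<bar>N t \<omega>\<bar>" for \<omega>
      by (auto simp: sgn_real_def)
  qed (use i in simp)
  finally show ?thesis .
qed

text \<open>Telescoping the strictly convex function \<open>root_fun\<close> of linear growth along a martingale
  bounds its squared increments although the martingale is only integrable.\<close>

lemma martingale_truncated_squares:
  fixes K :: real
  assumes N: "martingale M \<F> N" and mp: "(m, p) \<in> partitions_upto T" and T: "0 \<le> T"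
  defines "S \<equiv> (\<lambda>\<omega>. \<Sum>j<m. if \<bar>N (p j) \<omega>\<bar> \<le> K \<and> \<bar>N (p (Suc j)) \<omega>\<bar> \<le> K
      then (N (p (Suc j)) \<omega> - N (p j) \<omega>)\<^sup>2 else 0)"
  shows "integrable M S"
    "(\<integral>\<omega>. S \<omega> \<partial>M) \<le> 2 * (1 + K\<^sup>2)\<^sup>2 * (1 + (\<integral>\<omega>. \<bar>N T \<omega>\<bar> \<partial>M))"
proof -
  define D where "D a b = root_fun b - root_fun a - a / root_fun a * (b - a)" for a b
  have p: "0 \<le> p j" "p j \<le> p (Suc j)" "p (Suc j) \<le> T" "0 \<le> p (Suc j)" if "j < m" for j
    using mp that by (auto simp: partitions_upto_def dest: order_trans)
  have NF: "N t \<in> borel_measurable (\<F> t)" "integrable M (N t)" if "0 \<le> t" for t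
    using N that by (auto simp: martingale_def)
  have [measurable]: "root_fun \<in> borel_measurable borel"
    unfolding root_fun_def by measurable
  have iroot: "integrable M (\<lambda>\<omega>. root_fun (N t \<omega>))" if "0 \<le> t" for t
  proof (rule Bochner_Integration.integrable_bound)
    show "integrable M (\<lambda>\<omega>. 1 + \<bar>N t \<omega>\<bar>)" using NF[OF that] by simp
    show "(\<lambda>\<omega>. root_fun (N t \<omega>)) \<in> borel_measurable M"
      using NF[OF that] by simp
    show "AE \<omega> in M. norm (root_fun (N t \<omega>)) \<le> norm (1 + \<bar>N t \<omega>\<bar>)"
      using root_fun_le root_fun_pos(2) by (intro AE_I2) (simp add: less_imp_le)
  qed
  \<comment> \<open>The linear term of the divergence has mean 0: its slope
    \<open>a / root_fun a\<close> is known at the left endpoint and bounded by 1, so integrability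
    of the martingale is enough.\<close>
  have drift: "integrable M (\<lambda>\<omega>. N (p j) \<omega> / root_fun (N (p j) \<omega>) * (N (p (Suc j)) \<omega> - N (p j) \<omega>))"
    "(\<integral>\<omega>. N (p j) \<omega> / root_fun (N (p j) \<omega>) * (N (p (Suc j)) \<omega> - N (p j) \<omega>) \<partial>M) = 0" if "j < m" for j
  proof -
    note [measurable] = NF(1)[OF p(1)[OF that]]
    have Z: "(\<lambda>\<omega>. N (p j) \<omega> / root_fun (N (p j) \<omega>)) \<in> borel_measurable (\<F> (p j))"
      by measurable
    have c: "\<bar>N (p j) \<omega> / root_fun (N (p j) \<omega>)\<bar> \<le> 1" for \<omega>
      using abs_le_root_fun[of "N (p j) \<omega>"] root_fun_pos(2)[of "N (p j) \<omega>"] by simp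
    note mt = martingale_mult_past[OF N p(1)[OF that] p(2)[OF that] Z c]
      martingale_mult_past[OF N p(1)[OF that] order_refl Z c]
    show "integrable M (\<lambda>\<omega>. N (p j) \<omega> / root_fun (N (p j) \<omega>) * (N (p (Suc j)) \<omega> - N (p j) \<omega>))"
      unfolding right_diff_distrib by (intro Bochner_Integration.integrable_diff mt)
    show "(\<integral>\<omega>. N (p j) \<omega> / root_fun (N (p j) \<omega>) * (N (p (Suc j)) \<omega> - N (p j) \<omega>) \<partial>M) = 0"
      unfolding right_diff_distrib by (subst Bochner_Integration.integral_diff) (use mt in auto)
  qed
  have iD: "integrable M (\<lambda>\<omega>. D (N (p j) \<omega>) (N (p (Suc j)) \<omega>))"
    and ED: "(\<integral>\<omega>. D (N (p j) \<omega>) (N (p (Suc j)) \<omega>) \<partial>M)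
      = (\<integral>\<omega>. root_fun (N (p (Suc j)) \<omega>) \<partial>M) - (\<integral>\<omega>. root_fun (N (p j) \<omega>) \<partial>M)" if "j < m" for j
    using drift[OF that] iroot[OF p(1)[OF that]] iroot[OF p(4)[OF that]] unfolding D_def by auto
  \<comment> \<open>If one of the points leaves \<open>{-K..K}\<close>, the left side is 0 and
    convexity suffices; otherwise the strict form applies.\<close>
  have le: "(if \<bar>a\<bar> \<le> K \<and> \<bar>b\<bar> \<le> K then (b - a)\<^sup>2 else 0) \<le> 2 * (1 + K\<^sup>2)\<^sup>2 * D a b" for a b
    using root_fun_convex[of b a] root_fun_strictly_convex[of a K b] by (auto simp: D_def)
  have S_meas: "S \<in> borel_measurable M"
    unfolding S_def
  proof (intro borel_measurable_sum)
    fix j assume "j \<in> {..<m}"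
    then have [measurable]: "N (p j) \<in> borel_measurable M" "N (p (Suc j)) \<in> borel_measurable M"
      using NF(2) p by auto
    show "(\<lambda>\<omega>. if \<bar>N (p j) \<omega>\<bar> \<le> K \<and> \<bar>N (p (Suc j)) \<omega>\<bar> \<le> K
      then (N (p (Suc j)) \<omega> - N (p j) \<omega>)\<^sup>2 else 0) \<in> borel_measurable M"
      by measurable
  qed
  have iB: "integrable M (\<lambda>\<omega>. 2 * (1 + K\<^sup>2)\<^sup>2 * (\<Sum>j<m. D (N (p j) \<omega>) (N (p (Suc j)) \<omega>)))"
    using iD by auto
  have S_le: "S \<omega> \<le> 2 * (1 + K\<^sup>2)\<^sup>2 * (\<Sum>j<m. D (N (p j) \<omega>) (N (p (Suc j)) \<omega>))" for \<omega>
    unfolding S_def sum_distrib_left by (intro sum_mono le)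
  have S0: "0 \<le> S \<omega>" for \<omega> unfolding S_def by (intro sum_nonneg) auto
  show "integrable M S"
  proof (rule Bochner_Integration.integrable_bound[OF iB S_meas])
    show "AE \<omega> in M. norm (S \<omega>) \<le> norm (2 * (1 + K\<^sup>2)\<^sup>2 * (\<Sum>j<m. D (N (p j) \<omega>) (N (p (Suc j)) \<omega>)))"
      using S_le S0 by (intro AE_I2) (smt (verit) real_norm_def)
  qed
  then have "(\<integral>\<omega>. S \<omega> \<partial>M) \<le> (\<integral>\<omega>. 2 * (1 + K\<^sup>2)\<^sup>2 * (\<Sum>j<m. D (N (p j) \<omega>) (N (p (Suc j)) \<omega>)) \<partial>M)"
    using iB S_le by (intro integral_mono)
  also have "\<dots> = 2 * (1 + K\<^sup>2)\<^sup>2 * (\<Sum>j<m. \<integral>\<omega>. D (N (p j) \<omega>) (N (p (Suc j)) \<omega>) \<partial>M)"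
    using iD by (simp add: Bochner_Integration.integral_sum)
  finally have S_E: "(\<integral>\<omega>. S \<omega> \<partial>M)
      \<le> 2 * (1 + K\<^sup>2)\<^sup>2 * (\<Sum>j<m. \<integral>\<omega>. D (N (p j) \<omega>) (N (p (Suc j)) \<omega>) \<partial>M)" .
  have "(\<Sum>j<m. \<integral>\<omega>. D (N (p j) \<omega>) (N (p (Suc j)) \<omega>) \<partial>M)
      = (\<integral>\<omega>. root_fun (N (p m) \<omega>) \<partial>M) - (\<integral>\<omega>. root_fun (N (p 0) \<omega>) \<partial>M)"
    using sum_lessThan_telescope[of "\<lambda>j. \<integral>\<omega>. root_fun (N (p j) \<omega>) \<partial>M" m] ED by simp
  also have "\<dots> \<le> 1 + (\<integral>\<omega>. \<bar>N T \<omega>\<bar> \<partial>M)"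
  proof (cases "m = 0")
    case True
    then show ?thesis by (simp add: add_nonneg_nonneg)
  next
    case False
    then obtain m' where m': "m = Suc m'" by (cases m) auto
    have pm: "0 \<le> p m" "p m \<le> T" using p[of m'] m' by auto
    have "0 \<le> (\<integral>\<omega>. root_fun (N (p 0) \<omega>) \<partial>M)"
      using root_fun_pos(2) by (intro integral_nonneg_AE AE_I2) (simp add: less_imp_le)
    moreover have "(\<integral>\<omega>. root_fun (N (p m) \<omega>) \<partial>M) \<le> (\<integral>\<omega>. 1 + \<bar>N (p m) \<omega>\<bar> \<partial>M)"
      using iroot[OF pm(1)] NF(2)[OF pm(1)] root_fun_le by (intro integral_mono) auto
    moreover have "(\<integral>\<omega>. 1 + \<bar>N (p m) \<omega>\<bar> \<partial>M) = 1 + (\<integral>\<omega>. \<bar>N (p m) \<omega>\<bar> \<partial>M)"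
      using NF(2)[OF pm(1)] by (simp add: prob_space)
    moreover have "(\<integral>\<omega>. \<bar>N (p m) \<omega>\<bar> \<partial>M) \<le> (\<integral>\<omega>. \<bar>N T \<omega>\<bar> \<partial>M)"
      by (rule martingale_abs_mono[OF N pm])
    ultimately show ?thesis by linarith
  qed
  finally show "(\<integral>\<omega>. S \<omega> \<partial>M) \<le> 2 * (1 + K\<^sup>2)\<^sup>2 * (1 + (\<integral>\<omega>. \<bar>N T \<omega>\<bar> \<partial>M))"
    by (intro order_trans[OF S_E] mult_left_mono) auto
qed

text \<open>The supremum over an interval is uncountable, so the exceptional event is defined
  through rational times and is measurable; continuity carries the bound to all times. Every path is
  bounded on the compact interval, so the probability of the event tends to 0 as the bound
  grows.\<close>

lemma continuous_process_bounded_in_prob: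
  fixes N :: "real \<Rightarrow> 'w \<Rightarrow> real"
  assumes N: "continuous_adapted M \<F> N" and \<epsilon>: "0 < \<epsilon>" and T: "0 \<le> T"
  shows "\<exists>K A. A \<in> sets M \<and> prob A \<le> \<epsilon> \<and> (\<forall>\<omega>\<in>space M - A. \<forall>t\<in>{0..T}. \<bar>N t \<omega>\<bar> \<le> K)"
proof -
  \<comment> \<open>Clamping the time extends each path continuously to the whole line. A time at
    which the path is large then has an open neighbourhood of such times, even at the endpoint
    \<open>T\<close>, and this contains a rational.\<close>
  define c where "c t = max 0 (min T t)" for t :: real
  have c: "c t \<in> {0..T}" for t using T by (auto simp: c_def)
  have cid: "c t = t" if "t \<in> {0..T}" for t using that by (auto simp: c_def)
  define A where "A n = {\<omega>\<in>space M. \<exists>q\<in>\<rat>. \<bar>N (c q) \<omega>\<bar> > real n}" for n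
  have NM: "N t \<in> borel_measurable M" if "0 \<le> t" for t
    using N that measurable_F_M by (auto simp: continuous_adapted_def)
  have [measurable]: "A n \<in> sets M" for n
  proof -
    have "A n = (\<Union>q\<in>\<rat>. {\<omega>\<in>space M. \<bar>N (c q) \<omega>\<bar> > real n})" by (auto simp: A_def)
    also have "\<dots> \<in> sets M"
    proof (intro sets.countable_UN'' countable_rat)
      fix q :: real
      have [measurable]: "N (c q) \<in> borel_measurable M" using NM c[of q] by simp
      show "{\<omega>\<in>space M. \<bar>N (c q) \<omega>\<bar> > real n} \<in> sets M" by measurable
    qed
    finally show ?thesis .
  qed
  have cont: "continuous_on UNIV (\<lambda>t. N (c t) \<omega>)" if "\<omega> \<in> space M" for \<omega>
  proof -
    have "continuous_on {0..} (\<lambda>t. N t \<omega>)"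
      using N that by (auto simp: continuous_adapted_def)
    moreover have "continuous_on UNIV c" unfolding c_def by (intro continuous_intros)
    ultimately show ?thesis
      by (rule continuous_on_compose2) (use c in auto)
  qed
  have "(\<lambda>n. prob (A n)) \<longlonglongrightarrow> 0"
  proof (rule prob_tendsto_zero, measurable, rule AE_I2)
    fix \<omega> assume \<omega>: "\<omega> \<in> space M"
    have "compact ((\<lambda>t. N (c t) \<omega>) ` {0..T})"
      using cont[OF \<omega>] by (intro compact_continuous_image) (auto intro: continuous_on_subset)
    then obtain b where b: "\<bar>N (c t) \<omega>\<bar> \<le> b" if "t \<in> {0..T}" for t
      by (force dest!: compact_imp_bounded simp: bounded_iff)
    obtain m where m: "b \<le> real m" using real_arch_simple by blast
    have bq: "\<bar>N (c q) \<omega>\<bar> \<le> real m" for q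
      using b[OF c[of q]] m cid[OF c[of q]] by simp
    then have "\<omega> \<notin> A n" if "m \<le> n" for n
      using that by (auto simp: A_def not_less intro: order_trans[OF bq])
    then show "\<forall>\<^sub>F n in sequentially. \<omega> \<notin> A n"
      by (auto simp: eventually_sequentially)
  qed
  then have "\<forall>\<^sub>F n in sequentially. prob (A n) < \<epsilon>"
    using \<epsilon> by (rule order_tendstoD)
  then obtain n where n: "prob (A n) < \<epsilon>" by (auto simp: eventually_sequentially)
  have "\<bar>N t \<omega>\<bar> \<le> real n" if \<omega>: "\<omega> \<in> space M - A n" and t: "t \<in> {0..T}" for \<omega> t
  proof (rule ccontr)
    assume "\<not> \<bar>N t \<omega>\<bar> \<le> real n"
    moreover have "open {u. \<bar>N (c u) \<omega>\<bar> > real n}"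
      using cont \<omega> by (intro open_Collect_less continuous_intros) auto
    ultimately obtain e where e: "0 < e" "ball t e \<subseteq> {u. \<bar>N (c u) \<omega>\<bar> > real n}"
      unfolding open_contains_ball by (metis (mono_tags, lifting) cid[OF t] mem_Collect_eq not_le)
    obtain q where "q \<in> \<rat>" "t < q" "q < t + e"
      using Rats_dense_in_real[of t "t + e"] e by auto
    then show False using e \<omega> by (auto simp: A_def subset_eq dist_real_def)
  qed
  then show ?thesis using n by (intro exI[of _ "real n"] exI[of _ "A n"]) auto
qed

text \<open>Three events, each of probability at most \<open>\<epsilon> / 3\<close>, are discarded:
  the localising time is reached before \<open>T\<close>, the path leaves \<open>{-K..K}\<close>, or
  the truncated sum of the stopped martingale is large. Off the first two neither stopping nor
  truncation has any effect; the third is Markov's inequality.\<close>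

lemma local_martingale_tight:
  assumes N: "continuous_local_martingale M \<F> N" and T: "0 \<le> T"
  shows "tight_on (partitions_upto T) (square_variation N)"
proof -
  have NM: "N t \<in> borel_measurable M" if "0 \<le> t" for t
    using N that measurable_F_M by (auto simp: continuous_adapted_def continuous_local_martingale_def)
  obtain \<tau> :: "nat \<Rightarrow> 'w \<Rightarrow> real" where st: "\<And>n. stopping_time \<F> (\<tau> n)"
    and lim: "AE \<omega> in M. filterlim (\<lambda>n. \<tau> n \<omega>) at_top sequentially"
    and mart: "\<And>n. martingale M \<F> (\<lambda>t \<omega>. N (min t (\<tau> n \<omega>)) \<omega>)"
    using N unfolding continuous_local_martingale_def by auto
  have [measurable]: "\<tau> n \<in> borel_measurable M" for n
    using st sets_F_subset space_F by (rule measurable_stopping_time)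
  show ?thesis
    unfolding tight_on_def
  proof (intro conjI ballI allI impI)
    show "square_variation N \<pi> \<in> borel_measurable M" if "\<pi> \<in> partitions_upto T" for \<pi>
      using NM that by (rule square_variation_measurable)
    fix \<epsilon> :: real assume \<epsilon>: "0 < \<epsilon>"
    have "(\<lambda>n. prob {\<omega>\<in>space M. \<tau> n \<omega> \<le> T}) \<longlonglongrightarrow> 0"
    proof (rule prob_tendsto_zero)
      show "AE \<omega> in M. \<forall>\<^sub>F n in sequentially. \<omega> \<notin> {\<omega> \<in> space M. \<tau> n \<omega> \<le> T}"
        using lim
      proof eventually_elim
        case (elim \<omega>)
        then have "\<forall>\<^sub>F n in sequentially. T < \<tau> n \<omega>"
          by (simp add: filterlim_at_top_dense)
        then show ?case by eventually_elim auto
      qed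
    qed measurable
    then have "\<forall>\<^sub>F n in sequentially. prob {\<omega>\<in>space M. \<tau> n \<omega> \<le> T} < \<epsilon> / 3"
      by (rule order_tendstoD) (use \<epsilon> in simp)
    then obtain n where n: "prob {\<omega>\<in>space M. \<tau> n \<omega> \<le> T} < \<epsilon> / 3"
      by (auto simp: eventually_sequentially)
    obtain K A where A[measurable]: "A \<in> sets M" and pA: "prob A \<le> \<epsilon> / 3"
      and K: "\<And>\<omega> t. \<omega>\<in>space M - A \<Longrightarrow> t\<in>{0..T} \<Longrightarrow> \<bar>N t \<omega>\<bar> \<le> K"
    proof -
      have "continuous_adapted M \<F> N" "0 < \<epsilon> / 3"
        using N \<epsilon> by (auto simp: continuous_local_martingale_def)
      from continuous_process_bounded_in_prob[OF this T] that show ?thesis by blast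
    qed
    define N' where "N' t \<omega> = N (min t (\<tau> n \<omega>)) \<omega>" for t \<omega>
    define C where "C = 2 * (1 + K\<^sup>2)\<^sup>2 * (1 + (\<integral>\<omega>. \<bar>N' T \<omega>\<bar> \<partial>M))"
    have C: "0 < C" unfolding C_def by (intro mult_pos_pos add_pos_nonneg zero_less_power) auto
    have "prob {\<omega>\<in>space M. square_variation N \<pi> \<omega> > 3 * C / \<epsilon>} \<le> \<epsilon>" if \<pi>: "\<pi> \<in> partitions_upto T" for \<pi>
    proof -
      obtain m p where mp: "\<pi> = (m, p)" by (cases \<pi>)
      define S where "S \<omega> = (\<Sum>j<m. if \<bar>N' (p j) \<omega>\<bar> \<le> K \<and> \<bar>N' (p (Suc j)) \<omega>\<bar> \<le> K
        then (N' (p (Suc j)) \<omega> - N' (p j) \<omega>)\<^sup>2 else 0)" for \<omega>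
      have S: "integrable M S" "(\<integral>\<omega>. S \<omega> \<partial>M) \<le> C"
        using martingale_truncated_squares[OF mart[of n], of m p T K] \<pi> T
        unfolding mp S_def C_def N'_def by auto
      have S0: "0 \<le> S \<omega>" for \<omega> unfolding S_def by (intro sum_nonneg) auto
      have [measurable]: "S \<in> borel_measurable M" using S by auto
      have "prob {\<omega>\<in>space M. S \<omega> \<ge> 3 * C / \<epsilon>} \<le> (\<integral>\<omega>. S \<omega> \<partial>M) / (3 * C / \<epsilon>)"
        using S S0 C \<epsilon> by (intro integral_Markov_inequality_measure[where A = "{}"]) auto
      also have "\<dots> \<le> C / (3 * C / \<epsilon>)"
        using S C \<epsilon> by (intro divide_right_mono) auto
      also have "\<dots> = \<epsilon> / 3" using C by simp
      finally have m1: "prob {\<omega>\<in>space M. S \<omega> \<ge> 3 * C / \<epsilon>} \<le> \<epsilon> / 3" .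
      have eq: "square_variation N \<pi> \<omega> = S \<omega>" if \<omega>: "\<omega> \<in> space M" "\<omega> \<notin> A" "\<not> \<tau> n \<omega> \<le> T" for \<omega>
        unfolding square_variation_def S_def mp fst_conv snd_conv
      proof (rule sum.cong[OF refl])
        fix j assume "j \<in> {..<m}"
        then have j: "p j \<in> {0..T}" "p (Suc j) \<in> {0..T}"
          using \<pi> unfolding mp partitions_upto_def by force+
        then have "N' (p j) \<omega> = N (p j) \<omega>" "N' (p (Suc j)) \<omega> = N (p (Suc j)) \<omega>"
          using \<omega> by (auto simp: N'_def min_def)
        moreover have "\<bar>N (p j) \<omega>\<bar> \<le> K" "\<bar>N (p (Suc j)) \<omega>\<bar> \<le> K"
          using K j \<omega> by auto
        ultimately show "(norm (N (p (Suc j)) \<omega> - N (p j) \<omega>))\<^sup>2 =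
          (if \<bar>N' (p j) \<omega>\<bar> \<le> K \<and> \<bar>N' (p (Suc j)) \<omega>\<bar> \<le> K then (N' (p (Suc j)) \<omega> - N' (p j) \<omega>)\<^sup>2 else 0)"
          by simp
      qed
      have "prob {\<omega>\<in>space M. square_variation N \<pi> \<omega> > 3 * C / \<epsilon>}
        \<le> prob ({\<omega>\<in>space M. \<tau> n \<omega> \<le> T} \<union> A) + prob {\<omega>\<in>space M. S \<omega> \<ge> 3 * C / \<epsilon>}"
              proof (rule prob_le_of_subset_Un)
        show "{\<omega>\<in>space M. square_variation N \<pi> \<omega> > 3 * C / \<epsilon>}
          \<subseteq> ({\<omega>\<in>space M. \<tau> n \<omega> \<le> T} \<union> A) \<union> {\<omega>\<in>space M. S \<omega> \<ge> 3 * C / \<epsilon>}"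
        proof
          fix \<omega> assume \<omega>: "\<omega> \<in> {\<omega>\<in>space M. square_variation N \<pi> \<omega> > 3 * C / \<epsilon>}"
          then show "\<omega> \<in> ({\<omega>\<in>space M. \<tau> n \<omega> \<le> T} \<union> A) \<union> {\<omega>\<in>space M. S \<omega> \<ge> 3 * C / \<epsilon>}"
            using eq[of \<omega>] by (cases "\<tau> n \<omega> \<le> T"; cases "\<omega> \<in> A") auto
        qed
      qed auto
      moreover have "prob ({\<omega>\<in>space M. \<tau> n \<omega> \<le> T} \<union> A) \<le> prob {\<omega>\<in>space M. \<tau> n \<omega> \<le> T} + prob A"
        by (rule prob_le_of_subset_Un) auto
      ultimately show ?thesis using n pA m1 by linarith
    qed
    then show "\<exists>L. \<forall>\<pi>\<in>partitions_upto T. prob {\<omega>\<in>space M. square_variation N \<pi> \<omega> > L} \<le> \<epsilon>" by blast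
  qed
qed

text \<open>An increment of the finite variation part \<open>A\<^sub>1 - A\<^sub>2\<close> is
  bounded in modulus by that of the nondecreasing process \<open>A\<^sub>1 + A\<^sub>2\<close>,
  whose squared increments sum to at most the square of its value at \<open>T\<close>. This is a
  single random variable, the same for all partitions, hence tight.\<close>

lemma semimartingale_tight:
  fixes X :: "real \<Rightarrow> 'w \<Rightarrow> 'b::euclidean_space"
  assumes X: "continuous_semimartingale M \<F> X" and T: "0 \<le> T"
  shows "tight_on (partitions_upto T) (square_variation X)"
proof -
  have XM: "X t \<in> borel_measurable M" if "0 \<le> t" for t
    using X that measurable_F_M by (auto simp: continuous_adapted_def continuous_semimartingale_def)
  have coord: "tight_on (partitions_upto T) (square_variation (\<lambda>t \<omega>. X t \<omega> \<bullet> e))" if e: "e \<in> Basis" for e :: 'b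
  proof -
    obtain N A\<^sub>1 A\<^sub>2 :: "real \<Rightarrow> 'w \<Rightarrow> real" where N: "continuous_local_martingale M \<F> N"
      and A1: "continuous_adapted M \<F> A\<^sub>1" "\<forall>\<omega>\<in>space M. mono_on {0..} (\<lambda>t. A\<^sub>1 t \<omega>)"
      and A2: "continuous_adapted M \<F> A\<^sub>2" "\<forall>\<omega>\<in>space M. mono_on {0..} (\<lambda>t. A\<^sub>2 t \<omega>)"
      and A0: "\<forall>\<omega>\<in>space M. N 0 \<omega> = 0 \<and> A\<^sub>1 0 \<omega> = 0 \<and> A\<^sub>2 0 \<omega> = 0"
      and eq: "\<forall>t\<ge>0. \<forall>\<omega>\<in>space M. X t \<omega> \<bullet> e = X 0 \<omega> \<bullet> e + N t \<omega> + (A\<^sub>1 t \<omega> - A\<^sub>2 t \<omega>)"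
      using X e unfolding continuous_semimartingale_def by blast
    have [measurable]: "A\<^sub>1 T \<in> borel_measurable M" "A\<^sub>2 T \<in> borel_measurable M"
      using A1(1) A2(1) T measurable_F_M[of "A\<^sub>1 T" T] measurable_F_M[of "A\<^sub>2 T" T]
      unfolding continuous_adapted_def by auto
    define V where "V \<omega> = 2 * (A\<^sub>1 T \<omega> + A\<^sub>2 T \<omega>)\<^sup>2" for \<omega>
    have "V \<in> borel_measurable M" unfolding V_def by measurable
    then have "tight_on (partitions_upto T) (\<lambda>\<pi> \<omega>. (square_variation N \<pi> \<omega> + square_variation N \<pi> \<omega>) + V \<omega>)"
      using local_martingale_tight[OF N T] by (intro tight_on_add tight_on_const)
    then show ?thesis
    proof (rule tight_on_mono)
      show "square_variation (\<lambda>t \<omega>. X t \<omega> \<bullet> e) \<pi> \<in> borel_measurable M" if "\<pi> \<in> partitions_upto T" for \<pi>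
        by (rule square_variation_measurable[OF _ that]) (use XM in auto)
      fix \<pi> \<omega> assume \<pi>: "\<pi> \<in> partitions_upto T" and \<omega>: "\<omega> \<in> space M"
      obtain m p where mp: "\<pi> = (m, p)" by (cases \<pi>)
      have p: "0 \<le> p j" "p j \<le> p (Suc j)" "p (Suc j) \<le> T" if "j < m" for j
        using \<pi> that unfolding mp partitions_upto_def by auto
      define a where "a t = A\<^sub>1 t \<omega> + A\<^sub>2 t \<omega>" for t
      have mono1: "A\<^sub>1 u \<omega> \<le> A\<^sub>1 v \<omega>" and mono2: "A\<^sub>2 u \<omega> \<le> A\<^sub>2 v \<omega>" if "0 \<le> u" "u \<le> v" for u v
        using A1(2) A2(2) \<omega> that by (auto simp: mono_on_def)
      have mono: "a u \<le> a v" if "0 \<le> u" "u \<le> v" for u v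
        using mono1[OF that] mono2[OF that] by (simp add: a_def)
      have "(\<Sum>j<m. (a (p (Suc j)) - a (p j))\<^sup>2) \<le> (\<Sum>j<m. a (p (Suc j)) - a (p j))\<^sup>2"
        using mono p by (intro sum_squares_le_square_sum) auto
      also have "\<dots> = (a (p m) - a (p 0))\<^sup>2"
        using sum_lessThan_telescope[of "\<lambda>j. a (p j)" m] by simp
      also have "\<dots> \<le> (a T)\<^sup>2"
      proof (cases "m = 0")
        case False
        then have "0 \<le> p 0" using p by auto
        have "p j \<le> p m" if "j \<le> m" for j
          using that p(2) by (induction rule: inc_induct) (auto intro: order_trans)
        then have "p 0 \<le> p m" by simp
        moreover have "p m \<le> T" using p(3)[of "m - 1"] False by simp
        ultimately have "a 0 \<le> a (p 0)" "a (p 0) \<le> a (p m)" "a (p m) \<le> a T"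
          using \<open>0 \<le> p 0\<close> by (auto intro!: mono)
        moreover have "a 0 = 0" using A0 \<omega> by (simp add: a_def)
        ultimately show ?thesis by (intro power_mono) auto
      qed simp
      finally have fv: "(\<Sum>j<m. (a (p (Suc j)) - a (p j))\<^sup>2) \<le> (a T)\<^sup>2" .
      have "square_variation (\<lambda>t \<omega>. X t \<omega> \<bullet> e) \<pi> \<omega> = (\<Sum>j<m. (X (p (Suc j)) \<omega> \<bullet> e - X (p j) \<omega> \<bullet> e)\<^sup>2)"
        by (simp add: square_variation_def mp)
      also have "\<dots> \<le> (\<Sum>j<m. 2 * (N (p (Suc j)) \<omega> - N (p j) \<omega>)\<^sup>2 + 2 * (a (p (Suc j)) - a (p j))\<^sup>2)"
      proof (rule sum_mono)
        fix j assume "j \<in> {..<m}"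
        then have j: "0 \<le> p j" "p j \<le> p (Suc j)" using p by auto
        define b where "b = (A\<^sub>1 (p (Suc j)) \<omega> - A\<^sub>2 (p (Suc j)) \<omega>) - (A\<^sub>1 (p j) \<omega> - A\<^sub>2 (p j) \<omega>)"
        have X1: "X (p (Suc j)) \<omega> \<bullet> e = X 0 \<omega> \<bullet> e + N (p (Suc j)) \<omega> + (A\<^sub>1 (p (Suc j)) \<omega> - A\<^sub>2 (p (Suc j)) \<omega>)"
          and X2: "X (p j) \<omega> \<bullet> e = X 0 \<omega> \<bullet> e + N (p j) \<omega> + (A\<^sub>1 (p j) \<omega> - A\<^sub>2 (p j) \<omega>)"
          using j \<omega> by (auto intro!: eq[rule_format])
        have "X (p (Suc j)) \<omega> \<bullet> e - X (p j) \<omega> \<bullet> e = (N (p (Suc j)) \<omega> - N (p j) \<omega>) + b"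
          unfolding X1 X2 b_def by simp
        then have "(X (p (Suc j)) \<omega> \<bullet> e - X (p j) \<omega> \<bullet> e)\<^sup>2 \<le> 2 * (N (p (Suc j)) \<omega> - N (p j) \<omega>)\<^sup>2 + 2 * b\<^sup>2"
          using norm_add_squared_le[of "N (p (Suc j)) \<omega> - N (p j) \<omega>" b] by simp
        moreover have "\<bar>b\<bar> \<le> a (p (Suc j)) - a (p j)"
          using mono1[OF j] mono2[OF j] unfolding b_def a_def by linarith
        then have "b\<^sup>2 \<le> (a (p (Suc j)) - a (p j))\<^sup>2"
          using power_mono[of "\<bar>b\<bar>" _ 2] by simp
        ultimately show "(X (p (Suc j)) \<omega> \<bullet> e - X (p j) \<omega> \<bullet> e)\<^sup>2
          \<le> 2 * (N (p (Suc j)) \<omega> - N (p j) \<omega>)\<^sup>2 + 2 * (a (p (Suc j)) - a (p j))\<^sup>2" by linarith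
      qed
      also have "\<dots> = 2 * square_variation N \<pi> \<omega> + 2 * (\<Sum>j<m. (a (p (Suc j)) - a (p j))\<^sup>2)"
        by (simp add: square_variation_def mp sum.distrib sum_distrib_left)
      also have "\<dots> \<le> 2 * square_variation N \<pi> \<omega> + V \<omega>"
        using fv by (simp add: V_def a_def)
      finally show "square_variation (\<lambda>t \<omega>. X t \<omega> \<bullet> e) \<pi> \<omega>
        \<le> square_variation N \<pi> \<omega> + square_variation N \<pi> \<omega> + V \<omega>" by simp
    qed
  qed
  have "tight_on (partitions_upto T) (\<lambda>\<pi> \<omega>. \<Sum>e\<in>Basis. square_variation (\<lambda>t \<omega>. X t \<omega> \<bullet> e) \<pi> \<omega>)"
    using coord by (intro tight_on_sum) auto
  then show ?thesis
  proof (rule tight_on_mono)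
    show "square_variation X \<pi> \<in> borel_measurable M" if "\<pi> \<in> partitions_upto T" for \<pi>
      using XM that by (rule square_variation_measurable)
    fix \<pi> \<omega>
    have "(norm (v::'b))\<^sup>2 = (\<Sum>e\<in>Basis. (v \<bullet> e)\<^sup>2)" for v
      unfolding power2_norm_eq_inner by (subst euclidean_inner) (simp add: power2_eq_square)
    then show "square_variation X \<pi> \<omega> \<le> (\<Sum>e\<in>Basis. square_variation (\<lambda>t \<omega>. X t \<omega> \<bullet> e) \<pi> \<omega>)"
      unfolding square_variation_def
      by (subst sum.swap) (simp add: inner_diff_left)
  qed
qed

end

section \<open>Mean-square increments of a Stratonovich solution\<close>

text \<open>Since \<open>g\<close> is continuous on \<open>K\<close> only, it is extended by 0 to a
  Borel function on the whole space before composing.\<close>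

lemma borel_measurable_continuous_compose_compact:
  fixes g :: "'a::euclidean_space \<Rightarrow> 'b::euclidean_space"
  assumes "compact K" "continuous_on K g" "Y \<in> borel_measurable N" "\<And>\<omega>. \<omega> \<in> space N \<Longrightarrow> Y \<omega> \<in> K"
  shows "(\<lambda>\<omega>. g (Y \<omega>)) \<in> borel_measurable N"
proof -
  have [measurable]: "(\<lambda>x. if x \<in> K then g x else 0) \<in> borel_measurable borel"
    using assms(1,2) by (intro borel_measurable_continuous_on_if) (auto intro: borel_closed compact_imp_closed)
  have "(\<lambda>\<omega>. if Y \<omega> \<in> K then g (Y \<omega>) else 0) \<in> borel_measurable N"
    using measurable_compose[OF assms(3), of "\<lambda>x. if x \<in> K then g x else 0" borel] by simp
  then show ?thesis
    by (subst measurable_cong[where g = "\<lambda>\<omega>. if Y \<omega> \<in> K then g (Y \<omega>) else 0"]) (use assms(4) in auto)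
qed

lemma (in prob_space) prob_le_of_exceptional_set:
  assumes "A \<in> sets M" "prob A \<le> \<epsilon>" "AE \<omega> in M. \<omega> \<notin> A \<longrightarrow> \<not> P \<omega>"
  shows "prob {\<omega>\<in>space M. P \<omega>} \<le> \<epsilon>"
proof -
  have "prob {\<omega>\<in>space M. P \<omega>} \<le> prob A"
    using assms(3) by (intro finite_measure_mono_AE assms(1)) auto
  with assms(2) show ?thesis by linarith
qed

lemma (in prob_space) prob_Un_le:
  assumes "A \<in> sets M" "C \<in> sets M" "prob A \<le> a" "prob C \<le> c"
  shows "prob (A \<union> C) \<le> a + c"
  using measure_Un_le[OF assms(1,2)] assms by linarith

text \<open>The process \<open>A\<close> is the drift integral \<open>\<integral> f 0 (X s) ds\<close>; only its Lipschitz bound matters here, so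
  \<open>f 0\<close> itself does not occur.\<close>

locale stratonovich_frame = brownian_setup M \<F> k B
  for M :: "'w measure" and \<F> k B +
  fixes K :: "'a::euclidean_space set" and f :: "nat \<Rightarrow> 'a \<Rightarrow> 'a" and Df :: "nat \<Rightarrow> 'a \<Rightarrow> 'a \<Rightarrow> 'a"
    and C :: real and X A :: "real \<Rightarrow> 'w \<Rightarrow> 'a"
  assumes K: "compact K"
    and C: "1 \<le> C"
    and f_cont: "\<And>i. i \<in> {1..k} \<Longrightarrow> continuous_on K (f i)"
    and f_bound: "\<And>i x. i \<in> {1..k} \<Longrightarrow> x \<in> K \<Longrightarrow> norm (f i x) \<le> C"
    and f_lip: "\<And>i x y. i \<in> {1..k} \<Longrightarrow> x \<in> K \<Longrightarrow> y \<in> K \<Longrightarrow> norm (f i x - f i y) \<le> C * norm (x - y)"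
    and Df_lin: "\<And>i x. i \<in> {1..k} \<Longrightarrow> x \<in> K \<Longrightarrow> linear (Df i x)"
    and Df_bound: "\<And>i x v. i \<in> {1..k} \<Longrightarrow> x \<in> K \<Longrightarrow> norm (Df i x v) \<le> C * norm v"
    and Df_cont: "\<And>i l. i \<in> {1..k} \<Longrightarrow> l \<in> {1..k} \<Longrightarrow> continuous_on K (\<lambda>x. Df i x (f l x))"
    and Df_taylor: "\<And>\<epsilon>. 0 < \<epsilon> \<Longrightarrow> \<exists>r>0. \<forall>i\<in>{1..k}. \<forall>x\<in>K. \<forall>y\<in>K. norm (y - x) < r \<longrightarrow>
        norm (f i y - f i x - Df i x (y - x)) \<le> \<epsilon> * norm (y - x)"
    and X_K: "\<And>t \<omega>. 0 \<le> t \<Longrightarrow> \<omega> \<in> space M \<Longrightarrow> X t \<omega> \<in> K"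
    and X_meas: "\<And>t. 0 \<le> t \<Longrightarrow> X t \<in> borel_measurable (\<F> t)"
    and X_tight: "tight_on (partitions_upto 1) (square_variation X)"
    and A_meas: "\<And>t. 0 \<le> t \<Longrightarrow> A t \<in> borel_measurable M"
    and A_lip: "\<And>s t. 0 \<le> s \<Longrightarrow> s \<le> t \<Longrightarrow> AE \<omega> in M. norm (A t \<omega> - A s \<omega>) \<le> C * (t - s)"
    and approx: "\<And>s t. 0 \<le> s \<Longrightarrow> s < t \<Longrightarrow> vanishes_in_prob (\<lambda>n \<omega>. X t \<omega> - X s \<omega> - (A t \<omega> - A s \<omega>)
        - (\<Sum>i=1..k. stratonovich_sum (\<lambda>u \<omega>. f i (X u \<omega>)) (B i) n (uniform_pt s t n) \<omega>))"
begin

section \<open>The discrete equation on a uniform subdivision\<close>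

definition Ito :: "real \<Rightarrow> real \<Rightarrow> nat \<Rightarrow> 'w \<Rightarrow> 'a" where
  "Ito s t n \<omega> = (\<Sum>i=1..k. \<Sum>j<n.
     inc i (uniform_pt s t n j) (uniform_pt s t n (Suc j)) \<omega> *\<^sub>R f i (X (uniform_pt s t n j) \<omega>))"

definition Correction :: "real \<Rightarrow> real \<Rightarrow> nat \<Rightarrow> 'w \<Rightarrow> 'a" where
  "Correction s t n \<omega> = (\<Sum>i=1..k. \<Sum>j<n. (1/2) *\<^sub>R (inc i (uniform_pt s t n j) (uniform_pt s t n (Suc j)) \<omega> *\<^sub>R
     (f i (X (uniform_pt s t n (Suc j)) \<omega>) - f i (X (uniform_pt s t n j) \<omega>))))"

definition QX :: "real \<Rightarrow> real \<Rightarrow> nat \<Rightarrow> 'w \<Rightarrow> real" where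
  "QX s t n = square_variation X (n, uniform_pt s t n)"

definition QB :: "real \<Rightarrow> real \<Rightarrow> nat \<Rightarrow> 'w \<Rightarrow> real" where
  "QB s t n \<omega> = (\<Sum>i=1..k. \<Sum>j<n. (inc i (uniform_pt s t n j) (uniform_pt s t n (Suc j)) \<omega>)\<^sup>2)"

text \<open>The defect of the discrete equation with \<open>n\<close> cells. For fixed
  \<open>s < t\<close> it tends to 0 in probability as \<open>n\<close> grows, with no rate.\<close>

definition Err :: "real \<Rightarrow> real \<Rightarrow> nat \<Rightarrow> 'w \<Rightarrow> 'a" where
  "Err s t n \<omega> = X t \<omega> - X s \<omega> - (A t \<omega> - A s \<omega>) - Ito s t n \<omega> - Correction s t n \<omega>"

text \<open>The average of the two endpoint values is the left value plus half the
  increment.\<close>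

lemma stratonovich_eq_Ito_Correction:
  "(\<Sum>i=1..k. stratonovich_sum (\<lambda>u \<omega>. f i (X u \<omega>)) (B i) n (uniform_pt s t n) \<omega>) = Ito s t n \<omega> + Correction s t n \<omega>"
  unfolding Ito_def Correction_def stratonovich_sum_def sum.distrib[symmetric] inc_def
proof (intro sum.cong refl)
  fix i j
  let ?a = "B i (uniform_pt s t n (Suc j)) \<omega> - B i (uniform_pt s t n j) \<omega>"
  let ?x = "f i (X (uniform_pt s t n j) \<omega>)" and ?y = "f i (X (uniform_pt s t n (Suc j)) \<omega>)"
  have "(1 / 2) *\<^sub>R (?x + ?y) = ?x + (1 / 2) *\<^sub>R (?y - ?x)"
    by (simp add: algebra_simps scaleR_left_distrib[symmetric] flip: scaleR_2)
  then show "?a *\<^sub>R (1 / 2) *\<^sub>R (?x + ?y) = ?a *\<^sub>R ?x + (1 / 2) *\<^sub>R ?a *\<^sub>R (?y - ?x)"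
    by (simp only: scaleR_right_distrib scaleR_left_commute)
qed

lemma Err_vanishes:
  assumes "0 \<le> s" "s < t" shows "vanishes_in_prob (Err s t)"
proof -
  have "Err s t = (\<lambda>n \<omega>. X t \<omega> - X s \<omega> - (A t \<omega> - A s \<omega>) - (Ito s t n \<omega> + Correction s t n \<omega>))"
    by (simp add: fun_eq_iff Err_def)
  then show ?thesis using approx[OF assms] unfolding stratonovich_eq_Ito_Correction by simp
qed

lemma continuous_of_X_measurable:
  fixes g :: "'a \<Rightarrow> 'b::euclidean_space"
  assumes g: "continuous_on K g" and t: "0 \<le> t"
  shows "(\<lambda>\<omega>. g (X t \<omega>)) \<in> borel_measurable (\<F> t)"
  using X_K t by (intro borel_measurable_continuous_compose_compact[OF K g X_meas]) (auto simp: space_F)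

lemma continuous_of_X_measurable':
  fixes g :: "'a \<Rightarrow> 'b::euclidean_space"
  assumes g: "continuous_on K g" and t: "0 \<le> t"
  shows "(\<lambda>\<omega>. g (X t \<omega>)) \<in> borel_measurable M"
  using continuous_of_X_measurable[OF assms] measurable_F_M by blast

lemma X_meas': "0 \<le> t \<Longrightarrow> X t \<in> borel_measurable M"
  using X_meas measurable_F_M by blast

lemmas f_X_meas = continuous_of_X_measurable'[OF f_cont]

lemma pt_measurable:
  assumes "0 \<le> s" "s < t" "j < n"
  shows "X (uniform_pt s t n j) \<in> borel_measurable M" "X (uniform_pt s t n (Suc j)) \<in> borel_measurable M"
    "i \<in> {1..k} \<Longrightarrow> inc i (uniform_pt s t n j) (uniform_pt s t n (Suc j)) \<in> borel_measurable M"
    "i \<in> {1..k} \<Longrightarrow> (\<lambda>\<omega>. f i (X (uniform_pt s t n j) \<omega>)) \<in> borel_measurable M"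
    "i \<in> {1..k} \<Longrightarrow> (\<lambda>\<omega>. f i (X (uniform_pt s t n (Suc j)) \<omega>)) \<in> borel_measurable M"
  using uniform_pt_bounds[OF assms] by (auto intro!: X_meas' inc_measurable f_X_meas)

lemma Ito_measurable:
  assumes "0 \<le> s" "s < t" shows "Ito s t n \<in> borel_measurable M"
  unfolding Ito_def[abs_def]
  by (intro borel_measurable_sum borel_measurable_scaleR pt_measurable[OF assms]) auto

lemma Correction_measurable:
  assumes "0 \<le> s" "s < t" shows "Correction s t n \<in> borel_measurable M"
  unfolding Correction_def[abs_def]
  by (intro borel_measurable_sum borel_measurable_scaleR borel_measurable_diff borel_measurable_const
      pt_measurable[OF assms]) auto

lemma QB_measurable:
  assumes "0 \<le> s" "s < t" shows "QB s t n \<in> borel_measurable M"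
  unfolding QB_def[abs_def]
  by (intro borel_measurable_sum borel_measurable_power pt_measurable[OF assms]) auto

lemma uniform_pt_partition:
  assumes "0 \<le> s" "s < t" "t \<le> 1" shows "(n, uniform_pt s t n) \<in> partitions_upto 1"
  unfolding partitions_upto_def
proof (clarsimp, intro conjI)
  fix j assume "j < n"
  note b = uniform_pt_bounds[OF assms(1,2) this]
  show "0 \<le> uniform_pt s t n j" "uniform_pt s t n j \<le> uniform_pt s t n (Suc j)" "uniform_pt s t n (Suc j) \<le> 1"
    using b assms(3) by auto
qed

lemma QX_measurable:
  assumes "0 \<le> s" "s < t" shows "QX s t n \<in> borel_measurable M"
  unfolding QX_def square_variation_def[abs_def] fst_conv snd_conv
  by (intro borel_measurable_sum borel_measurable_power borel_measurable_norm[THEN measurable_compose[rotated]]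
      borel_measurable_diff pt_measurable[OF assms]) auto

lemma Err_measurable:
  assumes "0 \<le> s" "s < t" shows "Err s t n \<in> borel_measurable M"
  unfolding Err_def[abs_def]
  by (intro borel_measurable_diff X_meas' A_meas Ito_measurable Correction_measurable assms) (use assms in auto)

lemma QX_nonneg: "0 \<le> QX s t n \<omega>"
  unfolding QX_def square_variation_def by (intro sum_nonneg) auto

text \<open>After the Lipschitz bound for the fields, Cauchy-Schwarz over the cells separates the
  Brownian increments from those of \<open>X\<close>; a second use, over the index \<open>i\<close>,
  costs the factor \<open>k\<close>.\<close>

lemma Correction_bound:
  assumes st: "0 \<le> s" "s < t" and \<omega>: "\<omega> \<in> space M"
  shows "(norm (Correction s t n \<omega>))\<^sup>2 \<le> real k * C\<^sup>2 * QB s t n \<omega> * QX s t n \<omega>"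
proof -
  let ?p = "uniform_pt s t n"
  let ?b = "\<lambda>i j. inc i (?p j) (?p (Suc j)) \<omega>" and ?d = "\<lambda>j. norm (X (?p (Suc j)) \<omega> - X (?p j) \<omega>)"
  have part: "(norm (\<Sum>j<n. (1/2) *\<^sub>R (?b i j *\<^sub>R (f i (X (?p (Suc j)) \<omega>) - f i (X (?p j) \<omega>)))))\<^sup>2
      \<le> C\<^sup>2 * (\<Sum>j<n. (?b i j)\<^sup>2) * QX s t n \<omega>" if i: "i \<in> {1..k}" for i
  proof -
    have "norm (\<Sum>j<n. (1/2) *\<^sub>R (?b i j *\<^sub>R (f i (X (?p (Suc j)) \<omega>) - f i (X (?p j) \<omega>))))
      \<le> (\<Sum>j<n. \<bar>?b i j\<bar> * (C * ?d j))"
    proof (rule order_trans[OF norm_sum sum_mono])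
      fix j assume "j \<in> {..<n}"
      then have j: "0 \<le> ?p j" "0 \<le> ?p (Suc j)" using uniform_pt_bounds[OF st, of j n] by auto
      have "\<bar>?b i j\<bar> * norm (f i (X (?p (Suc j)) \<omega>) - f i (X (?p j) \<omega>)) \<le> \<bar>?b i j\<bar> * (C * ?d j)"
        using f_lip[OF i X_K X_K] \<omega> j by (intro mult_left_mono) auto
      then show "norm ((1/2) *\<^sub>R (?b i j *\<^sub>R (f i (X (?p (Suc j)) \<omega>) - f i (X (?p j) \<omega>)))) \<le> \<bar>?b i j\<bar> * (C * ?d j)"
        by (simp, smt (verit) abs_ge_zero mult_nonneg_nonneg norm_ge_zero)
    qed
    then have "(norm (\<Sum>j<n. (1/2) *\<^sub>R (?b i j *\<^sub>R (f i (X (?p (Suc j)) \<omega>) - f i (X (?p j) \<omega>)))))\<^sup>2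
      \<le> (\<Sum>j<n. \<bar>?b i j\<bar> * (C * ?d j))\<^sup>2" by (intro power_mono) auto
    also have "\<dots> \<le> (\<Sum>j<n. \<bar>?b i j\<bar>\<^sup>2) * (\<Sum>j<n. (C * ?d j)\<^sup>2)"
      by (rule Cauchy_Schwarz_ineq_sum)
    also have "\<dots> = C\<^sup>2 * (\<Sum>j<n. (?b i j)\<^sup>2) * QX s t n \<omega>"
      by (simp add: QX_def square_variation_def power_mult_distrib sum_distrib_left[symmetric])
    finally show ?thesis .
  qed
  have "(norm (Correction s t n \<omega>))\<^sup>2 \<le> real k *
    (\<Sum>i=1..k. (norm (\<Sum>j<n. (1/2) *\<^sub>R (?b i j *\<^sub>R (f i (X (?p (Suc j)) \<omega>) - f i (X (?p j) \<omega>)))))\<^sup>2)"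
    unfolding Correction_def using norm_sum_squared_le[of "{1..k}"] by simp
  also have "\<dots> \<le> real k * (\<Sum>i=1..k. C\<^sup>2 * (\<Sum>j<n. (?b i j)\<^sup>2) * QX s t n \<omega>)"
    by (intro mult_left_mono sum_mono part) auto
  also have "\<dots> = real k * C\<^sup>2 * QB s t n \<omega> * QX s t n \<omega>"
    by (simp add: QB_def sum_distrib_left[symmetric] sum_distrib_right[symmetric])
  finally show ?thesis .
qed

text \<open>Orthogonality is used in time only. The \<open>k\<close> noises are combined by
  Cauchy-Schwarz, which costs a factor \<open>k\<close> on top of the number of noises; hence the
  square of \<open>k\<close>.\<close>

lemma ito_sum_L2:
  fixes y :: "nat \<Rightarrow> nat \<Rightarrow> 'w \<Rightarrow> 'b::euclidean_space"
  assumes st: "0 \<le> s" "s < t" and n: "0 < n"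
    and y: "\<And>i j. i \<in> {1..k} \<Longrightarrow> j < n \<Longrightarrow> y i j \<in> borel_measurable (\<F> (uniform_pt s t n j))"
      "\<And>i j. i \<in> {1..k} \<Longrightarrow> j < n \<Longrightarrow> integrable M (\<lambda>\<omega>. (norm (y i j \<omega>))\<^sup>2)"
      "\<And>i j. i \<in> {1..k} \<Longrightarrow> j < n \<Longrightarrow> (\<integral>\<omega>. (norm (y i j \<omega>))\<^sup>2 \<partial>M) \<le> c"
  defines "S \<equiv> (\<lambda>\<omega>. \<Sum>i=1..k. \<Sum>j<n. inc i (uniform_pt s t n j) (uniform_pt s t n (Suc j)) \<omega> *\<^sub>R y i j \<omega>)"
  shows "S \<in> borel_measurable M" "integrable M (\<lambda>\<omega>. (norm (S \<omega>))\<^sup>2)"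
    "(\<integral>\<omega>. (norm (S \<omega>))\<^sup>2 \<partial>M) \<le> (real k)\<^sup>2 * c * (t - s)" "(\<integral>\<omega>. S \<omega> \<partial>M) = 0"
proof -
  let ?p = "uniform_pt s t n"
  define T where "T i \<omega> = (\<Sum>j<n. inc i (?p j) (?p (Suc j)) \<omega> *\<^sub>R y i j \<omega>)" for i \<omega>
  have T: "T i \<in> borel_measurable M" "integrable M (\<lambda>\<omega>. (norm (T i \<omega>))\<^sup>2)"
    "(\<integral>\<omega>. (norm (T i \<omega>))\<^sup>2 \<partial>M) \<le> c * (t - s)" "(\<integral>\<omega>. T i \<omega> \<partial>M) = 0" if i: "i \<in> {1..k}" for i
  proof -
    have *: "?p j \<le> ?p (Suc j)" "innovation (?p j) (?p (Suc j)) (inc i (?p j) (?p (Suc j))) (?p (Suc j) - ?p j)"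
      if "j < n" for j
      using uniform_pt_bounds[OF st that] by (auto intro!: innovation_inc i)
    note os = orthogonal_sum[of n ?p "\<lambda>j. inc i (?p j) (?p (Suc j))" "\<lambda>j. ?p (Suc j) - ?p j" "y i",
        OF * y(1)[OF i] y(2)[OF i], folded T_def]
    show "T i \<in> borel_measurable M" using os(1) measurable_F_M by auto
    show "integrable M (\<lambda>\<omega>. (norm (T i \<omega>))\<^sup>2)" "(\<integral>\<omega>. T i \<omega> \<partial>M) = 0" using os by auto
    have "(\<integral>\<omega>. (norm (T i \<omega>))\<^sup>2 \<partial>M) = (\<Sum>j<n. (?p (Suc j) - ?p j) * (\<integral>\<omega>. (norm (y i j \<omega>))\<^sup>2 \<partial>M))"
      by (rule os(3)) auto
    also have "\<dots> \<le> (\<Sum>j<n. (?p (Suc j) - ?p j) * c)"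
      using * y(3)[OF i] by (intro sum_mono mult_left_mono) auto
    also have "\<dots> = (\<Sum>j<n. ?p (Suc j) - ?p j) * c" by (rule sum_distrib_right[symmetric])
    also have "\<dots> = c * (t - s)"
      using sum_lessThan_telescope[of ?p n] n by simp
    finally show "(\<integral>\<omega>. (norm (T i \<omega>))\<^sup>2 \<partial>M) \<le> c * (t - s)" .
  qed
  have S: "S = (\<lambda>\<omega>. \<Sum>i=1..k. T i \<omega>)" unfolding S_def T_def by simp
  show [measurable]: "S \<in> borel_measurable M"
    unfolding S using T(1) by (intro borel_measurable_sum) auto
  have le: "(norm (S \<omega>))\<^sup>2 \<le> real k * (\<Sum>i=1..k. (norm (T i \<omega>))\<^sup>2)" for \<omega>
    unfolding S using norm_sum_squared_le[of "{1..k}"] by simp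
  have int: "integrable M (\<lambda>\<omega>. real k * (\<Sum>i=1..k. (norm (T i \<omega>))\<^sup>2))"
    using T(2) by (intro integrable_mult_right Bochner_Integration.integrable_sum) auto
  show intS: "integrable M (\<lambda>\<omega>. (norm (S \<omega>))\<^sup>2)"
  proof (rule Bochner_Integration.integrable_bound[OF int])
    show "AE \<omega> in M. norm ((norm (S \<omega>))\<^sup>2) \<le> norm (real k * (\<Sum>i=1..k. (norm (T i \<omega>))\<^sup>2))"
      using order_trans[OF le abs_ge_self] by (intro AE_I2) simp
  qed measurable
  have "(\<integral>\<omega>. (norm (S \<omega>))\<^sup>2 \<partial>M) \<le> (\<integral>\<omega>. real k * (\<Sum>i=1..k. (norm (T i \<omega>))\<^sup>2) \<partial>M)"
    by (intro integral_mono intS int le)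
  also have "\<dots> = real k * (\<Sum>i=1..k. \<integral>\<omega>. (norm (T i \<omega>))\<^sup>2 \<partial>M)"
    using T(2) by (simp add: Bochner_Integration.integral_sum)
  also have "\<dots> \<le> real k * (\<Sum>i=1..k. c * (t - s))"
    using T(3) by (intro mult_left_mono sum_mono) auto
  also have "\<dots> = (real k)\<^sup>2 * c * (t - s)" by (simp add: power2_eq_square)
  finally show "(\<integral>\<omega>. (norm (S \<omega>))\<^sup>2 \<partial>M) \<le> (real k)\<^sup>2 * c * (t - s)" .
  have "integrable M (T i)" if "i \<in> {1..k}" for i
    using T(1,2)[OF that] integrable_of_square by blast
  then show "(\<integral>\<omega>. S \<omega> \<partial>M) = 0"
    unfolding S using T(4) by (simp add: Bochner_Integration.integral_sum)
qed

lemma Ito_L2: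
  assumes st: "0 \<le> s" "s < t" and n: "0 < n"
  shows "integrable M (\<lambda>\<omega>. (norm (Ito s t n \<omega>))\<^sup>2)"
    "(\<integral>\<omega>. (norm (Ito s t n \<omega>))\<^sup>2 \<partial>M) \<le> (real k)\<^sup>2 * C\<^sup>2 * (t - s)"
proof -
  let ?p = "uniform_pt s t n"
  have m: "(\<lambda>\<omega>. f i (X (?p j) \<omega>)) \<in> borel_measurable (\<F> (?p j))" if "i \<in> {1..k}" "j < n" for i j
    using uniform_pt_bounds[OF st that(2)] by (intro continuous_of_X_measurable f_cont that) auto
  have b: "(norm (f i (X (?p j) \<omega>)))\<^sup>2 \<le> C\<^sup>2" if "i \<in> {1..k}" "j < n" "\<omega> \<in> space M" for i j \<omega>
    using uniform_pt_bounds[OF st that(2)] that by (intro power_mono f_bound X_K) auto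
  have int: "integrable M (\<lambda>\<omega>. (norm (f i (X (?p j) \<omega>)))\<^sup>2)" if "i \<in> {1..k}" "j < n" for i j
    using b that pt_measurable(4)[OF st that(2,1)]
    by (intro integrable_const_bound[where B = "C\<^sup>2"] AE_I2) auto
  have E: "(\<integral>\<omega>. (norm (f i (X (?p j) \<omega>)))\<^sup>2 \<partial>M) \<le> C\<^sup>2" if "i \<in> {1..k}" "j < n" for i j
  proof -
    have "(\<integral>\<omega>. (norm (f i (X (?p j) \<omega>)))\<^sup>2 \<partial>M) \<le> (\<integral>\<omega>. C\<^sup>2 \<partial>M)"
      using int[OF that] b[OF that] by (intro integral_mono) auto
    then show ?thesis by (simp add: prob_space)
  qed
  note il = ito_sum_L2[OF st n, of "\<lambda>i j \<omega>. f i (X (?p j) \<omega>)" "C\<^sup>2", OF m int E, folded Ito_def]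
  show "integrable M (\<lambda>\<omega>. (norm (Ito s t n \<omega>))\<^sup>2)"
    "(\<integral>\<omega>. (norm (Ito s t n \<omega>))\<^sup>2 \<partial>M) \<le> (real k)\<^sup>2 * C\<^sup>2 * (t - s)"
    using il(2,3) by auto
qed

text \<open>The limit of \<open>QB\<close> is \<open>k * (t - s)\<close>; the additional
  \<open>t - s\<close> in the threshold is the room in which convergence in probability
  acts.\<close>

lemma QB_eventually:
  assumes st: "0 \<le> s" "s < t" and \<eta>: "0 < \<eta>"
  shows "\<forall>\<^sub>F n in sequentially. prob {\<omega>\<in>space M. QB s t n \<omega> > real (k + 1) * (t - s)} \<le> \<eta>"
proof -
  have "vanishes_in_prob (\<lambda>n \<omega>. \<Sum>i=1..k. (\<Sum>j<n. inc i (uniform_pt s t n j) (uniform_pt s t n (Suc j)) \<omega> *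
            inc i (uniform_pt s t n j) (uniform_pt s t n (Suc j)) \<omega>) - (if i = i then t - s else 0))"
  proof (rule vanishes_in_prob_sum)
    fix i assume i: "i \<in> {1..k}"
    show "vanishes_in_prob (\<lambda>n \<omega>. (\<Sum>j<n. inc i (uniform_pt s t n j) (uniform_pt s t n (Suc j)) \<omega> *
            inc i (uniform_pt s t n j) (uniform_pt s t n (Suc j)) \<omega>) - (if i = i then t - s else 0))"
      by (rule quadratic_variation_inc[OF i i st])
    show "(\<lambda>\<omega>. (\<Sum>j<n. inc i (uniform_pt s t n j) (uniform_pt s t n (Suc j)) \<omega> *
            inc i (uniform_pt s t n j) (uniform_pt s t n (Suc j)) \<omega>) - (if i = i then t - s else 0)) \<in> borel_measurable M" for n
      using pt_measurable(3)[OF st] i by (intro borel_measurable_diff borel_measurable_sum borel_measurable_times) auto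
  qed
  then have v: "vanishes_in_prob (\<lambda>n \<omega>. QB s t n \<omega> - real k * (t - s))"
    by (simp add: QB_def sum_subtractf power2_eq_square)
  have "\<forall>\<^sub>F n in sequentially. prob {\<omega>\<in>space M. norm (QB s t n \<omega> - real k * (t - s)) > t - s} < \<eta>"
    using v by (rule vanishes_in_probD) (use st \<eta> QB_measurable[OF st] in auto)
  then show ?thesis
  proof eventually_elim
    case (elim n)
    note [measurable] = QB_measurable[OF st, of n]
    have "prob {\<omega>\<in>space M. QB s t n \<omega> > real (k + 1) * (t - s)}
      \<le> prob {\<omega>\<in>space M. norm (QB s t n \<omega> - real k * (t - s)) > t - s}"
      by (intro finite_measure_mono) (auto simp: algebra_simps)
    with elim show ?case by linarith
  qed
qed

lemma Err_eventually:
  assumes st: "0 \<le> s" "s < t" and \<eta>: "0 < \<eta>" and e: "0 < e"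
  shows "\<forall>\<^sub>F n in sequentially. prob {\<omega>\<in>space M. norm (Err s t n \<omega>) > e} \<le> \<eta>"
proof -
  have "\<forall>\<^sub>F n in sequentially. prob {\<omega>\<in>space M. norm (Err s t n \<omega>) > e} < \<eta>"
    using Err_vanishes[OF st] e \<eta> Err_measurable[OF st] by (rule vanishes_in_probD)
  then show ?thesis by eventually_elim simp
qed

text \<open>Stated for free \<open>Y\<close> and \<open>Z\<close> because it serves two purposes:
  \<open>Y\<close> is the increment of \<open>X\<close> with \<open>Z\<close> the Ito sum, or
  \<open>Y\<close> is \<open>W\<close> with \<open>Z\<close> equal to \<open>Ito_rem\<close>. In
  both cases \<open>Y\<close> is the sum of the drift increment, \<open>Z\<close>, the correction
  and the defect. The correction is bounded by the length of the interval times the square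
  variation, which is what makes short cells profitable.\<close>

lemma increment_bound:
  assumes st: "0 \<le> s" "s < t" and \<omega>: "\<omega> \<in> space M"
    and A: "norm (A t \<omega> - A s \<omega>) \<le> C * (t - s)"
    and QB: "QB s t n \<omega> \<le> real (k + 1) * (t - s)" and e: "norm (Err s t n \<omega>) \<le> e"
    and Y: "Y + Ito s t n \<omega> = X t \<omega> - X s \<omega> + Z"
  shows "(norm Y)\<^sup>2 \<le> 4 * C\<^sup>2 * (t - s)\<^sup>2 + 4 * (norm Z)\<^sup>2
    + 4 * real k * C\<^sup>2 * real (k + 1) * (t - s) * QX s t n \<omega> + 4 * e\<^sup>2"
proof -
  have "Y = (A t \<omega> - A s \<omega>) + Z + Correction s t n \<omega> + Err s t n \<omega>"
    using Y unfolding Err_def by (simp add: algebra_simps)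
  then have "(norm Y)\<^sup>2 \<le> 4 * (norm (A t \<omega> - A s \<omega>))\<^sup>2 + 4 * (norm Z)\<^sup>2 + 4 * (norm (Correction s t n \<omega>))\<^sup>2
    + 4 * (norm (Err s t n \<omega>))\<^sup>2"
    using norm_add4_squared_le by metis
  moreover have "(norm (A t \<omega> - A s \<omega>))\<^sup>2 \<le> (C * (t - s))\<^sup>2"
    using A by (intro power_mono) auto
  moreover have "(norm (Err s t n \<omega>))\<^sup>2 \<le> e\<^sup>2"
    using e by (intro power_mono) auto
  moreover have "(norm (Correction s t n \<omega>))\<^sup>2 \<le> real k * C\<^sup>2 * (real (k + 1) * (t - s)) * QX s t n \<omega>"
    by (rule order_trans[OF Correction_bound[OF st \<omega>, of n]])
      (intro mult_right_mono mult_left_mono QB QX_nonneg mult_nonneg_nonneg; simp)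
  moreover have "(C * (t - s))\<^sup>2 = C\<^sup>2 * (t - s)\<^sup>2"
    by (rule power_mult_distrib)
  moreover have "4 * real k * C\<^sup>2 * real (k + 1) * (t - s) * QX s t n \<omega>
      = 4 * (real k * C\<^sup>2 * (real (k + 1) * (t - s)) * QX s t n \<omega>)"
    by (simp only: mult.assoc)
  ultimately show ?thesis by linarith
qed

text \<open>On a cell of length \<open>h\<close> the squared correction is at most a constant times \<open>h\<close> times the square
  variation over a much finer partition.  The latter is tight, so as \<open>h\<close> tends to \<open>0\<close> only the
  Ito sums of the cells contribute to the square variation of \<open>X\<close>.\<close>

lemma QX_approx:
  assumes st: "0 \<le> s" "s < t" "t \<le> 1" and \<epsilon>: "0 < \<epsilon>"
  shows "\<forall>\<^sub>F n in sequentially. \<exists>G. integrable M G \<and> (\<forall>\<omega>\<in>space M. 0 \<le> G \<omega>) \<and>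
    (\<integral>\<omega>. G \<omega> \<partial>M) \<le> 4 * (real k)\<^sup>2 * C\<^sup>2 * (t - s) \<and>
    prob {\<omega>\<in>space M. QX s t n \<omega> > G \<omega> + \<epsilon>} \<le> \<epsilon>"
proof -
  obtain L where L: "\<And>\<pi>. \<pi> \<in> partitions_upto 1 \<Longrightarrow> prob {\<omega>\<in>space M. square_variation X \<pi> \<omega> > L} \<le> \<epsilon> / 3"
    using X_tight \<epsilon> unfolding tight_on_def by (meson zero_less_divide_iff zero_less_numeral)
  \<comment> \<open>\<open>D / n\<close> is what the drift and the corrections of all
    \<open>n\<close> cells contribute together, once the fine square variation is bounded by
    \<open>\<bar>L\<bar>\<close>.\<close>
  define D where "D = 4 * C\<^sup>2 * (t - s)\<^sup>2 + 4 * real k * C\<^sup>2 * real (k + 1) * (t - s) * \<bar>L\<bar>"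
  have "(\<lambda>n. D / real n) \<longlonglongrightarrow> 0" by (rule lim_const_over_n)
  then have "\<forall>\<^sub>F n in sequentially. D / real n < \<epsilon> / 2"
    by (rule order_tendstoD) (use \<epsilon> in simp)
  then show ?thesis
    using eventually_gt_at_top[of 0]
  proof eventually_elim
    case (elim n)
    then have n: "0 < n" by simp
    let ?p = "uniform_pt s t n"
    define h where "h = (t - s) / real n"
    have h: "?p (Suc j) - ?p j = h" for j by (simp add: h_def uniform_pt_Suc_diff)
    have p: "0 \<le> ?p j" "?p j < ?p (Suc j)" "0 \<le> ?p (Suc j)" if "j < n" for j
      using uniform_pt_bounds[OF st(1,2) that] by auto
    \<comment> \<open>The defects of the \<open>n\<close> cells are to contribute
      \<open>n * (4 * e\<^sup>2) = \<epsilon> / 2\<close>.\<close>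
    define e where "e = sqrt (\<epsilon> / (8 * real n))"
    have e: "0 < e" "e\<^sup>2 = \<epsilon> / (8 * real n)" using \<epsilon> n by (auto simp: e_def)
    \<comment> \<open>Two exceptional events per cell use up \<open>2 * \<epsilon> / 3\<close> of
      probability; the remaining third goes to the event that the fine square variation exceeds
      \<open>L\<close>.\<close>
    define \<eta> where "\<eta> = \<epsilon> / (3 * real n)"
    have \<eta>: "0 < \<eta>" using \<epsilon> n by (auto simp: \<eta>_def)
    \<comment> \<open>The inner scale \<open>m\<close> is chosen after the cells are fixed, so that
      finitely many limits in probability take effect at once.\<close>
    have "\<forall>\<^sub>F m in sequentially. \<forall>j\<in>{..<n}.
        prob {\<omega>\<in>space M. norm (Err (?p j) (?p (Suc j)) m \<omega>) > e} \<le> \<eta>"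
      using Err_eventually[OF p(1,2) \<eta> e(1)] by (intro eventually_ball_finite) auto
    moreover have "\<forall>\<^sub>F m in sequentially. \<forall>j\<in>{..<n}.
        prob {\<omega>\<in>space M. QB (?p j) (?p (Suc j)) m \<omega> > real (k + 1) * (?p (Suc j) - ?p j)} \<le> \<eta>"
      using QB_eventually[OF p(1,2) \<eta>] by (intro eventually_ball_finite) auto
    ultimately have "\<forall>\<^sub>F m in sequentially. 0 < m \<and> (\<forall>j\<in>{..<n}.
        prob {\<omega>\<in>space M. norm (Err (?p j) (?p (Suc j)) m \<omega>) > e} \<le> \<eta>) \<and> (\<forall>j\<in>{..<n}.
        prob {\<omega>\<in>space M. QB (?p j) (?p (Suc j)) m \<omega> > real (k + 1) * (?p (Suc j) - ?p j)} \<le> \<eta>)"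
      using eventually_gt_at_top[of 0] by eventually_elim blast
    then obtain m where m: "0 < m"
      and mE: "\<And>j. j < n \<Longrightarrow> prob {\<omega>\<in>space M. norm (Err (?p j) (?p (Suc j)) m \<omega>) > e} \<le> \<eta>"
      and mB: "\<And>j. j < n \<Longrightarrow> prob {\<omega>\<in>space M. QB (?p j) (?p (Suc j)) m \<omega> > real (k + 1) * (?p (Suc j) - ?p j)} \<le> \<eta>"
      by (auto simp: eventually_sequentially)
    define I where "I j = Ito (?p j) (?p (Suc j)) m" for j
    define G where "G \<omega> = (\<Sum>j<n. 4 * (norm (I j \<omega>))\<^sup>2)" for \<omega>
    define E1 where "E1 j = {\<omega>\<in>space M. norm (Err (?p j) (?p (Suc j)) m \<omega>) > e}" for j
    define E2 where "E2 j = {\<omega>\<in>space M. QB (?p j) (?p (Suc j)) m \<omega> > real (k + 1) * (?p (Suc j) - ?p j)}" for j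
    define E3 where "E3 = {\<omega>\<in>space M. square_variation X (n * m, uniform_pt s t (n * m)) \<omega> > L}"
    have E12[measurable]: "E1 j \<in> sets M" "E2 j \<in> sets M" if "j < n" for j
      using Err_measurable[OF p(1,2)[OF that], of m, measurable] QB_measurable[OF p(1,2)[OF that], of m, measurable]
      unfolding E1_def E2_def by auto
    have E3[measurable]: "E3 \<in> sets M"
      using QX_measurable[OF st(1,2), of "n * m", measurable] unfolding E3_def QX_def by auto
    have iG: "integrable M G" unfolding G_def I_def
      using Ito_L2(1)[OF p(1,2) m] by (intro Bochner_Integration.integrable_sum integrable_mult_right) auto
    have "(\<integral>\<omega>. G \<omega> \<partial>M) = (\<Sum>j<n. 4 * (\<integral>\<omega>. (norm (I j \<omega>))\<^sup>2 \<partial>M))"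
      unfolding G_def I_def using Ito_L2(1)[OF p(1,2) m]
      by (simp add: Bochner_Integration.integral_sum)
    also have "\<dots> \<le> (\<Sum>j<n. 4 * ((real k)\<^sup>2 * C\<^sup>2 * (?p (Suc j) - ?p j)))"
      unfolding I_def using Ito_L2(2)[OF p(1,2) m] by (intro sum_mono mult_left_mono) auto
    also have "\<dots> = 4 * (real k)\<^sup>2 * C\<^sup>2 * (t - s)"
      unfolding h using n by (simp add: h_def)
    finally have EG: "(\<integral>\<omega>. G \<omega> \<partial>M) \<le> 4 * (real k)\<^sup>2 * C\<^sup>2 * (t - s)" .
    define Bad where "Bad = E3 \<union> (\<Union>j<n. E1 j \<union> E2 j)"
    have Bad[measurable]: "Bad \<in> sets M" unfolding Bad_def using E12 by (intro sets.Un E3 sets.finite_UN) auto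
    have "prob (\<Union>j<n. E1 j \<union> E2 j) \<le> (\<Sum>j<n. prob (E1 j \<union> E2 j))"
      using E12 by (intro finite_measure_subadditive_finite) auto
    also have "\<dots> \<le> (\<Sum>j<n. \<eta> + \<eta>)"
      using E12 mE mB by (intro sum_mono prob_Un_le) (auto simp: E1_def E2_def)
    also have "\<dots> = 2 * \<epsilon> / 3" using n by (simp add: \<eta>_def)
    finally have "prob (\<Union>j<n. E1 j \<union> E2 j) \<le> 2 * \<epsilon> / 3" .
    moreover have "prob E3 \<le> \<epsilon> / 3"
      unfolding E3_def using uniform_pt_partition[OF st] by (intro L)
    ultimately have pBad: "prob Bad \<le> \<epsilon>"
      unfolding Bad_def using prob_Un_le[OF E3, of "\<Union>j<n. E1 j \<union> E2 j" "\<epsilon> / 3" "2 * \<epsilon> / 3"] E12 by auto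
    have "AE \<omega> in M. \<forall>j\<in>{..<n}. norm (A (?p (Suc j)) \<omega> - A (?p j) \<omega>) \<le> C * (?p (Suc j) - ?p j)"
    proof (rule AE_finite_allI)
      fix j assume "j \<in> {..<n}"
      then show "AE \<omega> in M. norm (A (?p (Suc j)) \<omega> - A (?p j) \<omega>) \<le> C * (?p (Suc j) - ?p j)"
        using A_lip[of "?p j" "?p (Suc j)"] p[of j] by auto
    qed simp
    then have "AE \<omega> in M. \<omega> \<notin> Bad \<longrightarrow> \<not> QX s t n \<omega> > G \<omega> + \<epsilon>"
    proof (rule AE_mp, intro AE_I2 impI)
      fix \<omega> assume \<omega>: "\<omega> \<in> space M" "\<omega> \<notin> Bad"
        and Al: "\<forall>j\<in>{..<n}. norm (A (?p (Suc j)) \<omega> - A (?p j) \<omega>) \<le> C * (?p (Suc j) - ?p j)"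
      define c where "c = 4 * real k * C\<^sup>2 * real (k + 1) * h"
      have c0: "0 \<le> c" using st by (auto simp: c_def h_def)
      have bd: "(norm (X (?p (Suc j)) \<omega> - X (?p j) \<omega>))\<^sup>2 \<le>
        4 * C\<^sup>2 * h\<^sup>2 + 4 * (norm (I j \<omega>))\<^sup>2 + c * QX (?p j) (?p (Suc j)) m \<omega> + 4 * e\<^sup>2" if j: "j < n" for j
        using increment_bound[OF p(1,2)[OF j] \<omega>(1), of m e "X (?p (Suc j)) \<omega> - X (?p j) \<omega>" "I j \<omega>"] \<omega> Al j
        unfolding Bad_def E1_def E2_def c_def h I_def by (auto simp: not_less)
      \<comment> \<open>The bound \<open>L\<close> holds uniformly over all partitions, so it
        applies to the subdivision into \<open>n * m\<close> cells although \<open>m\<close> is not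
        controlled.\<close>
      have QQ: "(\<Sum>j<n. QX (?p j) (?p (Suc j)) m \<omega>) = QX s t (n * m) \<omega>"
        unfolding QX_def square_variation_def fst_conv snd_conv uniform_pt_refine[OF n m]
        using sum_uniform_refine[of "\<lambda>l. (norm (X (uniform_pt s t (n * m) (Suc l)) \<omega> - X (uniform_pt s t (n * m) l) \<omega>))\<^sup>2" m n]
        by simp
      have "QX s t n \<omega> \<le> (\<Sum>j<n. 4 * C\<^sup>2 * h\<^sup>2 + 4 * (norm (I j \<omega>))\<^sup>2 + c * QX (?p j) (?p (Suc j)) m \<omega> + 4 * e\<^sup>2)"
        unfolding QX_def[of s t n] square_variation_def fst_conv snd_conv by (intro sum_mono bd) auto
      also have "\<dots> = real n * (4 * C\<^sup>2 * h\<^sup>2) + G \<omega> + c * QX s t (n * m) \<omega> + real n * (4 * e\<^sup>2)"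
        by (simp add: sum.distrib G_def sum_distrib_left[symmetric] QQ)
      also have "\<dots> \<le> real n * (4 * C\<^sup>2 * h\<^sup>2) + G \<omega> + c * \<bar>L\<bar> + real n * (4 * e\<^sup>2)"
      proof -
        have "QX s t (n * m) \<omega> \<le> \<bar>L\<bar>" using \<omega> by (auto simp: Bad_def E3_def QX_def)
        then show ?thesis using c0 by (intro add_mono mult_left_mono) auto
      qed
      also have "\<dots> = G \<omega> + D / real n + \<epsilon> / 2"
      proof -
        have ee: "real n * (4 * e\<^sup>2) = \<epsilon> / 2" using n by (simp add: e(2))
        have "real n * (4 * C\<^sup>2 * h\<^sup>2) + c * \<bar>L\<bar> = D / real n"
          using n by (simp add: c_def D_def h_def power2_eq_square field_simps)
        then show ?thesis unfolding ee by linarith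
      qed
      also have "\<dots> \<le> G \<omega> + \<epsilon>" using elim(1) by linarith
      finally show "\<not> QX s t n \<omega> > G \<omega> + \<epsilon>" by simp
    qed
    then have "prob {\<omega>\<in>space M. QX s t n \<omega> > G \<omega> + \<epsilon>} \<le> \<epsilon>"
      using pBad Bad by (intro prob_le_of_exceptional_set)
    moreover have "\<forall>\<omega>\<in>space M. 0 \<le> G \<omega>" unfolding G_def by (auto intro!: sum_nonneg)
    ultimately show ?case using iG EG by blast
  qed
qed

text \<open>Passage to the limit in \<open>increment_bound\<close>: \<open>fatou_in_prob\<close>
  removes the defect and the exceptional events, and what survives is the bound \<open>a\<close> for
  \<open>Z\<close> and the bound \<open>g\<close> for an integrable approximate majorant of the
  square variation. Both rounds of the bootstrap are instances.\<close>

lemma increment_L2_of_approx: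
  assumes st: "0 \<le> s" "s < t" "t \<le> 1"
    and Y: "Y \<in> borel_measurable M" "\<And>n \<omega>. 0 < n \<Longrightarrow> \<omega> \<in> space M \<Longrightarrow> Y \<omega> + Ito s t n \<omega> = X t \<omega> - X s \<omega> + Z n \<omega>"
    and Z: "\<And>n. 0 < n \<Longrightarrow> integrable M (\<lambda>\<omega>. (norm (Z n \<omega>))\<^sup>2)"
      "\<And>n. 0 < n \<Longrightarrow> (\<integral>\<omega>. (norm (Z n \<omega>))\<^sup>2 \<partial>M) \<le> a"
    and G: "\<And>\<epsilon>. 0 < \<epsilon> \<Longrightarrow> \<forall>\<^sub>F n in sequentially. \<exists>G. integrable M G \<and> (\<forall>\<omega>\<in>space M. 0 \<le> G \<omega>) \<and>
        (\<integral>\<omega>. G \<omega> \<partial>M) \<le> g \<and> prob {\<omega>\<in>space M. QX s t n \<omega> > G \<omega> + \<epsilon>} \<le> \<epsilon>"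
  shows "integrable M (\<lambda>\<omega>. (norm (Y \<omega>))\<^sup>2)"
    "(\<integral>\<omega>. (norm (Y \<omega>))\<^sup>2 \<partial>M) \<le> 4 * C\<^sup>2 * (t - s)\<^sup>2 + 4 * a + 4 * real k * C\<^sup>2 * real (k + 1) * (t - s) * g"
proof -
  define c where "c = 4 * real k * C\<^sup>2 * real (k + 1) * (t - s)"
  have c0: "0 \<le> c" using st by (auto simp: c_def)
  have *: "\<exists>H. integrable M H \<and> (\<forall>\<omega>\<in>space M. 0 \<le> H \<omega>) \<and> (\<integral>\<omega>. H \<omega> \<partial>M) \<le> 4 * C\<^sup>2 * (t - s)\<^sup>2 + 4 * a + c * g \<and>
        prob {\<omega>\<in>space M. (norm (Y \<omega>))\<^sup>2 > H \<omega> + \<epsilon>} \<le> \<epsilon>" if \<epsilon>: "0 < \<epsilon>" for \<epsilon>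
  proof -
    \<comment> \<open>Both budgets fit into \<open>\<epsilon>\<close>: three events of probability
      at most \<open>\<delta>\<close>, and the error \<open>c * \<delta> + 4 * \<delta>\<close>,
      where the defect is allowed the size \<open>sqrt \<delta>\<close>.\<close>
    define \<delta> where "\<delta> = \<epsilon> / (c + 4)"
    have "(c + 4) * \<delta> = \<epsilon>" "0 < \<delta>"
      using \<epsilon> c0 by (auto simp: \<delta>_def)
    moreover from this have "0 \<le> c * \<delta>" using c0 by simp
    ultimately have \<delta>: "0 < \<delta>" "c * \<delta> + 4 * \<delta> = \<epsilon>" "4 * \<delta> \<le> \<epsilon>"
      by (auto simp: algebra_simps)
    have "\<forall>\<^sub>F n in sequentially. 0 < n \<and> (\<exists>G. integrable M G \<and> (\<forall>\<omega>\<in>space M. 0 \<le> G \<omega>) \<and>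
        (\<integral>\<omega>. G \<omega> \<partial>M) \<le> g \<and> prob {\<omega>\<in>space M. QX s t n \<omega> > G \<omega> + \<delta>} \<le> \<delta>) \<and>
        prob {\<omega>\<in>space M. QB s t n \<omega> > real (k + 1) * (t - s)} \<le> \<delta> \<and>
        prob {\<omega>\<in>space M. norm (Err s t n \<omega>) > sqrt \<delta>} \<le> \<delta>"
      using \<delta> by (intro eventually_conj eventually_gt_at_top G QB_eventually Err_eventually st) auto
    then obtain n G where n: "0 < n" and G: "integrable M G" "\<forall>\<omega>\<in>space M. 0 \<le> G \<omega>" "(\<integral>\<omega>. G \<omega> \<partial>M) \<le> g"
      and pG: "prob {\<omega>\<in>space M. QX s t n \<omega> > G \<omega> + \<delta>} \<le> \<delta>"
      and pB: "prob {\<omega>\<in>space M. QB s t n \<omega> > real (k + 1) * (t - s)} \<le> \<delta>"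
      and pE: "prob {\<omega>\<in>space M. norm (Err s t n \<omega>) > sqrt \<delta>} \<le> \<delta>"
      by (auto simp: eventually_sequentially)
    note [measurable] = QX_measurable[OF st(1,2)] QB_measurable[OF st(1,2)] Err_measurable[OF st(1,2)]
      borel_measurable_integrable[OF G(1)]
    define H where "H \<omega> = 4 * C\<^sup>2 * (t - s)\<^sup>2 + 4 * (norm (Z n \<omega>))\<^sup>2 + c * G \<omega>" for \<omega>
    have "integrable M H" unfolding H_def using Z(1)[OF n] G by simp
    moreover have "\<forall>\<omega>\<in>space M. 0 \<le> H \<omega>" unfolding H_def using G c0 by auto
    moreover have "(\<integral>\<omega>. H \<omega> \<partial>M) \<le> 4 * C\<^sup>2 * (t - s)\<^sup>2 + 4 * a + c * g"
    proof -
      have "(\<integral>\<omega>. H \<omega> \<partial>M) = 4 * C\<^sup>2 * (t - s)\<^sup>2 + 4 * (\<integral>\<omega>. (norm (Z n \<omega>))\<^sup>2 \<partial>M) + c * (\<integral>\<omega>. G \<omega> \<partial>M)"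
        unfolding H_def using Z(1)[OF n] G by (simp add: prob_space)
      also have "\<dots> \<le> 4 * C\<^sup>2 * (t - s)\<^sup>2 + 4 * a + c * g"
        using Z(2)[OF n] G c0 by (intro add_mono mult_left_mono) auto
      finally show ?thesis .
    qed
    moreover have "prob {\<omega>\<in>space M. (norm (Y \<omega>))\<^sup>2 > H \<omega> + \<epsilon>} \<le> \<epsilon>"
    proof (rule prob_le_of_exceptional_set)
      define Bad where "Bad = ({\<omega>\<in>space M. QX s t n \<omega> > G \<omega> + \<delta>} \<union> {\<omega>\<in>space M. QB s t n \<omega> > real (k + 1) * (t - s)})
        \<union> {\<omega>\<in>space M. norm (Err s t n \<omega>) > sqrt \<delta>}"
      show "Bad \<in> sets M" unfolding Bad_def by measurable
      have "prob Bad \<le> (\<delta> + \<delta>) + \<delta>"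
        unfolding Bad_def by (intro prob_Un_le pG pB pE) measurable
      then show "prob Bad \<le> \<epsilon>" using \<delta> by linarith
      show "AE \<omega> in M. \<omega> \<notin> Bad \<longrightarrow> \<not> (norm (Y \<omega>))\<^sup>2 > H \<omega> + \<epsilon>"
        using A_lip[OF st(1) less_imp_le[OF st(2)]]
      proof (rule AE_mp, intro AE_I2 impI)
        fix \<omega> assume \<omega>: "\<omega> \<in> space M" "\<omega> \<notin> Bad" and Al: "norm (A t \<omega> - A s \<omega>) \<le> C * (t - s)"
        have "(norm (Y \<omega>))\<^sup>2 \<le> 4 * C\<^sup>2 * (t - s)\<^sup>2 + 4 * (norm (Z n \<omega>))\<^sup>2 + c * QX s t n \<omega> + 4 * (sqrt \<delta>)\<^sup>2"
          unfolding c_def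
          by (rule increment_bound[OF st(1,2) \<omega>(1) Al _ _ Y(2)[OF n \<omega>(1)]]) (use \<omega> in \<open>auto simp: Bad_def\<close>)
        also have "c * QX s t n \<omega> \<le> c * (G \<omega> + \<delta>)"
          using \<omega> c0 by (intro mult_left_mono) (auto simp: Bad_def)
        finally show "\<not> (norm (Y \<omega>))\<^sup>2 > H \<omega> + \<epsilon>"
          using \<delta> by (simp add: H_def algebra_simps)
      qed
    qed
    ultimately show ?thesis by blast
  qed
  have m: "(\<lambda>\<omega>. (norm (Y \<omega>))\<^sup>2) \<in> borel_measurable M" using Y(1) by measurable
  show "integrable M (\<lambda>\<omega>. (norm (Y \<omega>))\<^sup>2)"
    by (rule fatou_in_prob(1)[OF m _ *]) auto
  show "(\<integral>\<omega>. (norm (Y \<omega>))\<^sup>2 \<partial>M) \<le> 4 * C\<^sup>2 * (t - s)\<^sup>2 + 4 * a + 4 * real k * C\<^sup>2 * real (k + 1) * (t - s) * g"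
    unfolding c_def[symmetric] by (rule fatou_in_prob(2)[OF m _ *]) auto
qed

text \<open>The three terms of \<open>increment_L2_of_approx\<close> for
  \<open>a = (real k)\<^sup>2 * C\<^sup>2 * (t - s)\<close> and
  \<open>g = 4 * (real k)\<^sup>2 * C\<^sup>2 * (t - s)\<close>, with
  \<open>(t - s)\<^sup>2 \<le> t - s\<close> for times up to 1.\<close>

definition cX :: real where
  "cX = 4 * C\<^sup>2 + 4 * ((real k)\<^sup>2 * C\<^sup>2) + 4 * real k * C\<^sup>2 * real (k + 1) * (4 * (real k)\<^sup>2 * C\<^sup>2)"

lemma cX_nonneg: "0 \<le> cX" by (simp add: cX_def)

text \<open>First round: \<open>Z\<close> is the Ito sum, whose second moment is of order
  \<open>t - s\<close>, and the majorant of the square variation comes from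
  \<open>QX_approx\<close>.\<close>

lemma X_increment_L2:
  assumes st: "0 \<le> s" "s \<le> t" "t \<le> 1"
  shows "integrable M (\<lambda>\<omega>. (norm (X t \<omega> - X s \<omega>))\<^sup>2)"
    "(\<integral>\<omega>. (norm (X t \<omega> - X s \<omega>))\<^sup>2 \<partial>M) \<le> cX * (t - s)"
proof -
  have "integrable M (\<lambda>\<omega>. (norm (X t \<omega> - X s \<omega>))\<^sup>2) \<and> (\<integral>\<omega>. (norm (X t \<omega> - X s \<omega>))\<^sup>2 \<partial>M) \<le> cX * (t - s)"
  proof (cases "s = t")
    case False
    then have st': "0 \<le> s" "s < t" "t \<le> 1" using st by auto
    have [measurable]: "X s \<in> borel_measurable M" "X t \<in> borel_measurable M"
      using st by (auto intro!: X_meas')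
    note inc = increment_L2_of_approx[OF st', of "\<lambda>\<omega>. X t \<omega> - X s \<omega>" "Ito s t",
        OF _ _ Ito_L2[OF st'(1,2)] QX_approx[OF st']]
    have "(\<integral>\<omega>. (norm (X t \<omega> - X s \<omega>))\<^sup>2 \<partial>M) \<le> 4 * C\<^sup>2 * (t - s)\<^sup>2 + 4 * ((real k)\<^sup>2 * C\<^sup>2 * (t - s))
      + 4 * real k * C\<^sup>2 * real (k + 1) * (t - s) * (4 * (real k)\<^sup>2 * C\<^sup>2 * (t - s))"
      by (rule inc(2)) auto
    also have "\<dots> = 4 * C\<^sup>2 * (t - s)\<^sup>2 + 4 * ((real k)\<^sup>2 * C\<^sup>2) * (t - s)
      + 4 * real k * C\<^sup>2 * real (k + 1) * (4 * (real k)\<^sup>2 * C\<^sup>2) * (t - s)\<^sup>2"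
      by (simp add: power2_eq_square algebra_simps)
    also have "\<dots> \<le> 4 * C\<^sup>2 * (t - s) + 4 * ((real k)\<^sup>2 * C\<^sup>2) * (t - s)
      + 4 * real k * C\<^sup>2 * real (k + 1) * (4 * (real k)\<^sup>2 * C\<^sup>2) * (t - s)"
    proof -
      have "(t - s)\<^sup>2 \<le> t - s" using st' by (simp add: power2_eq_square mult_left_le)
      then show ?thesis by (intro add_mono mult_left_mono) auto
    qed
    also have "\<dots> = cX * (t - s)" by (simp add: cX_def algebra_simps)
    finally show ?thesis using inc(1) by auto
  qed auto
  then show "integrable M (\<lambda>\<omega>. (norm (X t \<omega> - X s \<omega>))\<^sup>2)"
    "(\<integral>\<omega>. (norm (X t \<omega> - X s \<omega>))\<^sup>2 \<partial>M) \<le> cX * (t - s)" by auto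
qed

text \<open>After the first round the square variation has a finite mean of order
  \<open>t - s\<close> and can serve as its own majorant in the second round.\<close>

lemma QX_L1:
  assumes st: "0 \<le> s" "s < t" "t \<le> 1" and n: "0 < n"
  shows "integrable M (QX s t n)" "(\<integral>\<omega>. QX s t n \<omega> \<partial>M) \<le> cX * (t - s)"
proof -
  let ?p = "uniform_pt s t n"
  have p: "0 \<le> ?p j" "?p j \<le> ?p (Suc j)" "?p (Suc j) \<le> 1" if "j < n" for j
    using uniform_pt_bounds[OF st(1,2) that] st(3) by auto
  note L2 = X_increment_L2[OF p]
  show "integrable M (QX s t n)"
    unfolding QX_def square_variation_def[abs_def] using L2(1) by auto
  have "(\<integral>\<omega>. QX s t n \<omega> \<partial>M) = (\<Sum>j<n. \<integral>\<omega>. (norm (X (?p (Suc j)) \<omega> - X (?p j) \<omega>))\<^sup>2 \<partial>M)"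
    unfolding QX_def square_variation_def fst_conv snd_conv using L2(1)
    by (intro Bochner_Integration.integral_sum) auto
  also have "\<dots> \<le> (\<Sum>j<n. cX * (?p (Suc j) - ?p j))"
    using L2(2) by (intro sum_mono) auto
  also have "\<dots> = cX * (t - s)"
    using sum_lessThan_telescope[of ?p n] n by (simp add: sum_distrib_left[symmetric])
  finally show "(\<integral>\<omega>. QX s t n \<omega> \<partial>M) \<le> cX * (t - s)" .
qed

section \<open>The remainder after the first-order Brownian term\<close>

definition W :: "real \<Rightarrow> real \<Rightarrow> 'w \<Rightarrow> 'a" where
  "W s t \<omega> = X t \<omega> - X s \<omega> - (\<Sum>i=1..k. inc i s t \<omega> *\<^sub>R f i (X s \<omega>))"

definition Ito_rem :: "real \<Rightarrow> real \<Rightarrow> nat \<Rightarrow> 'w \<Rightarrow> 'a" where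
  "Ito_rem s t n \<omega> = (\<Sum>i=1..k. \<Sum>j<n. inc i (uniform_pt s t n j) (uniform_pt s t n (Suc j)) \<omega> *\<^sub>R
     (f i (X (uniform_pt s t n j) \<omega>) - f i (X s \<omega>)))"

lemma Ito_rem_eq:
  assumes "0 < n"
  shows "Ito_rem s t n \<omega> = Ito s t n \<omega> - (\<Sum>i=1..k. inc i s t \<omega> *\<^sub>R f i (X s \<omega>))"
proof -
  have "(\<Sum>j<n. inc i (uniform_pt s t n j) (uniform_pt s t n (Suc j)) \<omega>) = inc i s t \<omega>" for i
    unfolding inc_def using sum_lessThan_telescope[of "\<lambda>j. B i (uniform_pt s t n j) \<omega>" n] assms by simp
  then show ?thesis
    by (simp add: Ito_rem_def Ito_def scaleR_diff_right sum_subtractf scaleR_left.sum[symmetric])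
qed

text \<open>The integrands are increments of Lipschitz functions of \<open>X\<close>, so by the
  first round their second moments are at most \<open>C\<^sup>2 * cX * (t - s)\<close>. This
  supplies the second factor \<open>t - s\<close>.\<close>

lemma Ito_rem_L2:
  assumes st: "0 \<le> s" "s < t" "t \<le> 1" and n: "0 < n"
  shows "Ito_rem s t n \<in> borel_measurable M"
    "integrable M (\<lambda>\<omega>. (norm (Ito_rem s t n \<omega>))\<^sup>2)"
    "(\<integral>\<omega>. (norm (Ito_rem s t n \<omega>))\<^sup>2 \<partial>M) \<le> (real k)\<^sup>2 * (C\<^sup>2 * cX) * (t - s)\<^sup>2"
    "(\<integral>\<omega>. Ito_rem s t n \<omega> \<partial>M) = 0"
proof -
  let ?p = "uniform_pt s t n"
  have p: "0 \<le> ?p j" "s \<le> ?p j" "?p j \<le> 1" "?p j \<le> t" if "j < n" for j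
    using uniform_pt_bounds[OF st(1,2) that] st(3) by auto
  have m: "(\<lambda>\<omega>. f i (X (?p j) \<omega>) - f i (X s \<omega>)) \<in> borel_measurable (\<F> (?p j))" if "i \<in> {1..k}" "j < n" for i j
    using p[OF that(2)] st that
    by (intro borel_measurable_diff continuous_of_X_measurable f_cont
        measurable_F_mono[of _ s "?p j", OF continuous_of_X_measurable[OF f_cont]]) auto
  have le: "(norm (f i (X (?p j) \<omega>) - f i (X s \<omega>)))\<^sup>2 \<le> C\<^sup>2 * (norm (X (?p j) \<omega> - X s \<omega>))\<^sup>2"
    if "i \<in> {1..k}" "j < n" "\<omega> \<in> space M" for i j \<omega>
    using f_lip[OF that(1) X_K X_K, OF p(1)[OF that(2)] that(3) st(1) that(3)]
    by (metis norm_ge_zero power_mono power_mult_distrib)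
  have int: "integrable M (\<lambda>\<omega>. (norm (f i (X (?p j) \<omega>) - f i (X s \<omega>)))\<^sup>2)" if "i \<in> {1..k}" "j < n" for i j
  proof (rule Bochner_Integration.integrable_bound)
    show "integrable M (\<lambda>\<omega>. C\<^sup>2 * (norm (X (?p j) \<omega> - X s \<omega>))\<^sup>2)"
      using X_increment_L2(1)[OF st(1) p(2,3)[OF that(2)]] by simp
    show "AE \<omega> in M. norm ((norm (f i (X (?p j) \<omega>) - f i (X s \<omega>)))\<^sup>2) \<le> norm (C\<^sup>2 * (norm (X (?p j) \<omega> - X s \<omega>))\<^sup>2)"
      using le[OF that] by (intro AE_I2) simp
    show "(\<lambda>\<omega>. (norm (f i (X (?p j) \<omega>) - f i (X s \<omega>)))\<^sup>2) \<in> borel_measurable M"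
      using measurable_F_M[OF m[OF that]] by measurable
  qed
  have E: "(\<integral>\<omega>. (norm (f i (X (?p j) \<omega>) - f i (X s \<omega>)))\<^sup>2 \<partial>M) \<le> C\<^sup>2 * cX * (t - s)" if "i \<in> {1..k}" "j < n" for i j
  proof -
    have "(\<integral>\<omega>. (norm (f i (X (?p j) \<omega>) - f i (X s \<omega>)))\<^sup>2 \<partial>M) \<le> (\<integral>\<omega>. C\<^sup>2 * (norm (X (?p j) \<omega> - X s \<omega>))\<^sup>2 \<partial>M)"
      using int[OF that] le[OF that] X_increment_L2(1)[OF st(1) p(2,3)[OF that(2)]] by (intro integral_mono) auto
    also have "\<dots> \<le> C\<^sup>2 * (cX * (?p j - s))"
      using X_increment_L2(2)[OF st(1) p(2,3)[OF that(2)]] by (simp add: mult_left_mono)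
    also have "\<dots> \<le> C\<^sup>2 * (cX * (t - s))"
      using p(4)[OF that(2)] cX_nonneg by (intro mult_left_mono) auto
    finally show ?thesis by simp
  qed
  note il = ito_sum_L2[OF st(1,2) n, of "\<lambda>i j \<omega>. f i (X (?p j) \<omega>) - f i (X s \<omega>)" "C\<^sup>2 * cX * (t - s)",
      OF m int E, folded Ito_rem_def]
  show "Ito_rem s t n \<in> borel_measurable M" "integrable M (\<lambda>\<omega>. (norm (Ito_rem s t n \<omega>))\<^sup>2)"
    "(\<integral>\<omega>. Ito_rem s t n \<omega> \<partial>M) = 0"
    using il(1,2,4) by (auto simp: Ito_rem_def[abs_def])
  show "(\<integral>\<omega>. (norm (Ito_rem s t n \<omega>))\<^sup>2 \<partial>M) \<le> (real k)\<^sup>2 * (C\<^sup>2 * cX) * (t - s)\<^sup>2"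
    using il(3) by (simp add: power2_eq_square mult.assoc)
qed

lemma W_measurable:
  assumes "0 \<le> s" "s < t" shows "W s t \<in> borel_measurable M"
  unfolding W_def[abs_def] using assms
  by (intro borel_measurable_diff borel_measurable_sum borel_measurable_scaleR X_meas' f_X_meas inc_measurable) auto

text \<open>Again the three terms of \<open>increment_L2_of_approx\<close>, now for
  \<open>a = (real k)\<^sup>2 * (C\<^sup>2 * cX) * (t - s)\<^sup>2\<close> and
  \<open>g = cX * (t - s)\<close>; all of them scale exactly like
  \<open>(t - s)\<^sup>2\<close>.\<close>

definition cW :: real where
  "cW = 4 * C\<^sup>2 + 4 * ((real k)\<^sup>2 * (C\<^sup>2 * cX)) + 4 * real k * C\<^sup>2 * real (k + 1) * cX"

lemma cW_nonneg: "0 \<le> cW" using cX_nonneg by (simp add: cW_def)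

text \<open>Second round: \<open>Ito_rem\<close> takes the place of the Ito sum, and the approximate
  majorant of the square variation is the square variation itself.\<close>

lemma W_L2:
  assumes st: "0 \<le> s" "s < t" "t \<le> 1"
  shows "integrable M (\<lambda>\<omega>. (norm (W s t \<omega>))\<^sup>2)" "(\<integral>\<omega>. (norm (W s t \<omega>))\<^sup>2 \<partial>M) \<le> cW * (t - s)\<^sup>2"
proof -
  have QX: "\<forall>\<^sub>F n in sequentially. \<exists>G. integrable M G \<and> (\<forall>\<omega>\<in>space M. 0 \<le> G \<omega>) \<and>
        (\<integral>\<omega>. G \<omega> \<partial>M) \<le> cX * (t - s) \<and> prob {\<omega>\<in>space M. QX s t n \<omega> > G \<omega> + \<epsilon>} \<le> \<epsilon>" if "0 < \<epsilon>" for \<epsilon>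
    using eventually_gt_at_top[of 0]
  proof eventually_elim
    case (elim n)
    have "{\<omega>\<in>space M. QX s t n \<omega> > QX s t n \<omega> + \<epsilon>} = {}" using that by auto
    then show ?case
      using QX_L1[OF st elim] QX_nonneg that by (intro exI[of _ "QX s t n"]) auto
  qed
  have Y: "W s t \<omega> + Ito s t n \<omega> = X t \<omega> - X s \<omega> + Ito_rem s t n \<omega>" if "0 < n" for n \<omega>
    by (simp add: W_def Ito_rem_eq[OF that])
  note inc = increment_L2_of_approx[OF st W_measurable[OF st(1,2)] Y Ito_rem_L2(2,3)[OF st] QX]
  show "integrable M (\<lambda>\<omega>. (norm (W s t \<omega>))\<^sup>2)" by (rule inc(1))
  have "(\<integral>\<omega>. (norm (W s t \<omega>))\<^sup>2 \<partial>M) \<le> 4 * C\<^sup>2 * (t - s)\<^sup>2 + 4 * ((real k)\<^sup>2 * (C\<^sup>2 * cX) * (t - s)\<^sup>2)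
    + 4 * real k * C\<^sup>2 * real (k + 1) * (t - s) * (cX * (t - s))"
    by (rule inc(2))
  also have "\<dots> = cW * (t - s)\<^sup>2"
    by (simp add: cW_def power2_eq_square algebra_simps)
  finally show "(\<integral>\<omega>. (norm (W s t \<omega>))\<^sup>2 \<partial>M) \<le> cW * (t - s)\<^sup>2" .
qed

end

section \<open>The mean of the first-order remainder\<close>

lemma (in prob_space) expectation_le_of_le:
  fixes Z U :: "'a \<Rightarrow> real"
  assumes "Z \<in> borel_measurable M" "integrable M U" "(\<integral>\<omega>. U \<omega> \<partial>M) \<le> c"
    and "AE \<omega> in M. 0 \<le> Z \<omega> \<and> Z \<omega> \<le> U \<omega>"
  shows "integrable M Z" "(\<integral>\<omega>. Z \<omega> \<partial>M) \<le> c"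
proof -
  have "AE \<omega> in M. norm (Z \<omega>) \<le> norm (U \<omega>)"
    using assms(4) by eventually_elim auto
  then show Z: "integrable M Z" by (rule Bochner_Integration.integrable_bound[OF assms(2,1)])
  have "AE \<omega> in M. Z \<omega> \<le> U \<omega>" using assms(4) by eventually_elim auto
  from integral_mono_AE[OF Z assms(2) this] assms(3) show "(\<integral>\<omega>. Z \<omega> \<partial>M) \<le> c" by linarith
qed

lemma le_of_le_half: "x \<le> u / 2 \<Longrightarrow> 0 \<le> u \<Longrightarrow> x \<le> (u::real)"
  by simp

context stratonovich_frame
begin

lemma abs_inc_mult_le: "\<bar>inc i a b \<omega>\<bar> * \<bar>inc l a b \<omega>\<bar> \<le> ((inc i a b \<omega>)\<^sup>2 + (inc l a b \<omega>)\<^sup>2) / 2"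
  using young_weighted[of 1 "\<bar>inc i a b \<omega>\<bar>" "\<bar>inc l a b \<omega>\<bar>"] by simp

section \<open>Moments of products over a single cell\<close>

context
  fixes a b :: real
  assumes ab: "0 \<le> a" "a < b" "b \<le> 1"
begin

lemma ab_measurable [measurable]:
  "X a \<in> borel_measurable M" "X b \<in> borel_measurable M" "W a b \<in> borel_measurable M"
  using ab by (auto intro!: X_meas' W_measurable)

lemma ab_inc_measurable [measurable]: "i \<in> {1..k} \<Longrightarrow> inc i a b \<in> borel_measurable M"
  using ab by (auto intro!: inc_measurable)

lemma inc_moments_ab:
  assumes "i \<in> {1..k}"
  shows "integrable M (\<lambda>\<omega>. (inc i a b \<omega>)\<^sup>2)" "(\<integral>\<omega>. (inc i a b \<omega>)\<^sup>2 \<partial>M) = b - a"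
    "integrable M (\<lambda>\<omega>. inc i a b \<omega> ^ 4)" "(\<integral>\<omega>. inc i a b \<omega> ^ 4 \<partial>M) = 3 * (b - a)\<^sup>2"
  using inc_moment_integrable[OF assms ab(1,2)] inc_moments[OF assms ab(1,2)] by auto

lemma E_dX_inc:
  assumes i: "i \<in> {1..k}"
  shows "integrable M (\<lambda>\<omega>. norm (X b \<omega> - X a \<omega>) * \<bar>inc i a b \<omega>\<bar>)"
    "(\<integral>\<omega>. norm (X b \<omega> - X a \<omega>) * \<bar>inc i a b \<omega>\<bar> \<partial>M) \<le> (cX + 1) * (b - a)"
proof -
  note L2 = X_increment_L2[OF ab(1) less_imp_le[OF ab(2)] ab(3)] and m = inc_moments_ab[OF i]
  let ?U = "\<lambda>\<omega>. (norm (X b \<omega> - X a \<omega>))\<^sup>2 + (inc i a b \<omega>)\<^sup>2"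
  have *: "(\<lambda>\<omega>. norm (X b \<omega> - X a \<omega>) * \<bar>inc i a b \<omega>\<bar>) \<in> borel_measurable M" using i by measurable
  have U: "integrable M ?U" using L2 m by auto
  have EU: "(\<integral>\<omega>. ?U \<omega> \<partial>M) \<le> (cX + 1) * (b - a)" using L2 m by (simp add: algebra_simps)
  have le: "AE \<omega> in M. 0 \<le> norm (X b \<omega> - X a \<omega>) * \<bar>inc i a b \<omega>\<bar> \<and> norm (X b \<omega> - X a \<omega>) * \<bar>inc i a b \<omega>\<bar> \<le> ?U \<omega>"
  proof (rule AE_I2, rule conjI)
    fix \<omega>
    have "norm (X b \<omega> - X a \<omega>) * \<bar>inc i a b \<omega>\<bar> \<le> ?U \<omega> / 2"
      using young_weighted[of 1 "norm (X b \<omega> - X a \<omega>)" "\<bar>inc i a b \<omega>\<bar>"] by simp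
    moreover have "0 \<le> ?U \<omega>" by simp
    ultimately show "norm (X b \<omega> - X a \<omega>) * \<bar>inc i a b \<omega>\<bar> \<le> ?U \<omega>" by (rule le_of_le_half)
  qed simp
  show "integrable M (\<lambda>\<omega>. norm (X b \<omega> - X a \<omega>) * \<bar>inc i a b \<omega>\<bar>)"
    "(\<integral>\<omega>. norm (X b \<omega> - X a \<omega>) * \<bar>inc i a b \<omega>\<bar> \<partial>M) \<le> (cX + 1) * (b - a)"
    using expectation_le_of_le[OF * U EU le] by auto
qed

lemma sqrt_ab: "0 < sqrt (b - a)" "sqrt (b - a) * sqrt (b - a) = b - a"
    "(b - a)\<^sup>2 / sqrt (b - a) = (b - a) * sqrt (b - a)"
proof -
  show "0 < sqrt (b - a)" "sqrt (b - a) * sqrt (b - a) = b - a" using ab by auto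
  then show "(b - a)\<^sup>2 / sqrt (b - a) = (b - a) * sqrt (b - a)"
    by (simp add: power2_eq_square nonzero_divide_eq_eq mult.assoc)
qed

text \<open>The factors have root mean square sizes of order \<open>b - a\<close> and
  \<open>sqrt (b - a)\<close>. The Young weight \<open>1 / sqrt (b - a)\<close> balances them, so
  that both resulting terms have order \<open>(b - a) * sqrt (b - a)\<close>.\<close>

lemma E_W_inc:
  assumes i: "i \<in> {1..k}"
  shows "integrable M (\<lambda>\<omega>. norm (W a b \<omega>) * \<bar>inc i a b \<omega>\<bar>)"
    "(\<integral>\<omega>. norm (W a b \<omega>) * \<bar>inc i a b \<omega>\<bar> \<partial>M) \<le> (cW + 1) * (b - a) * sqrt (b - a)"
proof -
  note L2 = W_L2[OF ab] and m = inc_moments_ab[OF i]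
  let ?h = "sqrt (b - a)"
  let ?U = "\<lambda>\<omega>. (norm (W a b \<omega>))\<^sup>2 / ?h + ?h * (inc i a b \<omega>)\<^sup>2"
  have *: "(\<lambda>\<omega>. norm (W a b \<omega>) * \<bar>inc i a b \<omega>\<bar>) \<in> borel_measurable M" using i by measurable
  have U: "integrable M ?U" using L2 m by auto
  have "(\<integral>\<omega>. ?U \<omega> \<partial>M) = (\<integral>\<omega>. (norm (W a b \<omega>))\<^sup>2 \<partial>M) / ?h + ?h * (b - a)"
    using L2 m by simp
  also have "\<dots> \<le> cW * (b - a)\<^sup>2 / ?h + ?h * (b - a)"
    using L2(2) sqrt_ab(1) by (intro add_right_mono divide_right_mono) auto
  also have "cW * (b - a)\<^sup>2 / ?h = cW * ((b - a) * ?h)"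
    using sqrt_ab(3) by (metis times_divide_eq_right)
  finally have EU: "(\<integral>\<omega>. ?U \<omega> \<partial>M) \<le> (cW + 1) * (b - a) * ?h" by (simp add: algebra_simps)
  have le: "AE \<omega> in M. 0 \<le> norm (W a b \<omega>) * \<bar>inc i a b \<omega>\<bar> \<and> norm (W a b \<omega>) * \<bar>inc i a b \<omega>\<bar> \<le> ?U \<omega>"
  proof (rule AE_I2, rule conjI)
    fix \<omega>
    have "norm (W a b \<omega>) * \<bar>inc i a b \<omega>\<bar> \<le> ?U \<omega> / 2"
      using young_weighted[of "1 / ?h" "norm (W a b \<omega>)" "\<bar>inc i a b \<omega>\<bar>"] sqrt_ab(1) by (simp add: mult.commute)
    moreover have "0 \<le> ?U \<omega>" using sqrt_ab(1) by (intro add_nonneg_nonneg) auto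
    ultimately show "norm (W a b \<omega>) * \<bar>inc i a b \<omega>\<bar> \<le> ?U \<omega>" by (rule le_of_le_half)
  qed simp
  show "integrable M (\<lambda>\<omega>. norm (W a b \<omega>) * \<bar>inc i a b \<omega>\<bar>)"
    "(\<integral>\<omega>. norm (W a b \<omega>) * \<bar>inc i a b \<omega>\<bar> \<partial>M) \<le> (cW + 1) * (b - a) * sqrt (b - a)"
    using expectation_le_of_le[OF * U EU le] by auto
qed

text \<open>Three factors of size \<open>sqrt (b - a)\<close>. The product of the two Brownian
  increments is first replaced by the mean of their squares, so that Young's inequality leads to
  Gaussian fourth moments, each equal to \<open>3 * (b - a)\<^sup>2\<close>.\<close>

lemma E_inc_inc_dX:
  assumes i: "i \<in> {1..k}" and l: "l \<in> {1..k}"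
  shows "integrable M (\<lambda>\<omega>. \<bar>inc l a b \<omega>\<bar> * \<bar>inc i a b \<omega>\<bar> * norm (X b \<omega> - X a \<omega>))"
    "(\<integral>\<omega>. \<bar>inc l a b \<omega>\<bar> * \<bar>inc i a b \<omega>\<bar> * norm (X b \<omega> - X a \<omega>) \<partial>M) \<le> (3 + cX) * (b - a) * sqrt (b - a)"
proof -
  note L2 = X_increment_L2[OF ab(1) less_imp_le[OF ab(2)] ab(3)]
    and m = inc_moments_ab[OF i] and m' = inc_moments_ab[OF l]
  let ?h = "sqrt (b - a)"
  let ?U = "\<lambda>\<omega>. (inc i a b \<omega> ^ 4 + inc l a b \<omega> ^ 4) / (2 * ?h) + ?h * (norm (X b \<omega> - X a \<omega>))\<^sup>2"
  let ?Z = "\<lambda>\<omega>. \<bar>inc l a b \<omega>\<bar> * \<bar>inc i a b \<omega>\<bar> * norm (X b \<omega> - X a \<omega>)"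
  have *: "?Z \<in> borel_measurable M" using i l by measurable
  have U: "integrable M ?U" using L2 m m' by auto
  have "(\<integral>\<omega>. ?U \<omega> \<partial>M) = 3 * (b - a)\<^sup>2 / ?h + ?h * (\<integral>\<omega>. (norm (X b \<omega> - X a \<omega>))\<^sup>2 \<partial>M)"
    using L2 m m' by (simp add: field_simps)
  also have "\<dots> \<le> 3 * (b - a)\<^sup>2 / ?h + ?h * (cX * (b - a))"
    using L2(2) sqrt_ab(1) by (intro add_left_mono mult_left_mono) auto
  also have "3 * (b - a)\<^sup>2 / ?h = 3 * ((b - a) * ?h)"
    using sqrt_ab(3) by (metis times_divide_eq_right)
  finally have EU: "(\<integral>\<omega>. ?U \<omega> \<partial>M) \<le> (3 + cX) * (b - a) * ?h" by (simp add: algebra_simps)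
  have le: "AE \<omega> in M. 0 \<le> ?Z \<omega> \<and> ?Z \<omega> \<le> ?U \<omega>"
  proof (rule AE_I2, rule conjI)
    fix \<omega>
    let ?d = "norm (X b \<omega> - X a \<omega>)"
    have y: "(inc i a b \<omega>)\<^sup>2 * ?d \<le> (inc i a b \<omega> ^ 4 / ?h + ?h * ?d\<^sup>2) / 2" for i
      using young_weighted[of "1 / ?h" "(inc i a b \<omega>)\<^sup>2" ?d] sqrt_ab(1)
      by (simp add: mult.commute power_mult[symmetric])
    have "?Z \<omega> \<le> ((inc l a b \<omega>)\<^sup>2 + (inc i a b \<omega>)\<^sup>2) / 2 * ?d"
      by (intro mult_right_mono abs_inc_mult_le) simp
    also have "\<dots> \<le> (inc i a b \<omega> ^ 4 / ?h + inc l a b \<omega> ^ 4 / ?h) / 4 + ?h * ?d\<^sup>2 / 2"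
    proof -
      have avg: "(v + u) / 2 \<le> (p + q) / 4 + z / 2" if "u \<le> (p + z) / 2" "v \<le> (q + z) / 2" for u v p q z :: real
        using that by (simp add: field_simps)
      have "((inc l a b \<omega>)\<^sup>2 + (inc i a b \<omega>)\<^sup>2) / 2 * ?d = ((inc l a b \<omega>)\<^sup>2 * ?d + (inc i a b \<omega>)\<^sup>2 * ?d) / 2"
        by (simp add: algebra_simps)
      then show ?thesis using avg[OF y[of i] y[of l]] by simp
    qed
    also have "\<dots> \<le> (inc i a b \<omega> ^ 4 / ?h + inc l a b \<omega> ^ 4 / ?h) / 2 + ?h * ?d\<^sup>2"
    proof -
      have "0 \<le> inc i a b \<omega> ^ 4 / ?h" "0 \<le> inc l a b \<omega> ^ 4 / ?h" "0 \<le> ?h * ?d\<^sup>2"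
        using sqrt_ab(1) by auto
      moreover have "(p + q) / 4 + z / 2 \<le> (p + q) / 2 + z" if "0 \<le> p" "0 \<le> q" "0 \<le> z" for p q z :: real
        using that by (simp add: field_simps)
      ultimately show ?thesis by blast
    qed
    also have "\<dots> = ?U \<omega>" using sqrt_ab(1) by (simp add: field_simps)
    finally show "?Z \<omega> \<le> ?U \<omega>" .
  qed simp
  show "integrable M ?Z" "(\<integral>\<omega>. ?Z \<omega> \<partial>M) \<le> (3 + cX) * (b - a) * ?h"
    using expectation_le_of_le[OF * U EU le] by auto
qed

text \<open>As \<open>Y\<close> belongs to the past, the squared increments factor out with mean
  \<open>b - a\<close>, and a small mean of \<open>Y\<close> survives as a small factor.\<close>

lemma E_inc_inc_past:
  assumes i: "i \<in> {1..k}" and l: "l \<in> {1..k}"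
    and Y: "Y \<in> borel_measurable (\<F> a)" "integrable M Y" "\<And>\<omega>. 0 \<le> Y \<omega>" "(\<integral>\<omega>. Y \<omega> \<partial>M) \<le> c"
  shows "integrable M (\<lambda>\<omega>. \<bar>inc l a b \<omega>\<bar> * \<bar>inc i a b \<omega>\<bar> * Y \<omega>)"
    "(\<integral>\<omega>. \<bar>inc l a b \<omega>\<bar> * \<bar>inc i a b \<omega>\<bar> * Y \<omega> \<partial>M) \<le> (b - a) * c"
proof -
  let ?U = "\<lambda>\<omega>. (Y \<omega> * (inc i a b \<omega>)\<^sup>2 + Y \<omega> * (inc l a b \<omega>)\<^sup>2) / 2"
  have [measurable]: "Y \<in> borel_measurable M" using Y by auto
  have *: "(\<lambda>\<omega>. \<bar>inc l a b \<omega>\<bar> * \<bar>inc i a b \<omega>\<bar> * Y \<omega>) \<in> borel_measurable M" using i l by measurable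
  have P: "integrable M (\<lambda>\<omega>. Y \<omega> * (inc i a b \<omega>)\<^sup>2)"
    "(\<integral>\<omega>. Y \<omega> * (inc i a b \<omega>)\<^sup>2 \<partial>M) = (b - a) * (\<integral>\<omega>. Y \<omega> \<partial>M)" if "i \<in> {1..k}" for i
    using innovation_inc[OF that ab(1,2)] Y unfolding innovation_def by auto
  have U: "integrable M ?U" using P i l by auto
  have "(\<integral>\<omega>. ?U \<omega> \<partial>M) = (b - a) * (\<integral>\<omega>. Y \<omega> \<partial>M)"
    using P[OF i] P[OF l] by simp
  also have "\<dots> \<le> (b - a) * c" using Y ab by (intro mult_left_mono) auto
  finally have EU: "(\<integral>\<omega>. ?U \<omega> \<partial>M) \<le> (b - a) * c" .
  have le: "AE \<omega> in M. 0 \<le> \<bar>inc l a b \<omega>\<bar> * \<bar>inc i a b \<omega>\<bar> * Y \<omega> \<and> \<bar>inc l a b \<omega>\<bar> * \<bar>inc i a b \<omega>\<bar> * Y \<omega> \<le> ?U \<omega>"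
  proof (rule AE_I2, rule conjI)
    fix \<omega>
    show "0 \<le> \<bar>inc l a b \<omega>\<bar> * \<bar>inc i a b \<omega>\<bar> * Y \<omega>" using Y(3) by simp
    have "\<bar>inc l a b \<omega>\<bar> * \<bar>inc i a b \<omega>\<bar> * Y \<omega> \<le> ((inc l a b \<omega>)\<^sup>2 + (inc i a b \<omega>)\<^sup>2) / 2 * Y \<omega>"
      using Y(3) by (intro mult_right_mono abs_inc_mult_le)
    then show "\<bar>inc l a b \<omega>\<bar> * \<bar>inc i a b \<omega>\<bar> * Y \<omega> \<le> ?U \<omega>" by (simp add: algebra_simps)
  qed
  show "integrable M (\<lambda>\<omega>. \<bar>inc l a b \<omega>\<bar> * \<bar>inc i a b \<omega>\<bar> * Y \<omega>)"
    "(\<integral>\<omega>. \<bar>inc l a b \<omega>\<bar> * \<bar>inc i a b \<omega>\<bar> * Y \<omega> \<partial>M) \<le> (b - a) * c"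
    using expectation_le_of_le[OF * U EU le] by auto
qed

end

text \<open>The sources of error on one cell, in this order: the Taylor error of short increments,
  the part due to \<open>W\<close>, the Brownian part of increments longer than \<open>r\<close>,
  and the variation of the coefficients \<open>Df i x (f l x)\<close> away from \<open>x0\<close>.
  The second and third have means of order \<open>(b - a) * sqrt (b - a)\<close>; the other two have
  order \<open>b - a\<close> with a factor that can be made small.\<close>

definition frozen_bound :: "real \<Rightarrow> real \<Rightarrow> 'a \<Rightarrow> nat \<Rightarrow> real \<Rightarrow> real \<Rightarrow> 'w \<Rightarrow> real" where
  "frozen_bound \<epsilon> r x0 i a b \<omega> = \<epsilon> * (norm (X b \<omega> - X a \<omega>) * \<bar>inc i a b \<omega>\<bar>) + 3 * C * (norm (W a b \<omega>) * \<bar>inc i a b \<omega>\<bar>)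
    + 2 * C\<^sup>2 / r * (\<Sum>l=1..k. \<bar>inc l a b \<omega>\<bar> * \<bar>inc i a b \<omega>\<bar> * norm (X b \<omega> - X a \<omega>))
    + (\<Sum>l=1..k. \<bar>inc l a b \<omega>\<bar> * \<bar>inc i a b \<omega>\<bar> * norm (Df i (X a \<omega>) (f l (X a \<omega>)) - Df i x0 (f l x0)))"

text \<open>Write \<open>y - x\<close> as \<open>W a b\<close> plus the Brownian part with fields at
  \<open>x\<close>, and apply \<open>Df i x\<close>. For \<open>norm (y - x) < r\<close> the Taylor
  bound is available. Otherwise the crude bound \<open>2 * C * norm (y - x)\<close> is used, and its
  Brownian part is multiplied by \<open>norm (y - x) / r \<ge> 1\<close>, which gains half an order;
  this is where the term with \<open>2 * C\<^sup>2 / r\<close> comes from.\<close>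

lemma frozen_increment_le:
  assumes ab: "0 \<le> a" "a \<le> b" and \<omega>: "\<omega> \<in> space M" and i: "i \<in> {1..k}"
    and r: "0 < r" "\<And>x y. x \<in> K \<Longrightarrow> y \<in> K \<Longrightarrow> norm (y - x) < r \<Longrightarrow>
        norm (f i y - f i x - Df i x (y - x)) \<le> \<epsilon> * norm (y - x)"
    and \<epsilon>: "0 \<le> \<epsilon>"
  shows "norm (inc i a b \<omega> *\<^sub>R (f i (X b \<omega>) - f i (X a \<omega>) - (\<Sum>l=1..k. inc l a b \<omega> *\<^sub>R Df i x0 (f l x0))))
    \<le> frozen_bound \<epsilon> r x0 i a b \<omega>"
proof -
  define x y where "x = X a \<omega>" and "y = X b \<omega>"
  have xy: "x \<in> K" "y \<in> K" using X_K ab \<omega> by (auto simp: x_def y_def)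
  interpret D: linear "Df i x" by (rule Df_lin[OF i xy(1)])
  let ?d = "norm (y - x)" and ?w = "norm (W a b \<omega>)" and ?b = "\<lambda>l. inc l a b \<omega>"
  have yx: "y - x = W a b \<omega> + (\<Sum>l=1..k. ?b l *\<^sub>R f l x)"
    by (simp add: W_def x_def y_def)
  have Dyx: "Df i x (y - x) = Df i x (W a b \<omega>) + (\<Sum>l=1..k. ?b l *\<^sub>R Df i x (f l x))"
    unfolding yx by (simp add: D.add D.sum D.scaleR)
  have split: "f i y - f i x - (\<Sum>l=1..k. ?b l *\<^sub>R Df i x0 (f l x0)) =
    (f i y - f i x - Df i x (y - x)) + Df i x (W a b \<omega>) + (\<Sum>l=1..k. ?b l *\<^sub>R (Df i x (f l x) - Df i x0 (f l x0)))"
    unfolding Dyx by (simp add: scaleR_diff_right sum_subtractf)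
  have d_le: "?d \<le> ?w + C * (\<Sum>l=1..k. \<bar>?b l\<bar>)"
  proof -
    have "?d \<le> ?w + norm (\<Sum>l=1..k. ?b l *\<^sub>R f l x)"
      unfolding yx by (rule norm_triangle_ineq)
    also have "norm (\<Sum>l=1..k. ?b l *\<^sub>R f l x) \<le> (\<Sum>l=1..k. C * \<bar>?b l\<bar>)"
    proof (rule order_trans[OF norm_sum sum_mono])
      fix l assume l: "l \<in> {1..k}"
      show "norm (?b l *\<^sub>R f l x) \<le> C * \<bar>?b l\<bar>"
        using mult_left_mono[OF f_bound[OF l xy(1)], of "\<bar>?b l\<bar>"] by (simp add: mult.commute)
    qed
    finally show ?thesis by (simp add: sum_distrib_left)
  qed
  let ?s = "2 * C\<^sup>2 / r * (\<Sum>l=1..k. \<bar>?b l\<bar> * ?d)"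
  have C0: "0 \<le> C" using C by simp
  have s0: "0 \<le> ?s" using r(1) by (intro mult_nonneg_nonneg sum_nonneg) auto
  have T: "norm (f i y - f i x - Df i x (y - x)) \<le> \<epsilon> * ?d + 2 * C * ?w + ?s"
  proof (cases "?d < r")
    case True
    then have "norm (f i y - f i x - Df i x (y - x)) \<le> \<epsilon> * ?d" using r(2) xy by blast
    moreover have "0 \<le> 2 * C * ?w" using C0 by simp
    ultimately show ?thesis using s0 by linarith
  next
    case False
    have "norm (f i y - f i x - Df i x (y - x)) \<le> C * ?d + C * ?d"
      using f_lip[OF i xy(2,1)] Df_bound[OF i xy(1), of "y - x"] norm_triangle_ineq4[of "f i y - f i x" "Df i x (y - x)"]
      by linarith
    also have "\<dots> \<le> 2 * C * (?w + C * (\<Sum>l=1..k. \<bar>?b l\<bar>))"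
      using mult_left_mono[OF d_le C0] by simp
    also have "\<dots> \<le> 2 * C * ?w + ?s"
    proof -
      define \<sigma> where "\<sigma> = (\<Sum>l=1..k. \<bar>?b l\<bar>)"
      have \<sigma>: "(\<Sum>l=1..k. \<bar>?b l\<bar> * ?d) = \<sigma> * ?d" by (simp add: \<sigma>_def sum_distrib_right)
      have "\<sigma> * 1 \<le> \<sigma> * (?d / r)"
        using False r(1) unfolding \<sigma>_def by (intro mult_left_mono sum_nonneg) auto
      then have "2 * C\<^sup>2 * \<sigma> \<le> 2 * C\<^sup>2 * (\<sigma> * (?d / r))"
        by (intro mult_left_mono) auto
      then show ?thesis
        unfolding \<sigma> \<sigma>_def[symmetric] by (simp add: power2_eq_square algebra_simps)
    qed
    finally show ?thesis using mult_nonneg_nonneg[OF \<epsilon> norm_ge_zero[of "y - x"]] by linarith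
  qed
  have "norm (\<Sum>l=1..k. ?b l *\<^sub>R (Df i x (f l x) - Df i x0 (f l x0)))
    \<le> (\<Sum>l=1..k. \<bar>?b l\<bar> * norm (Df i x (f l x) - Df i x0 (f l x0)))"
    by (rule order_trans[OF norm_sum]) simp
  then have "norm (f i y - f i x - (\<Sum>l=1..k. ?b l *\<^sub>R Df i x0 (f l x0)))
    \<le> (\<epsilon> * ?d + 2 * C * ?w + ?s) + C * ?w + (\<Sum>l=1..k. \<bar>?b l\<bar> * norm (Df i x (f l x) - Df i x0 (f l x0)))"
    unfolding split using T Df_bound[OF i xy(1), of "W a b \<omega>"]
    by (intro norm_triangle_le[OF add_mono[OF norm_triangle_le[OF add_mono]]])
  then have "\<bar>?b i\<bar> * norm (f i y - f i x - (\<Sum>l=1..k. ?b l *\<^sub>R Df i x0 (f l x0)))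
    \<le> \<bar>?b i\<bar> * ((\<epsilon> * ?d + 2 * C * ?w + ?s) + C * ?w + (\<Sum>l=1..k. \<bar>?b l\<bar> * norm (Df i x (f l x) - Df i x0 (f l x0))))"
    by (rule mult_left_mono) simp
  also have "\<dots> = frozen_bound \<epsilon> r x0 i a b \<omega>"
    unfolding frozen_bound_def x_def[symmetric] y_def[symmetric]
    by (simp add: distrib_left sum_distrib_left mult_ac)
  finally show ?thesis by (simp add: x_def y_def)
qed

text \<open>The term linear in \<open>b - a\<close> carries only the small factors
  \<open>\<epsilon>\<close> and \<open>\<beta>\<close>. The other one has an additional
  \<open>sqrt (b - a)\<close> and vanishes with the mesh even after summation over the cells,
  however large its constant.\<close>

lemma E_frozen_bound:
  assumes ab: "0 \<le> a" "a < b" "b \<le> 1" and i: "i \<in> {1..k}" and x0: "x0 \<in> K" and r: "0 < r" and \<epsilon>: "0 \<le> \<epsilon>"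
    and \<beta>: "\<And>l. l \<in> {1..k} \<Longrightarrow>
      (\<integral>\<omega>. norm (Df i (X a \<omega>) (f l (X a \<omega>)) - Df i x0 (f l x0)) \<partial>M) \<le> \<beta>"
  shows "integrable M (frozen_bound \<epsilon> r x0 i a b)"
    "(\<integral>\<omega>. frozen_bound \<epsilon> r x0 i a b \<omega> \<partial>M) \<le> (\<epsilon> * (cX + 1) + real k * \<beta>) * (b - a)
       + (3 * C * (cW + 1) + 2 * C\<^sup>2 / r * (real k * (3 + cX))) * ((b - a) * sqrt (b - a))"
proof -
  have Dm: "(\<lambda>\<omega>. norm (Df i (X a \<omega>) (f l (X a \<omega>)) - Df i x0 (f l x0))) \<in> borel_measurable (\<F> a)" if "l \<in> {1..k}" for l
  proof -
    have [measurable]: "(\<lambda>\<omega>. Df i (X a \<omega>) (f l (X a \<omega>))) \<in> borel_measurable (\<F> a)"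
      using continuous_of_X_measurable[OF Df_cont[OF i that] ab(1)] .
    show ?thesis by measurable
  qed
  have Di: "integrable M (\<lambda>\<omega>. norm (Df i (X a \<omega>) (f l (X a \<omega>)) - Df i x0 (f l x0)))" if l: "l \<in> {1..k}" for l
  proof (rule integrable_const_bound[where B = "2 * (C * C)"])
    have "norm (Df i x (f l x)) \<le> C * C" if "x \<in> K" for x
      using Df_bound[OF i that, of "f l x"] mult_left_mono[OF f_bound[OF l that], of C] C by linarith
    from this[OF X_K[OF ab(1)]] this[OF x0]
    have "norm (Df i (X a \<omega>) (f l (X a \<omega>)) - Df i x0 (f l x0)) \<le> 2 * (C * C)" if "\<omega> \<in> space M" for \<omega>
      using norm_triangle_ineq4[of "Df i (X a \<omega>) (f l (X a \<omega>))" "Df i x0 (f l x0)"] that by fastforce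
    then show "AE \<omega> in M. norm (norm (Df i (X a \<omega>) (f l (X a \<omega>)) - Df i x0 (f l x0))) \<le> 2 * (C * C)"
      by (intro AE_I2) simp
  qed (use measurable_F_M[OF Dm[OF l]] in simp)
  note e1 = E_dX_inc[OF ab i] and e2 = E_W_inc[OF ab i] and e3 = E_inc_inc_dX[OF ab i]
    and e4 = E_inc_inc_past[OF ab i _ Dm Di _ \<beta>]
  show "integrable M (frozen_bound \<epsilon> r x0 i a b)"
    unfolding frozen_bound_def[abs_def] using e1(1) e2(1) e3(1) e4(1)
    by (intro Bochner_Integration.integrable_add integrable_mult_right Bochner_Integration.integrable_sum) auto
  have "(\<integral>\<omega>. frozen_bound \<epsilon> r x0 i a b \<omega> \<partial>M) =
      \<epsilon> * (\<integral>\<omega>. norm (X b \<omega> - X a \<omega>) * \<bar>inc i a b \<omega>\<bar> \<partial>M) + 3 * C * (\<integral>\<omega>. norm (W a b \<omega>) * \<bar>inc i a b \<omega>\<bar> \<partial>M)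
    + 2 * C\<^sup>2 / r * (\<Sum>l=1..k. \<integral>\<omega>. \<bar>inc l a b \<omega>\<bar> * \<bar>inc i a b \<omega>\<bar> * norm (X b \<omega> - X a \<omega>) \<partial>M)
    + (\<Sum>l=1..k. \<integral>\<omega>. \<bar>inc l a b \<omega>\<bar> * \<bar>inc i a b \<omega>\<bar> * norm (Df i (X a \<omega>) (f l (X a \<omega>)) - Df i x0 (f l x0)) \<partial>M)"
  proof -
    define S3 where "S3 \<omega> = (\<Sum>l=1..k. \<bar>inc l a b \<omega>\<bar> * \<bar>inc i a b \<omega>\<bar> * norm (X b \<omega> - X a \<omega>))" for \<omega>
    define S4 where "S4 \<omega> = (\<Sum>l=1..k. \<bar>inc l a b \<omega>\<bar> * \<bar>inc i a b \<omega>\<bar> * norm (Df i (X a \<omega>) (f l (X a \<omega>)) - Df i x0 (f l x0)))" for \<omega>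
    have S3: "integrable M S3" "(\<integral>\<omega>. S3 \<omega> \<partial>M) = (\<Sum>l=1..k. \<integral>\<omega>. \<bar>inc l a b \<omega>\<bar> * \<bar>inc i a b \<omega>\<bar> * norm (X b \<omega> - X a \<omega>) \<partial>M)"
      unfolding S3_def using e3(1) by (auto intro!: Bochner_Integration.integral_sum Bochner_Integration.integrable_sum)
    have S4: "integrable M S4" "(\<integral>\<omega>. S4 \<omega> \<partial>M) = (\<Sum>l=1..k. \<integral>\<omega>. \<bar>inc l a b \<omega>\<bar> * \<bar>inc i a b \<omega>\<bar> * norm (Df i (X a \<omega>) (f l (X a \<omega>)) - Df i x0 (f l x0)) \<partial>M)"
      unfolding S4_def using e4(1) by (auto intro!: Bochner_Integration.integral_sum Bochner_Integration.integrable_sum)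
    show ?thesis
      unfolding frozen_bound_def S3(2)[symmetric] S4(2)[symmetric] S3_def[symmetric] S4_def[symmetric]
      using e1(1) e2(1) S3(1) S4(1) by simp
  qed
  also have "\<dots> \<le> \<epsilon> * ((cX + 1) * (b - a)) + 3 * C * ((cW + 1) * (b - a) * sqrt (b - a))
    + 2 * C\<^sup>2 / r * (\<Sum>l=1..k. (3 + cX) * (b - a) * sqrt (b - a)) + (\<Sum>l=1..k. (b - a) * \<beta>)"
    using \<epsilon> C r e1(2) e2(2) e3(2) e4(2)
    by (intro add_mono mult_left_mono sum_mono) auto
  also have "\<dots> = (\<epsilon> * (cX + 1) + real k * \<beta>) * (b - a)
       + (3 * C * (cW + 1) + 2 * C\<^sup>2 / r * (real k * (3 + cX))) * ((b - a) * sqrt (b - a))"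
  proof -
    define h where "h = b - a"
    show ?thesis unfolding h_def[symmetric] by (simp add: algebra_simps)
  qed
  finally show "(\<integral>\<omega>. frozen_bound \<epsilon> r x0 i a b \<omega> \<partial>M) \<le> (\<epsilon> * (cX + 1) + real k * \<beta>) * (b - a)
       + (3 * C * (cW + 1) + 2 * C\<^sup>2 / r * (real k * (3 + cX))) * ((b - a) * sqrt (b - a))" .
qed

text \<open>Continuity of \<open>g\<close> settles the values near \<open>x0\<close>. Elsewhere
  \<open>g\<close> is bounded, and there the squared increment of \<open>X\<close> divided by
  \<open>r\<^sup>2\<close> is at least 1, while its mean is at most
  \<open>cX * t / r\<^sup>2\<close>.\<close>

lemma mean_continuous_of_X:
  fixes g :: "'a \<Rightarrow> 'b::euclidean_space"
  assumes g: "continuous_on K g" and x0: "x0 \<in> K" "AE \<omega> in M. X 0 \<omega> = x0" and \<epsilon>: "0 < \<epsilon>"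
  shows "\<exists>t0>0. \<forall>t\<in>{0..<t0}. (\<integral>\<omega>. norm (g (X t \<omega>) - g x0) \<partial>M) \<le> \<epsilon>"
proof -
  obtain b where b: "\<And>x. x \<in> K \<Longrightarrow> norm (g x) \<le> b"
    using compact_imp_bounded[OF compact_continuous_image[OF g K]] by (auto simp: bounded_iff)
  have b0: "0 \<le> b" using b[OF x0(1)] norm_ge_zero order_trans by blast
  obtain r where r: "0 < r" "\<And>x. x \<in> K \<Longrightarrow> norm (x - x0) < r \<Longrightarrow> norm (g x - g x0) < \<epsilon> / 2"
    using g x0(1) \<epsilon> unfolding continuous_on_iff dist_norm by (meson half_gt_zero)
  define c where "c = 2 * b / r\<^sup>2 * cX"
  have c0: "0 \<le> c" using b0 cX_nonneg by (auto simp: c_def)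
  define t0 where "t0 = min 1 (\<epsilon> / (2 * (c + 1)))"
  have t0: "0 < t0" using \<epsilon> c0 by (auto simp: t0_def)
  have "(\<integral>\<omega>. norm (g (X t \<omega>) - g x0) \<partial>M) \<le> \<epsilon>" if t: "t \<in> {0..<t0}" for t
  proof (rule expectation_le_of_le)
    have t': "0 \<le> t" "t \<le> 1" "t \<le> \<epsilon> / (2 * (c + 1))" using t by (auto simp: t0_def)
    note L2 = X_increment_L2[OF order_refl t'(1,2)]
    show "(\<lambda>\<omega>. norm (g (X t \<omega>) - g x0)) \<in> borel_measurable M"
      using continuous_of_X_measurable'[OF g t'(1)] by measurable
    show "integrable M (\<lambda>\<omega>. \<epsilon> / 2 + 2 * b / r\<^sup>2 * (norm (X t \<omega> - X 0 \<omega>))\<^sup>2)"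
      using L2(1) by simp
    have "(\<integral>\<omega>. \<epsilon> / 2 + 2 * b / r\<^sup>2 * (norm (X t \<omega> - X 0 \<omega>))\<^sup>2 \<partial>M)
      = \<epsilon> / 2 + 2 * b / r\<^sup>2 * (\<integral>\<omega>. (norm (X t \<omega> - X 0 \<omega>))\<^sup>2 \<partial>M)"
      using L2(1) by (simp add: prob_space)
    also have "\<dots> \<le> \<epsilon> / 2 + 2 * b / r\<^sup>2 * (cX * (t - 0))"
      using b0 by (intro add_left_mono mult_left_mono L2(2)) auto
    also have "\<dots> = \<epsilon> / 2 + c * t" by (simp add: c_def)
    also have "\<dots> \<le> \<epsilon>"
    proof -
      have "c * t \<le> (c + 1) * t" using t' by (intro mult_right_mono) auto
      also have "\<dots> \<le> (c + 1) * (\<epsilon> / (2 * (c + 1)))" using t' c0 by (intro mult_left_mono) auto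
      also have "\<dots> = \<epsilon> / 2" using c0 by (simp add: field_simps)
      finally show ?thesis by simp
    qed
    finally show "(\<integral>\<omega>. \<epsilon> / 2 + 2 * b / r\<^sup>2 * (norm (X t \<omega> - X 0 \<omega>))\<^sup>2 \<partial>M) \<le> \<epsilon>" .
    show "AE \<omega> in M. 0 \<le> norm (g (X t \<omega>) - g x0) \<and>
      norm (g (X t \<omega>) - g x0) \<le> \<epsilon> / 2 + 2 * b / r\<^sup>2 * (norm (X t \<omega> - X 0 \<omega>))\<^sup>2"
      using x0(2)
    proof (rule AE_mp, intro AE_I2 impI conjI)
      fix \<omega> assume \<omega>: "\<omega> \<in> space M" "X 0 \<omega> = x0"
      have XK: "X t \<omega> \<in> K" using X_K t' \<omega> by auto
      show "norm (g (X t \<omega>) - g x0) \<le> \<epsilon> / 2 + 2 * b / r\<^sup>2 * (norm (X t \<omega> - X 0 \<omega>))\<^sup>2"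
      proof (cases "norm (X t \<omega> - x0) < r")
        case True
        then have "norm (g (X t \<omega>) - g x0) < \<epsilon> / 2" using r(2) XK by blast
        moreover have "0 \<le> 2 * b / r\<^sup>2 * (norm (X t \<omega> - X 0 \<omega>))\<^sup>2" using b0 by auto
        ultimately show ?thesis by linarith
      next
        case False
        then have "r\<^sup>2 \<le> (norm (X t \<omega> - X 0 \<omega>))\<^sup>2" using r(1) \<omega> by (intro power_mono) auto
        then have "2 * b / r\<^sup>2 * r\<^sup>2 \<le> 2 * b / r\<^sup>2 * (norm (X t \<omega> - X 0 \<omega>))\<^sup>2"
          using b0 by (intro mult_left_mono) auto
        moreover have "norm (g (X t \<omega>) - g x0) \<le> b + b"
          using b[OF XK] b[OF x0(1)] norm_triangle_ineq4[of "g (X t \<omega>)" "g x0"] by linarith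
        ultimately show ?thesis using r(1) \<epsilon> by simp
      qed
    qed simp
  qed
  then show ?thesis using t0 by blast
qed

section \<open>The Ito-Stratonovich drift as the limit of the correction\<close>

definition drift :: "'a \<Rightarrow> 'a" where
  "drift x = (1/2) *\<^sub>R (\<Sum>i=1..k. Df i x (f i x))"

text \<open>The fluctuations of the discrete Brownian covariations, weighted with the coefficients
  frozen at \<open>x0\<close>. The subtracted \<open>t - 0\<close> has the shape in which
  \<open>quadratic_variation_inc\<close> delivers the limit.\<close>

definition QV_rem :: "'a \<Rightarrow> real \<Rightarrow> nat \<Rightarrow> 'w \<Rightarrow> 'a" where
  "QV_rem x0 t n \<omega> = (\<Sum>i=1..k. \<Sum>l=1..k. (1/2) *\<^sub>R (((\<Sum>j<n. inc i (uniform_pt 0 t n j) (uniform_pt 0 t n (Suc j)) \<omega> *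
            inc l (uniform_pt 0 t n j) (uniform_pt 0 t n (Suc j)) \<omega>)
      - (if i = l then t - 0 else 0)) *\<^sub>R Df i x0 (f l x0)))"

lemma QV_rem_vanishes:
  assumes t: "0 < t"
  shows "vanishes_in_prob (QV_rem x0 t)" "QV_rem x0 t n \<in> borel_measurable M"
proof -
  let ?q = "\<lambda>i l n \<omega>. (\<Sum>j<n. inc i (uniform_pt 0 t n j) (uniform_pt 0 t n (Suc j)) \<omega> *
            inc l (uniform_pt 0 t n j) (uniform_pt 0 t n (Suc j)) \<omega>) - (if i = l then t - 0 else 0)"
  have q: "?q i l n \<in> borel_measurable M" if "i \<in> {1..k}" "l \<in> {1..k}" for i l n
    using that pt_measurable(3)[OF order_refl t]
    by (intro borel_measurable_diff borel_measurable_sum borel_measurable_times borel_measurable_const) auto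
  have m: "(\<lambda>\<omega>. (1/2) *\<^sub>R (?q i l n \<omega> *\<^sub>R Df i x0 (f l x0))) \<in> borel_measurable M" if "i \<in> {1..k}" "l \<in> {1..k}" for i l n
    using q[OF that] by (intro borel_measurable_scaleR borel_measurable_const)
  show "QV_rem x0 t n \<in> borel_measurable M"
    unfolding QV_rem_def[abs_def] using m by (intro borel_measurable_sum) auto
  have v: "vanishes_in_prob (\<lambda>n \<omega>. (1/2) *\<^sub>R (?q i l n \<omega> *\<^sub>R Df i x0 (f l x0)))"
    if il: "i \<in> {1..k}" "l \<in> {1..k}" for i l
  proof (rule vanishes_in_prob_dominated[OF quadratic_variation_inc[OF il order_refl t], of "norm (Df i x0 (f l x0))"])
    show "AE \<omega> in M. norm ((1/2) *\<^sub>R (?q i l n \<omega> *\<^sub>R Df i x0 (f l x0)))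
      \<le> norm (Df i x0 (f l x0)) * norm (?q i l n \<omega>)" for n
    proof (rule AE_I2)
      fix \<omega>
      have "norm ((1/2) *\<^sub>R (z *\<^sub>R v)) \<le> norm v * norm z" for z :: real and v :: 'a
        by (simp add: mult.commute)
      then show "norm ((1/2) *\<^sub>R (?q i l n \<omega> *\<^sub>R Df i x0 (f l x0)))
        \<le> norm (Df i x0 (f l x0)) * norm (?q i l n \<omega>)" .
    qed
  qed (use q[OF il] m[OF il] in auto)
  show "vanishes_in_prob (QV_rem x0 t)"
    unfolding QV_rem_def[abs_def]
  proof (rule vanishes_in_prob_sum)
    fix i assume i: "i \<in> {1..k}"
    show "vanishes_in_prob (\<lambda>n \<omega>. \<Sum>l=1..k. (1/2) *\<^sub>R (?q i l n \<omega> *\<^sub>R Df i x0 (f l x0)))"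
      using v[OF i] m[OF i] by (rule vanishes_in_prob_sum)
    show "(\<lambda>\<omega>. \<Sum>l=1..k. (1/2) *\<^sub>R (?q i l n \<omega> *\<^sub>R Df i x0 (f l x0))) \<in> borel_measurable M" for n
      using m[OF i] by (intro borel_measurable_sum)
  qed
qed

text \<open>Freezing the derivatives of the vector fields at \<open>x0\<close> turns the correction into the quadratic
  covariation of the Brownian motions.\<close>

lemma Correction_eq_frozen:
  "Correction 0 t n \<omega> - t *\<^sub>R drift x0 =
    (\<Sum>i=1..k. \<Sum>j<n. (1/2) *\<^sub>R (inc i (uniform_pt 0 t n j) (uniform_pt 0 t n (Suc j)) \<omega> *\<^sub>R
      (f i (X (uniform_pt 0 t n (Suc j)) \<omega>) - f i (X (uniform_pt 0 t n j) \<omega>)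
       - (\<Sum>l=1..k. inc l (uniform_pt 0 t n j) (uniform_pt 0 t n (Suc j)) \<omega> *\<^sub>R Df i x0 (f l x0))))) + QV_rem x0 t n \<omega>"
proof -
  let ?b = "\<lambda>i j. inc i (uniform_pt 0 t n j) (uniform_pt 0 t n (Suc j)) \<omega>" and ?g = "\<lambda>i l. Df i x0 (f l x0)"
  have 1: "QV_rem x0 t n \<omega> = (\<Sum>i=1..k. (\<Sum>l=1..k. (1/2) *\<^sub>R ((\<Sum>j<n. ?b i j * ?b l j) *\<^sub>R ?g i l))
      - (t/2) *\<^sub>R ?g i i)"
    unfolding QV_rem_def
  proof (rule sum.cong[OF refl])
    fix i assume i: "i \<in> {1..k}"
    have "(\<Sum>l=1..k. (1/2) *\<^sub>R (((\<Sum>j<n. ?b i j * ?b l j) - (if i = l then t - 0 else 0)) *\<^sub>R ?g i l))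
      = (\<Sum>l=1..k. (1/2) *\<^sub>R ((\<Sum>j<n. ?b i j * ?b l j) *\<^sub>R ?g i l) - (if i = l then (t/2) *\<^sub>R ?g i l else 0))"
      by (intro sum.cong) (auto simp: scaleR_diff_left scaleR_diff_right)
    also have "\<dots> = (\<Sum>l=1..k. (1/2) *\<^sub>R ((\<Sum>j<n. ?b i j * ?b l j) *\<^sub>R ?g i l)) - (t/2) *\<^sub>R ?g i i"
      using i by (simp add: sum_subtractf)
    finally show "(\<Sum>l=1..k. (1/2) *\<^sub>R (((\<Sum>j<n. ?b i j * ?b l j) - (if i = l then t - 0 else 0)) *\<^sub>R ?g i l))
      = (\<Sum>l=1..k. (1/2) *\<^sub>R ((\<Sum>j<n. ?b i j * ?b l j) *\<^sub>R ?g i l)) - (t/2) *\<^sub>R ?g i i" .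
  qed
  have 2: "(\<Sum>l=1..k. (1/2) *\<^sub>R ((\<Sum>j<n. ?b i j * ?b l j) *\<^sub>R ?g i l))
     = (\<Sum>j<n. (1/2) *\<^sub>R (?b i j *\<^sub>R (\<Sum>l=1..k. ?b l j *\<^sub>R ?g i l)))" for i
    by (simp add: scaleR_sum_right scaleR_sum_left sum.swap[of _ "{..<n}"])
  have 3: "t *\<^sub>R drift x0 = (\<Sum>i=1..k. (t/2) *\<^sub>R ?g i i)"
    by (simp add: drift_def scaleR_sum_right)
  show ?thesis
    unfolding 1 2 3 Correction_def
    by (simp add: scaleR_diff_right sum_subtractf)
qed

lemma A_increment_integrable:
  assumes "0 \<le> t"
  shows "integrable M (\<lambda>\<omega>. A t \<omega> - A 0 \<omega>)" "integrable M (\<lambda>\<omega>. (norm (A t \<omega> - A 0 \<omega>))\<^sup>2)"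
    "(\<integral>\<omega>. (norm (A t \<omega> - A 0 \<omega>))\<^sup>2 \<partial>M) \<le> (C * t)\<^sup>2"
proof -
  have [measurable]: "A t \<in> borel_measurable M" "A 0 \<in> borel_measurable M"
    using assms by (auto intro!: A_meas)
  have b: "AE \<omega> in M. norm (A t \<omega> - A 0 \<omega>) \<le> C * t" using A_lip[OF order_refl assms] by simp
  show "integrable M (\<lambda>\<omega>. A t \<omega> - A 0 \<omega>)" by (rule integrable_const_bound[OF b]) measurable
  have b2: "AE \<omega> in M. (norm (A t \<omega> - A 0 \<omega>))\<^sup>2 \<le> (C * t)\<^sup>2"
    using b by eventually_elim (auto intro!: power_mono)
  then show i: "integrable M (\<lambda>\<omega>. (norm (A t \<omega> - A 0 \<omega>))\<^sup>2)"
    by (intro integrable_const_bound[where B = "(C * t)\<^sup>2"]) (auto elim!: eventually_mono)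
  from integral_mono_AE[OF i _ b2]
  show "(\<integral>\<omega>. (norm (A t \<omega> - A 0 \<omega>))\<^sup>2 \<partial>M) \<le> (C * t)\<^sup>2" by (simp add: prob_space)
qed

text \<open>The variable \<open>D = W 0 t - (A t - A 0) - Ito_rem 0 t n - t *\<^sub>R drift
  x0\<close> has the mean to be estimated, because \<open>Ito_rem\<close> is centred. It equals the
  correction minus \<open>t *\<^sub>R drift x0\<close>, plus the defect. Freezing the coefficients
  costs at most \<open>e\<close>, whose mean is within two thirds of \<open>\<epsilon> * t\<close>;
  \<open>QV_rem\<close> and the defect are small only in probability, and
  \<open>norm_expectation_le_of_approx\<close> fits them into the last third.\<close>

lemma mean_W:
  assumes x0: "x0 \<in> K" "AE \<omega> in M. X 0 \<omega> = x0" and \<epsilon>: "0 < \<epsilon>"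
  shows "\<exists>t0>0. \<forall>t. 0 < t \<and> t < t0 \<longrightarrow>
    norm ((\<integral>\<omega>. W 0 t \<omega> \<partial>M) - (\<integral>\<omega>. A t \<omega> - A 0 \<omega> \<partial>M) - t *\<^sub>R drift x0) \<le> \<epsilon> * t"
proof -
  \<comment> \<open>The total factor of \<open>\<epsilon>1\<close> in \<open>E_frozen_bound\<close>,
    summed over the fields; the \<open>+ 1\<close> keeps it positive for
    \<open>k = 0\<close>.\<close>
  define N where "N = real k * ((cX + 1) + real k) + 1"
  define \<epsilon>1 where "\<epsilon>1 = \<epsilon> / (3 * N)"
  have den: "0 < N" unfolding N_def using cX_nonneg by (intro add_nonneg_pos) auto
  have \<epsilon>1: "0 < \<epsilon>1" using \<epsilon> den by (auto simp: \<epsilon>1_def)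
  have \<epsilon>1': "real k * (\<epsilon>1 * (cX + 1) + real k * \<epsilon>1) \<le> \<epsilon> / 3"
  proof -
    have "real k * (\<epsilon>1 * (cX + 1) + real k * \<epsilon>1) = \<epsilon>1 * (real k * ((cX + 1) + real k))"
      by (simp add: algebra_simps)
    also have "\<dots> \<le> \<epsilon>1 * N" using \<epsilon>1 by (intro mult_left_mono) (auto simp: N_def)
    also have "\<dots> = \<epsilon> / 3" using den by (simp add: \<epsilon>1_def)
    finally show ?thesis .
  qed
  obtain r where r: "0 < r" "\<And>i x y. i \<in> {1..k} \<Longrightarrow> x \<in> K \<Longrightarrow> y \<in> K \<Longrightarrow> norm (y - x) < r \<Longrightarrow>
      norm (f i y - f i x - Df i x (y - x)) \<le> \<epsilon>1 * norm (y - x)"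
    using Df_taylor[OF \<epsilon>1] by blast
  have "\<forall>i\<in>{1..k}. \<forall>l\<in>{1..k}. \<exists>t0>0. \<forall>t\<in>{0..<t0}.
      (\<integral>\<omega>. norm (Df i (X t \<omega>) (f l (X t \<omega>)) - Df i x0 (f l x0)) \<partial>M) \<le> \<epsilon>1"
    using mean_continuous_of_X[OF Df_cont x0 \<epsilon>1] by blast
  then obtain T where T: "\<And>i l. i \<in> {1..k} \<Longrightarrow> l \<in> {1..k} \<Longrightarrow> 0 < T i l"
    "\<And>i l t. i \<in> {1..k} \<Longrightarrow> l \<in> {1..k} \<Longrightarrow> t \<in> {0..<T i l} \<Longrightarrow>
      (\<integral>\<omega>. norm (Df i (X t \<omega>) (f l (X t \<omega>)) - Df i x0 (f l x0)) \<partial>M) \<le> \<epsilon>1"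
    by metis
  \<comment> \<open>The element 1 keeps the set nonempty for \<open>k = 0\<close> and confines the
    times to \<open>[0, 1]\<close>, where the moment bounds hold.\<close>
  define t0 where "t0 = Min (insert 1 ((\<lambda>(i, l). T i l) ` ({1..k} \<times> {1..k})))"
  have t0: "0 < t0" "t0 \<le> 1"
    using T(1) by (auto simp: t0_def)
  have t0_le: "t0 \<le> T i l" if "i \<in> {1..k}" "l \<in> {1..k}" for i l
    unfolding t0_def using that by (intro Min_le) (auto intro!: image_eqI[of _ _ "(i, l)"])
  have "norm ((\<integral>\<omega>. W 0 t \<omega> \<partial>M) - (\<integral>\<omega>. A t \<omega> - A 0 \<omega> \<partial>M) - t *\<^sub>R drift x0) \<le> \<epsilon> * t"
    if t: "0 < t" "t < t0" for t
  proof -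
    have t1: "t \<le> 1" using t t0 by linarith
    \<comment> \<open>A bound for the second moment of \<open>D\<close> below. It is independent of
      \<open>n\<close>, so \<open>\<eta>\<close> can be fixed before \<open>n\<close> is
      chosen.\<close>
    define c where "c = 4 * (cW * t\<^sup>2) + 4 * (C * t)\<^sup>2 + 4 * ((real k)\<^sup>2 * (C\<^sup>2 * cX) * t\<^sup>2) + 4 * (norm (t *\<^sub>R drift x0))\<^sup>2"
    have c0: "0 \<le> c" using cW_nonneg cX_nonneg unfolding c_def by (intro add_nonneg_nonneg mult_nonneg_nonneg) auto
    define \<eta> where "\<eta> = min 1 (\<epsilon> * t / (3 * (1 + (c + 1) / 2)))"
    have "0 < \<epsilon> * t / (3 * (1 + (c + 1) / 2))" using \<epsilon> t c0 by (intro divide_pos_pos mult_pos_pos add_pos_nonneg divide_nonneg_pos) auto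
    then have \<eta>: "0 < \<eta>" by (auto simp: \<eta>_def)
    have "\<eta>\<^sup>2 + \<eta> * (c + 1) / 2 \<le> \<eta> * (1 + (c + 1) / 2)"
    proof -
      have "\<eta>\<^sup>2 \<le> \<eta> * 1" unfolding power2_eq_square using \<eta> by (intro mult_left_mono) (auto simp: \<eta>_def)
      then show ?thesis by (simp add: algebra_simps)
    qed
    also have "\<dots> \<le> \<epsilon> * t / (3 * (1 + (c + 1) / 2)) * (1 + (c + 1) / 2)"
      using c0 by (intro mult_right_mono) (auto simp: \<eta>_def)
    also have "\<dots> = \<epsilon> * t / 3" using c0 by (simp add: field_simps)
    finally have \<eta>': "\<eta>\<^sup>2 + \<eta> * (c + 1) / 2 \<le> \<epsilon> * t / 3" .
    \<comment> \<open>The terms with an extra square root of the cell length add up to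
      \<open>Q * sqrt (t / n) * t\<close>, which a large \<open>n\<close> makes small for fixed
      \<open>t\<close>.\<close>
    define Q where "Q = real k * (3 * C * (cW + 1) + 2 * C\<^sup>2 / r * (real k * (3 + cX)))"
    have Q0: "0 \<le> Q" unfolding Q_def using C cW_nonneg cX_nonneg r(1)
      by (intro mult_nonneg_nonneg add_nonneg_nonneg divide_nonneg_pos) auto
    have "(\<lambda>n. Q * sqrt (t / real n)) \<longlonglongrightarrow> Q * sqrt 0"
      by (intro tendsto_intros lim_const_over_n)
    then have ev1: "\<forall>\<^sub>F n in sequentially. Q * sqrt (t / real n) < \<epsilon> / 3"
      by (rule order_tendstoD) (use \<epsilon> in simp)
    have "vanishes_in_prob (\<lambda>n \<omega>. QV_rem x0 t n \<omega> + Err 0 t n \<omega>)"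
      by (intro vanishes_in_prob_add QV_rem_vanishes t Err_vanishes Err_measurable) auto
    then have "\<forall>\<^sub>F n in sequentially. prob {\<omega>\<in>space M. norm (QV_rem x0 t n \<omega> + Err 0 t n \<omega>) > \<eta>\<^sup>2} < \<eta>\<^sup>2"
      by (rule vanishes_in_probD)
        (use \<eta> in \<open>auto intro!: borel_measurable_add QV_rem_vanishes t Err_measurable\<close>)
    then have "\<forall>\<^sub>F n in sequentially. 0 < n \<and> Q * sqrt (t / real n) < \<epsilon> / 3 \<and>
        prob {\<omega>\<in>space M. norm (QV_rem x0 t n \<omega> + Err 0 t n \<omega>) > \<eta>\<^sup>2} < \<eta>\<^sup>2"
      by (intro eventually_conj eventually_gt_at_top ev1)
    then obtain n where n: "0 < n" "Q * sqrt (t / real n) < \<epsilon> / 3"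
        "prob {\<omega>\<in>space M. norm (QV_rem x0 t n \<omega> + Err 0 t n \<omega>) > \<eta>\<^sup>2} < \<eta>\<^sup>2"
      by (auto simp: eventually_sequentially)
    let ?p = "uniform_pt 0 t n"
    have p: "0 \<le> ?p j" "?p j < ?p (Suc j)" "?p (Suc j) \<le> 1" "?p j < t0" "?p (Suc j) - ?p j = t / real n" if "j < n" for j
      using uniform_pt_bounds[OF order_refl t(1) that] t t1 uniform_pt_Suc_diff[of 0 t n j] by auto
    define e where "e \<omega> = (\<Sum>i=1..k. \<Sum>j<n. frozen_bound \<epsilon>1 r x0 i (?p j) (?p (Suc j)) \<omega>)" for \<omega>
    have \<beta>: "(\<integral>\<omega>. norm (Df i (X (?p j) \<omega>) (f l (X (?p j) \<omega>)) - Df i x0 (f l x0)) \<partial>M) \<le> \<epsilon>1"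
      if "i \<in> {1..k}" "l \<in> {1..k}" "j < n" for i l j
      using T(2)[OF that(1,2)] p(1,4)[OF that(3)] t0_le[OF that(1,2)] by auto
    note Ed = E_frozen_bound[OF p(1,2,3) _ x0(1) r(1) less_imp_le[OF \<epsilon>1] \<beta>]
    have ie: "integrable M e" unfolding e_def using Ed(1)
      by (intro Bochner_Integration.integrable_sum) auto
    have "(\<integral>\<omega>. e \<omega> \<partial>M) = (\<Sum>i=1..k. \<Sum>j<n. \<integral>\<omega>. frozen_bound \<epsilon>1 r x0 i (?p j) (?p (Suc j)) \<omega> \<partial>M)"
      unfolding e_def using Ed(1)
      by (subst Bochner_Integration.integral_sum) (auto intro!: sum.cong Bochner_Integration.integral_sum Bochner_Integration.integrable_sum)
    also have "\<dots> \<le> (\<Sum>i=1..k. \<Sum>j<n. (\<epsilon>1 * (cX + 1) + real k * \<epsilon>1) * (?p (Suc j) - ?p j)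
       + (3 * C * (cW + 1) + 2 * C\<^sup>2 / r * (real k * (3 + cX))) * ((?p (Suc j) - ?p j) * sqrt (?p (Suc j) - ?p j)))"
      using Ed(2) by (intro sum_mono) auto
    also have "\<dots> = (\<Sum>i=1..k. \<Sum>j<n. (\<epsilon>1 * (cX + 1) + real k * \<epsilon>1) * (t / real n)
       + (3 * C * (cW + 1) + 2 * C\<^sup>2 / r * (real k * (3 + cX))) * (t / real n * sqrt (t / real n)))"
      by (intro sum.cong) (auto simp: p(5))
    also have "\<dots> = real k * (\<epsilon>1 * (cX + 1) + real k * \<epsilon>1) * t + Q * sqrt (t / real n) * t"
      using n(1) by (simp add: Q_def field_simps)
    also have "\<dots> \<le> \<epsilon> / 3 * t + \<epsilon> / 3 * t"
      using \<epsilon>1' n(2) t by (intro add_mono mult_right_mono) auto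
    finally have Ee: "(\<integral>\<omega>. e \<omega> \<partial>M) \<le> \<epsilon> / 3 * t + \<epsilon> / 3 * t" .
    have e_ge: "norm (\<Sum>i=1..k. \<Sum>j<n. (1/2) *\<^sub>R (inc i (?p j) (?p (Suc j)) \<omega> *\<^sub>R
      (f i (X (?p (Suc j)) \<omega>) - f i (X (?p j) \<omega>)
       - (\<Sum>l=1..k. inc l (?p j) (?p (Suc j)) \<omega> *\<^sub>R Df i x0 (f l x0))))) \<le> e \<omega>" if \<omega>: "\<omega> \<in> space M" for \<omega>
      unfolding e_def
    proof (intro order_trans[OF norm_sum sum_mono])
      fix i j assume i: "i \<in> {1..k}" and j: "j \<in> {..<n}"
      have "norm (inc i (?p j) (?p (Suc j)) \<omega> *\<^sub>R (f i (X (?p (Suc j)) \<omega>) - f i (X (?p j) \<omega>)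
         - (\<Sum>l=1..k. inc l (?p j) (?p (Suc j)) \<omega> *\<^sub>R Df i x0 (f l x0)))) \<le> frozen_bound \<epsilon>1 r x0 i (?p j) (?p (Suc j)) \<omega>"
        by (rule frozen_increment_le[OF _ _ \<omega> i r(1) r(2)[OF i]]) (use p[of j] j \<epsilon>1 in auto)
      moreover have "norm ((1/2) *\<^sub>R v) \<le> norm v" for v :: 'a by simp
      ultimately show "norm ((1/2) *\<^sub>R (inc i (?p j) (?p (Suc j)) \<omega> *\<^sub>R (f i (X (?p (Suc j)) \<omega>) - f i (X (?p j) \<omega>)
         - (\<Sum>l=1..k. inc l (?p j) (?p (Suc j)) \<omega> *\<^sub>R Df i x0 (f l x0))))) \<le> frozen_bound \<epsilon>1 r x0 i (?p j) (?p (Suc j)) \<omega>"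
        using order_trans by blast
    qed
    have e0: "0 \<le> e \<omega>" if "\<omega> \<in> space M" for \<omega> using e_ge[OF that] norm_ge_zero order_trans by blast
    define D where "D \<omega> = W 0 t \<omega> + - (A t \<omega> - A 0 \<omega>) + - Ito_rem 0 t n \<omega> + - (t *\<^sub>R drift x0)" for \<omega>
    note WL = W_L2[OF order_refl t(1) t1] and IL = Ito_rem_L2[OF order_refl t(1) t1 n(1)]
      and AL = A_increment_integrable[OF less_imp_le[OF t(1)]]
    have [measurable]: "W 0 t \<in> borel_measurable M" "A t \<in> borel_measurable M" "A 0 \<in> borel_measurable M"
      using t by (auto intro!: W_measurable A_meas)
    note [measurable] = IL(1) borel_measurable_integrable[OF ie]
    have Dm[measurable]: "D \<in> borel_measurable M" unfolding D_def by measurable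
    let ?U = "\<lambda>\<omega>. 4 * (norm (W 0 t \<omega>))\<^sup>2 + 4 * (norm (A t \<omega> - A 0 \<omega>))\<^sup>2 + 4 * (norm (Ito_rem 0 t n \<omega>))\<^sup>2 + 4 * (norm (t *\<^sub>R drift x0))\<^sup>2"
    have "(norm (D \<omega>))\<^sup>2 \<le> ?U \<omega>" for \<omega>
      using norm_add4_squared_le[of "W 0 t \<omega>" "- (A t \<omega> - A 0 \<omega>)" "- Ito_rem 0 t n \<omega>" "- (t *\<^sub>R drift x0)"]
      unfolding D_def norm_minus_cancel .
    then have U: "AE \<omega> in M. 0 \<le> (norm (D \<omega>))\<^sup>2 \<and> (norm (D \<omega>))\<^sup>2 \<le> ?U \<omega>" by simp
    have iU: "integrable M ?U" using WL(1) IL(2) AL(2) by simp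
    have "(\<integral>\<omega>. ?U \<omega> \<partial>M) = 4 * (\<integral>\<omega>. (norm (W 0 t \<omega>))\<^sup>2 \<partial>M) + 4 * (\<integral>\<omega>. (norm (A t \<omega> - A 0 \<omega>))\<^sup>2 \<partial>M)
      + 4 * (\<integral>\<omega>. (norm (Ito_rem 0 t n \<omega>))\<^sup>2 \<partial>M) + 4 * (norm (t *\<^sub>R drift x0))\<^sup>2"
      using WL(1) IL(2) AL(2) by (simp add: prob_space)
    also have "\<dots> \<le> c"
      unfolding c_def using WL(2) IL(3) AL(3) by (intro add_mono mult_left_mono) auto
    finally have EU: "(\<integral>\<omega>. ?U \<omega> \<partial>M) \<le> c" .
    have D2m: "(\<lambda>\<omega>. (norm (D \<omega>))\<^sup>2) \<in> borel_measurable M" by measurable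
    note D2 = expectation_le_of_le[OF D2m iU EU U]
    have "prob {\<omega>\<in>space M. norm (D \<omega>) > e \<omega> + \<eta>\<^sup>2} \<le> prob {\<omega>\<in>space M. norm (QV_rem x0 t n \<omega> + Err 0 t n \<omega>) > \<eta>\<^sup>2}"
    proof (rule finite_measure_mono)
      show "{\<omega>\<in>space M. norm (D \<omega>) > e \<omega> + \<eta>\<^sup>2} \<subseteq> {\<omega>\<in>space M. norm (QV_rem x0 t n \<omega> + Err 0 t n \<omega>) > \<eta>\<^sup>2}"
      proof safe
        fix \<omega> assume \<omega>: "\<omega> \<in> space M" "norm (D \<omega>) > e \<omega> + \<eta>\<^sup>2"
        have "D \<omega> = (Correction 0 t n \<omega> - t *\<^sub>R drift x0) + Err 0 t n \<omega>"
          unfolding D_def Ito_rem_eq[OF n(1)] W_def Err_def by (simp add: algebra_simps)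
        then have "norm (D \<omega>) \<le> e \<omega> + norm (QV_rem x0 t n \<omega> + Err 0 t n \<omega>)"
          unfolding Correction_eq_frozen add.assoc by (simp only: norm_triangle_le[OF add_right_mono[OF e_ge[OF \<omega>(1)]]])
        then show "norm (QV_rem x0 t n \<omega> + Err 0 t n \<omega>) > \<eta>\<^sup>2" using \<omega> by linarith
      qed
      show "{\<omega>\<in>space M. norm (QV_rem x0 t n \<omega> + Err 0 t n \<omega>) > \<eta>\<^sup>2} \<in> sets M"
        using QV_rem_vanishes(2)[OF t(1), measurable] Err_measurable[OF order_refl t(1), measurable] by measurable
    qed
    then have "prob {\<omega>\<in>space M. norm (D \<omega>) > e \<omega> + \<eta>\<^sup>2} \<le> \<eta>\<^sup>2" using n(3) by linarith
    then have "norm (\<integral>\<omega>. D \<omega> \<partial>M) \<le> (\<integral>\<omega>. e \<omega> \<partial>M) + \<eta>\<^sup>2 + \<eta> * (c + 1) / 2"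
      by (intro norm_expectation_le_of_approx Dm D2 ie e0 \<eta>)
    also have "\<dots> \<le> \<epsilon> / 3 * t + \<epsilon> / 3 * t + \<epsilon> * t / 3" using Ee \<eta>' by linarith
    also have "\<dots> = \<epsilon> * t" by simp
    finally have "norm (\<integral>\<omega>. D \<omega> \<partial>M) \<le> \<epsilon> * t" .
    moreover have "(\<integral>\<omega>. D \<omega> \<partial>M) = (\<integral>\<omega>. W 0 t \<omega> \<partial>M) - (\<integral>\<omega>. A t \<omega> - A 0 \<omega> \<partial>M) - t *\<^sub>R drift x0"
    proof -
      have "integrable M (W 0 t)" "integrable M (Ito_rem 0 t n)"
        by (rule integrable_of_square[OF WL(1)], measurable) (rule integrable_of_square[OF IL(2,1)])
      then show ?thesis
        unfolding D_def using AL(1) IL(4) by (simp add: prob_space del: minus_diff_eq)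
    qed
    ultimately show ?thesis by simp
  qed
  then show ?thesis using t0(1) by blast
qed

end

section \<open>The generator at a point\<close>

lemma tendsto_of_abs_diff_le:
  fixes g :: "'b \<Rightarrow> real"
  assumes "\<forall>\<^sub>F t in F. \<bar>g t - L\<bar> \<le> h t" "(h \<longlongrightarrow> 0) F"
  shows "(g \<longlongrightarrow> L) F"
proof -
  have "((\<lambda>t. g t - L) \<longlongrightarrow> 0) F"
    by (rule Lim_null_comparison[OF _ assms(2)]) (use assms(1) in simp)
  then show ?thesis by (rule LIM_zero_cancel)
qed

context stratonovich_frame
begin

lemma E_inc_inc:
  assumes il: "i \<in> {1..k}" "l \<in> {1..k}" and t: "0 < t"
  shows "integrable M (\<lambda>\<omega>. inc i 0 t \<omega> * inc l 0 t \<omega>)"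
    "(\<integral>\<omega>. inc i 0 t \<omega> * inc l 0 t \<omega> \<partial>M) = (if i = l then t else 0)"
proof -
  have "integrable M (\<lambda>\<omega>. inc i 0 t \<omega> * inc l 0 t \<omega>) \<and>
    (\<integral>\<omega>. inc i 0 t \<omega> * inc l 0 t \<omega> \<partial>M) = (if i = l then t else 0)"
  proof (cases "i = l")
    case True
    then show ?thesis
      using inc_moment_integrable[OF il(1) order_refl t, of 2] inc_moments(2)[OF il(1) order_refl t]
      by (simp add: power2_eq_square)
  next
    case False
    show ?thesis
      using innovation_inc_inc[OF il False order_refl t, unfolded innovation_def, THEN conjunct2, rule_format, of "\<lambda>_. 1"] False
      by simp
  qed
  then show "integrable M (\<lambda>\<omega>. inc i 0 t \<omega> * inc l 0 t \<omega>)"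
    "(\<integral>\<omega>. inc i 0 t \<omega> * inc l 0 t \<omega> \<partial>M) = (if i = l then t else 0)" by auto
qed

definition lin_part :: "'a \<Rightarrow> real \<Rightarrow> 'w \<Rightarrow> 'a" where
  "lin_part x0 t \<omega> = (\<Sum>i=1..k. inc i 0 t \<omega> *\<^sub>R f i x0)"

lemma lin_part_measurable: "0 \<le> t \<Longrightarrow> lin_part x0 t \<in> borel_measurable M"
  unfolding lin_part_def[abs_def] using inc_measurable[of _ 0 t]
  by (intro borel_measurable_sum borel_measurable_scaleR) auto

lemma lin_part_norm:
  assumes "x0 \<in> K"
  shows "(norm (lin_part x0 t \<omega>))\<^sup>2 \<le> real k * C\<^sup>2 * (\<Sum>i=1..k. (inc i 0 t \<omega>)\<^sup>2)"
proof -
  have "(norm (lin_part x0 t \<omega>))\<^sup>2 \<le> real k * (\<Sum>i=1..k. (norm (inc i 0 t \<omega> *\<^sub>R f i x0))\<^sup>2)"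
    unfolding lin_part_def using norm_sum_squared_le[OF finite_atLeastAtMost, of "\<lambda>i. inc i 0 t \<omega> *\<^sub>R f i x0" 1 k]
    by (simp del: norm_scaleR)
  also have "\<dots> \<le> real k * (\<Sum>i=1..k. C\<^sup>2 * (inc i 0 t \<omega>)\<^sup>2)"
  proof (intro mult_left_mono sum_mono)
    fix i assume i: "i \<in> {1..k}"
    have "(norm (f i x0))\<^sup>2 \<le> C\<^sup>2" using f_bound[OF i assms] by (intro power_mono) auto
    then show "(norm (inc i 0 t \<omega> *\<^sub>R f i x0))\<^sup>2 \<le> C\<^sup>2 * (inc i 0 t \<omega>)\<^sup>2"
      by (simp add: power_mult_distrib mult.commute[of "C\<^sup>2"] mult_left_mono)
  qed simp
  finally show ?thesis by (simp add: sum_distrib_left mult.assoc)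
qed

section \<open>Limits of the terms of the Taylor expansion at the starting point\<close>

context
  fixes x0 :: 'a
  assumes x0: "x0 \<in> K" "AE \<omega> in M. X 0 \<omega> = x0"
begin

lemma X_increment_decomp: "AE \<omega> in M. X t \<omega> - X 0 \<omega> = lin_part x0 t \<omega> + W 0 t \<omega>"
  using x0(2) by eventually_elim (simp add: lin_part_def W_def)

lemma X_increment_integrable:
  assumes t: "0 < t" "t \<le> 1"
  shows "integrable M (\<lambda>\<omega>. X t \<omega> - X 0 \<omega>)" "(\<integral>\<omega>. X t \<omega> - X 0 \<omega> \<partial>M) = (\<integral>\<omega>. W 0 t \<omega> \<partial>M)"
proof -
  have [measurable]: "X t \<in> borel_measurable M" "X 0 \<in> borel_measurable M" "W 0 t \<in> borel_measurable M"
    "lin_part x0 t \<in> borel_measurable M"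
    using t by (auto intro!: X_meas' W_measurable lin_part_measurable)
  show i: "integrable M (\<lambda>\<omega>. X t \<omega> - X 0 \<omega>)"
    by (rule integrable_of_square[OF X_increment_L2(1)]) (use t in auto)
  have inc: "integrable M (inc i 0 t)" "(\<integral>\<omega>. inc i 0 t \<omega> \<partial>M) = 0" if "i \<in> {1..k}" for i
    using inc_moment_integrable[OF that order_refl t(1), of 1] inc_moments(1)[OF that order_refl t(1)] by auto
  have iL: "integrable M (lin_part x0 t)"
    unfolding lin_part_def using inc(1) by (intro Bochner_Integration.integrable_sum integrable_scaleR_left) auto
  have EL: "(\<integral>\<omega>. lin_part x0 t \<omega> \<partial>M) = 0"
    unfolding lin_part_def using inc
    by (subst Bochner_Integration.integral_sum) auto
  have iW: "integrable M (W 0 t)"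
    by (rule integrable_of_square[OF W_L2(1)]) (use t in auto)
  have "(\<integral>\<omega>. X t \<omega> - X 0 \<omega> \<partial>M) = (\<integral>\<omega>. lin_part x0 t \<omega> + W 0 t \<omega> \<partial>M)"
    by (rule integral_cong_AE) (use X_increment_decomp in auto)
  also have "\<dots> = (\<integral>\<omega>. W 0 t \<omega> \<partial>M)" using iL iW EL by simp
  finally show "(\<integral>\<omega>. X t \<omega> - X 0 \<omega> \<partial>M) = (\<integral>\<omega>. W 0 t \<omega> \<partial>M)" .
qed

text \<open>Since \<open>lin_part\<close> is centred, the mean increment of \<open>X\<close> is the
  mean of \<open>W\<close>, which \<open>mean_W\<close> describes up to \<open>o(t)\<close> as the
  mean drift integral plus \<open>t *\<^sub>R drift x0\<close>.\<close>

lemma mean_limit: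
  assumes A: "((\<lambda>t. (1 / t) *\<^sub>R (\<integral>\<omega>. A t \<omega> - A 0 \<omega> \<partial>M)) \<longlongrightarrow> v) (at_right 0)"
  shows "((\<lambda>t. (1 / t) *\<^sub>R (\<integral>\<omega>. X t \<omega> - X 0 \<omega> \<partial>M)) \<longlongrightarrow> v + drift x0) (at_right 0)"
proof -
  have "((\<lambda>t. (1 / t) *\<^sub>R ((\<integral>\<omega>. W 0 t \<omega> \<partial>M) - (\<integral>\<omega>. A t \<omega> - A 0 \<omega> \<partial>M))) \<longlongrightarrow> drift x0) (at_right 0)"
  proof (rule tendstoI)
    fix e :: real assume e: "0 < e"
    obtain t0 where t0: "0 < t0" "\<And>t. 0 < t \<Longrightarrow> t < t0 \<Longrightarrow>
      norm ((\<integral>\<omega>. W 0 t \<omega> \<partial>M) - (\<integral>\<omega>. A t \<omega> - A 0 \<omega> \<partial>M) - t *\<^sub>R drift x0) \<le> e / 2 * t"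
      using mean_W[OF x0, of "e / 2"] e by auto
    show "\<forall>\<^sub>F t in at_right 0. dist ((1 / t) *\<^sub>R ((\<integral>\<omega>. W 0 t \<omega> \<partial>M) - (\<integral>\<omega>. A t \<omega> - A 0 \<omega> \<partial>M))) (drift x0) < e"
      unfolding eventually_at_right_field
    proof (intro exI[of _ t0] conjI allI impI t0(1))
      fix t assume t: "0 < t" "t < t0"
      let ?v = "(\<integral>\<omega>. W 0 t \<omega> \<partial>M) - (\<integral>\<omega>. A t \<omega> - A 0 \<omega> \<partial>M)"
      have "(1 / t) *\<^sub>R ?v - drift x0 = (1 / t) *\<^sub>R (?v - t *\<^sub>R drift x0)"
        using t by (simp add: scaleR_diff_right)
      then have "dist ((1 / t) *\<^sub>R ?v) (drift x0) = norm (?v - t *\<^sub>R drift x0) / t"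
        using t by (simp add: dist_norm)
      also have "\<dots> \<le> (e / 2 * t) / t" using t0(2)[OF t] t by (intro divide_right_mono) auto
      also have "\<dots> < e" using t e by simp
      finally show "dist ((1 / t) *\<^sub>R ?v) (drift x0) < e" .
    qed
  qed
  from tendsto_add[OF A this]
  have "((\<lambda>t. (1 / t) *\<^sub>R (\<integral>\<omega>. W 0 t \<omega> \<partial>M)) \<longlongrightarrow> v + drift x0) (at_right 0)"
    by (simp add: scaleR_diff_right)
  moreover have "\<forall>\<^sub>F t in at_right 0. (1 / t) *\<^sub>R (\<integral>\<omega>. W 0 t \<omega> \<partial>M) = (1 / t) *\<^sub>R (\<integral>\<omega>. X t \<omega> - X 0 \<omega> \<partial>M)"
    unfolding eventually_at_right_field
    by (intro exI[of _ 1]) (auto simp: X_increment_integrable)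
  ultimately show ?thesis by (rule Lim_transform_eventually)
qed

text \<open>Only \<open>lin_part\<close> counts at order \<open>t\<close>, and the covariances of
  the Brownian increments leave just the diagonal terms of \<open>b\<close>. By Young's inequality
  with weight \<open>sqrt t\<close>, the mixed terms with \<open>W\<close> have order
  \<open>t * sqrt t\<close>; the purely quadratic term in \<open>W\<close> has order
  \<open>t\<^sup>2\<close>.\<close>

lemma quadratic_limit:
  fixes b :: "'a \<Rightarrow> 'a \<Rightarrow> real"
  assumes b: "bounded_bilinear b"
  shows "((\<lambda>t. (1 / t) * (\<integral>\<omega>. b (X t \<omega> - X 0 \<omega>) (X t \<omega> - X 0 \<omega>) \<partial>M)) \<longlongrightarrow> (\<Sum>i=1..k. b (f i x0) (f i x0))) (at_right 0)"
    and quadratic_integrable: "0 < t \<Longrightarrow> t \<le> 1 \<Longrightarrow> integrable M (\<lambda>\<omega>. b (X t \<omega> - X 0 \<omega>) (X t \<omega> - X 0 \<omega>))"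
proof -
  interpret b: bounded_bilinear b by fact
  obtain c where c: "0 < c" "\<And>x y. \<bar>b x y\<bar> \<le> norm x * norm y * c"
    using b.pos_bounded by auto
  have cont: "continuous_on UNIV (\<lambda>x. b x x)"
    by (intro b.continuous_on continuous_intros)
  have bm: "(\<lambda>\<omega>. b (Y \<omega>) (Y \<omega>)) \<in> borel_measurable M" if "Y \<in> borel_measurable M" for Y
    using measurable_compose[OF that borel_measurable_continuous_onI[OF cont]] by simp
  let ?Y = "\<lambda>t \<omega>. X t \<omega> - X 0 \<omega>" and ?L = "\<lambda>t. lin_part x0 t"
  let ?s = "\<Sum>i=1..k. b (f i x0) (f i x0)"
  have LL: "integrable M (\<lambda>\<omega>. b (?L t \<omega>) (?L t \<omega>))" "(\<integral>\<omega>. b (?L t \<omega>) (?L t \<omega>) \<partial>M) = t * ?s" if t: "0 < t" for t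
  proof -
    have eq: "b (?L t \<omega>) (?L t \<omega>) = (\<Sum>i=1..k. \<Sum>l=1..k. inc i 0 t \<omega> * inc l 0 t \<omega> * b (f i x0) (f l x0))" for \<omega>
      unfolding lin_part_def b.sum_left b.sum_right
      by (subst sum.swap) (simp add: b.scaleR_left b.scaleR_right mult.assoc mult.left_commute)
    show "integrable M (\<lambda>\<omega>. b (?L t \<omega>) (?L t \<omega>))"
      unfolding eq using E_inc_inc(1)[OF _ _ t]
      by (intro Bochner_Integration.integrable_sum integrable_mult_left) auto
    have "(\<integral>\<omega>. b (?L t \<omega>) (?L t \<omega>) \<partial>M)
      = (\<Sum>i=1..k. \<Sum>l=1..k. \<integral>\<omega>. inc i 0 t \<omega> * inc l 0 t \<omega> * b (f i x0) (f l x0) \<partial>M)"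
      unfolding eq using E_inc_inc(1)[OF _ _ t]
      by (subst Bochner_Integration.integral_sum)
        (auto intro!: sum.cong Bochner_Integration.integral_sum Bochner_Integration.integrable_sum integrable_mult_left)
    also have "\<dots> = (\<Sum>i=1..k. \<Sum>l=1..k. if i = l then t * b (f i x0) (f l x0) else 0)"
      using E_inc_inc[OF _ _ t] by (intro sum.cong) auto
    also have "\<dots> = (\<Sum>i=1..k. t * b (f i x0) (f i x0))"
      by (intro sum.cong) auto
    also have "\<dots> = t * ?s" by (simp add: sum_distrib_left)
    finally show "(\<integral>\<omega>. b (?L t \<omega>) (?L t \<omega>) \<partial>M) = t * ?s" .
  qed
  have Yint: "integrable M (\<lambda>\<omega>. b (?Y t \<omega>) (?Y t \<omega>))" if t: "0 < t" "t \<le> 1" for t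
  proof (rule Bochner_Integration.integrable_bound)
    show "integrable M (\<lambda>\<omega>. c * (norm (?Y t \<omega>))\<^sup>2)" using X_increment_L2(1)[of 0 t] t by simp
    show "(\<lambda>\<omega>. b (?Y t \<omega>) (?Y t \<omega>)) \<in> borel_measurable M"
      using t by (intro bm borel_measurable_diff X_meas') auto
    show "AE \<omega> in M. norm (b (?Y t \<omega>) (?Y t \<omega>)) \<le> norm (c * (norm (?Y t \<omega>))\<^sup>2)"
      using c by (intro AE_I2) (simp add: power2_eq_square mult_ac)
  qed
  then show "0 < t \<Longrightarrow> t \<le> 1 \<Longrightarrow> integrable M (\<lambda>\<omega>. b (X t \<omega> - X 0 \<omega>) (X t \<omega> - X 0 \<omega>))" .
  \<comment> \<open>Bounds the mean error after division by \<open>t\<close>: every summand retains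
    at least a factor \<open>sqrt t\<close>.\<close>
  define h where "h t = c * (sqrt t * (real k * C\<^sup>2 * real k) + cW * sqrt t + cW * t)" for t :: real
  have le: "\<bar>(1 / t) * (\<integral>\<omega>. b (?Y t \<omega>) (?Y t \<omega>) \<partial>M) - ?s\<bar> \<le> h t" if t: "0 < t" "t < 1" for t
  proof -
    have t1: "t \<le> 1" using t by simp
    have [measurable]: "X t \<in> borel_measurable M" "X 0 \<in> borel_measurable M" "W 0 t \<in> borel_measurable M"
      "lin_part x0 t \<in> borel_measurable M"
      using t by (auto intro!: X_meas' W_measurable lin_part_measurable)
    note [measurable] = bm[of "?Y t"] bm[of "?L t"]
    note WL = W_L2[OF order_refl t(1) t1]
    let ?D = "\<lambda>\<omega>. b (?Y t \<omega>) (?Y t \<omega>) - b (?L t \<omega>) (?L t \<omega>)"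
    let ?U = "\<lambda>\<omega>. c * (sqrt t * (real k * C\<^sup>2 * (\<Sum>i=1..k. (inc i 0 t \<omega>)\<^sup>2)) + (norm (W 0 t \<omega>))\<^sup>2 / sqrt t + (norm (W 0 t \<omega>))\<^sup>2)"
    have inc2: "integrable M (\<lambda>\<omega>. (inc i 0 t \<omega>)\<^sup>2)" "(\<integral>\<omega>. (inc i 0 t \<omega>)\<^sup>2 \<partial>M) = t" if "i \<in> {1..k}" for i
      using inc_moments_ab[OF order_refl t(1) t1 that] by auto
    define V where "V \<omega> = (\<Sum>i=1..k. (inc i 0 t \<omega>)\<^sup>2)" for \<omega>
    have V: "integrable M V" "(\<integral>\<omega>. V \<omega> \<partial>M) = real k * t"
      unfolding V_def using inc2 by (auto simp: Bochner_Integration.integral_sum)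
    have iU: "integrable M ?U"
      unfolding V_def[symmetric] using WL(1) V(1) by simp
    have "(\<integral>\<omega>. ?U \<omega> \<partial>M) = c * (sqrt t * (real k * C\<^sup>2 * (real k * t)) + (\<integral>\<omega>. (norm (W 0 t \<omega>))\<^sup>2 \<partial>M) / sqrt t
      + (\<integral>\<omega>. (norm (W 0 t \<omega>))\<^sup>2 \<partial>M))"
      unfolding V_def[symmetric] using WL(1) V by simp
    also have "\<dots> \<le> c * (sqrt t * (real k * C\<^sup>2 * (real k * t)) + (cW * (t - 0)\<^sup>2) / sqrt t + cW * (t - 0)\<^sup>2)"
      using WL(2) c t by (intro mult_left_mono add_mono divide_right_mono) auto
    also have "\<dots> = t * h t"
    proof -
      have sq: "t\<^sup>2 / sqrt t = t * sqrt t"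
        using t by (simp add: power2_eq_square nonzero_divide_eq_eq mult.assoc)
      have "cW * t\<^sup>2 / sqrt t = cW * (t * sqrt t)" unfolding sq[symmetric] by simp
      then show ?thesis unfolding h_def by (simp add: power2_eq_square algebra_simps)
    qed
    finally have EU: "(\<integral>\<omega>. ?U \<omega> \<partial>M) \<le> t * h t" .
    have "AE \<omega> in M. 0 \<le> \<bar>?D \<omega>\<bar> \<and> \<bar>?D \<omega>\<bar> \<le> ?U \<omega>"
      using X_increment_decomp[of t]
    proof eventually_elim
      case (elim \<omega>)
      let ?l = "norm (?L t \<omega>)" and ?w = "norm (W 0 t \<omega>)"
      have "?D \<omega> = b (?L t \<omega>) (W 0 t \<omega>) + b (W 0 t \<omega>) (?L t \<omega>) + b (W 0 t \<omega>) (W 0 t \<omega>)"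
        unfolding elim by (simp add: b.add_left b.add_right)
      then have "\<bar>?D \<omega>\<bar> \<le> ?l * ?w * c + ?w * ?l * c + ?w * ?w * c"
        using c(2)[of "?L t \<omega>" "W 0 t \<omega>"] c(2)[of "W 0 t \<omega>" "?L t \<omega>"] c(2)[of "W 0 t \<omega>" "W 0 t \<omega>"] by linarith
      also have "\<dots> = c * (2 * (?l * ?w) + ?w\<^sup>2)" by (simp add: power2_eq_square algebra_simps)
      also have "\<dots> \<le> c * ((sqrt t * ?l\<^sup>2 + ?w\<^sup>2 / sqrt t) + ?w\<^sup>2)"
        using young_weighted[of "sqrt t" ?l ?w] t c by (intro mult_left_mono add_right_mono) auto
      also have "\<dots> \<le> ?U \<omega>"
        using lin_part_norm[OF x0(1), of t \<omega>] t c by (intro mult_left_mono add_right_mono) auto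
      finally show ?case by simp
    qed
    note AE_le = this
    have "(\<lambda>\<omega>. \<bar>?D \<omega>\<bar>) \<in> borel_measurable M" by measurable
    from expectation_le_of_le(2)[OF this iU EU AE_le]
    have ED: "(\<integral>\<omega>. \<bar>?D \<omega>\<bar> \<partial>M) \<le> t * h t" .
    have diff: "(1 / t) * (\<integral>\<omega>. b (?Y t \<omega>) (?Y t \<omega>) \<partial>M) - ?s = (1 / t) * (\<integral>\<omega>. ?D \<omega> \<partial>M)"
      using Yint[OF t(1) t1] LL[OF t(1)] t by (simp add: right_diff_distrib)
    have "\<bar>(1 / t) * (\<integral>\<omega>. b (?Y t \<omega>) (?Y t \<omega>) \<partial>M) - ?s\<bar> = (1 / t) * \<bar>\<integral>\<omega>. ?D \<omega> \<partial>M\<bar>"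
      unfolding diff using t by (simp only: abs_mult abs_of_pos zero_less_divide_1_iff)
    also have "\<dots> \<le> (1 / t) * (\<integral>\<omega>. \<bar>?D \<omega>\<bar> \<partial>M)"
      using t by (intro mult_left_mono integral_abs_bound) simp
    also have "\<dots> \<le> (1 / t) * (t * h t)" using ED t by (intro mult_left_mono) auto
    also have "\<dots> = h t" using t by simp
    finally show ?thesis .
  qed
  show "((\<lambda>t. (1 / t) * (\<integral>\<omega>. b (X t \<omega> - X 0 \<omega>) (X t \<omega> - X 0 \<omega>) \<partial>M)) \<longlongrightarrow> ?s) (at_right 0)"
  proof (rule tendsto_of_abs_diff_le)
    show "\<forall>\<^sub>F t in at_right 0. \<bar>(1 / t) * (\<integral>\<omega>. b (?Y t \<omega>) (?Y t \<omega>) \<partial>M) - ?s\<bar> \<le> h t"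
      unfolding eventually_at_right_field using le by (intro exI[of _ 1]) auto
    have "(h \<longlongrightarrow> c * (sqrt 0 * (real k * C\<^sup>2 * real k) + cW * sqrt 0 + cW * 0)) (at_right 0)"
      unfolding h_def by (intro tendsto_intros)
    then show "(h \<longlongrightarrow> 0) (at_right 0)" by simp
  qed
qed

text \<open>Within distance \<open>r\<close> of \<open>x0\<close> the Taylor bound gives at most
  \<open>\<epsilon> * cX * t\<close>. Farther away \<open>R\<close> is merely bounded, and
  Chebyshev's inequality with the second moment of the increment would give \<open>O(t)\<close>
  instead of \<open>o(t)\<close>. There the increment is split into \<open>lin_part\<close> and
  \<open>W\<close>: the square of \<open>W\<close> has order \<open>t\<^sup>2\<close> already, and
  the square of \<open>lin_part\<close> gains half an order from the factor
  \<open>norm (X t - X 0) / r \<ge> 1\<close>.\<close>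

lemma remainder_limit:
  fixes R :: "'a \<Rightarrow> real"
  assumes R: "continuous_on K R"
    and taylor: "\<And>\<epsilon>. 0 < \<epsilon> \<Longrightarrow> \<exists>r>0. \<forall>y\<in>K. norm (y - x0) < r \<longrightarrow> \<bar>R y\<bar> \<le> \<epsilon> * (norm (y - x0))\<^sup>2"
  shows "((\<lambda>t. (1 / t) * (\<integral>\<omega>. R (X t \<omega>) \<partial>M)) \<longlongrightarrow> 0) (at_right 0)"
proof (rule tendstoI)
  fix e :: real assume e: "0 < e"
  define \<epsilon> where "\<epsilon> = e / (2 * (cX + 1))"
  have \<epsilon>: "0 < \<epsilon>" using e cX_nonneg by (auto simp: \<epsilon>_def)
  have \<epsilon>': "\<epsilon> * cX \<le> e / 2"
  proof -
    have "\<epsilon> * cX \<le> \<epsilon> * (cX + 1)" using \<epsilon> by (intro mult_left_mono) auto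
    also have "\<dots> = e / 2" using cX_nonneg by (simp add: \<epsilon>_def field_simps)
    finally show ?thesis .
  qed
  obtain r where r: "0 < r" "\<And>y. y \<in> K \<Longrightarrow> norm (y - x0) < r \<Longrightarrow> \<bar>R y\<bar> \<le> \<epsilon> * (norm (y - x0))\<^sup>2"
    using taylor[OF \<epsilon>] by blast
  obtain m where m: "\<And>y. y \<in> K \<Longrightarrow> \<bar>R y\<bar> \<le> m"
    using compact_imp_bounded[OF compact_continuous_image[OF R K]] by (auto simp: bounded_iff)
  have m0: "0 \<le> m" using m[OF x0(1)] by linarith
  \<comment> \<open>In the far region \<open>r\<^sup>2\<close> is at most twice the squared norm of
    \<open>lin_part\<close> plus twice that of \<open>W\<close>; multiplication by
    \<open>m / r\<^sup>2\<close> gives \<open>P\<close> as the weight of the latter and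
    \<open>Q\<close> as the weight of the sum that bounds the former.\<close>
  define P where "P = 2 * m / r\<^sup>2"
  define Q where "Q = P * (real k * C\<^sup>2) / r"
  have PQ: "0 \<le> P" "0 \<le> Q" using m0 r(1) by (auto simp: P_def Q_def)
  define h where "h t = P * cW * t + Q * (real k * (3 + cX)) * sqrt t" for t
  have le: "\<bar>(1 / t) * (\<integral>\<omega>. R (X t \<omega>) \<partial>M)\<bar> \<le> e / 2 + h t" if t: "0 < t" "t < 1" for t
  proof -
    have t1: "t \<le> 1" using t by simp
    note WL = W_L2[OF order_refl t(1) t1] and XL = X_increment_L2[OF order_refl less_imp_le[OF t(1)] t1]
      and E3 = E_inc_inc_dX[OF order_refl t(1) t1]
    have Rm: "(\<lambda>\<omega>. \<bar>R (X t \<omega>)\<bar>) \<in> borel_measurable M"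
      using continuous_of_X_measurable'[OF R, of t] t by simp
    define V where "V \<omega> = (\<Sum>i=1..k. \<bar>inc i 0 t \<omega>\<bar> * \<bar>inc i 0 t \<omega>\<bar> * norm (X t \<omega> - X 0 \<omega>))" for \<omega>
    have V: "integrable M V" "(\<integral>\<omega>. V \<omega> \<partial>M) \<le> real k * ((3 + cX) * t * sqrt t)"
    proof -
      show "integrable M V" unfolding V_def by (intro Bochner_Integration.integrable_sum E3(1))
      have "(\<integral>\<omega>. V \<omega> \<partial>M) = (\<Sum>i=1..k. \<integral>\<omega>. \<bar>inc i 0 t \<omega>\<bar> * \<bar>inc i 0 t \<omega>\<bar> * norm (X t \<omega> - X 0 \<omega>) \<partial>M)"
        unfolding V_def by (intro Bochner_Integration.integral_sum E3(1))
      also have "\<dots> \<le> (\<Sum>i=1..k. (3 + cX) * (t - 0) * sqrt (t - 0))" by (intro sum_mono E3(2))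
      finally show "(\<integral>\<omega>. V \<omega> \<partial>M) \<le> real k * ((3 + cX) * t * sqrt t)" by simp
    qed
    let ?U = "\<lambda>\<omega>. \<epsilon> * (norm (X t \<omega> - X 0 \<omega>))\<^sup>2 + P * (norm (W 0 t \<omega>))\<^sup>2 + Q * V \<omega>"
    have iU: "integrable M ?U" using XL(1) WL(1) V(1) by simp
    have "(\<integral>\<omega>. ?U \<omega> \<partial>M) = \<epsilon> * (\<integral>\<omega>. (norm (X t \<omega> - X 0 \<omega>))\<^sup>2 \<partial>M) + P * (\<integral>\<omega>. (norm (W 0 t \<omega>))\<^sup>2 \<partial>M) + Q * (\<integral>\<omega>. V \<omega> \<partial>M)"
      using XL(1) WL(1) V(1) by simp
    also have "\<dots> \<le> \<epsilon> * (cX * (t - 0)) + P * (cW * (t - 0)\<^sup>2) + Q * (real k * ((3 + cX) * t * sqrt t))"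
      using XL(2) WL(2) V(2) \<epsilon> PQ by (intro add_mono mult_left_mono) auto
    also have "\<dots> = t * (\<epsilon> * cX + h t)" by (simp add: h_def power2_eq_square algebra_simps)
    finally have EU: "(\<integral>\<omega>. ?U \<omega> \<partial>M) \<le> t * (\<epsilon> * cX + h t)" .
    have "AE \<omega> in M. 0 \<le> \<bar>R (X t \<omega>)\<bar> \<and> \<bar>R (X t \<omega>)\<bar> \<le> ?U \<omega>"
      using X_increment_decomp[of t] x0(2) AE_space
    proof eventually_elim
      case (elim \<omega>)
      let ?y = "norm (X t \<omega> - X 0 \<omega>)" and ?w = "norm (W 0 t \<omega>)" and ?l = "norm (lin_part x0 t \<omega>)"
      have XK: "X t \<omega> \<in> K" using X_K t elim by auto
      have nn: "0 \<le> \<epsilon> * ?y\<^sup>2" "0 \<le> P * ?w\<^sup>2" "0 \<le> Q * V \<omega>"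
        using \<epsilon> PQ unfolding V_def
        by (intro mult_nonneg_nonneg sum_nonneg zero_le_power2 norm_ge_zero abs_ge_zero; simp)+
      have "\<bar>R (X t \<omega>)\<bar> \<le> ?U \<omega>"
      proof (cases "?y < r")
        case True
        then have "\<bar>R (X t \<omega>)\<bar> \<le> \<epsilon> * ?y\<^sup>2" using r(2)[OF XK] elim(2) by simp
        then show ?thesis using nn by linarith
      next
        case False
        then have yr: "r \<le> ?y" by simp
        have "?y\<^sup>2 \<le> 2 * ?l\<^sup>2 + 2 * ?w\<^sup>2"
          unfolding elim(1) by (rule norm_add_squared_le)
        moreover have "r\<^sup>2 \<le> ?y\<^sup>2" using yr r(1) by (intro power_mono) auto
        moreover have "?l\<^sup>2 \<le> ?l\<^sup>2 * (?y / r)"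
        proof -
          have "1 \<le> ?y / r" using yr r(1) by simp
          then have "?l\<^sup>2 * 1 \<le> ?l\<^sup>2 * (?y / r)" by (intro mult_left_mono) auto
          then show ?thesis by simp
        qed
        moreover have "?l\<^sup>2 * (?y / r) \<le> real k * C\<^sup>2 * (\<Sum>i=1..k. (inc i 0 t \<omega>)\<^sup>2) * (?y / r)"
          using r(1) by (intro mult_right_mono lin_part_norm x0) auto
        ultimately have "r\<^sup>2 \<le> 2 * (real k * C\<^sup>2 * (\<Sum>i=1..k. (inc i 0 t \<omega>)\<^sup>2) * (?y / r)) + 2 * ?w\<^sup>2"
          by linarith
        also have "real k * C\<^sup>2 * (\<Sum>i=1..k. (inc i 0 t \<omega>)\<^sup>2) * (?y / r) = real k * C\<^sup>2 / r * V \<omega>"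
          by (simp add: V_def sum_distrib_left sum_distrib_right power2_eq_square sum_divide_distrib mult_ac)
        finally have "m / r\<^sup>2 * r\<^sup>2 \<le> m / r\<^sup>2 * (2 * (real k * C\<^sup>2 / r * V \<omega>) + 2 * ?w\<^sup>2)"
          using m0 by (intro mult_left_mono) auto
        also have "\<dots> = P * ?w\<^sup>2 + Q * V \<omega>"
          using r(1) by (simp add: P_def Q_def field_simps)
        finally have "m \<le> P * ?w\<^sup>2 + Q * V \<omega>" using r(1) by simp
        then show ?thesis using m[OF XK] nn by linarith
      qed
      then show ?case by simp
    qed
    from expectation_le_of_le(2)[OF Rm iU EU this]
    have ER: "(\<integral>\<omega>. \<bar>R (X t \<omega>)\<bar> \<partial>M) \<le> t * (\<epsilon> * cX + h t)" .
    have "\<bar>(1 / t) * (\<integral>\<omega>. R (X t \<omega>) \<partial>M)\<bar> \<le> (1 / t) * (\<integral>\<omega>. \<bar>R (X t \<omega>)\<bar> \<partial>M)"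
      using t integral_abs_bound[of M "\<lambda>\<omega>. R (X t \<omega>)"] by (simp add: abs_mult divide_right_mono)
    also have "\<dots> \<le> (1 / t) * (t * (\<epsilon> * cX + h t))" using ER t by (intro mult_left_mono) auto
    also have "\<dots> = \<epsilon> * cX + h t" using t by simp
    finally show ?thesis using \<epsilon>' by linarith
  qed
  have "(h \<longlongrightarrow> P * cW * 0 + Q * (real k * (3 + cX)) * sqrt 0) (at_right 0)"
    unfolding h_def by (intro tendsto_intros)
  then have "\<forall>\<^sub>F t in at_right 0. h t < e / 2"
    by (rule order_tendstoD) (use e in simp)
  moreover have "\<forall>\<^sub>F t in at_right (0::real). 0 < t \<and> t < 1"
    unfolding eventually_at_right_field by (intro exI[of _ 1]) auto
  ultimately show "\<forall>\<^sub>F t in at_right 0. dist ((1 / t) * (\<integral>\<omega>. R (X t \<omega>) \<partial>M)) 0 < e"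
  proof eventually_elim
    case (elim t)
    then show ?case using le[of t] by (simp add: dist_real_def)
  qed
qed

text \<open>The linear, the quadratic and the remainder part of the second-order expansion converge
  separately. As \<open>v\<close> is the limit of the averaged drift integral,
  \<open>v + drift x0\<close> is the Ito drift of the equation.\<close>

lemma generator_limit:
  fixes u l :: "'a \<Rightarrow> real" and b :: "'a \<Rightarrow> 'a \<Rightarrow> real"
  assumes A: "((\<lambda>t. (1 / t) *\<^sub>R (\<integral>\<omega>. A t \<omega> - A 0 \<omega> \<partial>M)) \<longlongrightarrow> v) (at_right 0)"
    and u: "continuous_on K u" and l: "bounded_linear l" and b: "bounded_bilinear b"
    and taylor: "\<And>\<epsilon>. 0 < \<epsilon> \<Longrightarrow> \<exists>r>0. \<forall>y\<in>K. norm (y - x0) < r \<longrightarrow>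
      \<bar>u y - u x0 - l (y - x0) - b (y - x0) (y - x0) / 2\<bar> \<le> \<epsilon> * (norm (y - x0))\<^sup>2"
  shows "((\<lambda>t. (1 / t) * (\<integral>\<omega>. u (X t \<omega>) - u (X 0 \<omega>) \<partial>M)) \<longlongrightarrow>
    l (v + drift x0) + (\<Sum>i=1..k. b (f i x0) (f i x0)) / 2) (at_right 0)"
proof -
  interpret l: bounded_linear l by fact
  interpret b: bounded_bilinear b by fact
  define R where "R y = u y - u x0 - l (y - x0) - b (y - x0) (y - x0) / 2" for y
  have R: "continuous_on K R"
    unfolding R_def by (intro continuous_intros u l.continuous_on b.continuous_on) auto
  have Rint: "integrable M (\<lambda>\<omega>. R (X t \<omega>))" if "0 < t" for t
  proof -
    obtain m where m: "\<And>y. y \<in> K \<Longrightarrow> \<bar>R y\<bar> \<le> m"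
      using compact_imp_bounded[OF compact_continuous_image[OF R K]] by (auto simp: bounded_iff)
    show ?thesis
      using that m X_K[of t] continuous_of_X_measurable'[OF R, of t]
      by (intro integrable_const_bound[where B = m] AE_I2) auto
  qed
  let ?Y = "\<lambda>t \<omega>. X t \<omega> - X 0 \<omega>"
  have "((\<lambda>t. l ((1 / t) *\<^sub>R (\<integral>\<omega>. ?Y t \<omega> \<partial>M)) + (1 / t) * (\<integral>\<omega>. b (?Y t \<omega>) (?Y t \<omega>) \<partial>M) / 2
      + (1 / t) * (\<integral>\<omega>. R (X t \<omega>) \<partial>M)) \<longlongrightarrow>
    l (v + drift x0) + (\<Sum>i=1..k. b (f i x0) (f i x0)) / 2 + 0) (at_right 0)"
    using taylor unfolding R_def[symmetric]
    by (intro tendsto_add tendsto_divide tendsto_const l.tendsto mean_limit[OF A] quadratic_limit[OF b]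
        remainder_limit[OF R]) auto
  then have "((\<lambda>t. l ((1 / t) *\<^sub>R (\<integral>\<omega>. ?Y t \<omega> \<partial>M)) + (1 / t) * (\<integral>\<omega>. b (?Y t \<omega>) (?Y t \<omega>) \<partial>M) / 2
      + (1 / t) * (\<integral>\<omega>. R (X t \<omega>) \<partial>M)) \<longlongrightarrow>
    l (v + drift x0) + (\<Sum>i=1..k. b (f i x0) (f i x0)) / 2) (at_right 0)" by simp
  moreover have "\<forall>\<^sub>F t in at_right 0. l ((1 / t) *\<^sub>R (\<integral>\<omega>. ?Y t \<omega> \<partial>M)) + (1 / t) * (\<integral>\<omega>. b (?Y t \<omega>) (?Y t \<omega>) \<partial>M) / 2
      + (1 / t) * (\<integral>\<omega>. R (X t \<omega>) \<partial>M) = (1 / t) * (\<integral>\<omega>. u (X t \<omega>) - u (X 0 \<omega>) \<partial>M)"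
    unfolding eventually_at_right_field
  proof (intro exI[of _ 1] conjI allI impI)
    fix t :: real assume t: "0 < t" "t < 1"
    then have t1: "t \<le> 1" by simp
    note Yi = X_increment_integrable(1)[OF t(1) t1] and bi = quadratic_integrable[OF b t(1) t1]
    have li: "integrable M (\<lambda>\<omega>. l (?Y t \<omega>))" using Yi by (rule integrable_bounded_linear[OF l])
    have um: "(\<lambda>\<omega>. u (X t \<omega>) - u (X 0 \<omega>)) \<in> borel_measurable M"
      using t by (intro borel_measurable_diff continuous_of_X_measurable'[OF u]) auto
    have "(\<integral>\<omega>. u (X t \<omega>) - u (X 0 \<omega>) \<partial>M) = (\<integral>\<omega>. l (?Y t \<omega>) + b (?Y t \<omega>) (?Y t \<omega>) / 2 + R (X t \<omega>) \<partial>M)"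
    proof (rule integral_cong_AE)
      show "AE \<omega> in M. u (X t \<omega>) - u (X 0 \<omega>) = l (?Y t \<omega>) + b (?Y t \<omega>) (?Y t \<omega>) / 2 + R (X t \<omega>)"
        using x0(2) by eventually_elim (simp add: R_def)
      show "(\<lambda>\<omega>. l (?Y t \<omega>) + b (?Y t \<omega>) (?Y t \<omega>) / 2 + R (X t \<omega>)) \<in> borel_measurable M"
        using borel_measurable_integrable[OF li] borel_measurable_integrable[OF bi]
          borel_measurable_integrable[OF Rint[OF t(1)]] by measurable
    qed (rule um)
    also have "\<dots> = l (\<integral>\<omega>. ?Y t \<omega> \<partial>M) + (\<integral>\<omega>. b (?Y t \<omega>) (?Y t \<omega>) \<partial>M) / 2 + (\<integral>\<omega>. R (X t \<omega>) \<partial>M)"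
      using li bi Rint[OF t(1)] integral_bounded_linear[OF l Yi] by simp
    finally show "l ((1 / t) *\<^sub>R (\<integral>\<omega>. ?Y t \<omega> \<partial>M)) + (1 / t) * (\<integral>\<omega>. b (?Y t \<omega>) (?Y t \<omega>) \<partial>M) / 2
      + (1 / t) * (\<integral>\<omega>. R (X t \<omega>) \<partial>M) = (1 / t) * (\<integral>\<omega>. u (X t \<omega>) - u (X 0 \<omega>) \<partial>M)"
      by (simp add: l.scaleR distrib_left)
  qed simp
  ultimately show ?thesis by (rule Lim_transform_eventually)
qed

end

end

section \<open>Vector fields of class C1 and Stratonovich solutions\<close>

text \<open>Differentiability is required of an extension to an open neighbourhood, so that
  \<open>Df\<close> is an ordinary derivative in the ambient space even when \<open>K\<close> is a
  sphere or a product of spheres. Continuity in each fixed direction is equivalent to continuity in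
  operator norm, the dimension being finite.\<close>

definition C1_near :: "'a::euclidean_space set \<Rightarrow> ('a \<Rightarrow> 'b::euclidean_space) \<Rightarrow> ('a \<Rightarrow> 'a \<Rightarrow> 'b) \<Rightarrow> bool" where
  "C1_near K f Df \<longleftrightarrow> (\<exists>U g. open U \<and> K \<subseteq> U \<and> (\<forall>x\<in>U. (g has_derivative Df x) (at x)) \<and>
     (\<forall>v. continuous_on U (\<lambda>x. Df x v)) \<and> (\<forall>x\<in>K. g x = f x))"

lemma norm_linear_le_sum_Basis:
  fixes L :: "'a::euclidean_space \<Rightarrow> 'b::real_normed_vector"
  assumes "linear L" shows "norm (L v) \<le> norm v * (\<Sum>e\<in>Basis. norm (L e))"
proof -
  interpret linear L by fact
  have "L v = (\<Sum>e\<in>Basis. (v \<bullet> e) *\<^sub>R L e)"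
    using arg_cong[OF euclidean_representation[of v], of L] by (simp add: sum scaleR)
  then have "norm (L v) \<le> (\<Sum>e\<in>Basis. \<bar>v \<bullet> e\<bar> * norm (L e))"
    using norm_sum[of "\<lambda>e. (v \<bullet> e) *\<^sub>R L e" Basis] by simp
  also have "\<dots> \<le> (\<Sum>e\<in>Basis. norm v * norm (L e))"
    by (intro sum_mono mult_right_mono Basis_le_norm) auto
  finally show ?thesis by (simp add: sum_distrib_left)
qed

lemma C1_near_linear:
  assumes "C1_near K f Df" "x \<in> K" shows "linear (Df x)"
  using assms has_derivative_linear unfolding C1_near_def by blast

lemma C1_near_continuous:
  assumes "C1_near K f Df"
  shows "continuous_on K f" "continuous_on K (\<lambda>x. Df x v)"
proof -
  obtain U g where U: "open U" "K \<subseteq> U" "\<And>x. x \<in> U \<Longrightarrow> (g has_derivative Df x) (at x)"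
    "\<And>v. continuous_on U (\<lambda>x. Df x v)" "\<And>x. x \<in> K \<Longrightarrow> g x = f x"
    using assms unfolding C1_near_def by blast
  have "continuous_on K g"
    using U(2,3) by (intro continuous_at_imp_continuous_on) (auto dest: has_derivative_continuous)
  then show "continuous_on K f" using U(5) by (simp cong: continuous_on_cong)
  show "continuous_on K (\<lambda>x. Df x v)" using U(4,2) by (rule continuous_on_subset)
qed

lemma C1_near_apply_continuous:
  assumes "C1_near K f Df" "continuous_on K h"
  shows "continuous_on K (\<lambda>x. Df x (h x))"
proof -
  have "Df x (h x) = (\<Sum>e\<in>Basis. (h x \<bullet> e) *\<^sub>R Df x e)" if "x \<in> K" for x
  proof -
    interpret linear "Df x" by (rule C1_near_linear[OF assms(1) that])
    show ?thesis
      using arg_cong[OF euclidean_representation[of "h x"], of "Df x"] by (simp add: sum scaleR)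
  qed
  moreover have "continuous_on K (\<lambda>x. \<Sum>e\<in>Basis. (h x \<bullet> e) *\<^sub>R Df x e)"
    by (intro continuous_intros assms C1_near_continuous[OF assms(1)])
  ultimately show ?thesis by (simp cong: continuous_on_cong)
qed

text \<open>Because \<open>K\<close> is not assumed convex, the mean value inequality is applied on
  balls inside a compact thickening of \<open>K\<close>; pairs farther apart than its radius are
  handled by boundedness. For the Taylor estimate it is applied to \<open>g - Df x\<close>, whose
  derivative is uniformly small near \<open>x\<close> by uniform continuity of \<open>Df\<close> on
  the thickening.\<close>

lemma C1_near_uniform:
  fixes f :: "'a::euclidean_space \<Rightarrow> 'b::euclidean_space"
  assumes K: "compact K" and f: "C1_near K f Df"
  shows C1_near_bounds: "\<exists>C\<ge>1. (\<forall>x\<in>K. norm (f x) \<le> C) \<and> (\<forall>x\<in>K. \<forall>y\<in>K. norm (f x - f y) \<le> C * norm (x - y))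
      \<and> (\<forall>x\<in>K. \<forall>v. norm (Df x v) \<le> C * norm v)"
    and C1_near_taylor: "0 < \<epsilon> \<Longrightarrow> \<exists>r>0. \<forall>x\<in>K. \<forall>y\<in>K. norm (y - x) < r \<longrightarrow>
      norm (f y - f x - Df x (y - x)) \<le> \<epsilon> * norm (y - x)"
proof -
  obtain U g where U: "open U" "K \<subseteq> U" and g: "\<And>x. x \<in> U \<Longrightarrow> (g has_derivative Df x) (at x)"
    and Dc: "\<And>v. continuous_on U (\<lambda>x. Df x v)" and gf: "\<And>x. x \<in> K \<Longrightarrow> g x = f x"
    using f unfolding C1_near_def by blast
  obtain \<delta> where \<delta>: "0 < \<delta>" "(\<Union>x\<in>K. cball x \<delta>) \<subseteq> U"
    using compact_subset_open_imp_cball_epsilon_subset[OF K U] by blast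
  \<comment> \<open>The closed \<open>\<delta>\<close>-neighbourhood of \<open>K\<close>, written as
    a sum of two compact sets to make its compactness immediate.\<close>
  define K' where "K' = (\<Union>x\<in>K. \<Union>y\<in>cball 0 \<delta>. {x + y})"
  have K': "compact K'" unfolding K'_def by (intro compact_sums' K compact_cball)
  have ball_K': "cball x \<delta> \<subseteq> K'" if "x \<in> K" for x
  proof
    fix z assume "z \<in> cball x \<delta>"
    then have "z = x + (z - x)" "z - x \<in> cball 0 \<delta>" by (auto simp: dist_norm norm_minus_commute)
    then show "z \<in> K'" using that unfolding K'_def by blast
  qed
  have K'U: "K' \<subseteq> U"
    using \<delta>(2) unfolding K'_def by (force simp: dist_norm)
  have KK': "K \<subseteq> K'" using ball_K' \<delta>(1) by force
  note Dc' = continuous_on_subset[OF Dc K'U]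
  have lin: "linear (Df x)" if "x \<in> K'" for x
    using g K'U that has_derivative_linear by blast
  have "\<exists>b. \<forall>x\<in>K'. norm (Df x e) \<le> b" for e
    using compact_imp_bounded[OF compact_continuous_image[OF Dc' K']] by (auto simp: bounded_iff)
  then obtain b where b: "\<And>x e. x \<in> K' \<Longrightarrow> norm (Df x e) \<le> b e" by metis
  define c where "c = (\<Sum>e\<in>Basis. b e)"
  have Dle: "norm (Df x v) \<le> c * norm v" if x: "x \<in> K'" for x v
  proof -
    have "norm (Df x v) \<le> norm v * (\<Sum>e\<in>Basis. norm (Df x e))"
      by (rule norm_linear_le_sum_Basis[OF lin[OF x]])
    also have "\<dots> \<le> norm v * c" unfolding c_def by (intro mult_left_mono sum_mono b x) auto
    finally show ?thesis by (simp add: mult.commute)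
  qed
  obtain m where m: "\<And>x. x \<in> K \<Longrightarrow> norm (f x) \<le> m"
    using compact_imp_bounded[OF compact_continuous_image[OF C1_near_continuous(1)[OF f] K]]
    by (auto simp: bounded_iff)
  \<comment> \<open>The entry \<open>2 * m / \<delta>\<close> serves pairs at distance more than
    \<open>\<delta>\<close>, whose images differ by at most \<open>2 * m\<close>.\<close>
  define C where "C = max 1 (max m (max c (2 * m / \<delta>)))"
  have lip: "norm (f x - f y) \<le> C * norm (x - y)" if xy: "x \<in> K" "y \<in> K" for x y
  proof (cases "norm (x - y) \<le> \<delta>")
    case True
    have "norm (g x - g y) \<le> c * norm (x - y)"
    proof (rule differentiable_bound)
      show "convex (cball y \<delta>)" by simp
      show "(g has_derivative Df z) (at z within cball y \<delta>)" if "z \<in> cball y \<delta>" for z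
      proof -
        have "z \<in> U" using that \<delta>(2) xy by blast
        then show ?thesis by (rule has_derivative_at_withinI[OF g])
      qed
      show "onorm (Df z) \<le> c" if "z \<in> cball y \<delta>" for z
        using Dle ball_K'[OF xy(2)] that by (intro onorm_le) auto
      show "x \<in> cball y \<delta>" "y \<in> cball y \<delta>" using True \<delta>(1) by (auto simp: dist_norm norm_minus_commute)
    qed
    also have "\<dots> \<le> C * norm (x - y)" by (intro mult_right_mono) (auto simp: C_def)
    finally show ?thesis using gf xy by simp
  next
    case False
    have m0: "0 \<le> m" using m[OF xy(1)] norm_ge_zero order_trans by blast
    have "norm (f x - f y) \<le> 2 * m"
      using m[OF xy(1)] m[OF xy(2)] norm_triangle_ineq4[of "f x" "f y"] by linarith
    also have "2 * m = 2 * m / \<delta> * \<delta>" using \<delta>(1) by simp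
    also have "\<dots> \<le> C * norm (x - y)"
      using False \<delta>(1) m0 by (intro mult_mono) (auto simp: C_def)
    finally show ?thesis .
  qed
  have "norm (Df x v) \<le> C * norm v" if "x \<in> K" for x v
    using Dle[of x v] KK' that mult_right_mono[of c C "norm v"] by (force simp: C_def)
  moreover have "1 \<le> C" "\<forall>x\<in>K. norm (f x) \<le> C" using m by (force simp: C_def)+
  ultimately show "\<exists>C\<ge>1. (\<forall>x\<in>K. norm (f x) \<le> C) \<and> (\<forall>x\<in>K. \<forall>y\<in>K. norm (f x - f y) \<le> C * norm (x - y))
      \<and> (\<forall>x\<in>K. \<forall>v. norm (Df x v) \<le> C * norm v)"
    using lip by blast
  assume \<epsilon>: "0 < \<epsilon>"
  \<comment> \<open>A linear map is bounded by the sum of its norms over the basis, so each basis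
    direction gets its share of \<open>\<epsilon>\<close>.\<close>
  define \<epsilon>1 where "\<epsilon>1 = \<epsilon> / real (DIM('a))"
  have \<epsilon>1: "0 < \<epsilon>1" using \<epsilon> by (simp add: \<epsilon>1_def)
  have "\<exists>r>0. \<forall>x\<in>K'. \<forall>z\<in>K'. dist z x < r \<longrightarrow> norm (Df z e - Df x e) < \<epsilon>1" for e
    using compact_uniformly_continuous[OF Dc' K', of e] \<epsilon>1 unfolding uniformly_continuous_on_def dist_norm by blast
  then obtain \<rho> where \<rho>: "\<And>e. 0 < \<rho> e" "\<And>e x z. x \<in> K' \<Longrightarrow> z \<in> K' \<Longrightarrow> dist z x < \<rho> e \<Longrightarrow> norm (Df z e - Df x e) < \<epsilon>1"
    by metis
  define r where "r = Min (insert \<delta> (\<rho> ` Basis))"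
  have r: "0 < r" "r \<le> \<delta>"
    using \<rho>(1) \<delta>(1) by (auto simp: r_def)
  have r_le: "r \<le> \<rho> e" if "e \<in> Basis" for e
    unfolding r_def using that by (intro Min_le) auto
  have "norm (f y - f x - Df x (y - x)) \<le> \<epsilon> * norm (y - x)" if xy: "x \<in> K" "y \<in> K" "norm (y - x) < r" for x y
  proof -
    have sub: "ball x r \<subseteq> K'" using ball_K'[OF xy(1)] r(2) by force
    have xK': "x \<in> K'" using KK' xy by blast
    interpret Dx: linear "Df x" by (rule lin[OF xK'])
    have bl: "bounded_linear (Df x)" using g K'U xK' has_derivative_bounded_linear by blast
    have "norm ((g y - Df x y) - (g x - Df x x)) \<le> \<epsilon> * norm (y - x)"
    proof (rule differentiable_bound)
      show "convex (ball x r)" by simp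
      show "((\<lambda>z. g z - Df x z) has_derivative (\<lambda>v. Df z v - Df x v)) (at z within ball x r)" if "z \<in> ball x r" for z
      proof -
        have "z \<in> U" using that sub K'U by blast
        then show ?thesis
          by (intro has_derivative_diff has_derivative_at_withinI[OF g] bounded_linear_imp_has_derivative[OF bl])
      qed
      show "onorm (\<lambda>v. Df z v - Df x v) \<le> \<epsilon>" if z: "z \<in> ball x r" for z
      proof (rule onorm_le)
        fix v
        have zK': "z \<in> K'" using sub z by blast
        have "linear (\<lambda>v. Df z v - Df x v)" by (intro linear_compose_sub lin zK' xK')
        then have "norm (Df z v - Df x v) \<le> norm v * (\<Sum>e\<in>Basis. norm (Df z e - Df x e))"
          by (rule norm_linear_le_sum_Basis)
        also have "\<dots> \<le> norm v * (\<Sum>e\<in>(Basis::'a set). \<epsilon>1)"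
        proof (intro mult_left_mono[OF _ norm_ge_zero] sum_mono less_imp_le[OF \<rho>(2)[OF xK' zK']])
          fix e :: 'a assume "e \<in> Basis"
          then show "dist z x < \<rho> e" using r_le[of e] z by (simp add: dist_commute)
        qed
        also have "\<dots> = \<epsilon> * norm v" by (simp add: \<epsilon>1_def)
        finally show "norm (Df z v - Df x v) \<le> \<epsilon> * norm v" .
      qed
      show "y \<in> ball x r" "x \<in> ball x r" using xy r(1) by (auto simp: dist_norm norm_minus_commute)
    qed
    moreover have "(g y - Df x y) - (g x - Df x x) = f y - f x - Df x (y - x)"
      using gf xy by (simp add: Dx.diff)
    ultimately show ?thesis by simp
  qed
  then show "\<exists>r>0. \<forall>x\<in>K. \<forall>y\<in>K. norm (y - x) < r \<longrightarrow>
      norm (f y - f x - Df x (y - x)) \<le> \<epsilon> * norm (y - x)" using r(1) by blast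
qed

text \<open>The quadratic polynomial is subtracted from \<open>g\<close> along the segment from
  \<open>x\<close> to \<open>y\<close>. The derivative of the difference is the first-order error of
  the gradient, which is small because the partial derivatives \<open>D e\<close> are differentiable
  at \<open>x\<close>; the mean value inequality on \<open>{0..1}\<close> then gives the
  bound.\<close>

lemma second_order_taylor:
  fixes g :: "'a::euclidean_space \<Rightarrow> real"
  assumes U: "open U" "x \<in> U"
    and g: "\<And>z. z \<in> U \<Longrightarrow> (g has_derivative (\<lambda>h. \<Sum>e\<in>Basis. (h \<bullet> e) *\<^sub>R D e z)) (at z)"
    and D: "\<And>e. e \<in> Basis \<Longrightarrow> (D e has_derivative (\<lambda>h. \<Sum>e'\<in>Basis. (h \<bullet> e') *\<^sub>R D2 e e')) (at x)"
    and \<epsilon>: "0 < \<epsilon>"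
  shows "\<exists>r>0. \<forall>y. norm (y - x) < r \<longrightarrow>
    \<bar>g y - g x - (\<Sum>e\<in>Basis. ((y - x) \<bullet> e) * D e x)
      - (\<Sum>e\<in>Basis. \<Sum>e'\<in>Basis. ((y - x) \<bullet> e) * ((y - x) \<bullet> e') * D2 e e') / 2\<bar> \<le> \<epsilon> * (norm (y - x))\<^sup>2"
proof -
  define \<epsilon>1 where "\<epsilon>1 = \<epsilon> / real (DIM('a))"
  have \<epsilon>1: "0 < \<epsilon>1" using \<epsilon> by (simp add: \<epsilon>1_def)
  have "\<exists>r>0. \<forall>z. norm (z - x) < r \<longrightarrow>
      \<bar>D e z - D e x - (\<Sum>e'\<in>Basis. ((z - x) \<bullet> e') * D2 e e')\<bar> \<le> \<epsilon>1 * norm (z - x)" if "e \<in> Basis" for e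
    using D[OF that] \<epsilon>1 unfolding has_derivative_at_alt by fastforce
  then obtain \<rho> where \<rho>: "\<And>e. e \<in> Basis \<Longrightarrow> 0 < \<rho> e" "\<And>e z. e \<in> Basis \<Longrightarrow> norm (z - x) < \<rho> e \<Longrightarrow>
      \<bar>D e z - D e x - (\<Sum>e'\<in>Basis. ((z - x) \<bullet> e') * D2 e e')\<bar> \<le> \<epsilon>1 * norm (z - x)"
    by metis
  obtain \<delta> where \<delta>: "0 < \<delta>" "ball x \<delta> \<subseteq> U" using U by (auto simp: open_contains_ball)
  define r where "r = Min (insert \<delta> (\<rho> ` Basis))"
  have r: "0 < r" "r \<le> \<delta>"
    using \<rho>(1) \<delta>(1) by (auto simp: r_def)
  have r_le: "r \<le> \<rho> e" if "e \<in> Basis" for e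
    unfolding r_def using that by (intro Min_le) auto
  have "\<bar>g y - g x - (\<Sum>e\<in>Basis. ((y - x) \<bullet> e) * D e x)
      - (\<Sum>e\<in>Basis. \<Sum>e'\<in>Basis. ((y - x) \<bullet> e) * ((y - x) \<bullet> e') * D2 e e') / 2\<bar> \<le> \<epsilon> * (norm (y - x))\<^sup>2"
    if y: "norm (y - x) < r" for y
  proof -
    define v where "v = y - x"
    define l where "l = (\<Sum>e\<in>Basis. (v \<bullet> e) * D e x)"
    define q where "q = (\<Sum>e\<in>Basis. \<Sum>e'\<in>Basis. (v \<bullet> e) * (v \<bullet> e') * D2 e e')"
    define \<phi> where "\<phi> \<tau> = g (x + \<tau> *\<^sub>R v) - \<tau> * l - \<tau>\<^sup>2 * q / 2" for \<tau> :: real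
    define \<phi>' where "\<phi>' \<tau> = (\<Sum>e\<in>Basis. (v \<bullet> e) * (D e (x + \<tau> *\<^sub>R v) - D e x - (\<Sum>e'\<in>Basis. ((\<tau> *\<^sub>R v) \<bullet> e') * D2 e e')))" for \<tau> :: real
    have near: "norm (\<tau> *\<^sub>R v) \<le> norm v" if "\<tau> \<in> {0..1}" for \<tau>
      using that by (simp add: mult_left_le_one_le)
    have der: "(\<phi> has_real_derivative \<phi>' \<tau>) (at \<tau> within {0..1})" if \<tau>: "\<tau> \<in> {0..1}" for \<tau>
    proof -
      have "x + \<tau> *\<^sub>R v \<in> ball x \<delta>" using near[OF \<tau>] y r(2) by (simp add: dist_norm v_def)
      then have "x + \<tau> *\<^sub>R v \<in> U" using \<delta>(2) by blast
      note g[OF this]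
      then have "((\<lambda>\<tau>. g (x + \<tau> *\<^sub>R v)) has_derivative (\<lambda>h. \<Sum>e\<in>Basis. ((h *\<^sub>R v) \<bullet> e) *\<^sub>R D e (x + \<tau> *\<^sub>R v))) (at \<tau> within {0..1})"
        by (rule has_derivative_compose[rotated]) (auto intro!: derivative_eq_intros)
      moreover have "(\<lambda>h. \<Sum>e\<in>Basis. ((h *\<^sub>R v) \<bullet> e) *\<^sub>R D e (x + \<tau> *\<^sub>R v)) = (*) (\<Sum>e\<in>Basis. (v \<bullet> e) * D e (x + \<tau> *\<^sub>R v))"
        by (auto simp: fun_eq_iff sum_distrib_right intro!: sum.cong)
      ultimately have "((\<lambda>\<tau>. g (x + \<tau> *\<^sub>R v)) has_real_derivative (\<Sum>e\<in>Basis. (v \<bullet> e) * D e (x + \<tau> *\<^sub>R v))) (at \<tau> within {0..1})"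
        unfolding has_field_derivative_def by simp
      then have "(\<phi> has_real_derivative (\<Sum>e\<in>Basis. (v \<bullet> e) * D e (x + \<tau> *\<^sub>R v)) - l - \<tau> * q) (at \<tau> within {0..1})"
        unfolding \<phi>_def by (auto intro!: derivative_eq_intros)
      moreover have "(\<Sum>e\<in>Basis. (v \<bullet> e) * D e (x + \<tau> *\<^sub>R v)) - l - \<tau> * q = \<phi>' \<tau>"
        unfolding \<phi>'_def l_def q_def
        by (simp add: sum_distrib_left sum_subtractf right_diff_distrib mult_ac)
      ultimately show ?thesis by simp
    qed
    have bd: "\<bar>\<phi>' \<tau>\<bar> \<le> \<epsilon> * (norm v)\<^sup>2" if \<tau>: "\<tau> \<in> {0..1}" for \<tau>
    proof -
      have "\<bar>\<phi>' \<tau>\<bar> \<le> (\<Sum>e\<in>(Basis::'a set). norm v * (\<epsilon>1 * norm v))"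
        unfolding \<phi>'_def
      proof (rule order_trans[OF sum_abs sum_mono])
        fix e :: 'a assume e: "e \<in> Basis"
        have "norm (x + \<tau> *\<^sub>R v - x) < \<rho> e" using near[OF \<tau>] y r_le[OF e] by (simp add: v_def)
        from \<rho>(2)[OF e this] have "\<bar>D e (x + \<tau> *\<^sub>R v) - D e x - (\<Sum>e'\<in>Basis. ((\<tau> *\<^sub>R v) \<bullet> e') * D2 e e')\<bar> \<le> \<epsilon>1 * norm (\<tau> *\<^sub>R v)"
          by (simp only: add_diff_cancel_left')
        also have "\<dots> \<le> \<epsilon>1 * norm v" using near[OF \<tau>] \<epsilon>1 by (intro mult_left_mono) auto
        finally show "\<bar>(v \<bullet> e) * (D e (x + \<tau> *\<^sub>R v) - D e x - (\<Sum>e'\<in>Basis. ((\<tau> *\<^sub>R v) \<bullet> e') * D2 e e'))\<bar> \<le> norm v * (\<epsilon>1 * norm v)"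
          unfolding abs_mult by (intro mult_mono Basis_le_norm e) auto
      qed
      also have "\<dots> = \<epsilon> * (norm v)\<^sup>2" by (simp add: \<epsilon>1_def power2_eq_square)
      finally show ?thesis .
    qed
    have "norm (\<phi> 1 - \<phi> 0) \<le> \<epsilon> * (norm v)\<^sup>2 * norm (1 - 0 :: real)"
      by (rule field_differentiable_bound[where S = "{0..1}" and f' = \<phi>']) (use der bd in auto)
    moreover have "\<phi> 1 - \<phi> 0 = g y - g x - l - q / 2" by (simp add: \<phi>_def v_def)
    ultimately show ?thesis by (simp add: l_def q_def v_def)
  qed
  then show ?thesis using r(1) by blast
qed

lemma sum_lessThan_add:
  fixes f :: "nat \<Rightarrow> 'a::comm_monoid_add"
  shows "(\<Sum>j<a + b. f j) = (\<Sum>j<a. f j) + (\<Sum>j<b. f (a + j))"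
  by (induction b) (simp_all add: add.assoc)

text \<open>The fundamental theorem of calculus at the left endpoint 0, as a derivative within
  \<open>{0..1}\<close>.\<close>

lemma average_integral_tendsto:
  fixes \<phi> :: "real \<Rightarrow> 'a::euclidean_space"
  assumes "continuous_on {0..} \<phi>" "\<And>n. 0 < \<tau> n" "\<tau> \<longlonglongrightarrow> 0"
  shows "(\<lambda>n. (1 / \<tau> n) *\<^sub>R integral {0..\<tau> n} \<phi>) \<longlonglongrightarrow> \<phi> 0"
proof -
  have c: "continuous_on {0..1} \<phi>" using assms(1) by (rule continuous_on_subset) auto
  have "((\<lambda>u. integral {0..u} \<phi>) has_vector_derivative \<phi> 0) (at 0 within {0..1})"
    by (rule integral_has_vector_derivative[OF c]) simp
  then have lim: "((\<lambda>u. (1 / \<bar>u\<bar>) *\<^sub>R (integral {0..u} \<phi> - u *\<^sub>R \<phi> 0)) \<longlongrightarrow> 0) (at 0 within {0..1})"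
    unfolding has_vector_derivative_def has_derivative_within by simp
  have "\<forall>\<^sub>F n in sequentially. \<tau> n < 1" using assms(3) by (rule order_tendstoD) simp
  then have "\<forall>\<^sub>F n in sequentially. \<tau> n \<in> {0..1} \<and> \<tau> n \<noteq> 0"
    by eventually_elim (use assms(2) in \<open>auto simp: less_imp_le less_imp_neq[symmetric]\<close>)
  then have "filterlim \<tau> (at 0 within {0..1}) sequentially"
    using assms(3) by (simp add: filterlim_at)
  from filterlim_compose[OF lim this]
  have "(\<lambda>n. (1 / \<bar>\<tau> n\<bar>) *\<^sub>R (integral {0..\<tau> n} \<phi> - \<tau> n *\<^sub>R \<phi> 0) + \<phi> 0) \<longlonglongrightarrow> 0 + \<phi> 0"
    by (intro tendsto_add tendsto_const)
  moreover have "(1 / \<bar>\<tau> n\<bar>) *\<^sub>R (integral {0..\<tau> n} \<phi> - \<tau> n *\<^sub>R \<phi> 0) + \<phi> 0 = (1 / \<tau> n) *\<^sub>R integral {0..\<tau> n} \<phi>" for n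
    using assms(2)[of n] by (simp add: scaleR_diff_right)
  ultimately show ?thesis by simp
qed

section \<open>From the integral equation to the discrete equation\<close>

context brownian_setup
begin

lemma stratonovich_sum_measurable:
  fixes Y :: "real \<Rightarrow> 'w \<Rightarrow> 'b::euclidean_space"
  assumes i: "i \<in> {1..k}" and Y: "\<And>u. 0 \<le> u \<Longrightarrow> Y u \<in> borel_measurable M" and p: "\<And>j. j \<le> m \<Longrightarrow> 0 \<le> p j"
  shows "stratonovich_sum Y (B i) m p \<in> borel_measurable M"
  unfolding stratonovich_sum_def[abs_def]
proof (rule borel_measurable_sum)
  fix j assume "j \<in> {..<m}"
  then have p': "0 \<le> p j" "0 \<le> p (Suc j)" using p by auto
  have [measurable]: "Y (p j) \<in> borel_measurable M" "Y (p (Suc j)) \<in> borel_measurable M"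
    "B i (p j) \<in> borel_measurable M" "B i (p (Suc j)) \<in> borel_measurable M"
    using p' Y measurable_F_M[OF B_measurable[OF i p'(1)]] measurable_F_M[OF B_measurable[OF i p'(2)]] by auto
  show "(\<lambda>\<omega>. (B i (p (Suc j)) \<omega> - B i (p j) \<omega>) *\<^sub>R (1 / 2) *\<^sub>R (Y (p j) \<omega> + Y (p (Suc j)) \<omega>)) \<in> borel_measurable M"
    by measurable
qed

text \<open>The definition speaks of integrals from 0 only. A fixed fine partition of
  \<open>[0, s]\<close> is therefore put in front of the uniform one of \<open>[s, t]\<close>: the
  whole sum is close to \<open>Jt\<close>, its first part is close to \<open>Js\<close>, and the
  difference is the sum over \<open>[s, t]\<close>.\<close>

lemma stratonovich_increment:
  fixes Y :: "real \<Rightarrow> 'w \<Rightarrow> 'b::euclidean_space"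
  assumes i: "i \<in> {1..k}" and Y: "\<And>u. 0 \<le> u \<Longrightarrow> Y u \<in> borel_measurable M" and st: "0 \<le> s" "s < t"
    and Js: "has_stratonovich_integral M Y (B i) s Js" and Jt: "has_stratonovich_integral M Y (B i) t Jt"
  shows "vanishes_in_prob (\<lambda>n \<omega>. Jt \<omega> - Js \<omega> - stratonovich_sum Y (B i) n (uniform_pt s t n) \<omega>)"
  unfolding vanishes_in_prob_def
proof (intro allI impI)
  fix \<epsilon> :: real assume "0 < \<epsilon>"
  then have \<epsilon>: "0 < \<epsilon> / 2" by simp
  obtain \<eta>1 where \<eta>1: "0 < \<eta>1" "\<forall>m p. p 0 = 0 \<and> p m = t \<and> (\<forall>j<m. p j \<le> p (Suc j) \<and> p (Suc j) - p j < \<eta>1) \<longrightarrow>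
        prob {\<omega>\<in>space M. norm (stratonovich_sum Y (B i) m p \<omega> - Jt \<omega>) > \<epsilon> / 2} < \<epsilon> / 2"
    using Jt[unfolded has_stratonovich_integral_def, THEN conjunct2, rule_format, OF \<epsilon>] by blast
  obtain \<eta>2 where \<eta>2: "0 < \<eta>2" "\<forall>m p. p 0 = 0 \<and> p m = s \<and> (\<forall>j<m. p j \<le> p (Suc j) \<and> p (Suc j) - p j < \<eta>2) \<longrightarrow>
        prob {\<omega>\<in>space M. norm (stratonovich_sum Y (B i) m p \<omega> - Js \<omega>) > \<epsilon> / 2} < \<epsilon> / 2"
    using Js[unfolded has_stratonovich_integral_def, THEN conjunct2, rule_format, OF \<epsilon>] by blast
  define \<eta> where "\<eta> = min \<eta>1 \<eta>2"
  have \<eta>: "0 < \<eta>" using \<eta>1 \<eta>2 by (simp add: \<eta>_def)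
  have mesh: "\<forall>\<^sub>F n in sequentially. 0 < n \<and> c / real n < \<eta>" for c
    by (intro eventually_conj eventually_gt_at_top order_tendstoD[OF lim_const_over_n] \<eta>)
  obtain N where N: "0 < N" "(s - 0) / real N < \<eta>"
    using mesh[of "s - 0"] by (auto simp: eventually_sequentially)
  let ?p0 = "uniform_pt 0 s N"
  have p0: "?p0 j \<le> ?p0 (Suc j)" "?p0 (Suc j) - ?p0 j < \<eta>" "0 \<le> ?p0 j" for j
    using uniform_pt_le_Suc[OF st(1)] uniform_pt_ge[OF st(1)] N(2) by (auto simp: uniform_pt_Suc_diff)
  show "\<forall>\<^sub>F n in sequentially. prob {\<omega>\<in>space M. norm (Jt \<omega> - Js \<omega> - stratonovich_sum Y (B i) n (uniform_pt s t n) \<omega>) > \<epsilon>} < \<epsilon>"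
    using mesh[of "t - s"]
  proof eventually_elim
    case (elim n)
    let ?q = "uniform_pt s t n"
    \<comment> \<open>At index \<open>N\<close> both branches give \<open>s\<close>, so the formula
      \<open>pN\<close> includes \<open>j = 0\<close> and no cell is lost at the junction.\<close>
    define p where "p j = (if j \<le> N then ?p0 j else ?q (j - N))" for j
    have q: "?q j \<le> ?q (Suc j)" "?q (Suc j) - ?q j < \<eta>" "0 \<le> ?q j" for j
      using uniform_pt_le_Suc[of s t] uniform_pt_ge[of s t n j] st elim by (auto simp: uniform_pt_Suc_diff)
    have pN: "p (N + j) = ?q j" for j using N(1) by (auto simp: p_def)
    have p_le: "p j = ?p0 j" if "j \<le> N" for j using that by (simp add: p_def)
    have split: "stratonovich_sum Y (B i) (N + n) p \<omega> = stratonovich_sum Y (B i) N ?p0 \<omega> + stratonovich_sum Y (B i) n ?q \<omega>" for \<omega>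
    proof -
      have "p (Suc (N + j)) = ?q (Suc j)" for j using pN[of "Suc j"] by simp
      then show ?thesis
        unfolding stratonovich_sum_def sum_lessThan_add by (simp add: pN p_le)
    qed
    have "p j \<le> p (Suc j) \<and> p (Suc j) - p j < \<eta>1" for j
    proof (cases "j < N")
      case True
      then show ?thesis using p0[of j] by (auto simp: p_le \<eta>_def)
    next
      case False
      then obtain j' where j': "j = N + j'" using le_Suc_ex by (metis not_less)
      show ?thesis using q[of j'] pN[of j'] pN[of "Suc j'"] by (auto simp: j' \<eta>_def)
    qed
    then have t1: "prob {\<omega>\<in>space M. norm (stratonovich_sum Y (B i) (N + n) p \<omega> - Jt \<omega>) > \<epsilon> / 2} < \<epsilon> / 2"
      using pN[of n] elim by (intro \<eta>1(2)[rule_format]) (auto simp: p_le)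
    have t2: "prob {\<omega>\<in>space M. norm (stratonovich_sum Y (B i) N ?p0 \<omega> - Js \<omega>) > \<epsilon> / 2} < \<epsilon> / 2"
      using p0 N by (intro \<eta>2(2)[rule_format]) (auto simp: \<eta>_def)
    have "0 \<le> p j" for j using p0(3) q(3) by (simp add: p_def)
    then have [measurable]: "stratonovich_sum Y (B i) (N + n) p \<in> borel_measurable M"
      "stratonovich_sum Y (B i) N ?p0 \<in> borel_measurable M"
      using p0(3) by (auto intro!: stratonovich_sum_measurable i Y)
    have [measurable]: "Jt \<in> borel_measurable M" "Js \<in> borel_measurable M"
      using Js Jt by (auto simp: has_stratonovich_integral_def)
    have "prob {\<omega>\<in>space M. norm (Jt \<omega> - Js \<omega> - stratonovich_sum Y (B i) n ?q \<omega>) > \<epsilon>}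
      \<le> prob {\<omega>\<in>space M. norm (stratonovich_sum Y (B i) (N + n) p \<omega> - Jt \<omega>) > \<epsilon> / 2}
        + prob {\<omega>\<in>space M. norm (stratonovich_sum Y (B i) N ?p0 \<omega> - Js \<omega>) > \<epsilon> / 2}"
    proof (rule prob_le_of_subset_Un)
      show "{\<omega>\<in>space M. norm (Jt \<omega> - Js \<omega> - stratonovich_sum Y (B i) n ?q \<omega>) > \<epsilon>}
        \<subseteq> {\<omega>\<in>space M. norm (stratonovich_sum Y (B i) (N + n) p \<omega> - Jt \<omega>) > \<epsilon> / 2}
        \<union> {\<omega>\<in>space M. norm (stratonovich_sum Y (B i) N ?p0 \<omega> - Js \<omega>) > \<epsilon> / 2}"
      proof
        fix \<omega> assume \<omega>: "\<omega> \<in> {\<omega>\<in>space M. norm (Jt \<omega> - Js \<omega> - stratonovich_sum Y (B i) n ?q \<omega>) > \<epsilon>}"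
        have eq: "Jt \<omega> - Js \<omega> - stratonovich_sum Y (B i) n ?q \<omega> =
          (stratonovich_sum Y (B i) N ?p0 \<omega> - Js \<omega>) - (stratonovich_sum Y (B i) (N + n) p \<omega> - Jt \<omega>)"
          unfolding split by simp
        have "\<epsilon> < norm (Jt \<omega> - Js \<omega> - stratonovich_sum Y (B i) n ?q \<omega>)" using \<omega> by simp
        note this[unfolded eq]
        then have "\<epsilon> < norm (stratonovich_sum Y (B i) N ?p0 \<omega> - Js \<omega>) + norm (stratonovich_sum Y (B i) (N + n) p \<omega> - Jt \<omega>)"
          using norm_triangle_ineq4[of "stratonovich_sum Y (B i) N ?p0 \<omega> - Js \<omega>" "stratonovich_sum Y (B i) (N + n) p \<omega> - Jt \<omega>"]
          by linarith
        then have "\<epsilon> / 2 < norm (stratonovich_sum Y (B i) N ?p0 \<omega> - Js \<omega>) \<or> \<epsilon> / 2 < norm (stratonovich_sum Y (B i) (N + n) p \<omega> - Jt \<omega>)"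
          by linarith
        then show "\<omega> \<in> {\<omega>\<in>space M. norm (stratonovich_sum Y (B i) (N + n) p \<omega> - Jt \<omega>) > \<epsilon> / 2}
          \<union> {\<omega>\<in>space M. norm (stratonovich_sum Y (B i) N ?p0 \<omega> - Js \<omega>) > \<epsilon> / 2}"
          using \<omega> by blast
      qed
    qed measurable
    then show ?case using t1 t2 by linarith
  qed
qed

text \<open>\<open>A\<close> is defined as what remains of the increment of \<open>X\<close> after
  the stochastic integrals, so it is measurable by construction. It agrees almost surely with the
  drift integral, from which it inherits the Lipschitz bound; the limit of its averaged mean is
  dominated convergence along sequences, with bound \<open>C\<close>.\<close>

lemma frame_of_solution:
  fixes f :: "nat \<Rightarrow> 'a::euclidean_space \<Rightarrow> 'a"
  assumes K: "compact K" and f0: "continuous_on K (f 0)"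
    and f: "\<And>i. i \<in> {1..k} \<Longrightarrow> C1_near K (f i) (Df i)"
    and sol: "stratonovich_solution M \<F> k B f K X"
    and x0: "x0 \<in> K" "AE \<omega> in M. X 0 \<omega> = x0"
  obtains C A where "stratonovich_frame M \<F> k B K f Df C X A"
    "((\<lambda>t. (1 / t) *\<^sub>R (\<integral>\<omega>. A t \<omega> - A 0 \<omega> \<partial>M)) \<longlongrightarrow> f 0 x0) (at_right 0)"
proof -
  have XK: "X t \<omega> \<in> K" if "0 \<le> t" "\<omega> \<in> space M" for t \<omega>
    using sol that by (auto simp: stratonovich_solution_def)
  have semi: "continuous_semimartingale M \<F> X" using sol by (auto simp: stratonovich_solution_def)
  then have ad: "continuous_adapted M \<F> X" by (simp add: continuous_semimartingale_def)
  have Xm: "X t \<in> borel_measurable (\<F> t)" if "0 \<le> t" for t using ad that by (simp add: continuous_adapted_def)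
  have XmM: "X t \<in> borel_measurable M" if "0 \<le> t" for t using Xm[OF that] by (rule measurable_F_M)
  obtain J where J: "\<And>i t. i \<in> {1..k} \<Longrightarrow> 0 \<le> t \<Longrightarrow> has_stratonovich_integral M (\<lambda>s \<omega>. f i (X s \<omega>)) (B i) t (J i t)"
    and eq: "\<And>t. 0 \<le> t \<Longrightarrow> AE \<omega> in M. X t \<omega> = X 0 \<omega> + integral {0..t} (\<lambda>s. f 0 (X s \<omega>)) + (\<Sum>i=1..k. J i t \<omega>)"
    using sol unfolding stratonovich_solution_def by blast
  have Jm: "J i t \<in> borel_measurable M" if "i \<in> {1..k}" "0 \<le> t" for i t
    using J[OF that] by (simp add: has_stratonovich_integral_def)
  have "\<forall>i\<in>{1..k}. \<exists>C\<ge>1. (\<forall>x\<in>K. norm (f i x) \<le> C) \<and> (\<forall>x\<in>K. \<forall>y\<in>K. norm (f i x - f i y) \<le> C * norm (x - y))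
      \<and> (\<forall>x\<in>K. \<forall>v. norm (Df i x v) \<le> C * norm v)"
    using C1_near_bounds[OF K f] by blast
  from bchoice[OF this] obtain c where
    cc: "\<forall>i\<in>{1..k}. 1 \<le> c i \<and> (\<forall>x\<in>K. norm (f i x) \<le> c i) \<and> (\<forall>x\<in>K. \<forall>y\<in>K. norm (f i x - f i y) \<le> c i * norm (x - y))
      \<and> (\<forall>x\<in>K. \<forall>v. norm (Df i x v) \<le> c i * norm v)" by blast
  have c: "\<And>i. i \<in> {1..k} \<Longrightarrow> 1 \<le> c i" "\<And>i x. i \<in> {1..k} \<Longrightarrow> x \<in> K \<Longrightarrow> norm (f i x) \<le> c i"
    "\<And>i x y. i \<in> {1..k} \<Longrightarrow> x \<in> K \<Longrightarrow> y \<in> K \<Longrightarrow> norm (f i x - f i y) \<le> c i * norm (x - y)"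
    "\<And>i x v. i \<in> {1..k} \<Longrightarrow> x \<in> K \<Longrightarrow> norm (Df i x v) \<le> c i * norm v"
    using cc by blast+
  obtain c0 where c0: "\<And>x. x \<in> K \<Longrightarrow> norm (f 0 x) \<le> c0"
    using compact_imp_bounded[OF compact_continuous_image[OF f0 K]] by (auto simp: bounded_iff)
  define C where "C = Max (insert 1 (insert c0 (c ` {1..k})))"
  have C: "1 \<le> C" "c0 \<le> C" "\<And>i. i \<in> {1..k} \<Longrightarrow> c i \<le> C"
    unfolding C_def by (rule Max_ge; simp)+
  define A where "A t \<omega> = X t \<omega> - X 0 \<omega> - (\<Sum>i=1..k. J i t \<omega>)" for t \<omega>
  have Am: "A t \<in> borel_measurable M" if "0 \<le> t" for t
    unfolding A_def using that by (intro borel_measurable_diff borel_measurable_sum XmM Jm) auto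
  have A_eq: "AE \<omega> in M. A t \<omega> = integral {0..t} (\<lambda>s. f 0 (X s \<omega>))" if "0 \<le> t" for t
    using eq[OF that] by eventually_elim (simp add: A_def algebra_simps)
  have path: "continuous_on {0..} (\<lambda>s. f 0 (X s \<omega>))" if \<omega>: "\<omega> \<in> space M" for \<omega>
  proof (rule continuous_on_compose2[OF f0])
    show "continuous_on {0..} (\<lambda>s. X s \<omega>)" using ad \<omega> by (simp add: continuous_adapted_def)
  qed (use XK \<omega> in auto)
  have A_lip: "AE \<omega> in M. norm (A t \<omega> - A s \<omega>) \<le> C * (t - s)" if st: "0 \<le> s" "s \<le> t" for s t
    using A_eq[OF st(1)] A_eq[OF order_trans[OF st]] AE_space
  proof eventually_elim
    case (elim \<omega>)
    have i: "(\<lambda>s. f 0 (X s \<omega>)) integrable_on {0..t}"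
      using path[OF elim(3)] by (intro integrable_continuous_real) (auto intro: continuous_on_subset)
    have "A t \<omega> - A s \<omega> = integral {s..t} (\<lambda>s. f 0 (X s \<omega>))"
      using Henstock_Kurzweil_Integration.integral_combine[OF st i] elim by (simp add: algebra_simps)
    also have "norm \<dots> \<le> C * (t - s)"
    proof (rule integral_bound[OF st(2)])
      show "continuous_on {s..t} (\<lambda>s. f 0 (X s \<omega>))"
        using path[OF elim(3)] by (rule continuous_on_subset) (use st in auto)
      show "norm (f 0 (X u \<omega>)) \<le> C" if "u \<in> {s..t}" for u
        using c0[OF XK[OF _ elim(3), of u]] that st C(2) by auto
    qed
    finally show ?case .
  qed
  have fXm: "(\<lambda>\<omega>. f i (X u \<omega>)) \<in> borel_measurable M" if "i \<in> {1..k}" "0 \<le> u" for i u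
    by (rule borel_measurable_continuous_compose_compact[OF K C1_near_continuous(1)[OF f[OF that(1)]] XmM[OF that(2)]])
      (use XK that in auto)
  have approx: "vanishes_in_prob (\<lambda>n \<omega>. X t \<omega> - X s \<omega> - (A t \<omega> - A s \<omega>)
        - (\<Sum>i=1..k. stratonovich_sum (\<lambda>u \<omega>. f i (X u \<omega>)) (B i) n (uniform_pt s t n) \<omega>))" if st: "0 \<le> s" "s < t" for s t
  proof -
    have t0: "0 \<le> t" using st by simp
    have "vanishes_in_prob (\<lambda>n \<omega>. \<Sum>i=1..k. J i t \<omega> - J i s \<omega> - stratonovich_sum (\<lambda>u \<omega>. f i (X u \<omega>)) (B i) n (uniform_pt s t n) \<omega>)"
    proof (rule vanishes_in_prob_sum)
      fix i assume i: "i \<in> {1..k}"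
      show "vanishes_in_prob (\<lambda>n \<omega>. J i t \<omega> - J i s \<omega> - stratonovich_sum (\<lambda>u \<omega>. f i (X u \<omega>)) (B i) n (uniform_pt s t n) \<omega>)"
        by (rule stratonovich_increment[OF i fXm[OF i] st J[OF i st(1)] J[OF i t0]])
      show "(\<lambda>\<omega>. J i t \<omega> - J i s \<omega> - stratonovich_sum (\<lambda>u \<omega>. f i (X u \<omega>)) (B i) n (uniform_pt s t n) \<omega>) \<in> borel_measurable M" for n
        using st t0 uniform_pt_ge[of s t n]
        by (intro borel_measurable_diff Jm i stratonovich_sum_measurable[OF i fXm[OF i]]) (auto intro: order_trans)
    qed
    moreover have "X t \<omega> - X s \<omega> - (A t \<omega> - A s \<omega>) - (\<Sum>i=1..k. S i) = (\<Sum>i=1..k. J i t \<omega> - J i s \<omega> - S i)" for \<omega> S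
      unfolding A_def by (simp add: sum_subtractf)
    ultimately show ?thesis by simp
  qed
  have "stratonovich_frame M \<F> k B K f Df C X A"
  proof (intro stratonovich_frame.intro stratonovich_frame_axioms.intro brownian_setup_axioms)
    show "\<exists>r>0. \<forall>i\<in>{1..k}. \<forall>x\<in>K. \<forall>y\<in>K. norm (y - x) < r \<longrightarrow>
        norm (f i y - f i x - Df i x (y - x)) \<le> \<epsilon> * norm (y - x)" if "0 < \<epsilon>" for \<epsilon>
    proof -
      have "\<forall>i\<in>{1..k}. \<exists>r>0. \<forall>x\<in>K. \<forall>y\<in>K. norm (y - x) < r \<longrightarrow>
          norm (f i y - f i x - Df i x (y - x)) \<le> \<epsilon> * norm (y - x)"
        using C1_near_taylor[OF K f that] by blast
      then obtain \<rho> where \<rho>: "\<And>i. i \<in> {1..k} \<Longrightarrow> 0 < \<rho> i" "\<And>i x y. i \<in> {1..k} \<Longrightarrow> x \<in> K \<Longrightarrow> y \<in> K \<Longrightarrow> norm (y - x) < \<rho> i \<Longrightarrow>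
          norm (f i y - f i x - Df i x (y - x)) \<le> \<epsilon> * norm (y - x)" by metis
      define r where "r = Min (insert 1 (\<rho> ` {1..k}))"
      have "0 < r" using \<rho>(1) by (auto simp: r_def)
      moreover have "r \<le> \<rho> i" if "i \<in> {1..k}" for i
        unfolding r_def using that by (intro Min_le) auto
      ultimately show ?thesis
        by (intro exI[of _ r] conjI ballI impI) (auto intro!: \<rho>(2) elim!: less_le_trans)
    qed
    show "norm (f i x) \<le> C" if "i \<in> {1..k}" "x \<in> K" for i x
      using c(2)[OF that] C(3)[OF that(1)] by linarith
    show "norm (f i x - f i y) \<le> C * norm (x - y)" if "i \<in> {1..k}" "x \<in> K" "y \<in> K" for i x y
      using order_trans[OF c(3)[OF that] mult_right_mono[OF C(3)[OF that(1)]]] by simp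
    show "norm (Df i x v) \<le> C * norm v" if "i \<in> {1..k}" "x \<in> K" for i x v
      using order_trans[OF c(4)[OF that] mult_right_mono[OF C(3)[OF that(1)]]] by simp
    show "tight_on (partitions_upto 1) (square_variation X)"
      by (rule semimartingale_tight[OF semi]) simp
    show "continuous_on K (f i)" if "i \<in> {1..k}" for i
      by (rule C1_near_continuous(1)[OF f[OF that]])
    show "linear (Df i x)" if "i \<in> {1..k}" "x \<in> K" for i x
      by (rule C1_near_linear[OF f[OF that(1)] that(2)])
    show "continuous_on K (\<lambda>x. Df i x (f l x))" if "i \<in> {1..k}" "l \<in> {1..k}" for i l
      by (rule C1_near_apply_continuous[OF f[OF that(1)] C1_near_continuous(1)[OF f[OF that(2)]]])
  qed (fact K C(1) XK Xm Am A_lip approx)+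
  moreover have "((\<lambda>t. (1 / t) *\<^sub>R (\<integral>\<omega>. A t \<omega> - A 0 \<omega> \<partial>M)) \<longlongrightarrow> f 0 x0) (at_right 0)"
    unfolding tendsto_at_iff_sequentially
  proof (intro allI impI)
    fix \<tau> :: "nat \<Rightarrow> real" assume \<tau>: "\<forall>n. \<tau> n \<in> {0<..} - {0}" "\<tau> \<longlonglongrightarrow> 0"
    then have pos: "0 < \<tau> n" for n by auto
    have "(\<lambda>n. \<integral>\<omega>. (1 / \<tau> n) *\<^sub>R (A (\<tau> n) \<omega> - A 0 \<omega>) \<partial>M) \<longlonglongrightarrow> (\<integral>\<omega>. f 0 x0 \<partial>M)"
    proof (rule integral_dominated_convergence[where w = "\<lambda>_. C"])
      show "(\<lambda>\<omega>. (1 / \<tau> n) *\<^sub>R (A (\<tau> n) \<omega> - A 0 \<omega>)) \<in> borel_measurable M" for n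
        using pos[of n] by (intro borel_measurable_scaleR borel_measurable_diff Am) auto
      show "AE \<omega> in M. norm ((1 / \<tau> n) *\<^sub>R (A (\<tau> n) \<omega> - A 0 \<omega>)) \<le> C" for n
        using A_lip[OF order_refl less_imp_le[OF pos[of n]]]
        by eventually_elim (use pos[of n] in \<open>simp add: divide_le_eq\<close>)
      have "AE \<omega> in M. \<forall>n. A (\<tau> n) \<omega> = integral {0..\<tau> n} (\<lambda>s. f 0 (X s \<omega>))"
        unfolding AE_all_countable using A_eq pos by (auto intro: less_imp_le)
      then show "AE \<omega> in M. (\<lambda>n. (1 / \<tau> n) *\<^sub>R (A (\<tau> n) \<omega> - A 0 \<omega>)) \<longlonglongrightarrow> f 0 x0"
        using A_eq[OF order_refl] x0(2) AE_space
      proof eventually_elim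
        case (elim \<omega>)
        show ?case
          using average_integral_tendsto[OF path[OF elim(4)] pos \<tau>(2)] elim by simp
      qed
    qed auto
    then show "((\<lambda>t. (1 / t) *\<^sub>R (\<integral>\<omega>. A t \<omega> - A 0 \<omega> \<partial>M)) \<circ> \<tau>) \<longlonglongrightarrow> f 0 x0"
      by (simp add: prob_space comp_def)
  qed
  ultimately show ?thesis using that by blast
qed

end

section \<open>Pairs of solutions\<close>

lemma differentiable_class_continuous:
  assumes "differentiable_class P (Suc m) U g"
  shows "continuous_on U g"
  using assms by (auto intro!: continuous_at_imp_continuous_on dest: has_derivative_continuous)

text \<open>The top-order condition \<open>P\<close> is arbitrary here, so continuity of the first
  partial derivatives is drawn from their own differentiability; this explains the two orders in the
  hypothesis.\<close>

lemma C1_near_of_differentiable_class: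
  assumes U: "open U" "S \<subseteq> U" and g: "differentiable_class P (Suc (Suc m)) U g" "\<And>x. x \<in> S \<Longrightarrow> g x = f x"
  shows "\<exists>Df. C1_near S f Df"
proof -
  obtain D where D: "\<And>x. x \<in> U \<Longrightarrow> (g has_derivative (\<lambda>h. \<Sum>e\<in>Basis. (h \<bullet> e) *\<^sub>R D e x)) (at x)"
    "\<And>e. e \<in> Basis \<Longrightarrow> differentiable_class P (Suc m) U (D e)"
    using g(1) by (auto simp del: differentiable_class.simps(2) simp: differentiable_class.simps(2)[of P "Suc m"])
  have "continuous_on U (\<lambda>x. \<Sum>e\<in>Basis. (v \<bullet> e) *\<^sub>R D e x)" for v
    by (intro continuous_intros differentiable_class_continuous[OF D(2)])
  then have "C1_near S f (\<lambda>x h. \<Sum>e\<in>Basis. (h \<bullet> e) *\<^sub>R D e x)"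
    unfolding C1_near_def using U g(2) D(1) by blast
  then show ?thesis by blast
qed

lemma C1_near_of_C_holder:
  assumes "C_holder_on 2 \<delta> S f" shows "\<exists>Df. C1_near S f Df"
  using assms C1_near_of_differentiable_class[where m = 0]
  unfolding C_holder_on_def numeral_2_eq_2 by metis

lemma continuous_of_C_holder:
  assumes "C_holder_on 1 \<delta> S f" shows "continuous_on S f"
proof -
  obtain U g where "S \<subseteq> U" "differentiable_class (holder_continuous_on \<delta>) (Suc 0) U g" "\<forall>x\<in>S. g x = f x"
    using assms unfolding C_holder_on_def One_nat_def by blast
  then have "continuous_on S g" by (blast intro: continuous_on_subset differentiable_class_continuous)
  then show ?thesis using \<open>\<forall>x\<in>S. g x = f x\<close> by (simp cong: continuous_on_cong)
qed

lemma C1_near_pair: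
  assumes "C1_near S f Df"
  shows "C1_near (S \<times> S) (\<lambda>z. (f (fst z), f (snd z))) (\<lambda>z h. (Df (fst z) (fst h), Df (snd z) (snd h)))"
proof -
  obtain U g where U: "open U" "S \<subseteq> U" "\<And>x. x \<in> U \<Longrightarrow> (g has_derivative Df x) (at x)"
    "\<And>v. continuous_on U (\<lambda>x. Df x v)" "\<And>x. x \<in> S \<Longrightarrow> g x = f x"
    using assms unfolding C1_near_def by blast
  have "((\<lambda>z. (g (fst z), g (snd z))) has_derivative (\<lambda>h. (Df (fst z) (fst h), Df (snd z) (snd h)))) (at z)"
    if "z \<in> U \<times> U" for z
  proof -
    have "((\<lambda>z. g (fst z)) has_derivative (\<lambda>h. Df (fst z) (fst h))) (at z)"
      using that by (intro has_derivative_compose[OF has_derivative_fst[OF has_derivative_ident] U(3)]) auto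
    moreover have "((\<lambda>z. g (snd z)) has_derivative (\<lambda>h. Df (snd z) (snd h))) (at z)"
      using that by (intro has_derivative_compose[OF has_derivative_snd[OF has_derivative_ident] U(3)]) auto
    ultimately show ?thesis by (rule has_derivative_Pair)
  qed
  moreover have "continuous_on (U \<times> U) (\<lambda>z. (Df (fst z) (fst v), Df (snd z) (snd v)))" for v
    by (intro continuous_on_Pair continuous_on_compose2[OF U(4) continuous_on_fst[OF continuous_on_id]]
        continuous_on_compose2[OF U(4) continuous_on_snd[OF continuous_on_id]]) auto
  ultimately show ?thesis
    unfolding C1_near_def using U
    by (intro exI[of _ "U \<times> U"] exI[of _ "\<lambda>z. (g (fst z), g (snd z))"]) (auto simp: open_Times)
qed

text \<open>Needed for finite combinations at once, because the chain rule for a linear map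
  expresses each partial derivative of the composition as such a combination.\<close>

lemma differentiable_class_linear_combination:
  assumes "finite I" "\<And>i. i \<in> I \<Longrightarrow> differentiable_class continuous_on m U (F i)"
  shows "differentiable_class continuous_on m U (\<lambda>x. \<Sum>i\<in>I. c i *\<^sub>R F i x)"
  using assms(2)
proof (induction m arbitrary: F)
  case 0
  then show ?case by (auto intro!: continuous_intros)
next
  case (Suc m)
  have "\<forall>i\<in>I. \<exists>D. (\<forall>x\<in>U. (F i has_derivative (\<lambda>h. \<Sum>e\<in>Basis. (h \<bullet> e) *\<^sub>R D e x)) (at x)) \<and>
          (\<forall>e\<in>Basis. differentiable_class continuous_on m U (D e))"
    using Suc.prems by simp
  from bchoice[OF this] obtain D where
    D: "\<And>i x. i \<in> I \<Longrightarrow> x \<in> U \<Longrightarrow> (F i has_derivative (\<lambda>h. \<Sum>e\<in>Basis. (h \<bullet> e) *\<^sub>R D i e x)) (at x)"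
    "\<And>i e. i \<in> I \<Longrightarrow> e \<in> Basis \<Longrightarrow> differentiable_class continuous_on m U (D i e)" by blast
  have "((\<lambda>x. \<Sum>i\<in>I. c i *\<^sub>R F i x) has_derivative (\<lambda>h. \<Sum>e\<in>Basis. (h \<bullet> e) *\<^sub>R (\<Sum>i\<in>I. c i *\<^sub>R D i e x))) (at x)"
    if x: "x \<in> U" for x
  proof -
    have "((\<lambda>x. \<Sum>i\<in>I. c i *\<^sub>R F i x) has_derivative (\<lambda>h. \<Sum>i\<in>I. c i *\<^sub>R (\<Sum>e\<in>Basis. (h \<bullet> e) *\<^sub>R D i e x))) (at x)"
      by (intro has_derivative_sum has_derivative_scaleR_right D x)
    moreover have "(\<Sum>i\<in>I. c i *\<^sub>R (\<Sum>e\<in>Basis. (h \<bullet> e) *\<^sub>R D i e x)) = (\<Sum>e\<in>Basis. (h \<bullet> e) *\<^sub>R (\<Sum>i\<in>I. c i *\<^sub>R D i e x))" for h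
      unfolding scaleR_sum_right by (subst sum.swap) (simp add: mult.commute)
    ultimately show ?thesis by simp
  qed
  then show ?case
    using Suc.IH D(2) by (auto intro!: exI[of _ "\<lambda>e x. \<Sum>i\<in>I. c i *\<^sub>R D i e x"])
qed

text \<open>The partial derivative of the composition along \<open>e\<close> combines the functions
  \<open>D e'\<close> after \<open>L\<close> with coefficients \<open>L e \<bullet> e'\<close>. The
  induction passes from \<open>g\<close> to these partial derivatives, hence \<open>g\<close> is
  kept arbitrary.\<close>

lemma differentiable_class_compose_linear:
  fixes L :: "'a::euclidean_space \<Rightarrow> 'b::euclidean_space" and g :: "'b \<Rightarrow> 'c::euclidean_space"
  assumes L: "bounded_linear L" and g: "differentiable_class continuous_on m U g"
  shows "differentiable_class continuous_on m (L -` U) (\<lambda>x. g (L x))"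
  using g
proof (induction m arbitrary: g)
  case 0
  then show ?case
    using continuous_on_compose2[of U g "L -` U" L] linear_continuous_on[OF L] by auto
next
  case (Suc m)
  interpret L: bounded_linear L by fact
  obtain D where D: "\<And>x. x \<in> U \<Longrightarrow> (g has_derivative (\<lambda>h. \<Sum>e\<in>Basis. (h \<bullet> e) *\<^sub>R D e x)) (at x)"
    "\<And>e. e \<in> Basis \<Longrightarrow> differentiable_class continuous_on m U (D e)"
    using Suc.prems by auto
  have "((\<lambda>x. g (L x)) has_derivative (\<lambda>h. \<Sum>e\<in>Basis. (h \<bullet> e) *\<^sub>R (\<Sum>e'\<in>Basis. (L e \<bullet> e') *\<^sub>R D e' (L x)))) (at x)"
    if x: "x \<in> L -` U" for x
  proof -
    have 1: "((\<lambda>x. g (L x)) has_derivative (\<lambda>h. \<Sum>e'\<in>Basis. (L h \<bullet> e') *\<^sub>R D e' (L x))) (at x)"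
      using x by (intro has_derivative_compose[OF bounded_linear_imp_has_derivative[OF L] D(1)]) auto
    have 2: "(\<Sum>e'\<in>Basis. (L h \<bullet> e') *\<^sub>R D e' (L x))
      = (\<Sum>e\<in>Basis. (h \<bullet> e) *\<^sub>R (\<Sum>e'\<in>Basis. (L e \<bullet> e') *\<^sub>R D e' (L x)))" for h
    proof -
      have "L h = (\<Sum>e\<in>Basis. (h \<bullet> e) *\<^sub>R L e)"
        using arg_cong[OF euclidean_representation[of h], of L] by (simp add: L.sum L.scaleR)
      then have "L h \<bullet> e' = (\<Sum>e\<in>Basis. (h \<bullet> e) * (L e \<bullet> e'))" for e'
        by (simp add: inner_sum_left)
      then show ?thesis
        unfolding scaleR_sum_right by (subst sum.swap) (simp add: scaleR_sum_left)
    qed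
    show ?thesis by (rule has_derivative_eq_rhs[OF 1 ext[OF 2]])
  qed
  moreover have "differentiable_class continuous_on m (L -` U) (\<lambda>x. \<Sum>e'\<in>Basis. (L e \<bullet> e') *\<^sub>R D e' (L x))" for e
    by (rule differentiable_class_linear_combination) (auto intro: Suc.IH D(2))
  ultimately show ?case
    by (auto intro!: exI[of _ "\<lambda>e x. \<Sum>e'\<in>Basis. (L e \<bullet> e') *\<^sub>R D e' (L x)"])
qed

text \<open>Turns a test function on the product into one on the sphere, by restriction to the graph
  of the identity or of the antipodal map. Compactness of \<open>S\<close> takes care of the
  support.\<close>

lemma smooth_compact_support_compose_linear:
  assumes L: "bounded_linear L" "\<And>x. x \<in> S \<Longrightarrow> L x \<in> T" and S: "compact S"
    and u: "smooth_compact_support T u"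
  shows "smooth_compact_support S (\<lambda>x. u (L x))"
proof -
  obtain U g where U: "open U" "T \<subseteq> U" "\<And>m. differentiable_class continuous_on m U g" "\<And>x. x \<in> T \<Longrightarrow> g x = u x"
    using u unfolding smooth_compact_support_def by blast
  have "open (L -` U)"
    using U(1) L(1) by (intro open_vimage linear_continuous_on)
  moreover have "S \<subseteq> L -` U" using L(2) U(2) by auto
  ultimately show ?thesis
    unfolding smooth_compact_support_def
    using differentiable_class_compose_linear[OF L(1) U(3)] U(4) L(2) S
    by (intro conjI exI[of _ "L -` U"] exI[of _ "\<lambda>x. g (L x)"]) (auto intro: compact_Int_closed)
qed

lemma bounded_bilinear_coords:
  fixes a :: "'a::euclidean_space \<Rightarrow> 'a \<Rightarrow> real"
  shows "bounded_bilinear (\<lambda>x y. \<Sum>e\<in>Basis. \<Sum>e'\<in>Basis. (x \<bullet> e) * (y \<bullet> e') * a e e')"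
  unfolding bilinear_conv_bounded_bilinear[symmetric] bilinear_def
  by (auto intro!: linearI simp: inner_add_left algebra_simps sum.distrib sum_distrib_left)

section \<open>Stratonovich integrals and semimartingales under negation and pairing\<close>

lemma partition_nonneg:
  fixes p :: "nat \<Rightarrow> real"
  assumes "p 0 = 0" "\<forall>j<m. p j \<le> p (Suc j) \<and> Q j" "j \<le> m"
  shows "0 \<le> p j"
  using assms(3)
proof (induction j)
  case (Suc j)
  then show ?case using assms(2) by (meson Suc_le_lessD less_imp_le order_trans)
qed (use assms(1) in simp)

text \<open>Partition points are nonnegative times, so agreement of the integrands there is enough.
  This matters because oddness of the fields can be used only where the solution is known to lie in
  \<open>S\<close>.\<close>

lemma has_stratonovich_integral_cong:
  assumes "\<And>s \<omega>. 0 \<le> s \<Longrightarrow> \<omega> \<in> space M \<Longrightarrow> Y s \<omega> = Y' s \<omega>"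
    and J: "has_stratonovich_integral M Y b t J"
  shows "has_stratonovich_integral M Y' b t J"
  unfolding has_stratonovich_integral_def
proof (intro conjI allI impI)
  show "J \<in> borel_measurable M" using J by (simp add: has_stratonovich_integral_def)
  fix \<epsilon> :: real assume "0 < \<epsilon>"
  then obtain \<eta> where \<eta>: "0 < \<eta>" "\<forall>m p. p 0 = 0 \<and> p m = t \<and> (\<forall>j<m. p j \<le> p (Suc j) \<and> p (Suc j) - p j < \<eta>) \<longrightarrow>
        measure M {\<omega>\<in>space M. norm (stratonovich_sum Y b m p \<omega> - J \<omega>) > \<epsilon>} < \<epsilon>"
    using J[unfolded has_stratonovich_integral_def, THEN conjunct2, rule_format, of \<epsilon>] by blast
  show "\<exists>\<eta>>0. \<forall>m p. p 0 = 0 \<and> p m = t \<and> (\<forall>j<m. p j \<le> p (Suc j) \<and> p (Suc j) - p j < \<eta>) \<longrightarrow>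
        measure M {\<omega>\<in>space M. norm (stratonovich_sum Y' b m p \<omega> - J \<omega>) > \<epsilon>} < \<epsilon>"
  proof (intro exI[of _ \<eta>] conjI allI impI \<eta>(1))
    fix m p assume p: "p 0 = 0 \<and> p m = t \<and> (\<forall>j<m. p j \<le> p (Suc j) \<and> p (Suc j) - p j < \<eta>)"
    have p0: "0 \<le> p j" if "j \<le> m" for j
      using p that by (blast intro: partition_nonneg)
    have "stratonovich_sum Y b m p \<omega> = stratonovich_sum Y' b m p \<omega>" if "\<omega> \<in> space M" for \<omega>
      unfolding stratonovich_sum_def using that p0 assms(1) by (intro sum.cong) auto
    then have "{\<omega>\<in>space M. norm (stratonovich_sum Y' b m p \<omega> - J \<omega>) > \<epsilon>} = {\<omega>\<in>space M. norm (stratonovich_sum Y b m p \<omega> - J \<omega>) > \<epsilon>}"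
      by auto
    then show "measure M {\<omega>\<in>space M. norm (stratonovich_sum Y' b m p \<omega> - J \<omega>) > \<epsilon>} < \<epsilon>"
      using \<eta>(2) p by simp
  qed
qed

lemma has_stratonovich_integral_minus:
  assumes J: "has_stratonovich_integral M Y b t J"
  shows "has_stratonovich_integral M (\<lambda>s \<omega>. - Y s \<omega>) b t (\<lambda>\<omega>. - J \<omega>)"
proof -
  have "stratonovich_sum (\<lambda>s \<omega>. - Y s \<omega>) b m p \<omega> - - J \<omega> = - (stratonovich_sum Y b m p \<omega> - J \<omega>)" for m p \<omega>
  proof -
    have "stratonovich_sum (\<lambda>s \<omega>. - Y s \<omega>) b m p \<omega> = - stratonovich_sum Y b m p \<omega>"
      unfolding stratonovich_sum_def sum_negf[symmetric]
      by (intro sum.cong refl) (simp add: algebra_simps)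
    then show ?thesis by simp
  qed
  then have "norm (stratonovich_sum (\<lambda>s \<omega>. - Y s \<omega>) b m p \<omega> - - J \<omega>) = norm (stratonovich_sum Y b m p \<omega> - J \<omega>)" for m p \<omega>
    by (metis norm_minus_cancel)
  then show ?thesis
    using J unfolding has_stratonovich_integral_def by simp
qed

text \<open>Each component gets half of \<open>\<epsilon>\<close>, both in size and in probability;
  measurability allows the two exceptional probabilities to be added.\<close>

lemma (in prob_space) has_stratonovich_integral_Pair:
  fixes Y Y' :: "real \<Rightarrow> 'a \<Rightarrow> 'b::euclidean_space"
  assumes J: "has_stratonovich_integral M Y b t J" and J': "has_stratonovich_integral M Y' b t J'"
    and m: "\<And>s. 0 \<le> s \<Longrightarrow> Y s \<in> borel_measurable M" "\<And>s. 0 \<le> s \<Longrightarrow> Y' s \<in> borel_measurable M"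
      "\<And>s. 0 \<le> s \<Longrightarrow> b s \<in> borel_measurable M"
  shows "has_stratonovich_integral M (\<lambda>s \<omega>. (Y s \<omega>, Y' s \<omega>)) b t (\<lambda>\<omega>. (J \<omega>, J' \<omega>))"
  unfolding has_stratonovich_integral_def
proof (intro conjI allI impI)
  have Jm[measurable]: "J \<in> borel_measurable M" "J' \<in> borel_measurable M"
    using J J' by (auto simp: has_stratonovich_integral_def)
  show "(\<lambda>\<omega>. (J \<omega>, J' \<omega>)) \<in> borel_measurable M" by measurable
  fix \<epsilon> :: real assume "0 < \<epsilon>"
  then have \<epsilon>: "0 < \<epsilon> / 2" by simp
  obtain \<eta>1 where \<eta>1: "0 < \<eta>1" "\<forall>m p. p 0 = 0 \<and> p m = t \<and> (\<forall>j<m. p j \<le> p (Suc j) \<and> p (Suc j) - p j < \<eta>1) \<longrightarrow>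
        prob {\<omega>\<in>space M. norm (stratonovich_sum Y b m p \<omega> - J \<omega>) > \<epsilon> / 2} < \<epsilon> / 2"
    using J[unfolded has_stratonovich_integral_def, THEN conjunct2, rule_format, OF \<epsilon>] by blast
  obtain \<eta>2 where \<eta>2: "0 < \<eta>2" "\<forall>m p. p 0 = 0 \<and> p m = t \<and> (\<forall>j<m. p j \<le> p (Suc j) \<and> p (Suc j) - p j < \<eta>2) \<longrightarrow>
        prob {\<omega>\<in>space M. norm (stratonovich_sum Y' b m p \<omega> - J' \<omega>) > \<epsilon> / 2} < \<epsilon> / 2"
    using J'[unfolded has_stratonovich_integral_def, THEN conjunct2, rule_format, OF \<epsilon>] by blast
  show "\<exists>\<eta>>0. \<forall>m p. p 0 = 0 \<and> p m = t \<and> (\<forall>j<m. p j \<le> p (Suc j) \<and> p (Suc j) - p j < \<eta>) \<longrightarrow>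
        prob {\<omega>\<in>space M. norm (stratonovich_sum (\<lambda>s \<omega>. (Y s \<omega>, Y' s \<omega>)) b m p \<omega> - (J \<omega>, J' \<omega>)) > \<epsilon>} < \<epsilon>"
  proof (intro exI[of _ "min \<eta>1 \<eta>2"] conjI allI impI)
    show "0 < min \<eta>1 \<eta>2" using \<eta>1 \<eta>2 by simp
    fix n p assume p: "p 0 = 0 \<and> p n = t \<and> (\<forall>j<n. p j \<le> p (Suc j) \<and> p (Suc j) - p j < min \<eta>1 \<eta>2)"
    have p0: "0 \<le> p j" if "j \<le> n" for j
      using p that by (blast intro: partition_nonneg)
    have sm: "stratonovich_sum V b n p \<in> borel_measurable M" if "\<And>s. 0 \<le> s \<Longrightarrow> V s \<in> borel_measurable M"
      for V :: "real \<Rightarrow> 'a \<Rightarrow> 'b"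
      unfolding stratonovich_sum_def[abs_def]
      by (intro borel_measurable_sum borel_measurable_scaleR borel_measurable_diff borel_measurable_add
          borel_measurable_const that m(3) p0) auto
    note [measurable] = sm[of Y, OF m(1)] sm[of Y', OF m(2)]
    have split: "stratonovich_sum (\<lambda>s \<omega>. (Y s \<omega>, Y' s \<omega>)) b n p \<omega> = (stratonovich_sum Y b n p \<omega>, stratonovich_sum Y' b n p \<omega>)" for \<omega>
      unfolding stratonovich_sum_def by (rule prod_eqI) (simp_all add: fst_sum snd_sum)
    have "prob {\<omega>\<in>space M. norm (stratonovich_sum (\<lambda>s \<omega>. (Y s \<omega>, Y' s \<omega>)) b n p \<omega> - (J \<omega>, J' \<omega>)) > \<epsilon>}
      \<le> prob {\<omega>\<in>space M. norm (stratonovich_sum Y b n p \<omega> - J \<omega>) > \<epsilon> / 2}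
      + prob {\<omega>\<in>space M. norm (stratonovich_sum Y' b n p \<omega> - J' \<omega>) > \<epsilon> / 2}"
    proof (rule prob_le_of_subset_Un)
      show "{\<omega>\<in>space M. norm (stratonovich_sum (\<lambda>s \<omega>. (Y s \<omega>, Y' s \<omega>)) b n p \<omega> - (J \<omega>, J' \<omega>)) > \<epsilon>}
        \<subseteq> {\<omega>\<in>space M. norm (stratonovich_sum Y b n p \<omega> - J \<omega>) > \<epsilon> / 2}
        \<union> {\<omega>\<in>space M. norm (stratonovich_sum Y' b n p \<omega> - J' \<omega>) > \<epsilon> / 2}"
      proof
        fix \<omega> assume \<omega>: "\<omega> \<in> {\<omega>\<in>space M. norm (stratonovich_sum (\<lambda>s \<omega>. (Y s \<omega>, Y' s \<omega>)) b n p \<omega> - (J \<omega>, J' \<omega>)) > \<epsilon>}"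
        then have "\<epsilon> < norm (stratonovich_sum Y b n p \<omega> - J \<omega>, stratonovich_sum Y' b n p \<omega> - J' \<omega>)"
          by (simp add: split)
        also have "\<dots> \<le> norm (stratonovich_sum Y b n p \<omega> - J \<omega>) + norm (stratonovich_sum Y' b n p \<omega> - J' \<omega>)"
          by (rule norm_Pair_le)
        finally have "\<epsilon> / 2 < norm (stratonovich_sum Y b n p \<omega> - J \<omega>) \<or> \<epsilon> / 2 < norm (stratonovich_sum Y' b n p \<omega> - J' \<omega>)"
          by linarith
        then show "\<omega> \<in> {\<omega>\<in>space M. norm (stratonovich_sum Y b n p \<omega> - J \<omega>) > \<epsilon> / 2}
          \<union> {\<omega>\<in>space M. norm (stratonovich_sum Y' b n p \<omega> - J' \<omega>) > \<epsilon> / 2}" using \<omega> by blast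
      qed
    qed measurable
    moreover have "prob {\<omega>\<in>space M. norm (stratonovich_sum Y b n p \<omega> - J \<omega>) > \<epsilon> / 2} < \<epsilon> / 2"
      using p by (intro \<eta>1(2)[rule_format]) auto
    moreover have "prob {\<omega>\<in>space M. norm (stratonovich_sum Y' b n p \<omega> - J' \<omega>) > \<epsilon> / 2} < \<epsilon> / 2"
      using p by (intro \<eta>2(2)[rule_format]) auto
    ultimately show "prob {\<omega>\<in>space M. norm (stratonovich_sum (\<lambda>s \<omega>. (Y s \<omega>, Y' s \<omega>)) b n p \<omega> - (J \<omega>, J' \<omega>)) > \<epsilon>} < \<epsilon>"
      by linarith
  qed
qed

lemma continuous_adapted_Pair:
  assumes "continuous_adapted M \<F> X" "continuous_adapted M \<F> Y"
  shows "continuous_adapted M \<F> (\<lambda>t \<omega>. (X t \<omega>, Y t \<omega>))"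
  using assms unfolding continuous_adapted_def
  by (auto intro!: borel_measurable_Pair continuous_on_Pair)

text \<open>A basis vector of the product has one zero component, so every coordinate of the pair is
  a coordinate of one of the two processes.\<close>

lemma continuous_semimartingale_Pair:
  assumes "continuous_semimartingale M \<F> X" "continuous_semimartingale M \<F> Y"
  shows "continuous_semimartingale M \<F> (\<lambda>t \<omega>. (X t \<omega>, Y t \<omega>))"
  unfolding continuous_semimartingale_def
proof (intro conjI ballI)
  show "continuous_adapted M \<F> (\<lambda>t \<omega>. (X t \<omega>, Y t \<omega>))"
    using assms by (intro continuous_adapted_Pair) (auto simp: continuous_semimartingale_def)
  fix e :: "'b \<times> 'c" assume "e \<in> Basis"
  then consider e' where "e = (e', 0)" "e' \<in> Basis" | e' where "e = (0, e')" "e' \<in> Basis"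
    by (auto simp: Basis_prod_def)
  then show "\<exists>N A\<^sub>1 A\<^sub>2 :: real \<Rightarrow> 'a \<Rightarrow> real.
        continuous_local_martingale M \<F> N \<and>
        continuous_adapted M \<F> A\<^sub>1 \<and> (\<forall>\<omega>\<in>space M. mono_on {0..} (\<lambda>t. A\<^sub>1 t \<omega>)) \<and>
        continuous_adapted M \<F> A\<^sub>2 \<and> (\<forall>\<omega>\<in>space M. mono_on {0..} (\<lambda>t. A\<^sub>2 t \<omega>)) \<and>
        (\<forall>\<omega>\<in>space M. N 0 \<omega> = 0 \<and> A\<^sub>1 0 \<omega> = 0 \<and> A\<^sub>2 0 \<omega> = 0) \<and>
        (\<forall>t\<ge>0. \<forall>\<omega>\<in>space M. (X t \<omega>, Y t \<omega>) \<bullet> e = (X 0 \<omega>, Y 0 \<omega>) \<bullet> e + N t \<omega> + (A\<^sub>1 t \<omega> - A\<^sub>2 t \<omega>))"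
  proof cases
    case 1
    then show ?thesis using assms(1) by (simp add: continuous_semimartingale_def)
  next
    case 2
    then show ?thesis using assms(2) by (simp add: continuous_semimartingale_def)
  qed
qed

section \<open>The antipodal symmetry, the coupled equation and its generator\<close>

context brownian_setup
begin

lemma martingale_minus:
  assumes "martingale M \<F> N" shows "martingale M \<F> (\<lambda>t \<omega>. - N t \<omega>)"
  unfolding martingale_def
proof (intro conjI allI impI)
  fix t :: real assume "0 \<le> t"
  then show "(\<lambda>\<omega>. - N t \<omega>) \<in> borel_measurable (\<F> t)" "integrable M (\<lambda>\<omega>. - N t \<omega>)"
    using assms by (auto simp: martingale_def)
next
  fix s t :: real assume st: "0 \<le> s \<and> s \<le> t"
  interpret S: finite_measure_subalgebra M "\<F> s"
    by unfold_locales (rule subalgebra_F)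
  have i: "integrable M (N t)" and e: "AE \<omega> in M. real_cond_exp M (\<F> s) (N t) \<omega> = N s \<omega>"
    using assms st by (auto simp: martingale_def)
  from S.real_cond_exp_cmult[OF i, of "- 1"] e
  show "AE \<omega> in M. real_cond_exp M (\<F> s) (\<lambda>\<omega>. - N t \<omega>) \<omega> = - N s \<omega>"
    by eventually_elim simp
qed

lemma continuous_adapted_minus:
  "continuous_adapted M \<F> X \<Longrightarrow> continuous_adapted M \<F> (\<lambda>t \<omega>. - X t \<omega>)"
  unfolding continuous_adapted_def by (auto intro!: borel_measurable_uminus continuous_on_minus)

lemma continuous_local_martingale_minus:
  assumes "continuous_local_martingale M \<F> N"
  shows "continuous_local_martingale M \<F> (\<lambda>t \<omega>. - N t \<omega>)"
  using assms continuous_adapted_minus martingale_minus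
  unfolding continuous_local_martingale_def by blast

text \<open>The two nondecreasing parts exchange their roles, since their negatives would not be
  nondecreasing.\<close>

lemma continuous_semimartingale_minus:
  fixes X :: "real \<Rightarrow> 'w \<Rightarrow> 'b::euclidean_space"
  assumes "continuous_semimartingale M \<F> X"
  shows "continuous_semimartingale M \<F> (\<lambda>t \<omega>. - X t \<omega>)"
  unfolding continuous_semimartingale_def
proof (intro conjI ballI)
  show "continuous_adapted M \<F> (\<lambda>t \<omega>. - X t \<omega>)"
    using assms by (intro continuous_adapted_minus) (simp add: continuous_semimartingale_def)
  fix e :: 'b assume "e \<in> Basis"
  then obtain N A\<^sub>1 A\<^sub>2 :: "real \<Rightarrow> 'w \<Rightarrow> real" where N: "continuous_local_martingale M \<F> N"
      and A1: "continuous_adapted M \<F> A\<^sub>1" "\<forall>\<omega>\<in>space M. mono_on {0..} (\<lambda>t. A\<^sub>1 t \<omega>)"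
      and A2: "continuous_adapted M \<F> A\<^sub>2" "\<forall>\<omega>\<in>space M. mono_on {0..} (\<lambda>t. A\<^sub>2 t \<omega>)"
      and A0: "\<forall>\<omega>\<in>space M. N 0 \<omega> = 0 \<and> A\<^sub>1 0 \<omega> = 0 \<and> A\<^sub>2 0 \<omega> = 0"
      and eq: "\<forall>t\<ge>0. \<forall>\<omega>\<in>space M. X t \<omega> \<bullet> e = X 0 \<omega> \<bullet> e + N t \<omega> + (A\<^sub>1 t \<omega> - A\<^sub>2 t \<omega>)"
    using assms unfolding continuous_semimartingale_def by blast
  have eq': "- X t \<omega> \<bullet> e = - X 0 \<omega> \<bullet> e + - N t \<omega> + (A\<^sub>2 t \<omega> - A\<^sub>1 t \<omega>)" if "0 \<le> t" "\<omega> \<in> space M" for t \<omega>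
    using eq[rule_format, OF that] by simp
  show "\<exists>N A\<^sub>1 A\<^sub>2 :: real \<Rightarrow> 'w \<Rightarrow> real.
        continuous_local_martingale M \<F> N \<and>
        continuous_adapted M \<F> A\<^sub>1 \<and> (\<forall>\<omega>\<in>space M. mono_on {0..} (\<lambda>t. A\<^sub>1 t \<omega>)) \<and>
        continuous_adapted M \<F> A\<^sub>2 \<and> (\<forall>\<omega>\<in>space M. mono_on {0..} (\<lambda>t. A\<^sub>2 t \<omega>)) \<and>
        (\<forall>\<omega>\<in>space M. N 0 \<omega> = 0 \<and> A\<^sub>1 0 \<omega> = 0 \<and> A\<^sub>2 0 \<omega> = 0) \<and>
        (\<forall>t\<ge>0. \<forall>\<omega>\<in>space M. - X t \<omega> \<bullet> e = - X 0 \<omega> \<bullet> e + N t \<omega> + (A\<^sub>1 t \<omega> - A\<^sub>2 t \<omega>))"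
  proof (rule exI[of _ "\<lambda>t \<omega>. - N t \<omega>"], rule exI[of _ A\<^sub>2], rule exI[of _ A\<^sub>1], intro conjI)
    show "\<forall>t\<ge>0. \<forall>\<omega>\<in>space M. - X t \<omega> \<bullet> e = - X 0 \<omega> \<bullet> e + - N t \<omega> + (A\<^sub>2 t \<omega> - A\<^sub>1 t \<omega>)"
      using eq' by blast
    show "\<forall>\<omega>\<in>space M. - N 0 \<omega> = 0 \<and> A\<^sub>2 0 \<omega> = 0 \<and> A\<^sub>1 0 \<omega> = 0" using A0 by simp
  qed (fact continuous_local_martingale_minus[OF N] A1 A2)+
qed

text \<open>The fields are odd, so along \<open>- X\<close> they are the negatives of their values
  along \<open>X\<close>, while the noise is unchanged. Hence the negatives of the integrals
  \<open>J\<close> solve the equation for \<open>- X\<close>.\<close>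

lemma stratonovich_solution_minus:
  assumes X: "stratonovich_solution M \<F> k B f S X"
    and S: "\<And>x. x \<in> S \<Longrightarrow> - x \<in> S"
    and odd: "\<And>i x. i \<in> {0..k} \<Longrightarrow> x \<in> S \<Longrightarrow> f i (- x) = - f i x"
  shows "stratonovich_solution M \<F> k B f S (\<lambda>t \<omega>. - X t \<omega>)"
proof -
  have XS: "X t \<omega> \<in> S" if "0 \<le> t" "\<omega> \<in> space M" for t \<omega>
    using X that by (auto simp: stratonovich_solution_def)
  obtain J where J: "\<And>i t. i \<in> {1..k} \<Longrightarrow> 0 \<le> t \<Longrightarrow> has_stratonovich_integral M (\<lambda>s \<omega>. f i (X s \<omega>)) (B i) t (J i t)"
    and eq: "\<And>t. 0 \<le> t \<Longrightarrow> AE \<omega> in M. X t \<omega> = X 0 \<omega> + integral {0..t} (\<lambda>s. f 0 (X s \<omega>)) + (\<Sum>i=1..k. J i t \<omega>)"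
    using X unfolding stratonovich_solution_def by blast
  have J': "has_stratonovich_integral M (\<lambda>s \<omega>. f i (- X s \<omega>)) (B i) t (\<lambda>\<omega>. - J i t \<omega>)"
    if "i \<in> {1..k}" "0 \<le> t" for i t
    by (rule has_stratonovich_integral_cong[OF _ has_stratonovich_integral_minus[OF J[OF that]]])
      (use that XS odd in auto)
  have eq': "AE \<omega> in M. - X t \<omega> = - X 0 \<omega> + integral {0..t} (\<lambda>s. f 0 (- X s \<omega>)) + (\<Sum>i=1..k. - J i t \<omega>)"
    if t: "0 \<le> t" for t
    using eq[OF t] AE_space
  proof eventually_elim
    case (elim \<omega>)
    have "integral {0..t} (\<lambda>s. f 0 (- X s \<omega>)) = integral {0..t} (\<lambda>s. - f 0 (X s \<omega>))"
      using elim(2) by (intro Henstock_Kurzweil_Integration.integral_cong odd XS) auto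
    also have "\<dots> = - integral {0..t} (\<lambda>s. f 0 (X s \<omega>))" by simp
    finally have i: "integral {0..t} (\<lambda>s. f 0 (- X s \<omega>)) = - integral {0..t} (\<lambda>s. f 0 (X s \<omega>))" .
    show ?case
      unfolding i sum_negf by (subst elim(1)) simp
  qed
  show ?thesis
    unfolding stratonovich_solution_def
  proof (intro conjI exI[of _ "\<lambda>i t \<omega>. - J i t \<omega>"])
    show "continuous_semimartingale M \<F> (\<lambda>t \<omega>. - X t \<omega>)"
      using X by (intro continuous_semimartingale_minus) (simp add: stratonovich_solution_def)
  qed (use XS S J' eq' in auto)
qed

text \<open>The common noise is essential: the pair is driven by the same \<open>k\<close> Brownian
  motions as each component, so it solves one equation whose fields act componentwise, and sums and
  integrals may be taken componentwise.\<close>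

lemma stratonovich_solution_Pair:
  fixes f :: "nat \<Rightarrow> 'a::euclidean_space \<Rightarrow> 'a"
  assumes X: "stratonovich_solution M \<F> k B f S X" and Y: "stratonovich_solution M \<F> k B f S Y"
    and S: "compact S" and f: "\<And>i. i \<in> {0..k} \<Longrightarrow> continuous_on S (f i)"
  shows "stratonovich_solution M \<F> k B (\<lambda>i z. (f i (fst z), f i (snd z))) (S \<times> S) (\<lambda>t \<omega>. (X t \<omega>, Y t \<omega>))"
proof -
  have XS: "X t \<omega> \<in> S" "Y t \<omega> \<in> S" if "0 \<le> t" "\<omega> \<in> space M" for t \<omega>
    using X Y that by (auto simp: stratonovich_solution_def)
  have semi: "continuous_semimartingale M \<F> X" "continuous_semimartingale M \<F> Y"
    using X Y by (auto simp: stratonovich_solution_def)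
  have ad: "continuous_adapted M \<F> X" "continuous_adapted M \<F> Y"
    using semi by (auto simp: continuous_semimartingale_def)
  have XM: "X t \<in> borel_measurable M" "Y t \<in> borel_measurable M" if "0 \<le> t" for t
    using ad that measurable_F_M[of "X t" t] measurable_F_M[of "Y t" t] by (auto simp: continuous_adapted_def)
  obtain J where J: "\<And>i t. i \<in> {1..k} \<Longrightarrow> 0 \<le> t \<Longrightarrow> has_stratonovich_integral M (\<lambda>s \<omega>. f i (X s \<omega>)) (B i) t (J i t)"
    and eq: "\<And>t. 0 \<le> t \<Longrightarrow> AE \<omega> in M. X t \<omega> = X 0 \<omega> + integral {0..t} (\<lambda>s. f 0 (X s \<omega>)) + (\<Sum>i=1..k. J i t \<omega>)"
    using X unfolding stratonovich_solution_def by blast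
  obtain J' where J': "\<And>i t. i \<in> {1..k} \<Longrightarrow> 0 \<le> t \<Longrightarrow> has_stratonovich_integral M (\<lambda>s \<omega>. f i (Y s \<omega>)) (B i) t (J' i t)"
    and eq': "\<And>t. 0 \<le> t \<Longrightarrow> AE \<omega> in M. Y t \<omega> = Y 0 \<omega> + integral {0..t} (\<lambda>s. f 0 (Y s \<omega>)) + (\<Sum>i=1..k. J' i t \<omega>)"
    using Y unfolding stratonovich_solution_def by blast
  have JJ: "has_stratonovich_integral M (\<lambda>s \<omega>. (f i (fst (X s \<omega>, Y s \<omega>)), f i (snd (X s \<omega>, Y s \<omega>)))) (B i) t
      (\<lambda>\<omega>. (J i t \<omega>, J' i t \<omega>))" if i: "i \<in> {1..k}" and t: "0 \<le> t" for i t
    unfolding fst_conv snd_conv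
  proof (rule has_stratonovich_integral_Pair[OF J[OF i t] J'[OF i t]])
    fix s :: real assume s: "0 \<le> s"
    have fc: "continuous_on S (f i)" using i by (intro f) auto
    show "(\<lambda>\<omega>. f i (X s \<omega>)) \<in> borel_measurable M" "(\<lambda>\<omega>. f i (Y s \<omega>)) \<in> borel_measurable M"
      using XM[OF s] XS[OF s] by (auto intro!: borel_measurable_continuous_compose_compact[OF S fc])
    show "B i s \<in> borel_measurable M" using B_measurable[OF i s] by (rule measurable_F_M)
  qed
  have EE: "AE \<omega> in M. (X t \<omega>, Y t \<omega>) = (X 0 \<omega>, Y 0 \<omega>)
      + integral {0..t} (\<lambda>s. (f 0 (fst (X s \<omega>, Y s \<omega>)), f 0 (snd (X s \<omega>, Y s \<omega>)))) + (\<Sum>i=1..k. (J i t \<omega>, J' i t \<omega>))"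
    if t: "0 \<le> t" for t
    using eq[OF t] eq'[OF t] AE_space
  proof eventually_elim
    case (elim \<omega>)
    have path: "(\<lambda>s. f 0 (V s \<omega>)) integrable_on {0..t}"
      if V: "continuous_adapted M \<F> V" "\<And>s. 0 \<le> s \<Longrightarrow> V s \<omega> \<in> S" for V
    proof (rule integrable_continuous_real, rule continuous_on_compose2[of S "f 0"])
      show "continuous_on {0..t} (\<lambda>s. V s \<omega>)"
        using V(1) elim(3) by (auto simp: continuous_adapted_def intro: continuous_on_subset)
    qed (use f V(2) in auto)
    have i: "(\<lambda>s. f 0 (X s \<omega>)) integrable_on {0..t}" "(\<lambda>s. f 0 (Y s \<omega>)) integrable_on {0..t}"
      using ad XS elim(3) by (auto intro!: path)
    let ?I = "\<lambda>V. integral {0..t} (\<lambda>s. f 0 (V s \<omega>))"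
    have "((\<lambda>s. (f 0 (X s \<omega>), f 0 (Y s \<omega>))) has_integral (?I X, ?I Y)) {0..t}"
    proof -
      have 1: "((\<lambda>s. (f 0 (X s \<omega>), 0)) has_integral (?I X, 0)) {0..t}"
        using has_integral_linear[OF integrable_integral[OF i(1)], of "\<lambda>x. (x, 0)"]
        by (simp add: comp_def bounded_linear_Pair bounded_linear_ident bounded_linear_zero)
      have 2: "((\<lambda>s. (0, f 0 (Y s \<omega>))) has_integral (0, ?I Y)) {0..t}"
        using has_integral_linear[OF integrable_integral[OF i(2)], of "\<lambda>x. (0, x)"]
        by (simp add: comp_def bounded_linear_Pair bounded_linear_ident bounded_linear_zero)
      show ?thesis using has_integral_add[OF 1 2] by simp
    qed
    then have I: "integral {0..t} (\<lambda>s. (f 0 (X s \<omega>), f 0 (Y s \<omega>))) = (?I X, ?I Y)" by (rule integral_unique)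
    have s: "(\<Sum>i=1..k. (J i t \<omega>, J' i t \<omega>)) = (\<Sum>i=1..k. J i t \<omega>, \<Sum>i=1..k. J' i t \<omega>)"
      by (rule prod_eqI) (simp_all add: fst_sum snd_sum)
    show ?case
      unfolding fst_conv snd_conv I s add_Pair using elim(1,2) by simp
  qed
  show ?thesis
    unfolding stratonovich_solution_def
    using XS JJ EE continuous_semimartingale_Pair[OF semi]
    by (intro conjI exI[of _ "\<lambda>i t \<omega>. (J i t \<omega>, J' i t \<omega>)"]) auto
qed

text \<open>\<open>G\<close> is the second-order operator of the equation applied to one fixed
  extension \<open>g\<close> of \<open>u\<close>: the gradient is paired with the Ito drift
  \<open>v\<close>, the second derivatives with the noise fields. It is formed from the data before
  any solution is considered, which makes it common to all solutions started in the same point; its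
  continuity comes from that of the coefficients.\<close>

lemma generator_exists:
  fixes f :: "nat \<Rightarrow> 'a::euclidean_space \<Rightarrow> 'a"
  assumes K: "compact K" and f0: "continuous_on K (f 0)"
    and f: "\<And>i. i \<in> {1..k} \<Longrightarrow> C1_near K (f i) (Df i)"
    and u: "smooth_compact_support K u"
  obtains G where "continuous_on K G"
    "\<And>x X. x \<in> K \<Longrightarrow> stratonovich_solution M \<F> k B f K X \<Longrightarrow> AE \<omega> in M. X 0 \<omega> = x \<Longrightarrow>
      ((\<lambda>t. (1 / t) * (\<integral>\<omega>. u (X t \<omega>) - u (X 0 \<omega>) \<partial>M)) \<longlongrightarrow> G x) (at_right 0)"
proof -
  obtain U g where U: "open U" "K \<subseteq> U" and g: "\<And>m. differentiable_class continuous_on m U g" "\<And>x. x \<in> K \<Longrightarrow> g x = u x"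
    using u unfolding smooth_compact_support_def by blast
  obtain D where D: "\<And>x. x \<in> U \<Longrightarrow> (g has_derivative (\<lambda>h. \<Sum>e\<in>Basis. (h \<bullet> e) *\<^sub>R D e x)) (at x)"
    "\<And>e. e \<in> Basis \<Longrightarrow> differentiable_class continuous_on (Suc 0) U (D e)"
    using g(1)[of "Suc (Suc 0)"] by (auto simp del: differentiable_class.simps(2) simp: differentiable_class.simps(2)[of _ "Suc 0"])
  have "\<forall>e\<in>Basis. \<exists>D2. (\<forall>x\<in>U. (D e has_derivative (\<lambda>h. \<Sum>e'\<in>Basis. (h \<bullet> e') *\<^sub>R D2 e' x)) (at x)) \<and>
      (\<forall>e'\<in>Basis. continuous_on U (D2 e'))"
    using D(2) by simp
  from bchoice[OF this] obtain D2 where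
    D2: "\<And>e x. e \<in> Basis \<Longrightarrow> x \<in> U \<Longrightarrow> (D e has_derivative (\<lambda>h. \<Sum>e'\<in>Basis. (h \<bullet> e') *\<^sub>R D2 e e' x)) (at x)"
    "\<And>e e'. e \<in> Basis \<Longrightarrow> e' \<in> Basis \<Longrightarrow> continuous_on U (D2 e e')" by blast
  have cont: "continuous_on K (D e)" "continuous_on K (D2 e e')" "continuous_on K u" if "e \<in> Basis" "e' \<in> Basis" for e e'
  proof -
    show "continuous_on K (D e)" using differentiable_class_continuous[OF D(2)[OF that(1)]] U(2) by (rule continuous_on_subset)
    show "continuous_on K (D2 e e')" using D2(2)[OF that] U(2) by (rule continuous_on_subset)
    have "continuous_on K g" using differentiable_class_continuous[OF g(1)] U(2) by (rule continuous_on_subset)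
    then show "continuous_on K u" using g(2) by (simp cong: continuous_on_cong)
  qed
  have cu: "continuous_on K u" using cont(3) nonempty_Basis by blast
  define l where "l x h = (\<Sum>e\<in>Basis. (h \<bullet> e) * D e x)" for x h
  define b where "b x h h' = (\<Sum>e\<in>Basis. \<Sum>e'\<in>Basis. (h \<bullet> e) * (h' \<bullet> e') * D2 e e' x)" for x h h'
  define v where "v x = f 0 x + (1/2) *\<^sub>R (\<Sum>i=1..k. Df i x (f i x))" for x
  define G where "G x = l x (v x) + (\<Sum>i=1..k. b x (f i x) (f i x)) / 2" for x
  have "continuous_on K v"
    unfolding v_def by (intro continuous_intros f0 C1_near_apply_continuous[OF f] C1_near_continuous(1)[OF f])
  then have "continuous_on K G"
    unfolding G_def l_def b_def
    by (intro continuous_intros cont C1_near_continuous(1)[OF f]) auto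
  moreover have "((\<lambda>t. (1 / t) * (\<integral>\<omega>. u (X t \<omega>) - u (X 0 \<omega>) \<partial>M)) \<longlongrightarrow> G x) (at_right 0)"
    if x: "x \<in> K" "stratonovich_solution M \<F> k B f K X" "AE \<omega> in M. X 0 \<omega> = x" for x X
  proof -
    obtain C A where fr: "stratonovich_frame M \<F> k B K f Df C X A"
      and A: "((\<lambda>t. (1 / t) *\<^sub>R (\<integral>\<omega>. A t \<omega> - A 0 \<omega> \<partial>M)) \<longlongrightarrow> f 0 x) (at_right 0)"
      using frame_of_solution[OF K f0 f x(2,1,3)] by blast
    interpret fr: stratonovich_frame M \<F> k B K f Df C X A by (rule fr)
    have xU: "x \<in> U" using x U by blast
    have l: "bounded_linear (l x)"
      unfolding l_def linear_conv_bounded_linear[symmetric]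
      by (intro linearI) (simp_all add: inner_add_left algebra_simps sum.distrib sum_distrib_left)
    have b: "bounded_bilinear (b x)" unfolding b_def by (rule bounded_bilinear_coords)
    have "\<exists>r>0. \<forall>y\<in>K. norm (y - x) < r \<longrightarrow>
      \<bar>u y - u x - l x (y - x) - b x (y - x) (y - x) / 2\<bar> \<le> \<epsilon> * (norm (y - x))\<^sup>2" if "0 < \<epsilon>" for \<epsilon>
      using second_order_taylor[OF U(1) xU D(1) D2(1)[OF _ xU] that] g(2) x(1)
      unfolding l_def b_def by fastforce
    from fr.generator_limit[OF x(1,3) A cu l b this]
    show ?thesis unfolding G_def v_def fr.drift_def .
  qed
  ultimately show ?thesis using that by blast
qed

end

section \<open>Diagonal mixtures\<close>

lemma restrict_borel_continuous_measurable:
  assumes "continuous_on S f" "\<And>x. x \<in> S \<Longrightarrow> f x \<in> T"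
  shows "f \<in> restrict_space borel S \<rightarrow>\<^sub>M restrict_space borel T"
  using borel_measurable_continuous_on_restrict[OF assms(1)] assms(2)
  by (intro measurable_restrict_space2) (auto simp: space_restrict_space)

context
  fixes S :: "'a::euclidean_space set" and \<rho> :: "'a measure" and \<alpha> :: real
  assumes \<rho>: "\<rho> \<in> borel_prob_measures S" and S: "\<And>x. x \<in> S \<Longrightarrow> - x \<in> S" and \<alpha>: "0 \<le> \<alpha>" "\<alpha> \<le> 1"
begin

interpretation \<rho>: prob_space \<rho>
  using \<rho> by (simp add: borel_prob_measures_def)

lemma sets_\<rho>: "sets \<rho> = sets (restrict_space borel S)"
  using \<rho> by (simp add: borel_prob_measures_def)

lemma space_\<rho>: "space \<rho> = S"
  using sets_eq_imp_space_eq[OF sets_\<rho>] by (simp add: space_restrict_space)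

lemma diagonal_measurable:
  "(\<lambda>x. (x, x)) \<in> \<rho> \<rightarrow>\<^sub>M restrict_space borel (S \<times> S)"
  "(\<lambda>x. (x, - x)) \<in> \<rho> \<rightarrow>\<^sub>M restrict_space borel (S \<times> S)"
  unfolding measurable_cong_sets[OF sets_\<rho> refl]
  using S by (auto intro!: restrict_borel_continuous_measurable continuous_intros)

lemma section_measurable:
  assumes E: "E \<in> sets (restrict_space borel (S \<times> S))" and x: "x \<in> S"
  shows "{y. (x, y) \<in> E} \<in> sets (restrict_space borel S)"
proof -
  have "(\<lambda>y. (x, y)) \<in> restrict_space borel S \<rightarrow>\<^sub>M restrict_space borel (S \<times> S)"
    using x by (intro restrict_borel_continuous_measurable continuous_intros) auto
  from measurable_sets[OF this E] have "(\<lambda>y. (x, y)) -` E \<inter> S \<in> sets (restrict_space borel S)"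
    by (simp add: space_restrict_space)
  moreover have "(\<lambda>y. (x, y)) -` E \<inter> S = {y. (x, y) \<in> E}"
    using sets.sets_into_space[OF E] by (auto simp: space_restrict_space)
  ultimately show ?thesis by simp
qed

text \<open>\<open>measure_of\<close> keeps the given set function only if that function is positive
  and countably additive, and falls back to 0 otherwise. Both properties follow once the function is
  recognised as the mixture of the two images of \<open>\<rho>\<close> under
  \<open>x \<mapsto> (x, x)\<close> and \<open>x \<mapsto> (x, - x)\<close>.\<close>

lemma emeasure_diagonal_mixture:
  shows sets_diagonal_mixture: "sets (diagonal_mixture S \<rho> \<alpha>) = sets (restrict_space borel (S \<times> S))"
    and "E \<in> sets (restrict_space borel (S \<times> S)) \<Longrightarrow> emeasure (diagonal_mixture S \<rho> \<alpha>) E =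
      ennreal \<alpha> * emeasure (distr \<rho> (restrict_space borel (S \<times> S)) (\<lambda>x. (x, x))) E
      + ennreal (1 - \<alpha>) * emeasure (distr \<rho> (restrict_space borel (S \<times> S)) (\<lambda>x. (x, - x))) E"
proof -
  let ?R = "restrict_space borel (S \<times> S)"
  let ?\<mu>1 = "distr \<rho> ?R (\<lambda>x. (x, x))" and ?\<mu>2 = "distr \<rho> ?R (\<lambda>x. (x, - x))"
  define \<mu> where "\<mu> E = (\<integral>\<^sup>+x. ennreal \<alpha> * emeasure (return (restrict_space borel S) x) {y. (x, y) \<in> E}
                 + ennreal (1 - \<alpha>) * emeasure (return (restrict_space borel S) (- x)) {y. (x, y) \<in> E} \<partial>\<rho>)" for E
  have dm: "diagonal_mixture S \<rho> \<alpha> = measure_of (S \<times> S) (sets ?R) \<mu>"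
    by (simp add: diagonal_mixture_def \<mu>_def[abs_def])
  have sp: "space ?R = S \<times> S" by (simp add: space_restrict_space)
  show "sets (diagonal_mixture S \<rho> \<alpha>) = sets ?R"
    unfolding dm using sets.sigma_sets_eq[of ?R] sets.space_closed[of ?R] by (simp add: sp)
  have \<mu>: "\<mu> E = ennreal \<alpha> * emeasure ?\<mu>1 E + ennreal (1 - \<alpha>) * emeasure ?\<mu>2 E" if E: "E \<in> sets ?R" for E
  proof -
    have m: "(\<lambda>x. (x, x)) -` E \<inter> space \<rho> \<in> sets \<rho>" "(\<lambda>x. (x, - x)) -` E \<inter> space \<rho> \<in> sets \<rho>"
      using measurable_sets[OF diagonal_measurable(1) E] measurable_sets[OF diagonal_measurable(2) E] by auto
    \<comment> \<open>The Dirac mass of a section of \<open>E\<close> is the indicator of the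
      corresponding preimage of \<open>E\<close>; this relies on sections being measurable.\<close>
    have "\<mu> E = (\<integral>\<^sup>+x. ennreal \<alpha> * indicator ((\<lambda>x. (x, x)) -` E \<inter> space \<rho>) x
        + ennreal (1 - \<alpha>) * indicator ((\<lambda>x. (x, - x)) -` E \<inter> space \<rho>) x \<partial>\<rho>)"
      unfolding \<mu>_def
    proof (rule nn_integral_cong)
      fix x assume "x \<in> space \<rho>"
      then have x: "x \<in> S" by (simp add: space_\<rho>)
      show "ennreal \<alpha> * emeasure (return (restrict_space borel S) x) {y. (x, y) \<in> E}
          + ennreal (1 - \<alpha>) * emeasure (return (restrict_space borel S) (- x)) {y. (x, y) \<in> E}
        = ennreal \<alpha> * indicator ((\<lambda>x. (x, x)) -` E \<inter> space \<rho>) x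
          + ennreal (1 - \<alpha>) * indicator ((\<lambda>x. (x, - x)) -` E \<inter> space \<rho>) x"
        using section_measurable[OF E x] x by (simp add: indicator_def space_\<rho>)
    qed
    also have "\<dots> = ennreal \<alpha> * emeasure \<rho> ((\<lambda>x. (x, x)) -` E \<inter> space \<rho>)
        + ennreal (1 - \<alpha>) * emeasure \<rho> ((\<lambda>x. (x, - x)) -` E \<inter> space \<rho>)"
      using m by (subst nn_integral_add) (auto simp: nn_integral_cmult_indicator)
    also have "\<dots> = ennreal \<alpha> * emeasure ?\<mu>1 E + ennreal (1 - \<alpha>) * emeasure ?\<mu>2 E"
      using E by (simp add: emeasure_distr diagonal_measurable)
    finally show ?thesis .
  qed
  show "emeasure (diagonal_mixture S \<rho> \<alpha>) E = ennreal \<alpha> * emeasure ?\<mu>1 E + ennreal (1 - \<alpha>) * emeasure ?\<mu>2 E"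
    if E: "E \<in> sets ?R"
    unfolding \<mu>[OF E, symmetric] dm
  proof (rule emeasure_measure_of_sigma[OF _ _ _ E])
    show "sigma_algebra (S \<times> S) (sets ?R)" using sets.sigma_algebra_axioms[of ?R] by (simp add: sp)
    show "positive (sets ?R) \<mu>" by (simp add: positive_def \<mu>)
    show "countably_additive (sets ?R) \<mu>"
    proof (rule countably_additiveI)
      fix A :: "nat \<Rightarrow> ('a \<times> 'a) set"
      assume A: "range A \<subseteq> sets ?R" "disjoint_family A" "\<Union>(range A) \<in> sets ?R"
      have "(\<Sum>i. \<mu> (A i)) = (\<Sum>i. ennreal \<alpha> * emeasure ?\<mu>1 (A i) + ennreal (1 - \<alpha>) * emeasure ?\<mu>2 (A i))"
        using A(1) \<mu> by (intro suminf_cong) auto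
      also have "\<dots> = ennreal \<alpha> * (\<Sum>i. emeasure ?\<mu>1 (A i)) + ennreal (1 - \<alpha>) * (\<Sum>i. emeasure ?\<mu>2 (A i))"
        by (simp add: suminf_add[symmetric])
      also have "\<dots> = \<mu> (\<Union>(range A))"
        using A by (simp add: \<mu> suminf_emeasure)
      finally show "(\<Sum>i. \<mu> (A i)) = \<mu> (\<Union>(range A))" .
    qed
  qed
qed

lemma diagonal_mixture_borel_prob: "diagonal_mixture S \<rho> \<alpha> \<in> borel_prob_measures (S \<times> S)"
proof -
  let ?R = "restrict_space borel (S \<times> S)"
  have sp: "space (diagonal_mixture S \<rho> \<alpha>) = space ?R"
    by (rule sets_eq_imp_space_eq[OF sets_diagonal_mixture])
  have 1: "emeasure (distr \<rho> ?R \<phi>) (space ?R) = 1" if "\<phi> \<in> \<rho> \<rightarrow>\<^sub>M ?R" for \<phi>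
    using prob_space.emeasure_space_1[OF \<rho>.prob_space_distr[OF that]] by simp
  have "emeasure (diagonal_mixture S \<rho> \<alpha>) (space ?R) = ennreal \<alpha> + ennreal (1 - \<alpha>)"
    using 1[OF diagonal_measurable(1)] 1[OF diagonal_measurable(2)]
    by (subst emeasure_diagonal_mixture(2)) auto
  also have "\<dots> = 1" using \<alpha> by (simp add: ennreal_plus[symmetric] del: ennreal_plus)
  finally have "prob_space (diagonal_mixture S \<rho> \<alpha>)"
    by (intro prob_spaceI) (simp add: sp)
  then show ?thesis using sets_diagonal_mixture by (simp add: borel_prob_measures_def)
qed

text \<open>Induction over nonnegative measurable functions; for indicators it is
  \<open>emeasure_diagonal_mixture\<close>.\<close>

lemma nn_integral_diagonal_mixture:
  assumes "f \<in> borel_measurable (restrict_space borel (S \<times> S))"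
  shows "(\<integral>\<^sup>+z. f z \<partial>diagonal_mixture S \<rho> \<alpha>) =
    ennreal \<alpha> * (\<integral>\<^sup>+x. f (x, x) \<partial>\<rho>) + ennreal (1 - \<alpha>) * (\<integral>\<^sup>+x. f (x, - x) \<partial>\<rho>)"
proof -
  let ?R = "restrict_space borel (S \<times> S)"
  have m: "(\<lambda>x. g (x, x)) \<in> borel_measurable \<rho>" "(\<lambda>x. g (x, - x)) \<in> borel_measurable \<rho>"
    if "g \<in> borel_measurable ?R" for g :: "'a \<times> 'a \<Rightarrow> ennreal"
    using measurable_compose[OF diagonal_measurable(1) that] measurable_compose[OF diagonal_measurable(2) that] by auto
  have ms: "g \<in> borel_measurable (diagonal_mixture S \<rho> \<alpha>)" if "g \<in> borel_measurable ?R" for g :: "'a \<times> 'a \<Rightarrow> ennreal"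
    using that by (simp add: measurable_cong_sets[OF sets_diagonal_mixture refl])
  have sp: "(x, x) \<in> space ?R" "(x, - x) \<in> space ?R" if "x \<in> space \<rho>" for x
    using that S by (auto simp: space_\<rho> space_restrict_space)
  show ?thesis
    using assms
  proof (induction rule: borel_measurable_induct)
    case (cong f g)
    have "(\<integral>\<^sup>+z. f z \<partial>diagonal_mixture S \<rho> \<alpha>) = (\<integral>\<^sup>+z. g z \<partial>diagonal_mixture S \<rho> \<alpha>)"
      using cong(3) by (intro nn_integral_cong) (simp add: sets_eq_imp_space_eq[OF sets_diagonal_mixture])
    moreover have "(\<integral>\<^sup>+x. f (x, x) \<partial>\<rho>) = (\<integral>\<^sup>+x. g (x, x) \<partial>\<rho>)" "(\<integral>\<^sup>+x. f (x, - x) \<partial>\<rho>) = (\<integral>\<^sup>+x. g (x, - x) \<partial>\<rho>)"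
      using cong(3) sp by (auto intro!: nn_integral_cong)
    ultimately show ?case using cong(4) by simp
  next
    case (set A)
    have "(\<integral>\<^sup>+x. indicator A (x, x) \<partial>\<rho>) = emeasure (distr \<rho> ?R (\<lambda>x. (x, x))) A"
      "(\<integral>\<^sup>+x. indicator A (x, - x) \<partial>\<rho>) = emeasure (distr \<rho> ?R (\<lambda>x. (x, - x))) A"
      using set nn_integral_distr[OF diagonal_measurable(1), of "indicator A"]
        nn_integral_distr[OF diagonal_measurable(2), of "indicator A"] by auto
    then show ?case
      using set by (simp add: emeasure_diagonal_mixture(2) sets_diagonal_mixture)
  next
    case (mult u c)
    then show ?case
      using m[OF mult(2)] ms[OF mult(2)] by (simp add: nn_integral_cmult distrib_left mult.left_commute)
  next
    case (add u v)
    then show ?case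
      using m[OF add(1)] ms[OF add(1)] m[OF add(3)] ms[OF add(3)]
      by (simp add: nn_integral_add distrib_left add_ac)
  next
    case (seq U)
    have mm: "incseq (\<lambda>i x. U i (x, x))" "incseq (\<lambda>i x. U i (x, - x))"
      using seq(3) by (auto simp: incseq_def le_fun_def)
    have i1: "incseq (\<lambda>i. \<integral>\<^sup>+x. U i (x, x) \<partial>\<rho>)" "incseq (\<lambda>i. \<integral>\<^sup>+x. U i (x, - x) \<partial>\<rho>)"
      using seq(3) by (auto simp: incseq_def le_fun_def intro!: nn_integral_mono)
    have "(\<integral>\<^sup>+z. (SUP i. U i) z \<partial>diagonal_mixture S \<rho> \<alpha>) = (SUP i. \<integral>\<^sup>+z. U i z \<partial>diagonal_mixture S \<rho> \<alpha>)"
      unfolding SUP_apply using seq(3) ms[OF seq(1)] by (intro nn_integral_monotone_convergence_SUP) auto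
    also have "\<dots> = (SUP i. ennreal \<alpha> * (\<integral>\<^sup>+x. U i (x, x) \<partial>\<rho>) + ennreal (1 - \<alpha>) * (\<integral>\<^sup>+x. U i (x, - x) \<partial>\<rho>))"
      using seq.IH by simp
    also have "\<dots> = (SUP i. ennreal \<alpha> * (\<integral>\<^sup>+x. U i (x, x) \<partial>\<rho>)) + (SUP i. ennreal (1 - \<alpha>) * (\<integral>\<^sup>+x. U i (x, - x) \<partial>\<rho>))"
      using i1 by (intro ennreal_SUP_add) (auto simp: incseq_def intro!: mult_left_mono)
    also have "\<dots> = ennreal \<alpha> * (SUP i. \<integral>\<^sup>+x. U i (x, x) \<partial>\<rho>) + ennreal (1 - \<alpha>) * (SUP i. \<integral>\<^sup>+x. U i (x, - x) \<partial>\<rho>)"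
      by (simp add: SUP_mult_left_ennreal)
    also have "\<dots> = ennreal \<alpha> * (\<integral>\<^sup>+x. (SUP i. U i) (x, x) \<partial>\<rho>) + ennreal (1 - \<alpha>) * (\<integral>\<^sup>+x. (SUP i. U i) (x, - x) \<partial>\<rho>)"
      unfolding SUP_apply using mm m[OF seq(1)] by (simp add: nn_integral_monotone_convergence_SUP)
    finally show ?case .
  qed
qed

text \<open>Adding the bound \<open>b\<close> makes the function nonnegative and reduces the claim
  to nonnegative integrals. The shifts cancel because the measures have mass 1 and the weights
  \<open>\<alpha>\<close> and \<open>1 - \<alpha>\<close> sum to 1.\<close>

lemma integral_diagonal_mixture:
  fixes f :: "'a \<times> 'a \<Rightarrow> real"
  assumes f: "f \<in> borel_measurable (restrict_space borel (S \<times> S))" and b: "\<And>z. z \<in> S \<times> S \<Longrightarrow> \<bar>f z\<bar> \<le> b"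
  shows "integrable (diagonal_mixture S \<rho> \<alpha>) f"
    "(\<integral>z. f z \<partial>diagonal_mixture S \<rho> \<alpha>) = \<alpha> * (\<integral>x. f (x, x) \<partial>\<rho>) + (1 - \<alpha>) * (\<integral>x. f (x, - x) \<partial>\<rho>)"
proof -
  let ?R = "restrict_space borel (S \<times> S)" and ?\<nu> = "diagonal_mixture S \<rho> \<alpha>"
  interpret \<nu>: prob_space ?\<nu> using diagonal_mixture_borel_prob by (simp add: borel_prob_measures_def)
  have sp: "space ?\<nu> = S \<times> S"
    using sets_eq_imp_space_eq[OF sets_diagonal_mixture] by (simp add: space_restrict_space)
  have fm: "f \<in> borel_measurable ?\<nu>" using f by (simp add: measurable_cong_sets[OF sets_diagonal_mixture refl])
  show i: "integrable ?\<nu> f"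
    by (rule \<nu>.integrable_const_bound[where B = b]) (use b fm sp in auto)
  have mm: "(\<lambda>x. f (x, x)) \<in> borel_measurable \<rho>" "(\<lambda>x. f (x, - x)) \<in> borel_measurable \<rho>"
    using measurable_compose[OF diagonal_measurable(1) f] measurable_compose[OF diagonal_measurable(2) f] by auto
  have ii: "integrable \<rho> (\<lambda>x. f (x, x))" "integrable \<rho> (\<lambda>x. f (x, - x))"
    using b mm S by (auto intro!: \<rho>.integrable_const_bound[where B = b] simp: space_\<rho>)
  have bx: "0 \<le> b + f z" if "z \<in> S \<times> S" for z using b[OF that] by linarith
  have nn: "0 \<le> (\<integral>x. b + f (x, x) \<partial>\<rho>)" "0 \<le> (\<integral>x. b + f (x, - x) \<partial>\<rho>)"
    using S by (auto intro!: integral_nonneg_AE AE_I2 bx simp: space_\<rho>)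
  have "ennreal (\<integral>z. b + f z \<partial>?\<nu>) = (\<integral>\<^sup>+z. ennreal (b + f z) \<partial>?\<nu>)"
    using i bx sp by (intro nn_integral_eq_integral[symmetric]) auto
  also have "\<dots> = ennreal \<alpha> * (\<integral>\<^sup>+x. ennreal (b + f (x, x)) \<partial>\<rho>) + ennreal (1 - \<alpha>) * (\<integral>\<^sup>+x. ennreal (b + f (x, - x)) \<partial>\<rho>)"
    using f by (intro nn_integral_diagonal_mixture) simp
  also have "(\<integral>\<^sup>+x. ennreal (b + f (x, x)) \<partial>\<rho>) = ennreal (\<integral>x. b + f (x, x) \<partial>\<rho>)"
    using ii bx by (intro nn_integral_eq_integral) (auto simp: space_\<rho>)
  also have "(\<integral>\<^sup>+x. ennreal (b + f (x, - x)) \<partial>\<rho>) = ennreal (\<integral>x. b + f (x, - x) \<partial>\<rho>)"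
    using ii bx S by (intro nn_integral_eq_integral) (auto simp: space_\<rho>)
  also have "ennreal \<alpha> * ennreal (\<integral>x. b + f (x, x) \<partial>\<rho>) + ennreal (1 - \<alpha>) * ennreal (\<integral>x. b + f (x, - x) \<partial>\<rho>)
    = ennreal (\<alpha> * (\<integral>x. b + f (x, x) \<partial>\<rho>) + (1 - \<alpha>) * (\<integral>x. b + f (x, - x) \<partial>\<rho>))"
    using \<alpha> nn by (simp add: ennreal_mult ennreal_plus)
  finally have "(\<integral>z. b + f z \<partial>?\<nu>) = \<alpha> * (\<integral>x. b + f (x, x) \<partial>\<rho>) + (1 - \<alpha>) * (\<integral>x. b + f (x, - x) \<partial>\<rho>)"
  proof (rule ennreal_inj[THEN iffD1, rotated 2])
    show "0 \<le> (\<integral>z. b + f z \<partial>?\<nu>)" using bx sp by (intro integral_nonneg_AE AE_I2) auto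
    show "0 \<le> \<alpha> * (\<integral>x. b + f (x, x) \<partial>\<rho>) + (1 - \<alpha>) * (\<integral>x. b + f (x, - x) \<partial>\<rho>)"
      using \<alpha> nn by (intro add_nonneg_nonneg mult_nonneg_nonneg) auto
  qed
  then show "(\<integral>z. f z \<partial>?\<nu>) = \<alpha> * (\<integral>x. f (x, x) \<partial>\<rho>) + (1 - \<alpha>) * (\<integral>x. f (x, - x) \<partial>\<rho>)"
    using i ii by (simp add: \<nu>.prob_space \<rho>.prob_space algebra_simps)
qed

end

theorem theorem4p5:
  fixes M :: "'w measure" and \<F> :: "real \<Rightarrow> 'w measure"
    and k :: nat and \<delta> :: real
    and B :: "nat \<Rightarrow> real \<Rightarrow> 'w \<Rightarrow> real"
    and F :: "nat \<Rightarrow> real ^ 'n \<Rightarrow> real ^ 'n"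
    and X :: "real ^ 'n \<Rightarrow> real \<Rightarrow> 'w \<Rightarrow> real ^ 'n"
    and \<rho> :: "(real ^ 'n) measure"
  assumes "filtered_prob_space M \<F>"
    and "brownian_motions M \<F> k B"
    and "0 < \<delta>" and "\<delta> \<le> 1"
    and "\<forall>i\<in>{0..k}. \<forall>x\<in>sphere 0 1. F i x \<bullet> x = 0"
    and "C_holder_on 1 \<delta> (sphere 0 1) (F 0)"
    and "\<forall>i\<in>{1..k}. C_holder_on 2 \<delta> (sphere 0 1) (F i)"
    and "\<forall>i\<in>{0..k}. \<forall>x\<in>sphere 0 1. F i (- x) = - F i x"
    and "one_point_process M \<F> k B F (sphere 0 1) X"
    and "invariant_measure M (sphere 0 1) X \<rho>"
  shows "\<forall>\<alpha>\<in>{0..1}.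
    diagonal_mixture (sphere 0 1) \<rho> \<alpha> \<in> borel_prob_measures (sphere 0 1 \<times> sphere 0 1) \<and>
    (\<forall>Z. two_point_process M \<F> k B F (sphere 0 1) Z \<longrightarrow>
       invariant_measure M (sphere 0 1 \<times> sphere 0 1) Z (diagonal_mixture (sphere 0 1) \<rho> \<alpha>))"
proof (intro ballI conjI allI impI)
  define S :: "(real ^ 'n) set" where "S = sphere 0 1"
  interpret filtered_prob_space M \<F> by fact
  interpret brownian_setup M \<F> k B by unfold_locales fact
  have \<rho>: "\<rho> \<in> borel_prob_measures S" using assms(10) by (simp add: invariant_measure_def S_def)
  have Sm: "- x \<in> S" if "x \<in> S" for x using that by (simp add: S_def)
  have Sc: "compact S" by (simp add: S_def)
  fix \<alpha> :: real assume "\<alpha> \<in> {0..1}"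
  then have \<alpha>: "0 \<le> \<alpha>" "\<alpha> \<le> 1" by auto
  show nu: "diagonal_mixture (sphere 0 1) \<rho> \<alpha> \<in> borel_prob_measures (sphere 0 1 \<times> sphere 0 1)"
    using diagonal_mixture_borel_prob[OF \<rho> Sm \<alpha>] by (simp add: S_def)
  have F0: "continuous_on S (F 0)" using continuous_of_C_holder[OF assms(6)] by (simp add: S_def)
  have "\<forall>i\<in>{1..k}. \<exists>Df. C1_near S (F i) Df"
    using assms(7) C1_near_of_C_holder unfolding S_def by blast
  from bchoice[OF this] obtain Df where Df: "\<And>i. i \<in> {1..k} \<Longrightarrow> C1_near S (F i) (Df i)" by blast
  have Fc: "continuous_on S (F i)" if "i \<in> {0..k}" for i
    using F0 C1_near_continuous(1)[OF Df, of i] that by (cases "i = 0") auto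
  have X: "stratonovich_solution M \<F> k B F S (X x)" "AE \<omega> in M. X x 0 \<omega> = x" if "x \<in> S" for x
    using assms(9) that by (auto simp: one_point_process_def S_def)
  have X': "stratonovich_solution M \<F> k B F S (\<lambda>t \<omega>. - X x t \<omega>)" if "x \<in> S" for x
    using X(1)[OF that] Sm assms(8) by (intro stratonovich_solution_minus) (auto simp: S_def)
  \<comment> \<open>The coupled equation as a single equation on \<open>S \<times> S\<close>, with
    the fields acting on each component.\<close>
  define F2 where "F2 i z = (F i (fst z), F i (snd z))" for i z
  define DF2 where "DF2 i z h = (Df i (fst z) (fst h), Df i (snd z) (snd h))" for i z h
  have F2: "C1_near (S \<times> S) (F2 i) (DF2 i)" if "i \<in> {1..k}" for i
    using C1_near_pair[OF Df[OF that]] unfolding F2_def DF2_def .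
  have F20: "continuous_on (S \<times> S) (F2 0)"
    unfolding F2_def
    by (intro continuous_on_Pair continuous_on_compose2[OF F0 continuous_on_fst[OF continuous_on_id]]
        continuous_on_compose2[OF F0 continuous_on_snd[OF continuous_on_id]]) auto
  have pair: "stratonovich_solution M \<F> k B F2 (S \<times> S) (\<lambda>t \<omega>. (V t \<omega>, V' t \<omega>))"
    if "stratonovich_solution M \<F> k B F S V" "stratonovich_solution M \<F> k B F S V'" for V V'
    using stratonovich_solution_Pair[OF that Sc Fc] unfolding F2_def .
  fix Z assume "two_point_process M \<F> k B F (sphere 0 1) Z"
  \<comment> \<open>The two component equations are recombined by the pairing lemma, the pair of
    components being \<open>Z z\<close> itself.\<close>
  then have Z: "stratonovich_solution M \<F> k B F2 (S \<times> S) (Z z)" "AE \<omega> in M. Z z 0 \<omega> = z" if "z \<in> S \<times> S" for z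
    using pair[of "\<lambda>t \<omega>. fst (Z z t \<omega>)" "\<lambda>t \<omega>. snd (Z z t \<omega>)"] that
    by (auto simp: two_point_process_def S_def)
  show "invariant_measure M (sphere 0 1 \<times> sphere 0 1) Z (diagonal_mixture (sphere 0 1) \<rho> \<alpha>)"
    unfolding S_def[symmetric] invariant_measure_def
  proof (rule conjI, use nu in \<open>simp add: S_def\<close>, intro allI impI)
    fix u assume u: "smooth_compact_support (S \<times> S) u"
    obtain G where G: "continuous_on (S \<times> S) G" and lim: "\<And>z V. z \<in> S \<times> S \<Longrightarrow>
      stratonovich_solution M \<F> k B F2 (S \<times> S) V \<Longrightarrow> AE \<omega> in M. V 0 \<omega> = z \<Longrightarrow>
      ((\<lambda>t. (1 / t) * (\<integral>\<omega>. u (V t \<omega>) - u (V 0 \<omega>) \<partial>M)) \<longlongrightarrow> G z) (at_right 0)"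
      using generator_exists[where f = F2 and Df = DF2, OF compact_Times[OF Sc Sc] F20 F2 u] by blast
    have limZ: "(generator_quotient M Z u z \<longlongrightarrow> G z) (at_right 0)" if "z \<in> S \<times> S" for z
      using lim[OF that Z[OF that]] unfolding generator_quotient_def[abs_def] .
    have genZ: "generator M Z u z = G z" if "z \<in> S \<times> S" for z
      unfolding generator_def by (rule tendsto_Lim[OF _ limZ[OF that]]) simp
    \<comment> \<open>If the linear image of \<open>X x\<close> under \<open>L\<close> solves the
      coupled equation, then \<open>G\<close> at \<open>L x\<close> is the one-point generator of
      the test function \<open>u\<close> after \<open>L\<close>, and invariance of
      \<open>\<rho>\<close> applies to that function. The maps in question are
      \<open>x \<mapsto> (x, x)\<close> and \<open>x \<mapsto> (x, - x)\<close>; oddness of the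
      fields enters through the second.\<close>
    have section_zero: "(\<integral>x. G (L x) \<partial>\<rho>) = 0"
      if L: "bounded_linear L" "\<And>x. x \<in> S \<Longrightarrow> L x \<in> S \<times> S"
        and V: "\<And>x. x \<in> S \<Longrightarrow> stratonovich_solution M \<F> k B F2 (S \<times> S) (\<lambda>t \<omega>. L (X x t \<omega>))" for L
    proof -
      have sm: "smooth_compact_support S (\<lambda>x. u (L x))"
        using L Sc u by (rule smooth_compact_support_compose_linear)
      have "generator M X (\<lambda>x. u (L x)) x = G (L x)" if x: "x \<in> S" for x
      proof -
        have "AE \<omega> in M. L (X x 0 \<omega>) = L x" using X(2)[OF x] by eventually_elim simp
        from lim[OF L(2)[OF x] V[OF x] this]
        have "(generator_quotient M X (\<lambda>x. u (L x)) x \<longlongrightarrow> G (L x)) (at_right 0)"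
          unfolding generator_quotient_def[abs_def] .
        then show ?thesis unfolding generator_def by (rule tendsto_Lim[rotated]) simp
      qed
      then have "(\<integral>x. G (L x) \<partial>\<rho>) = (\<integral>x. generator M X (\<lambda>x. u (L x)) x \<partial>\<rho>)"
        by (intro Bochner_Integration.integral_cong) (simp_all add: space_\<rho>[OF \<rho> Sm \<alpha>])
      also have "\<dots> = 0"
        using assms(10) sm by (simp add: invariant_measure_def S_def)
      finally show ?thesis .
    qed
    have z1: "(\<integral>x. G (x, x) \<partial>\<rho>) = 0"
      using pair[OF X(1) X(1)] by (intro section_zero bounded_linear_Pair bounded_linear_ident) auto
    have z2: "(\<integral>x. G (x, - x) \<partial>\<rho>) = 0"
      using pair[OF X(1) X'] Sm by (intro section_zero bounded_linear_Pair bounded_linear_ident bounded_linear_minus) auto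
    obtain b where b: "\<And>z. z \<in> S \<times> S \<Longrightarrow> \<bar>G z\<bar> \<le> b"
      using compact_imp_bounded[OF compact_continuous_image[OF G compact_Times[OF Sc Sc]]] by (auto simp: bounded_iff)
    \<comment> \<open>The mixture charges only the graphs of the identity and of the antipodal map,
      so its integral of \<open>G\<close> reduces to the two integrals just shown to vanish.\<close>
    note Gi = integral_diagonal_mixture[OF \<rho> Sm \<alpha> borel_measurable_continuous_on_restrict[OF G] b]
    have sp: "space (diagonal_mixture S \<rho> \<alpha>) = S \<times> S"
      using sets_eq_imp_space_eq[OF sets_diagonal_mixture[OF \<rho> Sm \<alpha>]] by (simp add: space_restrict_space)
    show "(\<forall>z\<in>S \<times> S. \<exists>l. (generator_quotient M Z u z \<longlongrightarrow> l) (at_right 0)) \<and>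
      integrable (diagonal_mixture S \<rho> \<alpha>) (generator M Z u) \<and> (\<integral>z. generator M Z u z \<partial>diagonal_mixture S \<rho> \<alpha>) = 0"
    proof (intro conjI ballI)
      show "\<exists>l. (generator_quotient M Z u z \<longlongrightarrow> l) (at_right 0)" if "z \<in> S \<times> S" for z
        using limZ[OF that] by blast
      have "integrable (diagonal_mixture S \<rho> \<alpha>) (generator M Z u) \<longleftrightarrow> integrable (diagonal_mixture S \<rho> \<alpha>) G"
        by (rule Bochner_Integration.integrable_cong) (use genZ sp in auto)
      then show "integrable (diagonal_mixture S \<rho> \<alpha>) (generator M Z u)" using Gi(1) by simp
      have "(\<integral>z. generator M Z u z \<partial>diagonal_mixture S \<rho> \<alpha>) = (\<integral>z. G z \<partial>diagonal_mixture S \<rho> \<alpha>)"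
        by (rule Bochner_Integration.integral_cong) (use genZ sp in auto)
      then show "(\<integral>z. generator M Z u z \<partial>diagonal_mixture S \<rho> \<alpha>) = 0" using Gi(2) z1 z2 by simp
    qed
  qed
qed

end
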